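(* Let $G$ be a (connected, locally finite, infinite) quasi-transitive unimodular graph. Then $G$ is amenable and has one end if and only if $G$ has an invariant spanning tree with one end, i.e., there is a random subgraph $T$ of $G$ whose distribution is invariant under $\mathrm{Aut}(G)$ and such that almost surely $T$ is a spanning tree of $G$ with exactly one end.
   Context: A graph $G$ is quasi-transitive if its automorphism group $\mathrm{Aut}(G)$ acts on $V(G)$ with finitely many orbits. It is unimodular if $\mathrm{Aut}(G)$ (a locally compact group with the topology of pointwise convergence) is unimodular; equivalently, $|\mathrm{Stab}(x)\,y|=|\mathrm{Stab}(y)\,x|$ for all $x,y$ in the same $\mathrm{Aut}(G)$-orbit, where $\mathrm{Stab}(x)$ is the stabilizer of $x$ in $\mathrm{Aut}(G)$. $G$ is amenable if $\inf |\partial K|/|K|=0$, where the infimum is over finite nonempty $K\subset V(G)$ and $\partial K$ is the set of edges with exactly one endpoint in $K$. An infinite connected locally finite graph has one end if the deletion of any finite set of vertices leaves exactly one infinite component. *)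

theory Defs
  imports "HOL-Probability.Probability" "HOL-Algebra.Group_Action"
begin

section \<open>Simple graphs\<close>

type_synonym 'v graph = "'v set \<times> 'v set set"

abbreviation verts :: "'v graph \<Rightarrow> 'v set" where "verts \<equiv> fst"
abbreviation edges :: "'v graph \<Rightarrow> 'v set set" where "edges \<equiv> snd"

definition simple_graph :: "'v graph \<Rightarrow> bool" where
  "simple_graph G \<longleftrightarrow> (\<forall>e\<in>edges G. e \<subseteq> verts G \<and> card e = 2)"

definition locally_finite :: "'v graph \<Rightarrow> bool" where
  "locally_finite G \<longleftrightarrow> (\<forall>v\<in>verts G. finite {e \<in> edges G. v \<in> e})"

definition reachable :: "'v graph \<Rightarrow> 'v \<Rightarrow> 'v \<Rightarrow> bool" where
  "reachable G = (\<lambda>u v. {u, v} \<in> edges G)\<^sup>*\<^sup>*"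

definition connected_graph :: "'v graph \<Rightarrow> bool" where
  "connected_graph G \<longleftrightarrow> verts G \<noteq> {} \<and> (\<forall>u\<in>verts G. \<forall>v\<in>verts G. reachable G u v)"

definition components_of :: "'v graph \<Rightarrow> 'v set set" where
  "components_of G = (\<lambda>u. {v \<in> verts G. reachable G u v}) ` verts G"

definition delete_verts :: "'v graph \<Rightarrow> 'v set \<Rightarrow> 'v graph" where
  "delete_verts G S = (verts G - S, {e \<in> edges G. e \<inter> S = {}})"

definition one_ended :: "'v graph \<Rightarrow> bool" where
  "one_ended G \<longleftrightarrow>
     (\<forall>S. finite S \<and> S \<subseteq> verts G \<longrightarrow> (\<exists>!C. C \<in> components_of (delete_verts G S) \<and> infinite C))"

definition is_cycle :: "'v graph \<Rightarrow> 'v list \<Rightarrow> bool" where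
  "is_cycle G p \<longleftrightarrow> length p \<ge> 3 \<and> distinct p \<and>
     (\<forall>i<length p. {p ! i, p ! (Suc i mod length p)} \<in> edges G)"

definition is_tree :: "'v graph \<Rightarrow> bool" where
  "is_tree G \<longleftrightarrow> simple_graph G \<and> connected_graph G \<and> (\<nexists>p. is_cycle G p)"

definition subgraphs :: "'v graph \<Rightarrow> 'v graph set" where
  "subgraphs G = {H. simple_graph H \<and> verts H \<subseteq> verts G \<and> edges H \<subseteq> edges G}"

definition spanning_tree :: "'v graph \<Rightarrow> 'v graph \<Rightarrow> bool" where
  "spanning_tree G T \<longleftrightarrow> T \<in> subgraphs G \<and> verts T = verts G \<and> is_tree T"

definition edge_boundary :: "'v graph \<Rightarrow> 'v set \<Rightarrow> 'v set set" where
  "edge_boundary G K = {e \<in> edges G. card (e \<inter> K) = 1}"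

definition amenable :: "'v graph \<Rightarrow> bool" where
  "amenable G \<longleftrightarrow>
     (INF K\<in>{K. finite K \<and> K \<noteq> {} \<and> K \<subseteq> verts G}.
        real (card (edge_boundary G K)) / real (card K)) = 0"

section \<open>Automorphisms\<close>

definition automorphisms :: "'v graph \<Rightarrow> ('v \<Rightarrow> 'v) set" where
  "automorphisms G =
     {f \<in> Bij (verts G). \<forall>u\<in>verts G. \<forall>v\<in>verts G. {f u, f v} \<in> edges G \<longleftrightarrow> {u, v} \<in> edges G}"

definition aut_group :: "'v graph \<Rightarrow> ('v \<Rightarrow> 'v) monoid" where
  "aut_group G = BijGroup (verts G)\<lparr>carrier := automorphisms G\<rparr>"

definition quasi_transitive :: "'v graph \<Rightarrow> bool" where
  "quasi_transitive G \<longleftrightarrow> finite (orbits (aut_group G) (verts G) (\<lambda>f. f))"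

definition aut_topology :: "'v graph \<Rightarrow> ('v \<Rightarrow> 'v) topology" where
  "aut_topology G =
     subtopology (product_topology (\<lambda>_. discrete_topology (verts G)) (verts G)) (automorphisms G)"

text \<open>
  A left Haar measure on a locally compact Hausdorff group with underlying group \<open>\<G>\<close>
  and topology \<open>X\<close>: a nonzero left-invariant Radon measure on the Borel sets.
\<close>

definition left_haar_measure :: "('g, 'm) monoid_scheme \<Rightarrow> 'g topology \<Rightarrow> 'g measure \<Rightarrow> bool" where
  "left_haar_measure \<G> X \<mu> \<longleftrightarrow>
     space \<mu> = carrier \<G> \<and>
     sets \<mu> = sigma_sets (carrier \<G>) {U. openin X U} \<and>
     emeasure \<mu> (carrier \<G>) \<noteq> 0 \<and>
     (\<forall>K. compactin X K \<longrightarrow> emeasure \<mu> K < \<infinity>) \<and>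
     (\<forall>A\<in>sets \<mu>. emeasure \<mu> A = (INF U\<in>{U. openin X U \<and> A \<subseteq> U}. emeasure \<mu> U)) \<and>
     (\<forall>U. openin X U \<longrightarrow> emeasure \<mu> U = (SUP K\<in>{K. compactin X K \<and> K \<subseteq> U}. emeasure \<mu> K)) \<and>
     (\<forall>g\<in>carrier \<G>. \<forall>A\<in>sets \<mu>. emeasure \<mu> (g <#\<^bsub>\<G>\<^esub> A) = emeasure \<mu> A)"

definition unimodular_group :: "('g, 'm) monoid_scheme \<Rightarrow> 'g topology \<Rightarrow> bool" where
  "unimodular_group \<G> X \<longleftrightarrow>
     (\<exists>\<mu>. left_haar_measure \<G> X \<mu> \<and>
          (\<forall>g\<in>carrier \<G>. \<forall>A\<in>sets \<mu>. emeasure \<mu> (A #>\<^bsub>\<G>\<^esub> g) = emeasure \<mu> A))"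

definition unimodular :: "'v graph \<Rightarrow> bool" where
  "unimodular G \<longleftrightarrow> unimodular_group (aut_group G) (aut_topology G)"

section \<open>Invariant random subgraphs\<close>

text \<open>
  The \<open>\<sigma>\<close>-algebra is the one \<open>subgraphs G\<close> inherits from the product space
  of subsets of \<open>verts G\<close> and subsets of \<open>edges G\<close>.
\<close>

definition subgraph_space :: "'v graph \<Rightarrow> 'v graph measure" where
  "subgraph_space G = sigma (subgraphs G)
     ((\<lambda>v. {H \<in> subgraphs G. v \<in> verts H}) ` verts G \<union>
      (\<lambda>e. {H \<in> subgraphs G. e \<in> edges H}) ` edges G)"

definition graph_image :: "('v \<Rightarrow> 'v) \<Rightarrow> 'v graph \<Rightarrow> 'v graph" where
  "graph_image f H = (f ` verts H, (\<lambda>e. f ` e) ` edges H)"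

text \<open>A random subgraph is represented by its distribution.\<close>

definition invariant_random_subgraph :: "'v graph \<Rightarrow> 'v graph measure \<Rightarrow> bool" where
  "invariant_random_subgraph G P \<longleftrightarrow>
     prob_space P \<and> sets P = sets (subgraph_space G) \<and>
     (\<forall>f\<in>automorphisms G. distr P (subgraph_space G) (graph_image f) = P)"

end

theory Submission
  imports Defs "HOL-Real_Asymp.Real_Asymp" "HOL-Complex_Analysis.Great_Picard"
begin

text \<open>
  Let \<open>G\<close> be amenable with one end. A Foelner set \<open>K\<close> has a spanning tree such that few edges of
  \<open>G\<close> inside \<open>K\<close> have ends far apart in the tree: remove few edges to cut \<open>K\<close> into small pieces,
  and do so on coarser and coarser scales. Call a tree edge heavy if both sides of its removal are large.
  By one-endedness, near most heavy edges there is an edge of \<open>G\<close> whose fundamental cycle is long,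
  but of bounded length, and contains the heavy edge. Exchanging edges along disjoint such cycles
  replaces many heavy edges by light ones, and reduces the density of heavy edges by a definite factor.
  Iterating over all scales gives trees with a vanishing density of far and of heavy edges.
  Seen from a Haar-random place they have a subsequential weak limit, which is invariant by unimodularity.
  The limit is a forest; it joins neighbours since few edges are far, and each of its edges cuts off a
  finite set since few edges are heavy, so it is a spanning tree with one end.

  Conversely, a spanning tree \<open>T\<close> with one end forces one end on \<open>G\<close>. Keep the edges of \<open>T\<close> that cut
  off fewer than \<open>n\<close> vertices. Their clusters are finite: an infinite one would contain the edge through
  which a connected set of \<open>n\<close> vertices is attached to the infinite part of the rest of \<open>T\<close>, but that
  edge cuts off at least \<open>n\<close> vertices. As \<open>n\<close> grows, adjacent vertices end up in the same cluster.
  By the mass-transport principle, the mean boundary-to-volume ratio of the cluster of a vertex is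
  comparable to the mean number of edges at the vertex that leave the cluster, which tends to \<open>0\<close>.
\<close>

section \<open>Trees and their cuts\<close>

text \<open>Trees are handled through cuts: deleting an edge two-colours the vertices, a path is the
  set of edges separating its ends, and an exchange adds the cut of the removed edge modulo 2 to the
  cuts along the fundamental cycle. A heavy edge on that cycle then cuts off only what lies between
  it and the removed edge, which is little where heavy edges do not branch. The obstacle is that an
  exchange may also turn light edges of the cycle into heavy ones. Very light edges are few on any
  path. Edges of intermediate weight, between two thresholds, are few for some consecutive pair in a
  long chain of thresholds, by pigeonhole. Each round may multiply the stretch by a constant that is
  not bounded over the rounds. What is carried along is therefore a tail bound uniform over all
  Foelner sets, while scales already treated are disturbed by geometrically decreasing amounts. Weak
  limits see finite windows only, so failing to be joined and failing to be light are phrased as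
  events in balls. Several orbits are balanced by the Haar measures of stabilizers, which
  unimodularity makes constant on orbits.\<close>

lemma sum_card_rel_swap:
  assumes "finite A" "finite B"
  shows "(\<Sum>x\<in>A. card {y \<in> B. R x y}) = (\<Sum>y\<in>B. card {x \<in> A. R x y})"
proof -
  have "(\<Sum>x\<in>A. card {y \<in> B. R x y}) = (\<Sum>x\<in>A. \<Sum>y\<in>B. if R x y then 1 else 0)"
    using assms by (simp add: sum.If_cases Int_def)
  also have "... = (\<Sum>y\<in>B. \<Sum>x\<in>A. if R x y then 1 else 0)" by (rule sum.swap)
  also have "... = (\<Sum>y\<in>B. card {x \<in> A. R x y})"
    using assms by (simp add: sum.If_cases Int_def)
  finally show ?thesis .
qed

section \<open>Connectivity through edge sets\<close>

text \<open>Only the edge set matters, so every point is connected to itself, vertex or not, and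
  deleting an edge is a set difference. As edges are unordered pairs, the reflexive transitive
  closure is already symmetric.\<close>

definition conn :: "'v set set => 'v => 'v => bool" where
  "conn F = (\<lambda>u v. {u, v} \<in> F)\<^sup>*\<^sup>*"

lemma conn_refl [simp]: "conn F x x"
  by (simp add: conn_def)

lemma conn_edge: "{x, y} \<in> F ==> conn F x y"
  by (simp add: conn_def r_into_rtranclp)

lemma conn_trans: "conn F x y ==> conn F y z ==> conn F x z"
  unfolding conn_def by (rule rtranclp_trans)

lemma conn_sym: "conn F x y ==> conn F y x"
  unfolding conn_def
proof (induction rule: rtranclp_induct)
  case (step y z)
  have "{z, y} \<in> F" using step.hyps by (simp add: insert_commute)
  with step.IH show ?case by (rule converse_rtranclp_into_rtranclp[rotated])
qed simp

lemma conn_mono: "conn F x y ==> F \<subseteq> F' ==> conn F' x y"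
  unfolding conn_def by (erule rtranclp_mono[THEN predicate2D, rotated]) auto

lemma conn_induct [consumes 1, case_names base step]:
  assumes "conn F x y" "P x" "\<And>y z. conn F x y ==> {y, z} \<in> F ==> P y ==> P z"
  shows "P y"
  using assms(1) unfolding conn_def
proof (induction rule: rtranclp_induct)
  case base
  show ?case by (rule assms(2))
next
  case (step y z)
  then show ?case using assms(3)[of y z] by (simp add: conn_def)
qed

lemma conn_least:
  assumes "conn F x y" "\<And>x. R x x" "\<And>x y z. R x y ==> R y z ==> R x z" "\<And>x y. {x, y} \<in> F ==> R x y"
  shows "R x y"
  using assms(1)
proof (induction rule: conn_induct)
  case base
  show ?case by (rule assms(2))
next
  case (step y z)
  show ?case using assms(3)[OF step.IH assms(4)[OF step.hyps(2)]] .
qed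

lemma conn_insert:
  assumes "conn (insert {a, b} F) x y"
  shows "conn F x y \<or> (conn F x a \<and> conn F b y) \<or> (conn F x b \<and> conn F a y)"
  using assms
proof (induction rule: conn_induct)
  case (step y z)
  show ?case
  proof (cases "{y, z} = {a, b}")
    case True
    then have "(y = a \<and> z = b) \<or> (y = b \<and> z = a)" by (auto simp: doubleton_eq_iff)
    with step.IH show ?thesis by auto
  next
    case False
    with step.hyps have "conn F y z" by (auto intro: conn_edge)
    with step.IH show ?thesis by (meson conn_trans)
  qed
qed simp

text \<open>A shortest walk to \<open>y\<close> never uses the edges at \<open>y\<close> before its last step.\<close>

lemma relpowp_avoid:
  assumes "((\<lambda>u v. {u, v} \<in> F) ^^ m) x z" "\<forall>i\<le>m. \<not> ((\<lambda>u v. {u, v} \<in> F) ^^ i) x y" "y \<in> g"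
  shows "conn (F - {g}) x z"
  using assms(1,2)
proof (induction m arbitrary: z)
  case (Suc m)
  then obtain w where w: "((\<lambda>u v. {u, v} \<in> F) ^^ m) x w" "{w, z} \<in> F" by auto
  have "w \<noteq> y" using w(1) Suc.prems(2) by (metis le_SucI order_refl)
  moreover have "z \<noteq> y" using Suc.prems by (metis order_refl)
  ultimately have wz: "w \<noteq> y" "z \<noteq> y" by simp_all
  have "{w, z} \<noteq> g" using assms(3) wz by auto
  moreover have "conn (F - {g}) x w" using Suc.IH w(1) Suc.prems(2) by auto
  ultimately show ?case using w(2) by (meson DiffI conn_edge conn_trans singletonD)
qed simp

section \<open>Paths and cuts in a tree\<close>

text \<open>Acyclicity is encoded by making every edge a bridge, because the arguments below speak
  of the two sides of an edge and not of cycles. The vertex set may be infinite: the same locale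
  serves the finite approximations and the infinite spanning tree.\<close>

locale tree =
  fixes K :: "'v set" and T :: "'v set set"
  assumes edgeE: "e \<in> T ==> \<exists>u v. u \<in> K \<and> v \<in> K \<and> u \<noteq> v \<and> e = {u, v}"
    and connected: "x \<in> K ==> y \<in> K ==> conn T x y"
    and bridge: "{u, v} \<in> T ==> \<not> conn (T - {{u, v}}) u v"
begin

definition sep :: "'v set => 'v => 'v => bool" where
  "sep e x y \<longleftrightarrow> \<not> conn (T - {e}) x y"

text \<open>The path from \<open>x\<close> to \<open>y\<close> as the set of edges that separate its
  ends; its cardinality is the tree distance.\<close>

definition P :: "'v => 'v => 'v set set" where
  "P x y = {e \<in> T. sep e x y}"

definition side :: "'v set => 'v => 'v set" where
  "side e x = {y \<in> K. \<not> sep e x y}"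

lemma edge_dest:
  assumes "{u, v} \<in> T"
  shows "u \<in> K \<and> v \<in> K \<and> u \<noteq> v"
proof -
  obtain a b where "a \<in> K" "b \<in> K" "a \<noteq> b" "{u, v} = {a, b}" using edgeE[OF assms] by blast
  then show ?thesis by (auto simp: doubleton_eq_iff)
qed

lemma edge_other:
  assumes "e \<in> T" "a \<in> e" obtains b where "e = {a, b}" "a \<in> K" "b \<in> K" "a \<noteq> b"
proof -
  obtain u v where "u \<in> K" "v \<in> K" "u \<noteq> v" "e = {u, v}" using edgeE[OF assms(1)] by blast
  with assms(2) that show thesis by (metis insert_commute insert_iff singletonD)
qed

lemma sep_refl [simp]: "\<not> sep e x x" by (simp add: sep_def)
lemma sep_sym: "sep e x y \<longleftrightarrow> sep e y x" by (auto simp: sep_def dest: conn_sym)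
lemma P_sym: "P x y = P y x" using sep_sym by (auto simp: P_def)
lemma P_refl [simp]: "P x x = {}" by (simp add: P_def)
lemma P_subset: "P x y \<subseteq> T" by (auto simp: P_def)
lemma not_sep_trans: "\<not> sep e x y ==> \<not> sep e y z ==> \<not> sep e x z"
  by (auto simp: sep_def intro: conn_trans)

lemma sep_ends: "e = {a, b} ==> e \<in> T ==> sep e a b"
  using bridge by (auto simp: sep_def)

lemma not_sep_edge: "{x, y} \<in> T ==> {x, y} \<noteq> e ==> \<not> sep e x y"
  by (auto simp: sep_def intro!: conn_edge)

lemma two_sides:
  assumes "{a, b} \<in> T" "x \<in> K"
  shows "\<not> sep {a, b} a x \<or> \<not> sep {a, b} b x"
proof -
  have "conn T a x" using assms connected edge_dest by blast
  then show ?thesis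
  proof (induction rule: conn_induct)
    case (step y z)
    show ?case
    proof (cases "{y, z} = {a, b}")
      case True
      then show ?thesis by (auto simp: doubleton_eq_iff)
    next
      case False
      have "\<not> sep {a, b} y z" by (rule not_sep_edge[OF step.hyps(2) False])
      then show ?thesis
        using step.IH not_sep_trans[of "{a, b}" a y z] not_sep_trans[of "{a, b}" b y z] by argo
    qed
  qed simp
qed

text \<open>Deleting an edge leaves two classes, told apart by whether they are separated from one
  fixed end. The colouring turns statements about separation into parity arguments, which
  \<open>sep_xor\<close> makes available.\<close>

lemma sep_colour:
  assumes "e \<in> T"
  obtains c :: "'v => bool" where "\<And>x y. x \<in> K ==> y \<in> K ==> sep e x y \<longleftrightarrow> c x \<noteq> c y"
proof -
  obtain a b where e: "e = {a, b}" using edgeE[OF assms] by blast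
  have ab: "sep e a b" using bridge e assms by (simp add: sep_def)
  have "sep e x y \<longleftrightarrow> sep e a x \<noteq> sep e a y" if xy: "x \<in> K" "y \<in> K" for x y
  proof -
    have A: "\<not> sep e a x \<or> \<not> sep e b x" "\<not> sep e a y \<or> \<not> sep e b y"
      using two_sides xy e assms by auto
    note tr = not_sep_trans[of e]
    show ?thesis
      using A tr[of x a y] tr[of x b y] tr[of a x y] tr[of a y x] sep_sym[of e]
      by (simp only:) argo
  qed
  with that show thesis by blast
qed

lemma sep_xor:
  assumes "e \<in> T" "x \<in> K" "y \<in> K" "z \<in> K"
  shows "sep e x z \<longleftrightarrow> (sep e x y \<noteq> sep e y z)"
  using sep_colour[OF assms(1)] assms(2-4) by metis

lemma P_edge: "{x, y} \<in> T ==> P x y = {{x, y}}"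
  using not_sep_edge sep_ends by (auto simp: P_def)

lemma P_trans: "P x z \<subseteq> P x y \<union> P y z"
  using not_sep_trans by (auto simp: P_def)

lemma finite_P: assumes "x \<in> K" "y \<in> K" shows "finite (P x y)"
proof -
  have "conn T x y" using connected assms by blast
  then show ?thesis
  proof (induction rule: conn_induct)
    case (step y z)
    then show ?case using P_trans[of x z y] P_edge[of y z] by (metis finite.emptyI finite_Un finite_insert finite_subset)
  qed simp
qed

text \<open>The last edge of a shortest walk. Such a walk reaches \<open>z\<close> without using
  this edge, so the path to \<open>y\<close> is the path to \<open>z\<close> with exactly one edge
  added; inductions on tree distance rest on this decomposition.\<close>

lemma parent:
  assumes "x \<in> K" "y \<in> K" "x \<noteq> y"
  obtains z where "{z, y} \<in> T" "z \<in> K" "{z, y} \<notin> P x z" "P x y = insert {z, y} (P x z)"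
proof -
  let ?R = "\<lambda>u v. {u, v} \<in> T"
  have "\<exists>n. (?R ^^ n) x y" using connected[OF assms(1,2)] by (simp add: conn_def rtranclp_power)
  then obtain n where n: "(?R ^^ n) x y" "\<And>i. i < n ==> \<not> (?R ^^ i) x y"
    using exists_least_iff[of "\<lambda>n. (?R ^^ n) x y"] by blast
  have "n \<noteq> 0" using n(1) assms(3) by (cases n) auto
  then obtain m where m: "n = Suc m" using not0_implies_Suc by blast
  with n(1) obtain z where z: "(?R ^^ m) x z" "{z, y} \<in> T" by auto
  have c: "conn (T - {{z, y}}) x z"
    by (rule relpowp_avoid[OF z(1), of y]) (use n(2) m in \<open>auto simp: less_Suc_eq_le\<close>)
  have zK: "z \<in> K" using edge_dest z by blast
  have "{z, y} \<notin> P x z" using c by (auto simp: P_def sep_def)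
  moreover have "P x y = insert {z, y} (P x z)"
  proof -
    have "e \<in> P x y \<longleftrightarrow> e \<in> insert {z, y} (P x z)" for e
    proof (cases "e \<in> T")
      case True
      have "sep e x y \<longleftrightarrow> sep e x z \<noteq> sep e z y" by (rule sep_xor[OF True assms(1) zK assms(2)])
      moreover have "sep e z y \<longleftrightarrow> e = {z, y}" using P_edge[OF z(2)] True by (auto simp: P_def)
      moreover have "\<not> sep {z, y} x z" using c by (simp add: sep_def)
      ultimately show ?thesis using True by (auto simp: P_def)
    qed (use z(2) in \<open>auto simp: P_def\<close>)
    then show ?thesis by blast
  qed
  ultimately show thesis using that z(2) zK by blast
qed

lemma P_eq_empty: "x \<in> K ==> y \<in> K ==> P x y = {} \<longleftrightarrow> x = y"
  using parent[of x y] by (metis P_refl insert_not_empty)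

text \<open>A walk that stays on the side of \<open>q\<close> after deletion of \<open>h\<close> can
  never use \<open>e\<close>, since the end \<open>a\<close> of \<open>e\<close> lies on the other
  side. This nesting of cuts is the basic tool for comparing two edges.\<close>

lemma cross:
  assumes "h \<in> T" "e \<noteq> h" "a \<in> e" "sep h a q" "\<not> sep h q q'"
  shows "\<not> sep e q q'"
proof -
  have "conn (T - {h}) q q'" using assms(5) by (simp add: sep_def)
  then have "\<not> sep e q q' \<and> \<not> sep h q q'"
  proof (induction rule: conn_induct)
    case (step y z)
    have "\<not> sep h y z" using conn_edge[OF step.hyps(2)] by (simp add: sep_def)
    then have "\<not> sep h q z" using step.IH not_sep_trans[of h q y z] by simp
    then have "a \<noteq> y" "a \<noteq> z" using step.IH assms(4) sep_sym[of h a q] by auto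
    show ?case
    proof (cases "{y, z} = e")
      case True
      then show ?thesis using assms(3) \<open>a \<noteq> y\<close> \<open>a \<noteq> z\<close> by auto
    next
      case False
      then have "\<not> sep e y z" using step not_sep_edge by blast
      then show ?thesis using step \<open>\<not> sep h q z\<close> not_sep_trans by blast
    qed
  qed simp
  then show ?thesis by simp
qed

text \<open>An end of an edge on the path lies itself on the path. An edge separating
  \<open>a\<close> from both \<open>u\<close> and \<open>v\<close> would leave \<open>u\<close> and
  \<open>v\<close> on one side and \<open>e\<close> beyond it, and then \<open>e\<close> could not
  separate them.\<close>

lemma P_split:
  assumes "e \<in> P u v" "a \<in> e" "u \<in> K" "v \<in> K"
  shows "P u a \<inter> P a v = {}" "P u a \<subseteq> P u v"
proof -
  have eT: "e \<in> T" and suv: "sep e u v" using assms by (auto simp: P_def)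
  obtain b where b: "e = {a, b}" "a \<in> K" "b \<in> K" using edge_other[OF eT assms(2)] by blast
  show 1: "P u a \<inter> P a v = {}"
  proof (rule equals0I)
    fix h assume "h \<in> P u a \<inter> P a v"
    then have h: "h \<in> T" "sep h u a" "sep h a v" by (auto simp: P_def)
    have "h \<noteq> e" using sep_xor[OF eT assms(3) b(2) assms(4)] h suv by auto
    moreover have "\<not> sep h u v" using sep_xor[OF h(1) assms(3) b(2) assms(4)] h by auto
    ultimately have "\<not> sep e u v" using cross[OF h(1) _ assms(2)] h sep_sym by blast
    with suv show False by simp
  qed
  show "P u a \<subseteq> P u v"
    using 1 sep_xor[OF _ assms(3) b(2) assms(4)] by (auto simp: P_def)
qed

lemma card_P_le:
  assumes "e \<in> P u v" "a \<in> e" "h \<in> P u v" "b \<in> h" "u \<in> K" "v \<in> K"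
  shows "P a b \<subseteq> P u v"
  using P_split(2)[OF assms(1,2,5,6)] P_split(2)[OF assms(3,4,5,6)] P_trans[of a b u] P_sym by blast

lemma side_eq:
  assumes "\<not> sep e x y" shows "side e x = side e y"
  using assms not_sep_trans sep_sym unfolding side_def by blast

lemma side_psubset_aux:
  assumes "g \<in> T" "h \<in> T" "g \<noteq> h" "c \<in> h" "sep g u c" "u \<in> K"
  shows "side g u \<subset> side h u"
proof -
  obtain d where d: "h = {c, d}" "c \<in> K" "d \<in> K" using edge_other[OF assms(2,4)] by blast
  have "side g u \<subseteq> side h u"
    using cross[of g h c u] assms sep_sym[of g u c] by (auto simp: side_def)
  moreover obtain w where w: "w = c \<or> w = d" "\<not> sep h u w"
    using two_sides[of c d u] assms d sep_sym by blast
  moreover have "\<not> sep g c d" using not_sep_edge d assms by metis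
  then have "sep g u w" using w(1) assms(5) not_sep_trans sep_sym by blast
  moreover have "w \<in> K" using w d by blast
  ultimately show ?thesis by (auto simp: side_def)
qed

lemma side_compl:
  assumes "e \<in> T" "u \<in> K" "v \<in> K" "sep e u v"
  shows "side e u = K - side e v"
  using sep_xor[OF assms(1,2,3)] assms(4) by (auto simp: side_def)

lemma side_psubset:
  assumes "g \<in> P u v" "h \<in> P u v" "g \<noteq> h" "u \<in> K" "v \<in> K"
  shows "side g u \<subset> side h u \<or> side h u \<subset> side g u"
proof -
  have gT: "g \<in> T" and hT: "h \<in> T" and gs: "sep g u v" and hs: "sep h u v" using assms by (auto simp: P_def)
  obtain c where c: "c \<in> h" "c \<in> K" using edgeE[OF hT] by blast
  show ?thesis
  proof (cases "sep g u c")
    case True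
    then show ?thesis using side_psubset_aux[OF gT hT assms(3) c(1)] assms by blast
  next
    case False
    then have "sep g v c" using sep_xor[OF gT assms(5,4) c(2)] gs sep_sym by blast
    then have "side g v \<subset> side h v" using side_psubset_aux[OF gT hT assms(3) c(1)] assms by blast
    moreover have "side g v \<subseteq> K" "side h v \<subseteq> K" by (auto simp: side_def)
    ultimately show ?thesis using side_compl[OF gT assms(4,5) gs] side_compl[OF hT assms(4,5) hs] by blast
  qed
qed

text \<open>Sides along a path are nested, so each size occurs at most once from either end.\<close>

lemma card_light_le:
  assumes "u \<in> K" "v \<in> K"
  shows "card {g \<in> P u v. finite (side g u) \<and> card (side g u) < M} \<le> M" (is "card ?A \<le> M")
proof -
  have "inj_on (\<lambda>g. card (side g u)) ?A"
  proof (rule inj_onI)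
    fix g h assume "g \<in> ?A" "h \<in> ?A" "card (side g u) = card (side h u)"
    then show "g = h" using side_psubset[of g u v h] assms
      psubset_card_mono[of "side g u" "side h u"] psubset_card_mono[of "side h u" "side g u"] by auto
  qed
  then have "card ?A = card ((\<lambda>g. card (side g u)) ` ?A)" by (simp add: card_image)
  also have "... \<le> card {..<M}" by (rule card_mono) auto
  finally show ?thesis by simp
qed

section \<open>Heavy edges and the subtree they form\<close>

text \<open>The guard is there because \<open>card\<close> of an infinite set is 0: an infinite side
  has to count as large.\<close>

definition heavy :: "nat => 'v set => bool" where
  "heavy t e \<longleftrightarrow> e \<in> T \<and> (\<forall>x\<in>K. finite (side e x) --> t \<le> card (side e x))"

lemma heavy_mono: "heavy t e ==> s \<le> t ==> heavy s e"
  by (auto simp: heavy_def intro: le_trans)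

lemma heavyD: "heavy t e ==> e \<in> T" by (simp add: heavy_def)

text \<open>A light edge on the path has its small side towards one of the two ends, and nestedness
  allows at most \<open>M\<close> edges of either kind.\<close>

lemma card_not_heavy_le:
  assumes "u \<in> K" "v \<in> K"
  shows "card {g \<in> P u v. \<not> heavy M g} \<le> 2 * M"
proof -
  let ?A = "\<lambda>u v. {g \<in> P u v. finite (side g u) \<and> card (side g u) < M}"
  have "{g \<in> P u v. \<not> heavy M g} \<subseteq> ?A u v \<union> ?A v u"
  proof
    fix g assume "g \<in> {g \<in> P u v. \<not> heavy M g}"
    then have g: "g \<in> T" "sep g u v" and "\<exists>x\<in>K. finite (side g x) \<and> card (side g x) < M"
      by (auto simp: P_def heavy_def not_le)
    then obtain x where x: "x \<in> K" "finite (side g x)" "card (side g x) < M" by blast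
    have "\<not> sep g x u \<or> \<not> sep g x v" using sep_xor[OF g(1) assms(1) x(1) assms(2)] g(2) sep_sym by blast
    then have "side g x = side g u \<or> side g x = side g v" using side_eq by blast
    then show "g \<in> ?A u v \<union> ?A v u" using g x sep_sym by (auto simp: P_def)
  qed
  moreover have "finite (?A u v \<union> ?A v u)" using finite_P assms by auto
  ultimately have "card {g \<in> P u v. \<not> heavy M g} \<le> card (?A u v \<union> ?A v u)" by (rule card_mono[rotated])
  also have "... \<le> card (?A u v) + card (?A v u)" by (rule card_Un_le)
  also have "... \<le> M + M" using card_light_le assms by (intro add_mono) auto
  finally show ?thesis by simp
qed

text \<open>The side of \<open>h\<close> on which \<open>e\<close> lies contains a whole side of
  \<open>e\<close>, the one turned away from \<open>h\<close>.\<close>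

lemma heavy_side:
  assumes "heavy t e" "e \<noteq> h" "h \<in> T" "a \<in> e" "finite (side h a)"
  shows "t \<le> card (side h a)"
proof -
  have eT: "e \<in> T" using assms heavyD by blast
  obtain b where b: "e = {a, b}" "a \<in> K" "b \<in> K" using edge_other[OF eT assms(4)] by blast
  obtain z w where z: "h = {z, w}" "z \<in> K" using edgeE[OF assms(3)] by blast
  have nab: "\<not> sep h a b" using not_sep_edge b eT assms(2) by metis
  obtain c where c: "c = a \<or> c = b" "sep e z c"
    using sep_xor[OF eT b(2) z(2) b(3)] sep_ends[OF b(1) eT] sep_sym by blast
  have "side e c \<subseteq> side h c"
    using cross[OF eT, of h z c] assms(2) c z by (auto simp: side_def)
  also have "side h c = side h a" using side_eq[OF nab] c by auto
  finally show ?thesis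
    using assms(1,5) c b by (metis card_mono finite_subset heavy_def le_trans)
qed

text \<open>Each side of an edge between two heavy edges contains one of them and is therefore
  large. So the heavy edges form a subtree.\<close>

lemma heavy_between:
  assumes "heavy t e" "heavy t q" "a \<in> e" "c \<in> q" "h \<in> P a c"
  shows "heavy t h"
proof (cases "h = e \<or> h = q")
  case False
  have h: "h \<in> T" "sep h a c" using assms by (auto simp: P_def)
  have aK: "a \<in> K" and cK: "c \<in> K" using assms heavyD edge_other by metis+
  have "t \<le> card (side h x)" if x: "x \<in> K" "finite (side h x)" for x
  proof -
    have "\<not> sep h x a \<or> \<not> sep h x c" using sep_xor[OF h(1) aK x(1) cK] h(2) sep_sym by blast
    then have "side h x = side h a \<or> side h x = side h c" using side_eq by blast
    moreover have "e \<noteq> h" "q \<noteq> h" using False by blast+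
    ultimately show ?thesis
      using heavy_side[OF assms(1) _ h(1) assms(3)] heavy_side[OF assms(2) _ h(1) assms(4)] x(2) by fastforce
  qed
  then show ?thesis using h(1) by (simp add: heavy_def)
qed (use assms in auto)

end

locale finite_tree = tree +
  assumes finite_K: "finite K"
begin

lemma T_subset_Pow: "T \<subseteq> Pow K" using edgeE by blast
lemma finite_T: "finite T" using finite_K T_subset_Pow by (simp add: finite_subset)
lemma finite_side [simp]: "finite (side e x)" using finite_K by (simp add: side_def)

lemma heavy_iff: "heavy t e \<longleftrightarrow> e \<in> T \<and> (\<forall>x\<in>K. t \<le> card (side e x))"
  by (auto simp: heavy_def)

definition hdeg :: "nat => 'a => nat" where
  "hdeg t w = card {q. heavy t q \<and> w \<in> q}"

lemma finite_heavy: "finite {q. heavy t q}"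
  using finite_T by (rule finite_subset[rotated]) (auto simp: heavy_def)

lemma card_edge: "e \<in> T ==> card e = 2"
  using edgeE by fastforce

lemma sum_hdeg: "(\<Sum>w\<in>K. hdeg t w) = 2 * card {q. heavy t q}"
proof -
  have "(\<Sum>w\<in>K. hdeg t w) = (\<Sum>w\<in>K. card {q \<in> {q. heavy t q}. w \<in> q})" by (simp add: hdeg_def)
  also have "... = (\<Sum>q\<in>{q. heavy t q}. card {w \<in> K. w \<in> q})"
    by (rule sum_card_rel_swap) (auto simp: finite_K finite_heavy)
  also have "... = (\<Sum>q\<in>{q. heavy t q}. 2)"
  proof (rule sum.cong[OF refl])
    fix q assume "q \<in> {q. heavy t q}"
    then have "q \<in> T" by (simp add: heavyD)
    then have "{w \<in> K. w \<in> q} = q" using T_subset_Pow by auto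
    then show "card {w \<in> K. w \<in> q} = 2" using card_edge \<open>q \<in> T\<close> by simp
  qed
  finally show ?thesis by simp
qed

end

section \<open>A tree seen from a root or from a heavy edge\<close>

context tree
begin

text \<open>From a root each vertex has a single edge leading back. This makes the far end an
  injective label for edges in \<open>card_heavy_le\<close>.\<close>

lemma far_end_unique:
  assumes "{y, b} \<in> P r y" "{y, b'} \<in> P r y" "r \<in> K"
  shows "{y, b} = {y, b'}"
proof (rule ccontr)
  let ?q = "{y, b}" and ?q' = "{y, b'}"
  assume ne: "?q \<noteq> ?q'"
  have q: "?q \<in> T" "sep ?q r y" and q': "?q' \<in> T" "sep ?q' r y" using assms by (auto simp: P_def)
  have yK: "y \<in> K" "b' \<in> K" using edge_dest[OF q'(1)] by auto
  have "\<not> sep ?q y b'" by (rule not_sep_edge[OF q'(1)]) (use ne in simp)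
  then have 1: "sep ?q r b'" using sep_xor[OF q(1) assms(3) yK] q(2) by simp
  have "sep ?q' y b'" using sep_ends[OF refl q'(1)] .
  then have "\<not> sep ?q' r b'" using sep_xor[OF q'(1) assms(3) yK] q'(2) by simp
  then have "\<not> sep ?q r b'"
    using cross[OF q'(1) ne, of y r b'] q'(2) sep_sym[of ?q' r y] by simp
  with 1 show False by simp
qed

lemma near_end: "{n, f} \<in> P a f ==> a \<in> K ==> {n, f} \<notin> P a n"
  using sep_xor[of "{n, f}" a n f] sep_ends[of "{n, f}" n f] edge_dest[of n f] by (auto simp: P_def)

text \<open>Directs an edge near \<open>x\<close> away from \<open>a\<close>, with near end
  \<open>n\<close> and far end \<open>f\<close>. The conditions on \<open>e\<close> keep the view on
  one side of \<open>e\<close>, so that the two ends of \<open>e\<close> can be treated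
  separately.\<close>

lemma orient:
  assumes "g \<in> T" "x \<in> g" "a \<in> K" "e \<in> T" "g \<noteq> e" "e \<notin> P a x"
  shows "\<exists>n f. g = {n, f} \<and> g \<in> P a f \<and> e \<notin> P a f \<and> card (P a n) \<le> card (P a x)"
proof -
  obtain y where y: "g = {x, y}" "x \<in> K" "y \<in> K" using edge_other[OF assms(1,2)] by blast
  have "\<not> sep e x y" using not_sep_edge y assms by metis
  then have ey: "e \<notin> P a y" using sep_xor[OF assms(4,3) y(2,3)] assms(6,4) by (auto simp: P_def)
  show ?thesis
  proof (cases "sep g a x")
    case True
    then have gP: "g \<in> P a x" using assms(1) by (simp add: P_def)
    then have "P a y \<subseteq> P a x" using P_split(2)[OF gP, of y] y assms by auto
    then have "card (P a y) \<le> card (P a x)" using finite_P assms(3) y by (auto intro: card_mono)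
    moreover have "g = {y, x}" using y(1) by auto
    ultimately show ?thesis using gP assms(6) by blast
  next
    case False
    then have "sep g a y" using sep_xor[OF assms(1,3) y(2,3)] sep_ends[OF y(1) assms(1)] by auto
    then have "g \<in> P a y" using assms(1) by (simp add: P_def)
    then show ?thesis using y(1) ey by blast
  qed
qed

lemma edge_at_depth:
  assumes "a \<in> K" "w \<in> K" "j < card (P a w)"
  shows "\<exists>m k. {m, k} \<in> P a k \<and> P a k \<subseteq> P a w \<and> card (P a m) = j"
  using assms(2,3)
proof (induction "card (P a w)" arbitrary: w rule: less_induct)
  case less
  then have "a \<noteq> w" by auto
  then obtain z where z: "{z, w} \<in> T" "z \<in> K" "{z, w} \<notin> P a z" "P a w = insert {z, w} (P a z)"
    using parent[OF assms(1) less.prems(1)] by blast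
  have c: "card (P a w) = Suc (card (P a z))" using z finite_P[OF assms(1) z(2)] by simp
  show ?case
  proof (cases "j < card (P a z)")
    case True
    then show ?thesis using less.hyps[of z] c z by auto
  next
    case False
    then have "card (P a z) = j" using less.prems c by simp
    then show ?thesis using z by (intro exI[of _ z] exI[of _ w]) auto
  qed
qed

text \<open>By \<open>heavy_between\<close>, a path that starts at a heavy edge cannot come back to
  heavy edges once it has left them; \<open>w\<close> is the vertex where it leaves.\<close>

lemma heavy_initial_segment:
  assumes "heavy t e" "a \<in> e" "y \<in> K"
  shows "\<exists>w\<in>K. (\<forall>h\<in>P a w. heavy t h) \<and> P a w \<subseteq> P a y \<and> (\<forall>h\<in>P w y. \<not> heavy t h)"
  using assms(3)
proof (induction "card (P a y)" arbitrary: y rule: less_induct)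
  case less
  have aK: "a \<in> K" using edge_other[OF heavyD[OF assms(1)] assms(2)] by blast
  show ?case
  proof (cases "a = y")
    case False
    then obtain z where z: "{z, y} \<in> T" "z \<in> K" "{z, y} \<notin> P a z" "P a y = insert {z, y} (P a z)"
      using parent[OF aK less.prems] by blast
    have c: "card (P a z) < card (P a y)" using z finite_P[OF aK z(2)] by simp
    show ?thesis
    proof (cases "heavy t {z, y}")
      case True
      then have "\<forall>h\<in>P a y. heavy t h" using heavy_between[OF assms(1) True assms(2), of y] by simp
      then show ?thesis using less.prems by (intro bexI[of _ y]) auto
    next
      case False
      obtain w where w: "w \<in> K" "\<forall>h\<in>P a w. heavy t h" "P a w \<subseteq> P a z" "\<forall>h\<in>P w z. \<not> heavy t h"
        using less.hyps[OF c z(2)] by blast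
      have "P w y \<subseteq> insert {z, y} (P w z)" using P_trans[of w y z] P_edge[OF z(1)] by auto
      then show ?thesis using w False z(4) by (intro bexI[of _ w]) auto
    qed
  qed (use aK in \<open>auto intro!: bexI[of _ y]\<close>)
qed

end

context finite_tree
begin

text \<open>Each heavy edge is charged to its far end as seen from a fixed root.\<close>

lemma card_heavy_le: "card {q. heavy t q} \<le> card {w \<in> K. 1 \<le> hdeg t w}"
proof (cases "K = {}")
  case True
  then have "{q. heavy t q} = {}" using edgeE heavyD by blast
  then show ?thesis by simp
next
  case False
  then obtain r where r: "r \<in> K" by blast
  have ex: "\<exists>y. y \<in> q \<and> q \<in> P r y" if "heavy t q" for q
  proof -
    have q: "q \<in> T" using that heavyD by blast
    obtain a b where ab: "q = {a, b}" "a \<in> K" "b \<in> K" using edgeE[OF q] by blast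
    have "sep q r a \<or> sep q r b" using sep_xor[OF q r ab(2,3)] sep_ends[OF ab(1) q] by auto
    then show ?thesis using ab q by (auto simp: P_def)
  qed
  define \<phi> where "\<phi> q = (SOME y. y \<in> q \<and> q \<in> P r y)" for q
  have \<phi>: "\<phi> q \<in> q" "q \<in> P r (\<phi> q)" if "heavy t q" for q
    using someI_ex[OF ex[OF that]] by (auto simp: \<phi>_def)
  have "inj_on \<phi> {q. heavy t q}"
  proof (rule inj_onI)
    fix q q' assume a: "q \<in> {q. heavy t q}" "q' \<in> {q. heavy t q}" "\<phi> q = \<phi> q'"
    then have "q \<in> T" "q' \<in> T" by (auto simp: heavyD)
    then obtain b b' where "q = {\<phi> q, b}" "q' = {\<phi> q, b'}"
      using edge_other[of q "\<phi> q"] edge_other[of q' "\<phi> q"] \<phi> a by (metis mem_Collect_eq)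
    moreover have "q \<in> P r (\<phi> q)" "q' \<in> P r (\<phi> q)" using \<phi> a by (metis mem_Collect_eq)+
    ultimately show "q = q'" using far_end_unique[of "\<phi> q" b r b'] r by metis
  qed
  moreover have "\<phi> ` {q. heavy t q} \<subseteq> {w \<in> K. 1 \<le> hdeg t w}"
  proof
    fix w assume "w \<in> \<phi> ` {q. heavy t q}"
    then obtain q where q: "heavy t q" "w \<in> q" using \<phi> by blast
    have "0 < card {q. heavy t q \<and> w \<in> q}"
      using q finite_heavy[of t] by (auto simp: card_gt_0_iff intro: finite_subset[OF _ finite_heavy[of t]])
    moreover have "w \<in> K" using q heavyD T_subset_Pow by blast
    ultimately show "w \<in> {w \<in> K. 1 \<le> hdeg t w}" by (simp add: hdeg_def)
  qed
  ultimately show ?thesis by (rule card_inj_on_le) (use finite_K in auto)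
qed

text \<open>At a leaf of the heavy subtree the only heavy edge has at least \<open>t\<close>
  vertices on the side of the leaf, and the sides belonging to different leaves are
  disjoint.\<close>

lemma leaf_count: "t * card {w \<in> K. hdeg t w = 1} \<le> card K"
proof -
  let ?L = "{w \<in> K. hdeg t w = 1}"
  have "\<exists>q. {q. heavy t q \<and> w \<in> q} = {q}" if "w \<in> ?L" for w
    using that by (simp add: hdeg_def card_1_singleton_iff)
  then obtain Q where Q: "\<And>w. w \<in> ?L ==> {q. heavy t q \<and> w \<in> q} = {Q w}" by metis
  have Qh: "heavy t (Q w)" "w \<in> Q w" if "w \<in> ?L" for w using Q[OF that] by auto
  have Qu: "q = Q w" if "w \<in> ?L" "heavy t q" "w \<in> q" for w q using Q[OF that(1)] that by blast
  let ?A = "\<lambda>w. side (Q w) w"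
  have sepQ: "sep (Q w) w w'" if w: "w \<in> ?L" "w' \<in> ?L" "w \<noteq> w'" for w w'
  proof -
    obtain z where z: "{z, w} \<in> T" "{z, w} \<in> P w' w"
    proof -
      have "w' \<in> K" "w \<in> K" "w' \<noteq> w" using w by auto
      then obtain z where "{z, w} \<in> T" "P w' w = insert {z, w} (P w' z)" by (rule parent)
      then show thesis using that by simp
    qed
    have "heavy t {z, w}"
      using heavy_between[OF Qh(1)[OF w(2)] Qh(1)[OF w(1)] Qh(2)[OF w(2)] Qh(2)[OF w(1)] z(2)] .
    then have "{z, w} = Q w" using Qu[OF w(1)] by blast
    then show ?thesis using z(2) sep_sym by (auto simp: P_def)
  qed
  have disj: "?A w \<inter> ?A w' = {}" if w: "w \<in> ?L" "w' \<in> ?L" "w \<noteq> w'" for w w'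
  proof (rule equals0I)
    fix y assume "y \<in> ?A w \<inter> ?A w'"
    then have y: "y \<in> K" "\<not> sep (Q w) w y" "\<not> sep (Q w') w' y" by (auto simp: side_def)
    have wK: "w \<in> K" "w' \<in> K" using w by auto
    have 1: "sep (Q w) w' y" using sepQ[OF w] y not_sep_trans[of "Q w" w y w'] sep_sym by blast
    have T': "Q w' \<in> T" using Qh(1)[OF w(2)] heavyD by blast
    have s': "sep (Q w') w w'" using sepQ[OF w(2,1)] w(3) sep_sym by blast
    show False
    \<comment> \<open>Equality occurs when the heavy subtree is a single edge and both of its ends
      are leaves.\<close>
    proof (cases "Q w = Q w'")
      case True
      then show False using 1 y(3) by simp
    next
      case False
      show False using cross[OF T' False Qh(2)[OF w(1)] s' y(3)] 1 by simp
    qed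
  qed
  have "t * card ?L = (\<Sum>w\<in>?L. t)" by simp
  also have "... \<le> (\<Sum>w\<in>?L. card (?A w))"
    using Qh(1) by (intro sum_mono) (auto simp: heavy_iff)
  also have "... = card (\<Union>w\<in>?L. ?A w)"
    using finite_K disj by (intro card_UN_disjoint[symmetric]) auto
  also have "... \<le> card K" by (rule card_mono[OF finite_K]) (auto simp: side_def)
  finally show ?thesis .
qed

text \<open>
  By the degree sum, the heavy edges form a subgraph with at most as many branching vertices as leaves,
  and \<open>t\<close> vertices of the tree hang at each leaf.
\<close>

lemma branch_count: "t * card {w \<in> K. 3 \<le> hdeg t w} \<le> card K"
proof -
  let ?c = "\<lambda>p. card {w \<in> K. p (hdeg t w)}"
  have ob: "(\<Sum>w\<in>K. of_bool (p (hdeg t w))) = ?c p" for p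
    using finite_K by (simp add: Int_def Collect_conj_eq[symmetric])
  have "2 * ?c (\<lambda>n. 1 \<le> n) + ?c (\<lambda>n. 3 \<le> n) = (\<Sum>w\<in>K. 2 * of_bool (1 \<le> hdeg t w) + of_bool (3 \<le> hdeg t w))"
    by (simp only: sum.distrib sum_distrib_left[symmetric] ob)
  also have "... \<le> (\<Sum>w\<in>K. hdeg t w + of_bool (hdeg t w = 1))"
    by (rule sum_mono) (auto simp: of_bool_def)
  also have "... = 2 * card {q. heavy t q} + ?c (\<lambda>n. n = 1)"
    using ob[of "\<lambda>n. n = 1"] by (simp add: sum.distrib sum_hdeg)
  finally have "?c (\<lambda>n. 3 \<le> n) \<le> ?c (\<lambda>n. n = 1)" using card_heavy_le[of t] by simp
  then have "t * ?c (\<lambda>n. 3 \<le> n) \<le> t * ?c (\<lambda>n. n = 1)" by simp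
  also have "... \<le> card K" by (rule leaf_count)
  finally show ?thesis .
qed

lemma hdeg_ge_3:
  assumes "heavy t q1" "heavy t q2" "heavy t q3" "z \<in> q1" "z \<in> q2" "z \<in> q3" "q1 \<noteq> q2" "q1 \<noteq> q3" "q2 \<noteq> q3"
  shows "3 \<le> hdeg t z"
proof -
  have "card {q1, q2, q3} \<le> card {q. heavy t q \<and> z \<in> q}"
    by (rule card_mono) (use assms in \<open>auto intro: finite_subset[OF _ finite_heavy[of t]]\<close>)
  then show ?thesis using assms(7-9) by (simp add: hdeg_def)
qed

text \<open>Two heavy edges at the same distance from \<open>a\<close> would part at a vertex that
  has a third heavy edge: \<open>e\<close> itself at distance 0, and the edge leading back towards
  \<open>a\<close> otherwise. The bound on \<open>hdeg\<close> forbids this.\<close>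

lemma heavy_unique:
  assumes e: "heavy t e" "a \<in> e"
  assumes "heavy t {n, f}" "{n, f} \<in> P a f" "e \<notin> P a f" "card (P a n) = j"
    and "heavy t {n', f'}" "{n', f'} \<in> P a f'" "e \<notin> P a f'" "card (P a n') = j"
    and "\<forall>z\<in>K. card (P a z) \<le> j --> hdeg t z \<le> 2"
  shows "{n, f} = {n', f'} \<and> n = n' \<and> f = f'"
  using assms(3-)
proof (induction j arbitrary: n f n' f')
  case 0
  have aK: "a \<in> K" using edge_other[OF heavyD[OF e(1)] e(2)] by blast
  have nK: "n \<in> K" "n' \<in> K" using 0 heavyD edge_dest by metis+
  have n: "n = a" "n' = a" using 0 finite_P[OF aK] P_eq_empty[OF aK] nK by (metis card_0_eq)+
  have ne: "{n, f} \<noteq> e" "{n', f'} \<noteq> e" using 0 by auto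
  have "{n, f} = {n', f'}"
  proof (rule ccontr)
    assume "{n, f} \<noteq> {n', f'}"
    then have "3 \<le> hdeg t a" using hdeg_ge_3[OF e(1) 0(1,5) e(2)] n ne by auto
    moreover have "hdeg t a \<le> 2" using 0 aK by auto
    ultimately show False by simp
  qed
  then show ?case using n by (auto simp: doubleton_eq_iff)
next
  case (Suc j)
  have aK: "a \<in> K" using edge_other[OF heavyD[OF e(1)] e(2)] by blast
  have par: "\<exists>m. heavy t {m, n} \<and> {m, n} \<in> P a n \<and> e \<notin> P a n \<and> card (P a m) = j \<and> {m, n} \<noteq> {n, f} \<and> n \<in> K"
    if "heavy t {n, f}" "{n, f} \<in> P a f" "e \<notin> P a f" "card (P a n) = Suc j" for n f
  proof -
    have nK: "n \<in> K" "f \<in> K" using that heavyD edge_dest by metis+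
    have "a \<noteq> n" using that by auto
    then obtain m where m: "{m, n} \<in> T" "m \<in> K" "{m, n} \<notin> P a m" "P a n = insert {m, n} (P a m)"
      using parent[OF aK nK(1)] by blast
    have mP: "{m, n} \<in> P a n" using m by simp
    have "heavy t {m, n}" using heavy_between[OF e(1) that(1) e(2) _ mP] by simp
    moreover have "P a n \<subseteq> P a f" using P_split(2)[OF that(2), of n] aK nK by simp
    moreover have "card (P a m) = j" using m that(4) finite_P[OF aK m(2)] by simp
    moreover have "{n, f} \<notin> P a n" by (rule near_end[OF that(2) aK])
    ultimately show ?thesis using mP that(3) nK by (intro exI[of _ m]) auto
  qed
  obtain m where m: "heavy t {m, n}" "{m, n} \<in> P a n" "e \<notin> P a n" "card (P a m) = j" "{m, n} \<noteq> {n, f}" "n \<in> K"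
    by (rule exE[OF par[OF Suc.prems(1-4)]]) blast
  obtain m' where m': "heavy t {m', n'}" "{m', n'} \<in> P a n'" "e \<notin> P a n'" "card (P a m') = j" "{m', n'} \<noteq> {n', f'}" "n' \<in> K"
    by (rule exE[OF par[OF Suc.prems(5-8)]]) blast
  have "\<forall>z\<in>K. card (P a z) \<le> j --> hdeg t z \<le> 2" using Suc.prems(9) by auto
  then have n: "n = n'" "{m, n} = {m', n'}"
    using Suc.IH[OF m(1-4) m'(1-4)] by auto
  have "{n, f} = {n', f'}"
  proof (rule ccontr)
    assume "{n, f} \<noteq> {n', f'}"
    then have "3 \<le> hdeg t n" using hdeg_ge_3[OF m(1) Suc.prems(1,5), of n] n m m' by auto
    moreover have "hdeg t n \<le> 2" using Suc.prems(4,9) m(6) by auto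
    ultimately show False by simp
  qed
  then show ?case using n by (auto simp: doubleton_eq_iff)
qed

text \<open>On either side of \<open>e\<close> there is at most one heavy edge at each of the
  distances \<open>0, ..., r\<close>; together with \<open>e\<close> this gives
  \<open>2 * (r + 1) + 1\<close>.\<close>

lemma heavy_ball:
  assumes "heavy t e" "e = {a, b}"
    and nb: "\<forall>z\<in>K. card (P a z) \<le> r \<or> card (P b z) \<le> r --> hdeg t z \<le> 2"
  shows "card {g. heavy t g \<and> (\<exists>x\<in>g. card (P a x) \<le> r)} \<le> 2 * r + 3"
proof -
  have eT: "e \<in> T" and K: "a \<in> K" "b \<in> K" using assms heavyD edge_dest by metis+
  define A where "A a j = {g. \<exists>n f. g = {n, f} \<and> heavy t {n, f} \<and> {n, f} \<in> P a f \<and> e \<notin> P a f \<and> card (P a n) = j}" for a j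
  have A1: "card (A c j) \<le> 1" if "c = a \<or> c = b" "j \<le> r" for c j
  proof -
    have fin: "finite (A c j)" by (rule finite_subset[OF _ finite_heavy[of t]]) (auto simp: A_def)
    have ce: "c \<in> e" using that assms(2) by auto
    have nb': "\<forall>z\<in>K. card (P c z) \<le> j --> hdeg t z \<le> 2" using nb that by auto
    have "g = g'" if gA: "g \<in> A c j" "g' \<in> A c j" for g g'
    proof -
      obtain n f where g: "heavy t {n, f}" "{n, f} \<in> P c f" "e \<notin> P c f" "card (P c n) = j" "g = {n, f}"
        using gA(1) unfolding A_def by blast
      obtain n' f' where g': "heavy t {n', f'}" "{n', f'} \<in> P c f'" "e \<notin> P c f'" "card (P c n') = j" "g' = {n', f'}"
        using gA(2) unfolding A_def by blast
      show ?thesis using heavy_unique[OF assms(1) ce g(1-4) g'(1-4) nb'] g(5) g'(5) by simp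
    qed
    then have "\<forall>g\<in>A c j. \<forall>g'\<in>A c j. g = g'" by blast
    then show ?thesis using card_le_Suc0_iff_eq[OF fin] by simp
  qed
  have UA: "card (\<Union>j\<le>r. A c j) \<le> r + 1" if "c = a \<or> c = b" for c
  proof -
    have "card (\<Union>j\<le>r. A c j) \<le> (\<Sum>j\<le>r. card (A c j))" by (rule card_UN_le) simp
    also have "... \<le> (\<Sum>j\<le>r. 1)" using A1[OF that] by (intro sum_mono) auto
    finally show ?thesis by simp
  qed
  have "{g. heavy t g \<and> (\<exists>x\<in>g. card (P a x) \<le> r)} \<subseteq> {e} \<union> (\<Union>j\<le>r. A a j) \<union> (\<Union>j\<le>r. A b j)"
  proof
    fix g assume "g \<in> {g. heavy t g \<and> (\<exists>x\<in>g. card (P a x) \<le> r)}"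
    then obtain x where g: "heavy t g" "x \<in> g" "card (P a x) \<le> r" by blast
    have gT: "g \<in> T" using g heavyD by blast
    have xK: "x \<in> K" using gT g(2) T_subset_Pow by blast
    have main: "g \<in> (\<Union>j\<le>r. A c j)" if c: "g \<noteq> e" "e \<notin> P c x" "c \<in> K" "card (P c x) \<le> r" for c
    proof -
      obtain n f where nf: "g = {n, f}" "g \<in> P c f" "e \<notin> P c f" "card (P c n) \<le> card (P c x)"
        using orient[OF gT g(2) c(3) eT c(1,2)] by blast
      then have "g \<in> A c (card (P c n))" using g(1) unfolding A_def by blast
      then show ?thesis using nf c by (intro UN_I[of "card (P c n)"]) auto
    qed
    show "g \<in> {e} \<union> (\<Union>j\<le>r. A a j) \<union> (\<Union>j\<le>r. A b j)"
    proof (cases "g = e \<or> e \<notin> P a x")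
      case True
      then show ?thesis using main[of a] g(3) K by blast
    next
      case False
      then have eP: "e \<in> P x a" using P_sym[of x a] by simp
      have "P x b \<subseteq> P x a" using P_split(2)[OF eP, of b] assms(2) xK K by auto
      then have "card (P x b) \<le> card (P x a)" using finite_P[OF xK K(1)] by (rule card_mono[rotated])
      then have "card (P b x) \<le> r" using g(3) P_sym[of x a] P_sym[of x b] by simp
      moreover have "e \<notin> P b x"
        using near_end[of b a x] eP assms(2) xK P_sym[of b x] by (simp add: insert_commute)
      ultimately show ?thesis using main[of b] False K by blast
    qed
  qed
  then have "card {g. heavy t g \<and> (\<exists>x\<in>g. card (P a x) \<le> r)} \<le> card ({e} \<union> (\<Union>j\<le>r. A a j) \<union> (\<Union>j\<le>r. A b j))"
    by (rule card_mono[rotated]) (auto intro: finite_subset[OF _ finite_heavy[of t]] simp: A_def)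
  also have "... \<le> card {e} + card (\<Union>j\<le>r. A a j) + card (\<Union>j\<le>r. A b j)"
    by (meson add_le_mono1 card_Un_le le_trans)
  also have "... \<le> 1 + (r + 1) + (r + 1)" using UA by (intro add_mono) auto
  finally show ?thesis by simp
qed

text \<open>Counts what hangs at \<open>w\<close> by light edges only. The small side of a light
  edge at \<open>w\<close> is the one turned away from the heavy edge \<open>q\<close>, so each of
  the at most \<open>D\<close> such edges contributes at most \<open>t\<close> vertices.\<close>

lemma bush_card:
  assumes "heavy t q" "w \<in> q" "card {h \<in> T. w \<in> h} \<le> D"
  shows "card {y \<in> K. \<forall>h\<in>P w y. \<not> heavy t h} \<le> 1 + D * t"
proof -
  have wK: "w \<in> K" using assms heavyD T_subset_Pow by blast
  let ?H = "{h \<in> T. w \<in> h}" and ?N = "{h \<in> T. w \<in> h \<and> \<not> heavy t h}"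
  have "{y \<in> K. \<forall>h\<in>P w y. \<not> heavy t h} \<subseteq> {w} \<union> (\<Union>h\<in>?N. K - side h w)"
  proof
    fix y assume y: "y \<in> {y \<in> K. \<forall>h\<in>P w y. \<not> heavy t h}"
    show "y \<in> {w} \<union> (\<Union>h\<in>?N. K - side h w)"
    proof (cases "y = w")
      case False
      have "y \<in> K" using y by simp
      then obtain z where z: "{z, w} \<in> T" "P y w = insert {z, w} (P y z)"
        using parent[of y w] wK False by metis
      then have "{z, w} \<in> P w y" using P_sym[of w y] by simp
      then have "{z, w} \<in> ?N" "y \<in> K - side {z, w} w" using y z by (auto simp: P_def side_def)
      then show ?thesis by blast
    qed simp
  qed
  then have "card {y \<in> K. \<forall>h\<in>P w y. \<not> heavy t h} \<le> card ({w} \<union> (\<Union>h\<in>?N. K - side h w))"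
    by (rule card_mono[rotated]) (use finite_K finite_T in auto)
  also have "... \<le> card {w} + card (\<Union>h\<in>?N. K - side h w)" by (rule card_Un_le)
  also have "card (\<Union>h\<in>?N. K - side h w) \<le> (\<Sum>h\<in>?N. card (K - side h w))"
    by (rule card_UN_le) (use finite_T in auto)
  also have "... \<le> (\<Sum>h\<in>?N. t)"
  proof (rule sum_mono)
    fix h assume h: "h \<in> ?N"
    then obtain x where x: "x \<in> K" "card (side h x) < t" by (auto simp: heavy_iff not_le)
    have "q \<noteq> h" using h assms(1) by auto
    then have "t \<le> card (side h w)" using heavy_side[OF assms(1) _ _ assms(2), of h] h by auto
    then have "sep h w x" using side_eq[of h w x] x by (metis not_le)
    then have "side h x = K - side h w" using side_compl[of h x w] h x wK sep_sym by blast
    then show "card (K - side h w) \<le> t" using x by simp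
  qed
  also have "(\<Sum>h\<in>?N. t) = card ?N * t" by simp
  also have "card ?N \<le> card ?H" using finite_T by (intro card_mono) auto
  also have "... \<le> D" by (rule assms(3))
  finally show ?thesis by simp
qed

text \<open>Each vertex between the two heavy edges hangs in a light bush at some vertex
  \<open>w\<close> where its path from \<open>a\<close> stops being heavy. If \<open>w\<close> were
  deeper than \<open>r\<close>, the heavy path to \<open>w\<close> would contain the only heavy edge
  at the depth of \<open>n\<close>, which is \<open>{n, f}\<close>.\<close>

lemma between_card:
  assumes e: "heavy t e" "a \<in> e" and g: "heavy t {n, f}" "{n, f} \<in> P a f" "e \<notin> P a f" "card (P a n) \<le> r"
    and nb: "\<forall>z\<in>K. card (P a z) \<le> r --> hdeg t z \<le> 2"
    and D: "\<And>w. w \<in> K ==> card {h \<in> T. w \<in> h} \<le> D"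
    and N: "card {w \<in> K. card (P a w) \<le> r} \<le> N"
  shows "card {y \<in> K. e \<notin> P a y \<and> {n, f} \<notin> P a y} \<le> N * (1 + D * t)"
proof -
  have aK: "a \<in> K" using edge_other[OF heavyD[OF e(1)] e(2)] by blast
  let ?W = "{w \<in> K. card (P a w) \<le> r \<and> (\<exists>q. heavy t q \<and> w \<in> q)}"
  let ?B = "\<lambda>w. {y \<in> K. \<forall>h\<in>P w y. \<not> heavy t h}"
  have "{y \<in> K. e \<notin> P a y \<and> {n, f} \<notin> P a y} \<subseteq> (\<Union>w\<in>?W. ?B w)"
  proof
    fix y assume y: "y \<in> {y \<in> K. e \<notin> P a y \<and> {n, f} \<notin> P a y}"
    then obtain w where w: "w \<in> K" "\<forall>h\<in>P a w. heavy t h" "P a w \<subseteq> P a y" "\<forall>h\<in>P w y. \<not> heavy t h"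
      using heavy_initial_segment[OF e, of y] by blast
    have "\<exists>q. heavy t q \<and> w \<in> q"
    proof (cases "a = w")
      case False
      then obtain z where "P a w = insert {z, w} (P a z)" by (rule parent[OF aK w(1)])
      then show ?thesis using w by blast
    qed (use e in auto)
    moreover have "card (P a w) \<le> r"
    proof (rule ccontr)
      assume "\<not> card (P a w) \<le> r"
      then obtain m k where mk: "{m, k} \<in> P a k" "P a k \<subseteq> P a w" "card (P a m) = card (P a n)"
        using edge_at_depth[OF aK w(1), of "card (P a n)"] g(4) by auto
      have "heavy t {m, k}" using mk w by blast
      moreover have "e \<notin> P a k" using mk w y by blast
      moreover have "\<forall>z\<in>K. card (P a z) \<le> card (P a n) --> hdeg t z \<le> 2" using nb g(4) by auto
      ultimately have "{n, f} = {m, k}" using heavy_unique[OF e g(1,2,3) refl _ mk(1) _ mk(3)] by blast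
      then show False using mk w y by auto
    qed
    ultimately show "y \<in> (\<Union>w\<in>?W. ?B w)" using w y by blast
  qed
  then have "card {y \<in> K. e \<notin> P a y \<and> {n, f} \<notin> P a y} \<le> card (\<Union>w\<in>?W. ?B w)"
    by (rule card_mono[rotated]) (use finite_K in auto)
  also have "... \<le> (\<Sum>w\<in>?W. card (?B w))" by (rule card_UN_le) (use finite_K in auto)
  also have "... \<le> (\<Sum>w\<in>?W. 1 + D * t)"
    using bush_card D by (intro sum_mono) blast
  also have "... = card ?W * (1 + D * t)" by simp
  also have "... \<le> N * (1 + D * t)"
  proof (rule mult_le_mono1)
    have "card ?W \<le> card {w \<in> K. card (P a w) \<le> r}" using finite_K by (intro card_mono) auto
    then show "card ?W \<le> N" using N by simp
  qed
  finally show ?thesis .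
qed

end

section \<open>Exchanging edges along fundamental cycles\<close>

context tree
begin

lemma P_mono_conn:
  assumes "conn A x y" "A \<subseteq> T"
  shows "P x y \<subseteq> A"
proof
  fix e assume "e \<in> P x y"
  then have "\<not> conn (T - {e}) x y" by (simp add: P_def sep_def)
  then have "\<not> A \<subseteq> T - {e}" using conn_mono[OF assms(1)] by metis
  then show "e \<in> A" using assms(2) by blast
qed

text \<open>The new edge inherits the cut of \<open>e\<close>, and the cut of \<open>e\<close> is
  added modulo 2 to the cut of every other edge on the fundamental cycle. The new cut is first
  guessed as \<open>cut\<close>; no edge of the new tree except \<open>g\<close> crosses it. Then it
  is compared with the true cut: both two-colour \<open>K\<close>, the true one refines the guess,
  and both separate the ends of \<open>g\<close>, so they agree.\<close>

lemma exchange: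
  assumes uv: "u \<in> K" "v \<in> K" and e: "e \<in> P u v" and f: "{u, v} \<notin> T"
  defines "T' \<equiv> insert {u, v} (T - {e})"
  shows "tree K T'"
    and "tree.sep T' {u, v} x y \<longleftrightarrow> sep e x y"
    and "g \<in> T - {e} ==> x \<in> K ==> y \<in> K ==>
      tree.sep T' g x y \<longleftrightarrow> (if g \<in> P u v then sep g x y \<noteq> sep e x y else sep g x y)"
proof -
  have eT: "e \<in> T" and se: "sep e u v" using e by (auto simp: P_def)
  then have uv': "u \<noteq> v" by auto
  have T'f: "T' - {{u, v}} = T - {e}" using f by (auto simp: T'_def)
  obtain a b where ab: "e = {a, b}" "a \<in> K" "b \<in> K" using edgeE[OF eT] by blast
  have conT': "conn T' x y" if "x \<in> K" "y \<in> K" for x y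
  proof -
    have sub: "T - {e} \<subseteq> T'" by (auto simp: T'_def)
    have 1: "conn T' p q" if "\<not> sep e p q" for p q
      using that conn_mono[OF _ sub] by (auto simp: sep_def)
    have 2: "conn T' u v" by (rule conn_edge) (simp add: T'_def)
    have 3: "conn T' u z" if "z \<in> K" for z
    proof (cases "sep e u z")
      case True
      then have "\<not> sep e v z" using sep_xor[OF eT uv(1,2) that] se by simp
      then show ?thesis using conn_trans[OF 2 1] by simp
    qed (rule 1)
    show ?thesis using 3[OF that(1)] 3[OF that(2)] conn_sym conn_trans by metis
  qed
  define cut where "cut g x y \<longleftrightarrow> (if g \<in> P u v then sep g x y \<noteq> sep e x y else sep g x y)" for g x y
  have cut_colour: "\<exists>c. \<forall>x\<in>K. \<forall>y\<in>K. cut g x y \<longleftrightarrow> c x \<noteq> (c y :: bool)" if g: "g \<in> T" for g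
  proof -
    obtain c where c: "\<And>x y. x \<in> K ==> y \<in> K ==> sep g x y \<longleftrightarrow> c x \<noteq> (c y :: bool)" using sep_colour[OF g] by blast
    obtain d where d: "\<And>x y. x \<in> K ==> y \<in> K ==> sep e x y \<longleftrightarrow> d x \<noteq> (d y :: bool)" using sep_colour[OF eT] by blast
    show ?thesis
      by (cases "g \<in> P u v"; rule exI[of _ "if g \<in> P u v then (\<lambda>x. c x \<noteq> d x) else c"])
        (auto simp: cut_def c d)
  qed
  have cut_edge: "\<not> cut g p q" if "g \<in> T - {e}" "{p, q} \<in> T' - {g}" for g p q
  proof (cases "{p, q} = {u, v}")
    case True
    have "\<not> cut g u v" using se that(1) by (auto simp: cut_def P_def)
    moreover have "p = u \<and> q = v \<or> p = v \<and> q = u" using True by (simp add: doubleton_eq_iff)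
    then have "cut g p q \<longleftrightarrow> cut g u v"
    proof (elim disjE conjE)
      assume "p = v" "q = u"
      then show ?thesis unfolding cut_def by (simp only: sep_sym[of g v u] sep_sym[of e v u])
    qed simp
    ultimately show ?thesis by simp
  next
    case False
    then have pq: "{p, q} \<in> T" "{p, q} \<noteq> e" "{p, q} \<noteq> g" using that(2) by (auto simp: T'_def)
    then have "\<not> sep g p q" "\<not> sep e p q" using not_sep_edge by metis+
    then show ?thesis by (simp add: cut_def)
  qed
  have T'K: "\<exists>u v. u \<in> K \<and> v \<in> K \<and> u \<noteq> v \<and> h = {u, v}" if "h \<in> T'" for h
    using that edgeE[of h] uv uv' by (auto simp: T'_def)
  have cut_conn: "q \<in> K \<and> \<not> cut g p q" if "g \<in> T - {e}" "conn (T' - {g}) p q" "p \<in> K" for g p q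
    using that(2)
  proof (induction rule: conn_induct)
    case base
    then show ?case using that by (auto simp: cut_def)
  next
    case (step y z)
    have "z \<in> K"
    proof -
      have "{y, z} \<in> T'" using step.hyps by simp
      then obtain u v where "u \<in> K" "v \<in> K" "{y, z} = {u, v}" using T'K by blast
      then show ?thesis by (auto simp: doubleton_eq_iff)
    qed
    moreover have "\<not> cut g y z" using cut_edge[OF that(1) step.hyps(2)] .
    moreover have "g \<in> T" using that(1) by simp
    then obtain c where "\<forall>x\<in>K. \<forall>y\<in>K. cut g x y \<longleftrightarrow> c x \<noteq> (c y :: bool)" by (rule exE[OF cut_colour])
    ultimately show ?case using step.IH that(3) by auto
  qed
  show tr: "tree K T'"
  proof
    fix p q assume pq: "{p, q} \<in> T'"
    show "\<not> conn (T' - {{p, q}}) p q"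
    proof (cases "{p, q} = {u, v}")
      case True
      then have "(p = u \<and> q = v) \<or> (p = v \<and> q = u)" by (auto simp: doubleton_eq_iff)
      then show ?thesis using se sep_sym[of e u v] True T'f by (auto simp: sep_def)
    next
      case False
      then have pqT: "{p, q} \<in> T - {e}" using pq by (auto simp: T'_def)
      have "sep {p, q} p q" using sep_ends pqT by blast
      moreover have "\<not> sep e p q" using not_sep_edge pqT by blast
      ultimately have "cut {p, q} p q" by (simp add: cut_def)
      moreover have "p \<in> K" using pqT edge_dest by blast
      ultimately show ?thesis using cut_conn[OF pqT] by blast
    qed
  qed (use T'K conT' in auto)
  interpret T': tree K T' by (rule tr)
  show "T'.sep {u, v} x y \<longleftrightarrow> sep e x y" by (simp add: T'.sep_def sep_def T'f)
  assume g: "g \<in> T - {e}" and xy: "x \<in> K" "y \<in> K"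
  obtain c d where cd: "g = {c, d}" "c \<in> K" "d \<in> K" using edgeE[of g] g by blast
  have gT': "g \<in> T'" using g by (auto simp: T'_def)
  obtain c1 where c1: "\<And>x y. x \<in> K ==> y \<in> K ==> T'.sep g x y \<longleftrightarrow> c1 x \<noteq> (c1 y :: bool)"
    using T'.sep_colour[OF gT'] by blast
  have gT: "g \<in> T" using g by simp
  obtain c2 where c2: "\<forall>x\<in>K. \<forall>y\<in>K. cut g x y \<longleftrightarrow> c2 x \<noteq> (c2 y :: bool)" by (rule exE[OF cut_colour[OF gT]])
  have imp: "c2 p = c2 q" if "c1 p = c1 q" "p \<in> K" "q \<in> K" for p q
    using cut_conn[OF g, of p q] that c1 c2 by (auto simp: T'.sep_def)
  have "c1 c \<noteq> c1 d" using T'.sep_ends[OF cd(1) gT'] c1 cd by simp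
  moreover have "c2 c \<noteq> c2 d"
  proof -
    have "sep g c d" "\<not> sep e c d" using sep_ends cd g not_sep_edge[of c d e] by auto
    then have "cut g c d" by (simp add: cut_def)
    then show ?thesis using c2 cd by simp
  qed
  ultimately have "c1 x \<noteq> c1 y \<longleftrightarrow> c2 x \<noteq> c2 y"
    using imp[of x y] imp[of x c] imp[of y c] imp[of x d] imp[of y d] xy cd by metis
  then have "T'.sep g x y \<longleftrightarrow> cut g x y" using c1 c2 xy by simp
  then show "T'.sep g x y \<longleftrightarrow> (if g \<in> P u v then sep g x y \<noteq> sep e x y else sep g x y)"
    by (simp add: cut_def)
qed

text \<open>Disjoint paths make the exchanges independent: an exchange alters only the cuts of edges
  on its own path, so a path still waiting for its exchange consists of the same edges as before.
  This is \<open>SP\<close> in the induction.\<close>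

lemma multi_exchange:
  assumes "finite I"
    and "\<And>e. e \<in> I ==> u e \<in> K \<and> v e \<in> K \<and> e \<in> P (u e) (v e) \<and> {u e, v e} \<notin> T"
    and "\<And>e e'. e \<in> I ==> e' \<in> I ==> e \<noteq> e' ==> P (u e) (v e) \<inter> P (u e') (v e') = {}"
  defines "T' \<equiv> (T - I) \<union> (\<lambda>e. {u e, v e}) ` I"
  shows "tree K T'"
    and "\<forall>e\<in>I. \<forall>x\<in>K. \<forall>y\<in>K. tree.sep T' {u e, v e} x y \<longleftrightarrow> sep e x y"
    and "\<forall>e\<in>I. \<forall>g\<in>P (u e) (v e) - {e}. g \<in> T' \<and> (\<forall>x\<in>K. \<forall>y\<in>K. tree.sep T' g x y \<longleftrightarrow> sep g x y \<noteq> sep e x y)"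
    and "\<forall>g\<in>T. (\<forall>e\<in>I. g \<notin> P (u e) (v e)) --> g \<in> T' \<and> (\<forall>x\<in>K. \<forall>y\<in>K. tree.sep T' g x y \<longleftrightarrow> sep g x y)"
proof -
  define Q where "Q e = P (u e) (v e)" for e
  let ?T = "\<lambda>I. (T - I) \<union> (\<lambda>e. {u e, v e}) ` I"
  have QT: "Q e \<subseteq> T" for e by (auto simp: Q_def P_def)
  have main: "tree K (?T I) \<and> (\<forall>e\<in>I. \<forall>x\<in>K. \<forall>y\<in>K. tree.sep (?T I) {u e, v e} x y \<longleftrightarrow> sep e x y) \<and>
    (\<forall>e\<in>I. \<forall>g\<in>Q e - {e}. g \<in> ?T I \<and> (\<forall>x\<in>K. \<forall>y\<in>K. tree.sep (?T I) g x y \<longleftrightarrow> sep g x y \<noteq> sep e x y)) \<and>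
    (\<forall>g\<in>T. (\<forall>e\<in>I. g \<notin> Q e) --> g \<in> ?T I \<and> (\<forall>x\<in>K. \<forall>y\<in>K. tree.sep (?T I) g x y \<longleftrightarrow> sep g x y))"
    using assms(1-3)
  proof (induction I rule: finite_induct)
    case empty
    have "tree K T" by unfold_locales
    then show ?case by simp
  next
    case (insert e I)
    let ?S = "?T I"
    have IH: "tree K ?S" "\<forall>e\<in>I. \<forall>x\<in>K. \<forall>y\<in>K. tree.sep ?S {u e, v e} x y \<longleftrightarrow> sep e x y"
      "\<forall>e\<in>I. \<forall>g\<in>Q e - {e}. g \<in> ?S \<and> (\<forall>x\<in>K. \<forall>y\<in>K. tree.sep ?S g x y \<longleftrightarrow> sep g x y \<noteq> sep e x y)"
      "\<forall>g\<in>T. (\<forall>e\<in>I. g \<notin> Q e) --> g \<in> ?S \<and> (\<forall>x\<in>K. \<forall>y\<in>K. tree.sep ?S g x y \<longleftrightarrow> sep g x y)"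
      using insert.IH insert.prems by simp_all
    interpret S: tree K ?S by (rule IH(1))
    have uv: "u e' \<in> K" "v e' \<in> K" "e' \<in> Q e'" "{u e', v e'} \<notin> T" if "e' \<in> insert e I" for e'
      using insert.prems(1)[OF that] by (auto simp: Q_def)
    have disj: "Q e' \<inter> Q e'' = {}" if "e' \<in> insert e I" "e'' \<in> insert e I" "e' \<noteq> e''" for e' e''
      using insert.prems(2)[OF that] by (simp add: Q_def)
    have eI: "e' \<noteq> e" if "e' \<in> I" for e' using that insert.hyps by auto
    have Qe: "g \<notin> Q e'" if "g \<in> Q e" "e' \<in> I" for g e' using disj[of e e'] that eI by auto
    have SP: "S.P (u e) (v e) = Q e"
    proof -
      have "g \<in> S.P (u e) (v e) \<longleftrightarrow> g \<in> Q e" for g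
      proof (cases "\<exists>e'\<in>I. g = {u e', v e'} \<or> g \<in> Q e'")
        case True
        then obtain e' where e': "e' \<in> I" "g = {u e', v e'} \<or> g \<in> Q e'" by blast
        have ne: "e' \<notin> Q e" using Qe e'(1) uv(3)[of e'] by blast
        have "e' \<in> T" using uv(3)[of e'] e'(1) QT by blast
        then have se': "\<not> sep e' (u e) (v e)" using ne by (simp add: Q_def P_def)
        have gne: "g \<notin> Q e" using e' Qe uv(4)[of e'] QT by blast
        moreover have "g \<notin> S.P (u e) (v e)"
        proof (cases "g = {u e', v e'}")
          case True
          then show ?thesis using IH(2) e'(1) uv[of e] se' by (simp add: S.P_def)
        next
          case False
          then have gQ: "g \<in> Q e'" using e' by blast
          then have "g \<in> T" using QT by blast
          then have sg: "\<not> sep g (u e) (v e)" using gne by (simp add: Q_def P_def)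
          show ?thesis
          proof (cases "g = e'")
            case True
            have "e' \<notin> ?S" using e'(1) uv(4) \<open>g \<in> T\<close> True by auto
            then show ?thesis using True by (simp add: S.P_def)
          next
            case False
            then show ?thesis using IH(3) e'(1) gQ sg se' uv[of e] by (auto simp: S.P_def)
          qed
        qed
        ultimately show ?thesis by simp
      next
        case False
        show ?thesis
        proof (cases "g \<in> T")
          case True
          then have "g \<in> ?S" "S.sep g (u e) (v e) \<longleftrightarrow> sep g (u e) (v e)" using IH(4) False uv[of e] by auto
          then show ?thesis using True by (auto simp: S.P_def Q_def P_def)
        next
          case False': False
          then have "g \<notin> ?S" using False by auto
          then show ?thesis using False' QT by (auto simp: S.P_def)
        qed
      qed
      then show ?thesis by blast
    qed
    have eS: "e \<in> S.P (u e) (v e)" using SP uv(3) by simp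
    have fS: "{u e, v e} \<notin> ?S"
    proof
      assume "{u e, v e} \<in> ?S"
      then obtain e' where e': "e' \<in> I" "{u e, v e} = {u e', v e'}" using uv(4)[of e] by auto
      then have "(u e = u e' \<and> v e = v e') \<or> (u e = v e' \<and> v e = u e')" by (simp add: doubleton_eq_iff)
      then have "Q e = Q e'" unfolding Q_def by (elim disjE conjE) (simp, simp add: P_sym[of "v e'" "u e'"])
      then show False using Qe[OF uv(3)[of e]] uv(3)[of e] e'(1) by auto
    qed
    have Teq: "insert {u e, v e} (?S - {e}) = ?T (insert e I)"
    proof -
      have "e \<notin> (\<lambda>e. {u e, v e}) ` I" using uv(3)[of e] uv(4) QT by blast
      then show ?thesis by auto
    qed
    note ex = S.exchange[OF uv(1)[of e] uv(2)[of e] eS fS, unfolded Teq SP, simplified]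
    let ?S' = "?T (insert e I)"
    have eTT: "e \<in> T" using uv(3)[of e] QT by blast
    have seS: "S.sep e x y \<longleftrightarrow> sep e x y" if "x \<in> K" "y \<in> K" for x y
      using IH(4) eTT Qe[OF uv(3)[of e]] that by auto
    have ex2: "tree.sep ?S' {u e, v e} x y \<longleftrightarrow> sep e x y" if "x \<in> K" "y \<in> K" for x y
      using ex(2) seS[OF that] by simp
    have ex3: "tree.sep ?S' g x y \<longleftrightarrow> (if g \<in> Q e then S.sep g x y \<noteq> sep e x y else S.sep g x y)"
      if "g \<in> ?S" "g \<noteq> e" "x \<in> K" "y \<in> K" for g x y
      using ex(3)[of g x y] that seS[OF that(3,4)] by auto
    have inS': "g \<in> ?S'" if "g \<in> ?S" "g \<noteq> e" for g using that by auto
    have "tree K ?S'" using ex(1) by simp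
    moreover have "\<forall>e'\<in>insert e I. \<forall>x\<in>K. \<forall>y\<in>K. tree.sep ?S' {u e', v e'} x y \<longleftrightarrow> sep e' x y"
    proof (intro ballI)
      fix e' x y assume a: "e' \<in> insert e I" "x \<in> K" "y \<in> K"
      show "tree.sep ?S' {u e', v e'} x y \<longleftrightarrow> sep e' x y"
      proof (cases "e' = e")
        case True
        then show ?thesis using ex2 a by simp
      next
        case False
        then have e': "e' \<in> I" using a by simp
        have g: "{u e', v e'} \<in> ?S" using e' by blast
        have "{u e', v e'} \<noteq> e" "{u e', v e'} \<notin> Q e" using uv(4)[of e'] a(1) eTT QT by auto
        then show ?thesis using ex3[OF g _ a(2,3)] IH(2) e' a by simp
      qed
    qed
    moreover have "\<forall>e'\<in>insert e I. \<forall>g\<in>Q e' - {e'}. g \<in> ?S' \<and> (\<forall>x\<in>K. \<forall>y\<in>K. tree.sep ?S' g x y \<longleftrightarrow> sep g x y \<noteq> sep e' x y)"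
    proof (intro ballI)
      fix e' g assume a: "e' \<in> insert e I" "g \<in> Q e' - {e'}"
      show "g \<in> ?S' \<and> (\<forall>x\<in>K. \<forall>y\<in>K. tree.sep ?S' g x y \<longleftrightarrow> sep g x y \<noteq> sep e' x y)"
      proof (cases "e' = e")
        case True
        then have g: "g \<in> Q e" "g \<noteq> e" "g \<in> T" using a QT by auto
        then have "g \<in> ?S" "\<forall>x\<in>K. \<forall>y\<in>K. S.sep g x y \<longleftrightarrow> sep g x y" using IH(4) Qe by auto
        then show ?thesis using ex3[of g] inS'[of g] g True by simp
      next
        case False
        then have e': "e' \<in> I" using a by simp
        have g: "g \<in> ?S" "\<forall>x\<in>K. \<forall>y\<in>K. S.sep g x y \<longleftrightarrow> sep g x y \<noteq> sep e' x y" using IH(3) e' a by auto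
        have "g \<notin> Q e" using Qe[of g e'] e' a by blast
        moreover have "g \<noteq> e" using calculation uv(3)[of e] by auto
        ultimately show ?thesis using ex3[of g] inS'[of g] g by simp
      qed
    qed
    moreover have "\<forall>g\<in>T. (\<forall>e'\<in>insert e I. g \<notin> Q e') --> g \<in> ?S' \<and> (\<forall>x\<in>K. \<forall>y\<in>K. tree.sep ?S' g x y \<longleftrightarrow> sep g x y)"
    proof (intro ballI impI)
      fix g assume a: "g \<in> T" "\<forall>e'\<in>insert e I. g \<notin> Q e'"
      then have g: "g \<in> ?S" "\<forall>x\<in>K. \<forall>y\<in>K. S.sep g x y \<longleftrightarrow> sep g x y" using IH(4) by auto
      have "g \<noteq> e" using a uv(3)[of e] by auto
      then show "g \<in> ?S' \<and> (\<forall>x\<in>K. \<forall>y\<in>K. tree.sep ?S' g x y \<longleftrightarrow> sep g x y)"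
        using ex3[of g] inS'[of g] g a by simp
    qed
    ultimately show ?case by blast
  qed
  note main' = main[folded T'_def, unfolded Q_def]
  show "tree K T'" using main' by (rule conjunct1)
  show "\<forall>e\<in>I. \<forall>x\<in>K. \<forall>y\<in>K. tree.sep T' {u e, v e} x y \<longleftrightarrow> sep e x y"
    using main' by (elim conjE)
  show "\<forall>e\<in>I. \<forall>g\<in>P (u e) (v e) - {e}. g \<in> T' \<and> (\<forall>x\<in>K. \<forall>y\<in>K. tree.sep T' g x y \<longleftrightarrow> sep g x y \<noteq> sep e x y)"
    using main' by (elim conjE)
  show "\<forall>g\<in>T. (\<forall>e\<in>I. g \<notin> P (u e) (v e)) --> g \<in> T' \<and> (\<forall>x\<in>K. \<forall>y\<in>K. tree.sep T' g x y \<longleftrightarrow> sep g x y)"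
    using main' by (elim conjE)
qed

end

section \<open>Selecting disjoint cycles and counting the gain\<close>

text \<open>Greedy selection, longest first: whatever is rejected meets a chosen set that is at
  least as long. How much is charged to one chosen set is counted separately in
  \<open>card_ball_good\<close>.\<close>

lemma vitali_disjoint:
  fixes p :: "'a => nat" and Q :: "'a => 'b set"
  assumes "finite A" "\<And>e. e \<in> A ==> Q e \<noteq> {}"
  shows "\<exists>I\<subseteq>A. (\<forall>e\<in>I. \<forall>e'\<in>I. e \<noteq> e' --> Q e \<inter> Q e' = {}) \<and>
    (\<forall>e\<in>A. \<exists>i\<in>I. Q e \<inter> Q i \<noteq> {} \<and> p e \<le> p i)"
  using assms
proof (induction "card A" arbitrary: A rule: less_induct)
  case less
  show ?case
  proof (cases "A = {}")
    case False
    have "Max (p ` A) \<in> p ` A" using less.prems False by (intro Max_in) auto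
    then obtain m where m: "m \<in> A" "p m = Max (p ` A)" by auto
    have mmax: "p e \<le> p m" if "e \<in> A" for e using that less.prems m by auto
    let ?B = "{e \<in> A. Q e \<inter> Q m = {}}"
    have "m \<notin> ?B" using less.prems m by auto
    then have "?B \<subset> A" using m by auto
    then have "card ?B < card A" using less.prems by (intro psubset_card_mono) auto
    then obtain I where I: "I \<subseteq> ?B" "\<forall>e\<in>I. \<forall>e'\<in>I. e \<noteq> e' --> Q e \<inter> Q e' = {}"
      "\<forall>e\<in>?B. \<exists>i\<in>I. Q e \<inter> Q i \<noteq> {} \<and> p e \<le> p i"
      using less.hyps[of ?B] less.prems by auto
    have "\<forall>e\<in>insert m I. \<forall>e'\<in>insert m I. e \<noteq> e' --> Q e \<inter> Q e' = {}"
      using I(1,2) by blast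
    moreover have "\<forall>e\<in>A. \<exists>i\<in>insert m I. Q e \<inter> Q i \<noteq> {} \<and> p e \<le> p i"
    proof
      fix e assume "e \<in> A"
      show "\<exists>i\<in>insert m I. Q e \<inter> Q i \<noteq> {} \<and> p e \<le> p i"
      proof (cases "Q e \<inter> Q m = {}")
        case True
        then show ?thesis using I(3) \<open>e \<in> A\<close> by blast
      next
        case False
        then show ?thesis using mmax[OF \<open>e \<in> A\<close>] by blast
      qed
    qed
    moreover have "insert m I \<subseteq> A" using I(1) m by auto
    ultimately show ?thesis by (intro exI[of _ "insert m I"]) simp
  qed simp
qed

context finite_tree
begin

text \<open>Let \<open>p\<close> be the length of the path of \<open>i\<close>. Everything charged
  to \<open>i\<close> lies within tree distance \<open>2 * p\<close> of \<open>i\<close>, where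
  without branching there are at most \<open>2 * (2 * p) + 3\<close> heavy edges, hence at most
  \<open>7 * p\<close>. The ratio \<open>6 / 7\<close> of the iteration comes from this 7.\<close>

lemma card_ball_good:
  assumes "heavy t i" "i \<in> P (u i) (v i)" "u i \<in> K" "v i \<in> K"
    and nb: "\<forall>a\<in>i. \<forall>z\<in>K. card (P a z) \<le> 2 * card (P (u i) (v i)) --> hdeg t z \<le> 2"
    and A: "\<And>e. e \<in> A ==> heavy t e \<and> e \<in> P (u e) (v e) \<and> u e \<in> K \<and> v e \<in> K"
  shows "card {e \<in> A. P (u e) (v e) \<inter> P (u i) (v i) \<noteq> {} \<and> card (P (u e) (v e)) \<le> card (P (u i) (v i))}
    \<le> 7 * card (P (u i) (v i))"
proof -
  let ?p = "card (P (u i) (v i))"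
  obtain a b where ab: "i = {a, b}" "a \<in> K" "b \<in> K" using edgeE[OF heavyD[OF assms(1)]] by blast
  have "{e \<in> A. P (u e) (v e) \<inter> P (u i) (v i) \<noteq> {} \<and> card (P (u e) (v e)) \<le> ?p} \<subseteq>
    {g. heavy t g \<and> (\<exists>x\<in>g. card (P a x) \<le> 2 * ?p)}"
  proof
    fix e assume e: "e \<in> {e \<in> A. P (u e) (v e) \<inter> P (u i) (v i) \<noteq> {} \<and> card (P (u e) (v e)) \<le> ?p}"
    then obtain h where h: "h \<in> P (u e) (v e)" "h \<in> P (u i) (v i)" by blast
    have e': "heavy t e" "e \<in> P (u e) (v e)" "u e \<in> K" "v e \<in> K" using A e by auto
    obtain z where z: "z \<in> h" "z \<in> K" using h edgeE[of h] by (auto simp: P_def)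
    obtain x where x: "x \<in> e" "x \<in> K" using e'(1) edgeE[of e] heavyD by blast
    have "P z x \<subseteq> P (u e) (v e)" by (rule card_P_le[OF h(1) z(1) e'(2) x(1) e'(3,4)])
    then have "card (P z x) \<le> card (P (u e) (v e))" using finite_P[OF e'(3,4)] by (rule card_mono[rotated])
    then have 1: "card (P z x) \<le> ?p" using e by simp
    have "P a z \<subseteq> P (u i) (v i)" by (rule card_P_le[OF assms(2) _ h(2) z(1) assms(3,4)]) (use ab in simp)
    then have 2: "card (P a z) \<le> ?p" using finite_P[OF assms(3,4)] by (intro card_mono)
    have "card (P a x) \<le> card (P a z \<union> P z x)"
      using P_trans finite_P ab z x by (intro card_mono) auto
    also have "... \<le> card (P a z) + card (P z x)" by (rule card_Un_le)
    finally have "card (P a x) \<le> 2 * ?p" using 1 2 by simp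
    then show "e \<in> {g. heavy t g \<and> (\<exists>x\<in>g. card (P a x) \<le> 2 * ?p)}" using e'(1) x by blast
  qed
  then have "card {e \<in> A. P (u e) (v e) \<inter> P (u i) (v i) \<noteq> {} \<and> card (P (u e) (v e)) \<le> ?p} \<le>
    card {g. heavy t g \<and> (\<exists>x\<in>g. card (P a x) \<le> 2 * ?p)}"
    by (rule card_mono[rotated]) (rule finite_subset[OF _ finite_heavy[of t]], auto)
  also have "... \<le> 2 * (2 * ?p) + 3"
    by (rule heavy_ball[OF assms(1) ab(1)]) (use nb ab in auto)
  also have "1 \<le> ?p" using assms(2) finite_P[OF assms(3,4)] by (metis One_nat_def Suc_leI card_gt_0_iff empty_iff)
  then have "2 * (2 * ?p) + 3 \<le> 7 * ?p" by simp
  finally show ?thesis .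
qed

text \<open>After the exchange the cut of \<open>q\<close> is the sum of the old cuts of
  \<open>q\<close> and \<open>i\<close>, so one of its sides consists of the vertices on which the
  two old cuts agree, as seen from the end \<open>c\<close> of \<open>i\<close> that faces
  \<open>q\<close>. These are the vertices between \<open>q\<close> and \<open>i\<close>, and
  \<open>between_card\<close> bounds them.\<close>

lemma exchanged_side_card:
  assumes i: "heavy t i" "i \<in> P u v" "u \<in> K" "v \<in> K" and q: "heavy t q" "q \<in> P u v" "q \<noteq> i"
    and nb: "\<forall>a\<in>i. \<forall>z\<in>K. card (P a z) \<le> card (P u v) --> hdeg t z \<le> 2"
    and D: "\<And>w. w \<in> K ==> card {h \<in> T. w \<in> h} \<le> D"
    and N: "\<And>a. a \<in> K ==> card {w \<in> K. card (P a w) \<le> card (P u v)} \<le> N"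
  shows "\<exists>c\<in>K. card {y \<in> K. sep q c y = sep i c y} \<le> N * (1 + D * t)"
proof -
  have iT: "i \<in> T" and qT: "q \<in> T" using i q heavyD by auto
  obtain a b where ab: "i = {a, b}" "a \<in> K" "b \<in> K" using edgeE[OF iT] by blast
  obtain x where x: "x \<in> q" "x \<in> K" using edgeE[OF qT] by blast
  obtain c where c: "c \<in> i" "c \<in> K" "i \<notin> P c x"
  proof (cases "i \<in> P a x")
    case True
    then have "i \<notin> P b x" using sep_xor[OF iT ab(2,3) x(2)] sep_ends[OF ab(1) iT] by (simp add: P_def)
    then show ?thesis using that ab by auto
  qed (use that ab in auto)
  obtain d where d: "i = {c, d}" "d \<in> K" using edge_other[OF iT c(1)] by blast
  obtain n f where nf: "q = {n, f}" "q \<in> P c f" "i \<notin> P c f" "card (P c n) \<le> card (P c x)"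
    using orient[OF qT x(1) c(2) iT q(3) c(3)] by blast
  have "P c x \<subseteq> P u v" by (rule card_P_le[OF i(2) c(1) q(2) x(1) i(3,4)])
  then have "card (P c x) \<le> card (P u v)" using finite_P[OF i(3,4)] by (rule card_mono[rotated])
  then have cn: "card (P c n) \<le> card (P u v)" using nf by simp
  have nfK: "n \<in> K" "f \<in> K" using qT nf edge_dest by blast+
  have "{y \<in> K. sep q c y = sep i c y} \<subseteq> {y \<in> K. i \<notin> P c y \<and> {n, f} \<notin> P c y}"
  proof
    fix y assume y: "y \<in> {y \<in> K. sep q c y = sep i c y}"
    have "\<not> sep i c y"
    proof
      assume s: "sep i c y"
      have "\<not> sep i n f" by (rule not_sep_edge) (use nf q qT in auto)
      then have "\<not> sep i c n" using sep_xor[OF iT c(2) nfK] nf(3) iT by (simp add: P_def)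
      then have "sep i n d" "\<not> sep i d y"
        using sep_ends[OF d(1) iT] s sep_xor[OF iT nfK(1) c(2) d(2)] sep_xor[OF iT c(2) d(2), of y] y sep_sym[of i n c] by auto
      then have "\<not> sep q d y" using cross[OF iT q(3), of n d y] nf(1) by simp
      moreover have "\<not> sep q c d" by (rule not_sep_edge) (use d q iT in auto)
      ultimately have "\<not> sep q c y" using not_sep_trans by metis
      then show False using y s by simp
    qed
    then show "y \<in> {y \<in> K. i \<notin> P c y \<and> {n, f} \<notin> P c y}" using y nf(1) by (auto simp: P_def)
  qed
  then have "card {y \<in> K. sep q c y = sep i c y} \<le> card {y \<in> K. i \<notin> P c y \<and> {n, f} \<notin> P c y}"
    using finite_K by (intro card_mono) auto
  also have "... \<le> N * (1 + D * t)"
    by (rule between_card[OF i(1) c(1) _ _ nf(3) cn]) (use q nf nb c D N in auto)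
  finally show ?thesis using c by blast
qed

text \<open>The heavy edges on the chosen tree paths become light, at the price of the new edges
  and of the light parts of the paths; \<^term>\<open>7\<close>-fold neighbourhoods of the paths cover \<^term>\<open>A\<close>.\<close>

lemma exchange_step:
  fixes A :: "'a set set" and u v :: "'a set => 'a"
  assumes A: "\<And>e. e \<in> A ==> heavy t e \<and> e \<in> P (u e) (v e) \<and> u e \<in> K \<and> v e \<in> K"
    and len: "\<And>e. e \<in> A ==> \<rho> \<le> card (P (u e) (v e)) \<and> card (P (u e) (v e)) \<le> L" and \<rho>: "2 \<le> \<rho>"
    and nb: "\<And>e a z. e \<in> A ==> a \<in> e ==> z \<in> K ==> card (P a z) \<le> 2 * L ==> hdeg t z \<le> 2"
    and D: "\<And>w. w \<in> K ==> card {h \<in> T. w \<in> h} \<le> D"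
    and N: "\<And>a. a \<in> K ==> card {w \<in> K. card (P a w) \<le> L} \<le> N"
    and t': "t \<le> t'" "N * (1 + D * t) < t'"
  shows "\<exists>I. I \<subseteq> A \<and> \<rho> * card I \<le> card T \<and>
    tree K ((T - I) \<union> (\<lambda>e. {u e, v e}) ` I) \<and>
    7 * card {q. tree.heavy K ((T - I) \<union> (\<lambda>e. {u e, v e}) ` I) t' q} + card A
      \<le> 7 * (card {q. heavy t q} + card I * (1 + 4 * M) + 2 * card {q. heavy M q \<and> \<not> heavy t q}) \<and>
    (\<forall>s. card {q. tree.heavy K ((T - I) \<union> (\<lambda>e. {u e, v e}) ` I) s q} \<le> card {q. heavy s q} + card I * (1 + 2 * s)) \<and>
    (\<forall>x\<in>K. \<forall>y\<in>K. P x y \<inter> I = {} --> tree.P ((T - I) \<union> (\<lambda>e. {u e, v e}) ` I) x y = P x y) \<and>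
    (\<forall>x\<in>K. \<forall>y\<in>K. card (tree.P ((T - I) \<union> (\<lambda>e. {u e, v e}) ` I) x y) \<le> card (P x y) * (L + 2))"
proof -
  define Q where "Q e = P (u e) (v e)" for e
  define p where "p e = card (Q e)" for e
  have AT: "A \<subseteq> T" using A heavyD by blast
  have finA: "finite A" using AT finite_T finite_subset by blast
  have QT: "Q e \<subseteq> T" for e by (auto simp: Q_def P_def)
  have finQ: "finite (Q e)" for e using QT finite_T finite_subset by blast
  obtain I where I: "I \<subseteq> A" "\<forall>e\<in>I. \<forall>e'\<in>I. e \<noteq> e' --> Q e \<inter> Q e' = {}"
    "\<forall>e\<in>A. \<exists>i\<in>I. Q e \<inter> Q i \<noteq> {} \<and> p e \<le> p i"
    using vitali_disjoint[OF finA, of Q p] A unfolding Q_def by blast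
  have finI: "finite I" using I finA finite_subset by blast
  have Iprop: "u e \<in> K \<and> v e \<in> K \<and> e \<in> P (u e) (v e) \<and> {u e, v e} \<notin> T" if "e \<in> I" for e
  proof -
    have "e \<in> A" using that I by blast
    moreover have "{u e, v e} \<notin> T"
    proof
      assume "{u e, v e} \<in> T"
      then have "card (P (u e) (v e)) = 1" using P_edge by simp
      then show False using len[OF \<open>e \<in> A\<close>] \<rho> by simp
    qed
    ultimately show ?thesis using A by blast
  qed
  let ?f = "\<lambda>e. {u e, v e}"
  let ?T = "(T - I) \<union> ?f ` I"
  have dis: "P (u e) (v e) \<inter> P (u e') (v e') = {}" if "e \<in> I" "e' \<in> I" "e \<noteq> e'" for e e'
    using I(2) that unfolding Q_def by blast
  note mx = multi_exchange[OF finI Iprop dis, folded Q_def]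
  interpret S: finite_tree K ?T
    using mx(1) finite_K by (intro finite_tree.intro) (auto simp: finite_tree_axioms_def)
  have UQ: "card (\<Union>i\<in>I. Q i) = (\<Sum>i\<in>I. p i)"
    unfolding p_def using finI finQ I(2) by (intro card_UN_disjoint) auto
  have UQT: "(\<Union>i\<in>I. Q i) \<subseteq> T" using QT by blast
  have 1: "\<rho> * card I \<le> card T"
  proof -
    have "\<rho> * card I = (\<Sum>i\<in>I. \<rho>)" by simp
    also have "... \<le> (\<Sum>i\<in>I. p i)" using len I(1) by (intro sum_mono) (auto simp: p_def Q_def)
    also have "... \<le> card T" using UQ UQT finite_T by (metis card_mono)
    finally show ?thesis .
  qed
  \<comment> \<open>Each edge of \<open>A\<close> is charged to a chosen path that its own path
    meets and that is at least as long.\<close>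
  have A7: "card A \<le> 7 * (\<Sum>i\<in>I. p i)"
  proof -
    have "A \<subseteq> (\<Union>i\<in>I. {e \<in> A. Q e \<inter> Q i \<noteq> {} \<and> p e \<le> p i})" using I(3) by blast
    then have "card A \<le> card (\<Union>i\<in>I. {e \<in> A. Q e \<inter> Q i \<noteq> {} \<and> p e \<le> p i})"
      by (rule card_mono[rotated]) (use finI finA in auto)
    also have "... \<le> (\<Sum>i\<in>I. card {e \<in> A. Q e \<inter> Q i \<noteq> {} \<and> p e \<le> p i})" by (rule card_UN_le[OF finI])
    also have "... \<le> (\<Sum>i\<in>I. 7 * p i)"
    proof (rule sum_mono)
      fix i assume "i \<in> I"
      then have i: "i \<in> A" using I by blast
      show "card {e \<in> A. Q e \<inter> Q i \<noteq> {} \<and> p e \<le> p i} \<le> 7 * p i"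
        unfolding p_def Q_def
        by (rule card_ball_good[of t]) (use A[OF i] A nb[OF i] len[OF i] in auto)
    qed
    finally show ?thesis by (simp add: sum_distrib_left)
  qed
  have S_edge: "S.sep q x y \<longleftrightarrow> sep q x y" if "q \<in> T" "q \<notin> (\<Union>i\<in>I. Q i)" "x \<in> K" "y \<in> K" for q x y
    using mx(4) that by blast
  have off: "S.side q x = side q x" if "q \<in> T" "q \<notin> (\<Union>i\<in>I. Q i)" "x \<in> K" for q x
    using S_edge that by (auto simp: S.side_def side_def)
  have heavy_off: "heavy s q" if "S.heavy s q" "q \<in> T" "q \<notin> (\<Union>i\<in>I. Q i)" for s q
    using that off by (auto simp: S.heavy_iff heavy_iff)
  have heavy_on: "\<not> S.heavy t' q" if i: "i \<in> I" and q: "q \<in> Q i" "q \<noteq> i" "heavy t q" for i q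
  proof -
    have iA: "i \<in> A" using i I by blast
    have "\<exists>c\<in>K. card {y \<in> K. sep q c y = sep i c y} \<le> N * (1 + D * t)"
    proof (rule exchanged_side_card[of t i "u i" "v i"])
      fix a assume "a \<in> K"
      have "card {w \<in> K. card (P a w) \<le> card (P (u i) (v i))} \<le> card {w \<in> K. card (P a w) \<le> L}"
        using len[OF iA] finite_K by (intro card_mono) auto
      then show "card {w \<in> K. card (P a w) \<le> card (P (u i) (v i))} \<le> N" using N[OF \<open>a \<in> K\<close>] by simp
    qed (use A[OF iA] q nb[OF iA] len[OF iA] D in \<open>auto simp: Q_def\<close>)
    then obtain c where c: "c \<in> K" "card {y \<in> K. sep q c y = sep i c y} \<le> N * (1 + D * t)" by blast
    have "\<forall>x\<in>K. \<forall>y\<in>K. S.sep q x y \<longleftrightarrow> sep q x y \<noteq> sep i x y" using mx(3) i q by blast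
    then have "S.side q c = {y \<in> K. sep q c y = sep i c y}" using c(1) by (auto simp: S.side_def)
    then have "card (S.side q c) < t'" using c t'(2) by simp
    then show ?thesis using c(1) unfolding S.heavy_iff by (meson not_le)
  qed
  have IQ: "i \<in> Q i" if "i \<in> I" for i using Iprop[OF that] by (simp add: Q_def)
  let ?U = "\<Union>i\<in>I. Q i"
  let ?H = "{q. heavy t q}"
  have finH: "finite {q. heavy s q}" for s by (rule finite_heavy)
  have finU: "finite ?U" using finI finQ by blast
  \<comment> \<open>A heavy edge of the new tree was heavy and off all paths, or is new, or lies on
    a path and was light before. The last kind is the loss; old heavy edges on the paths have
    disappeared from the count.\<close>
  have "{q. S.heavy t' q} \<subseteq> (?H - ?U) \<union> ?f ` I \<union> (?U - ?H)"
  proof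
    fix q assume "q \<in> {q. S.heavy t' q}"
    then have q: "S.heavy t' q" "q \<in> ?T" using S.heavyD by blast+
    show "q \<in> (?H - ?U) \<union> ?f ` I \<union> (?U - ?H)"
    proof (cases "q \<in> ?f ` I")
      case False
      then have qT: "q \<in> T" "q \<notin> I" using q False by blast+
      have "q \<in> (?H - ?U) \<union> (?U - ?H)"
      proof (cases "q \<in> ?U")
        case True
        then obtain i where i: "i \<in> I" "q \<in> Q i" by blast
        have "q \<noteq> i" using qT i by auto
        then have "\<not> heavy t q" using heavy_on[OF i] q(1) by blast
        then show ?thesis using True by simp
      next
        case False
        then have "heavy t' q" using heavy_off q qT by blast
        then show ?thesis using False heavy_mono t'(1) by simp
      qed
      then show ?thesis by blast
    qed blast
  qed
  then have "card {q. S.heavy t' q} \<le> card ((?H - ?U) \<union> ?f ` I \<union> (?U - ?H))"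
    by (rule card_mono[rotated]) (use finH finU finI in simp)
  also have "... \<le> card (?H - ?U) + card (?f ` I) + card (?U - ?H)"
    by (meson add_le_mono1 card_Un_le le_trans)
  also have "card (?f ` I) \<le> card I" by (rule card_image_le[OF finI])
  finally have h1: "card {q. S.heavy t' q} \<le> card (?H - ?U) + card I + card (?U - ?H)" by simp
  have h2: "card ?H = card (?H - ?U) + card (?H \<inter> ?U)" 
    using card_Int_Diff[OF finH, of t ?U] by simp
  have h3: "card ?U = card (?U - ?H) + card (?H \<inter> ?U)"
    using card_Int_Diff[OF finU, of ?H] by (simp add: Int_commute)
  \<comment> \<open>Edges below weight \<open>M\<close> number at most \<open>2 * M\<close> per
    path. Those between \<open>M\<close> and \<open>t\<close> stay in the estimate as they are; the
    choice of thresholds in \<open>step\<close> makes them rare.\<close>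
  have "?U - ?H \<subseteq> (\<Union>i\<in>I. {g \<in> Q i. \<not> heavy M g}) \<union> {q. heavy M q \<and> \<not> heavy t q}" by auto
  then have "card (?U - ?H) \<le> card ((\<Union>i\<in>I. {g \<in> Q i. \<not> heavy M g}) \<union> {q. heavy M q \<and> \<not> heavy t q})"
    by (rule card_mono[rotated]) (use finI finQ finH[of M] in auto)
  also have "... \<le> card (\<Union>i\<in>I. {g \<in> Q i. \<not> heavy M g}) + card {q. heavy M q \<and> \<not> heavy t q}" by (rule card_Un_le)
  also have "card (\<Union>i\<in>I. {g \<in> Q i. \<not> heavy M g}) \<le> (\<Sum>i\<in>I. card {g \<in> Q i. \<not> heavy M g})" by (rule card_UN_le[OF finI])
  also have "... \<le> (\<Sum>i\<in>I. 2 * M)"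
    using Iprop unfolding Q_def by (intro sum_mono card_not_heavy_le) auto
  finally have h4: "card (?U - ?H) \<le> card I * (2 * M) + card {q. heavy M q \<and> \<not> heavy t q}" by simp
  have "7 * card {q. S.heavy t' q} + card A \<le> 7 * card {q. S.heavy t' q} + 7 * card ?U" using A7 UQ by simp
  also have "... \<le> 7 * (card ?H + card I + 2 * card (?U - ?H))" using h1 h2 h3 by simp
  also have "... \<le> 7 * (card ?H + card I * (1 + 4 * M) + 2 * card {q. heavy M q \<and> \<not> heavy t q})"
    using h4 by (simp add: algebra_simps)
  finally have 2: "7 * card {q. S.heavy t' q} + card A
      \<le> 7 * (card ?H + card I * (1 + 4 * M) + 2 * card {q. heavy M q \<and> \<not> heavy t q})" .
  have 3: "card {q. S.heavy s q} \<le> card {q. heavy s q} + card I * (1 + 2 * s)" for s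
  proof -
    have "{q. S.heavy s q} \<subseteq> {q. heavy s q} \<union> (?f ` I \<union> (\<Union>i\<in>I. {g \<in> Q i. \<not> heavy s g}))"
    proof
      fix q assume "q \<in> {q. S.heavy s q}"
      then have q: "S.heavy s q" "q \<in> ?T" using S.heavyD by blast+
      show "q \<in> {q. heavy s q} \<union> (?f ` I \<union> (\<Union>i\<in>I. {g \<in> Q i. \<not> heavy s g}))"
      proof (cases "q \<in> ?f ` I \<or> q \<in> ?U")
        case False
        then have "q \<in> T" "q \<notin> ?U" using q(2) by blast+
        then show ?thesis using heavy_off[OF q(1)] by blast
      qed blast
    qed
    then have "card {q. S.heavy s q} \<le> card ({q. heavy s q} \<union> (?f ` I \<union> (\<Union>i\<in>I. {g \<in> Q i. \<not> heavy s g})))"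
      by (rule card_mono[rotated]) (use finI finQ finH[of s] in auto)
    also have "... \<le> card {q. heavy s q} + (card (?f ` I) + card (\<Union>i\<in>I. {g \<in> Q i. \<not> heavy s g}))"
      by (meson add_left_mono card_Un_le le_trans)
    also have "card (?f ` I) \<le> card I" by (rule card_image_le[OF finI])
    also have "card (\<Union>i\<in>I. {g \<in> Q i. \<not> heavy s g}) \<le> (\<Sum>i\<in>I. card {g \<in> Q i. \<not> heavy s g})" by (rule card_UN_le[OF finI])
    also have "... \<le> (\<Sum>i\<in>I. 2 * s)"
      using Iprop unfolding Q_def by (intro sum_mono card_not_heavy_le) auto
    finally show ?thesis by (simp add: algebra_simps)
  qed
  \<comment> \<open>A detour around an exchanged edge \<open>i\<close> costs the new edge and at
    most the at most \<open>L\<close> edges of \<open>Q i\<close>. This accounts for the factor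
    \<open>L + 2\<close> by which tree distances may grow.\<close>
  have P': "S.P x y \<subseteq> P x y \<union> (\<Union>i\<in>I \<inter> P x y. insert (?f i) (Q i))" if xy: "x \<in> K" "y \<in> K" for x y
  proof
    fix q assume "q \<in> S.P x y"
    then have q: "q \<in> ?T" "S.sep q x y" by (auto simp: S.P_def)
    show "q \<in> P x y \<union> (\<Union>i\<in>I \<inter> P x y. insert (?f i) (Q i))"
    proof (cases "q \<in> ?f ` I")
      case True
      then obtain i where i: "i \<in> I" "q = ?f i" by blast
      then have "sep i x y" using mx(2) q xy by blast
      then have "i \<in> P x y" using i(1) IQ QT by (auto simp: P_def)
      then show ?thesis using i by blast
    next
      case False
      then have qT: "q \<in> T" "q \<notin> I" using q False by blast+
      show ?thesis
      proof (cases "q \<in> ?U")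
        case True
        then obtain i where i: "i \<in> I" "q \<in> Q i" by blast
        have "q \<noteq> i" using qT i by auto
        then have "S.sep q x y \<longleftrightarrow> sep q x y \<noteq> sep i x y" using mx(3) i xy by blast
        then have "sep q x y \<or> sep i x y" using q by blast
        moreover have "i \<in> T" using i IQ QT by blast
        ultimately show ?thesis using i qT by (auto simp: P_def)
      next
        case False
        then have "sep q x y" using S_edge[OF qT(1) False xy] q by blast
        then show ?thesis using qT by (simp add: P_def)
      qed
    qed
  qed
  have 4: "S.P x y = P x y" if xy: "x \<in> K" "y \<in> K" and no: "P x y \<inter> I = {}" for x y
  proof
    show "S.P x y \<subseteq> P x y" using P'[OF xy] no by blast
    show "P x y \<subseteq> S.P x y"
    proof
      fix q assume q: "q \<in> P x y"
      then have qT: "q \<in> T" "q \<notin> I" "sep q x y" using no by (auto simp: P_def)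
      have "q \<in> ?T" using qT by blast
      moreover have "S.sep q x y"
      proof (cases "q \<in> ?U")
        case True
        then obtain i where i: "i \<in> I" "q \<in> Q i" by blast
        have "q \<noteq> i" using qT i by auto
        then have "S.sep q x y \<longleftrightarrow> sep q x y \<noteq> sep i x y" using mx(3) i xy by blast
        moreover have "i \<in> T" using i IQ QT by blast
        then have "\<not> sep i x y" using no i by (auto simp: P_def)
        ultimately show ?thesis using qT by blast
      qed (use S_edge[OF qT(1) _ xy] qT in blast)
      ultimately show "q \<in> S.P x y" by (simp add: S.P_def)
    qed
  qed
  have 5: "card (S.P x y) \<le> card (P x y) * (L + 2)" if xy: "x \<in> K" "y \<in> K" for x y
  proof -
    have fP: "finite (P x y)" by (rule finite_P[OF xy])
    have "card (S.P x y) \<le> card (P x y \<union> (\<Union>i\<in>I \<inter> P x y. insert (?f i) (Q i)))"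
      by (rule card_mono[OF _ P'[OF xy]]) (use fP finQ in auto)
    also have "... \<le> card (P x y) + card (\<Union>i\<in>I \<inter> P x y. insert (?f i) (Q i))" by (rule card_Un_le)
    also have "card (\<Union>i\<in>I \<inter> P x y. insert (?f i) (Q i)) \<le> (\<Sum>i\<in>I \<inter> P x y. card (insert (?f i) (Q i)))"
      by (rule card_UN_le) (use fP in auto)
    also have "... \<le> (\<Sum>i\<in>I \<inter> P x y. L + 1)"
    proof (rule sum_mono)
      fix i assume "i \<in> I \<inter> P x y"
      then have "card (Q i) \<le> L" using len I(1) by (auto simp: Q_def)
      then show "card (insert (?f i) (Q i)) \<le> L + 1" using card_insert_le_m1 finQ
        by (metis Suc_eq_plus1 card_insert_if le_SucI not_less_eq_eq)
    qed
    also have "... = card (I \<inter> P x y) * (L + 1)" by simp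
    also have "... \<le> card (P x y) * (L + 1)" by (intro mult_le_mono1 card_mono fP) auto
    finally show ?thesis by (simp add: algebra_simps)
  qed
  show ?thesis
    by (rule exI[of _ I], intro conjI allI ballI impI) (rule I(1) 1 mx(1) 2 3 4 5 | assumption)+
qed

end

section \<open>Locally finite graphs\<close>

lemma conn_cross:
  assumes "conn F x y" "c x \<noteq> (c y :: bool)"
  obtains p q where "{p, q} \<in> F" "conn F x p" "c p \<noteq> c q"
proof -
  have "c x = c y \<or> (\<exists>p q. {p, q} \<in> F \<and> conn F x p \<and> c p \<noteq> c q)"
    using assms(1)
  proof (induction rule: conn_induct)
    case (step y z)
    then show ?case by (cases "c y = c z") auto
  qed simp
  with assms(2) that show thesis by blast
qed

section \<open>Balls, boundaries and uniform bounds\<close>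

locale lf_graph =
  fixes V :: "'v set" and E :: "'v set set"
  assumes edgeE: "e \<in> E ==> \<exists>u v. u \<in> V \<and> v \<in> V \<and> u \<noteq> v \<and> e = {u, v}"
    and connected: "x \<in> V ==> y \<in> V ==> conn E x y"
    and locfin: "v \<in> V ==> finite {e \<in> E. v \<in> e}"
    and infinite_V: "infinite V"
begin

definition nbr :: "'v => 'v set" where "nbr x = {y. {x, y} \<in> E}"

primrec ball :: "'v => nat => 'v set" where
  "ball x 0 = {x}"
| "ball x (Suc r) = ball x r \<union> (\<Union>y\<in>ball x r. nbr y)"

definition bdry :: "'v set => 'v set set" where
  "bdry K = {e \<in> E. card (e \<inter> K) = 1}"

lemma edge_dest: assumes "{u, v} \<in> E" shows "u \<in> V \<and> v \<in> V \<and> u \<noteq> v"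
proof -
  obtain a b where "a \<in> V" "b \<in> V" "a \<noteq> b" "{u, v} = {a, b}" using edgeE[OF assms] by blast
  then show ?thesis by (auto simp: doubleton_eq_iff)
qed

lemma edge_other:
  assumes "e \<in> E" "a \<in> e" obtains b where "e = {a, b}" "a \<in> V" "b \<in> V" "a \<noteq> b"
proof -
  obtain u v where "u \<in> V" "v \<in> V" "u \<noteq> v" "e = {u, v}" using edgeE[OF assms(1)] by blast
  with assms(2) that show thesis by (metis insert_commute insert_iff singletonD)
qed

lemma edges_Pow: "E \<subseteq> Pow V" using edgeE by blast

lemma finite_nbr: assumes "x \<in> V" shows "finite (nbr x)"
proof -
  have "nbr x \<subseteq> \<Union>{e \<in> E. x \<in> e}" by (auto simp: nbr_def)
  moreover have "finite (\<Union>{e \<in> E. x \<in> e})" using locfin[OF assms] edgeE by fastforce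
  ultimately show ?thesis by (rule finite_subset)
qed

lemma nbr_sym: "y \<in> nbr x \<longleftrightarrow> x \<in> nbr y" by (simp add: nbr_def insert_commute)
lemma nbr_V: "y \<in> nbr x ==> x \<in> V \<and> y \<in> V \<and> x \<noteq> y" using edge_dest by (auto simp: nbr_def)

lemma ball_V: "x \<in> V ==> ball x r \<subseteq> V"
  by (induction r) (use nbr_V in auto)

lemma finite_ball: "x \<in> V ==> finite (ball x r)"
proof (induction r)
  case (Suc r)
  then show ?case using ball_V finite_nbr by auto
qed simp

lemma ball_mono: "r \<le> s ==> ball x r \<subseteq> ball x s"
  by (induction s rule: dec_induct) auto

lemma center_ball [simp]: "x \<in> ball x r" using ball_mono[of 0 r x] by auto

lemma ball_trans: "y \<in> ball x r ==> z \<in> ball y s ==> z \<in> ball x (r + s)"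
proof (induction s arbitrary: z)
  case (Suc s)
  then show ?case by (cases "z \<in> ball y s") auto
qed simp

lemma nbr_ball: "y \<in> nbr x ==> y \<in> ball x 1" by auto

lemma ball_sym: "y \<in> ball x r ==> x \<in> ball y r"
proof (induction r arbitrary: y)
  case (Suc r)
  show ?case
  proof (cases "y \<in> ball x r")
    case True
    then show ?thesis using Suc.IH ball_mono[of r "Suc r" y] by auto
  next
    case False
    then obtain z where z: "z \<in> ball x r" "y \<in> nbr z" using Suc.prems by auto
    then have "x \<in> ball z r" "z \<in> ball y 1" using Suc.IH nbr_sym[of y z] by auto
    then show ?thesis using ball_trans[of z y 1 x r] by simp
  qed
qed simp

lemma ex_ball: assumes "x \<in> V" "y \<in> V" shows "\<exists>r. y \<in> ball x r"
  using connected[OF assms]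
proof (induction rule: conn_induct)
  case (step y z)
  then obtain r where "y \<in> ball x r" by blast
  then have "z \<in> ball x (Suc r)" using step.hyps(2) by (auto simp: nbr_def)
  then show ?case by blast
qed (auto intro: exI[of _ 0])

lemma countable_V: "countable V"
proof -
  obtain x where x: "x \<in> V" using infinite_V by (meson finite.emptyI finite_subset subsetI)
  have "V \<subseteq> (\<Union>r. ball x r)" using ex_ball[OF x] by blast
  moreover have "countable (\<Union>r. ball x r)" using finite_ball[OF x] by (simp add: countable_finite)
  ultimately show ?thesis by (rule countable_subset)
qed

lemma countable_E: "countable E"
proof -
  have "E \<subseteq> (\<lambda>(u, v). {u, v}) ` (V \<times> V)" using edgeE by force
  moreover have "countable ((\<lambda>(u, v). {u, v}) ` (V \<times> V))" using countable_V by simp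
  ultimately show ?thesis by (rule countable_subset)
qed

lemma bdry_dest:
  assumes "e \<in> bdry K" obtains p q where "e = {p, q}" "p \<in> K" "q \<notin> K" "p \<in> V" "q \<in> V" "e \<in> E"
proof -
  have e: "e \<in> E" "card (e \<inter> K) = 1" using assms by (auto simp: bdry_def)
  obtain u v where uv: "u \<in> V" "v \<in> V" "u \<noteq> v" "e = {u, v}" using edgeE[OF e(1)] by blast
  have "\<not> (u \<in> K \<and> v \<in> K)" using e(2) uv by auto
  moreover have "u \<in> K \<or> v \<in> K" using e(2) uv(4) by (metis Int_insert_left Int_empty_left card.empty zero_neq_one)
  ultimately show thesis using that[of u v] that[of v u] uv e(1) by (auto simp: insert_commute)
qed

lemma bdryI: "{p, q} \<in> E ==> p \<in> K ==> q \<notin> K ==> {p, q} \<in> bdry K"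
  by (simp add: bdry_def)

lemma ball_bdry:
  assumes "y \<in> ball a r" "a \<in> K" "y \<notin> K"
  shows "\<exists>e\<in>bdry K. \<exists>p\<in>e \<inter> K. a \<in> ball p r"
  using assms(1,3)
proof (induction r arbitrary: y)
  case (Suc r)
  show ?case
  proof (cases "y \<in> ball a r")
    case True
    then obtain e p where "e \<in> bdry K" "p \<in> e \<inter> K" "a \<in> ball p r" using Suc by blast
    then show ?thesis using ball_mono[of r "Suc r" p] by auto
  next
    case False
    then obtain z where z: "z \<in> ball a r" "y \<in> nbr z" using Suc.prems by auto
    show ?thesis
    proof (cases "z \<in> K")
      case True
      have "{z, y} \<in> bdry K" using z True Suc.prems by (intro bdryI) (auto simp: nbr_def)
      moreover have "a \<in> ball z (Suc r)" using ball_sym[OF z(1)] ball_mono[of r "Suc r" z] by auto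
      ultimately show ?thesis using True by blast
    next
      case False
      then obtain e p where "e \<in> bdry K" "p \<in> e \<inter> K" "a \<in> ball p r" using Suc.IH z by blast
      then show ?thesis using ball_mono[of r "Suc r" p] by auto
    qed
  qed
qed (use assms in auto)

lemma finite_incident: assumes "finite K" "K \<subseteq> V" shows "finite {e \<in> E. e \<inter> K \<noteq> {}}"
proof -
  have "{e \<in> E. e \<inter> K \<noteq> {}} = (\<Union>v\<in>K. {e \<in> E. v \<in> e})" by auto
  then show ?thesis using assms locfin by auto
qed

lemma finite_bdry: assumes "finite K" "K \<subseteq> V" shows "finite (bdry K)"
  using finite_incident[OF assms] by (rule finite_subset[rotated]) (auto simp: bdry_def)

end

text \<open>Uniform bounds on degrees and ball sizes stand in for quasi-transitivity during the
  finite combinatorics; automorphisms supply them later.\<close>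

locale bd_graph = lf_graph +
  fixes D :: nat and \<beta> :: "nat => nat"
  assumes card_ball: "x \<in> V ==> card (ball x r) \<le> \<beta> r"
    and degree: "x \<in> V ==> card {e \<in> E. x \<in> e} \<le> D"
begin

lemma card_incident: assumes "finite K" "K \<subseteq> V" shows "card {e \<in> E. e \<inter> K \<noteq> {}} \<le> D * card K"
proof -
  have "{e \<in> E. e \<inter> K \<noteq> {}} = (\<Union>v\<in>K. {e \<in> E. v \<in> e})" by auto
  then have "card {e \<in> E. e \<inter> K \<noteq> {}} \<le> (\<Sum>v\<in>K. card {e \<in> E. v \<in> e})" by (simp add: card_UN_le assms)
  also have "... \<le> (\<Sum>v\<in>K. D)" using degree assms by (intro sum_mono) auto
  finally show ?thesis by (simp add: mult.commute)
qed

lemma card_UN_ball: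
  assumes "finite Z" "Z \<subseteq> V" shows "card (\<Union>z\<in>Z. ball z r) \<le> card Z * \<beta> r"
proof -
  have "card (\<Union>z\<in>Z. ball z r) \<le> (\<Sum>z\<in>Z. card (ball z r))" by (rule card_UN_le[OF assms(1)])
  also have "... \<le> (\<Sum>z\<in>Z. \<beta> r)" using card_ball assms by (intro sum_mono) auto
  finally show ?thesis by simp
qed

lemma card_near_bdry:
  assumes "finite K" "K \<subseteq> V"
  shows "card {a \<in> K. \<not> ball a r \<subseteq> K} \<le> card (bdry K) * \<beta> r"
proof -
  let ?p = "\<lambda>e. SOME p. p \<in> e \<inter> K"
  have p: "e \<inter> K = {?p e}" if "e \<in> bdry K" for e
  proof -
    have "card (e \<inter> K) = 1" using that by (simp add: bdry_def)
    then obtain x where "e \<inter> K = {x}" by (rule card_1_singletonE)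
    then show ?thesis by simp
  qed
  have "{a \<in> K. \<not> ball a r \<subseteq> K} \<subseteq> (\<Union>z\<in>?p ` bdry K. ball z r)"
  proof
    fix a assume "a \<in> {a \<in> K. \<not> ball a r \<subseteq> K}"
    then obtain y where "a \<in> K" "y \<in> ball a r" "y \<notin> K" by blast
    then obtain e q where "e \<in> bdry K" "q \<in> e \<inter> K" "a \<in> ball q r" using ball_bdry by blast
    then show "a \<in> (\<Union>z\<in>?p ` bdry K. ball z r)" using p by fastforce
  qed
  moreover have fin: "finite (?p ` bdry K)" "?p ` bdry K \<subseteq> V"
  proof -
    show "finite (?p ` bdry K)" using finite_bdry[OF assms] by simp
    show "?p ` bdry K \<subseteq> V" using p assms(2) by fastforce
  qed
  ultimately have "card {a \<in> K. \<not> ball a r \<subseteq> K} \<le> card (\<Union>z\<in>?p ` bdry K. ball z r)"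
    using finite_ball fin by (intro card_mono finite_UN_I[OF fin(1)]) auto
  also have "... \<le> card (?p ` bdry K) * \<beta> r" by (rule card_UN_ball[OF fin])
  also have "... \<le> card (bdry K) * \<beta> r" by (intro mult_le_mono1 card_image_le finite_bdry assms)
  finally show ?thesis .
qed

definition far :: "'a set => 'a set set => nat => 'a set set" where
  "far K T s = {e \<in> E. e \<subseteq> K \<and> (\<exists>x y. e = {x, y} \<and> s < card (tree.P T x y))}"

definition hv :: "'a set => 'a set set => nat => nat" where
  "hv K T s = card {q. tree.heavy K T s q}"

text \<open>Uniform one-endedness: large pieces of the complement of a set in a ball are joined nearby.\<close>

definition uniformly_joined :: "nat => nat => nat => bool" where
  "uniformly_joined \<rho> R Q \<longleftrightarrow> (\<forall>a\<in>V. \<forall>S\<subseteq>ball a \<rho>. \<forall>w\<in>ball a (Suc \<rho>). \<forall>w'\<in>ball a (Suc \<rho>).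
    (\<exists>W. finite W \<and> Q \<le> card W \<and> (\<forall>y\<in>W. conn {e \<in> E. e \<inter> S = {}} w y)) \<and>
    (\<exists>W. finite W \<and> Q \<le> card W \<and> (\<forall>y\<in>W. conn {e \<in> E. e \<inter> S = {}} w' y)) \<and> w \<notin> S \<and> w' \<notin> S -->
    conn {e \<in> E. e \<inter> S = {} \<and> e \<subseteq> ball a R} w w')"

end

section \<open>Long cycles of bounded size through heavy edges\<close>

locale graph_tree = bd_graph V E D \<beta> + finite_tree K T
  for V :: "'v set" and E :: "'v set set" and D \<beta> and K :: "'v set" and T :: "'v set set" +
  assumes KV: "K \<subseteq> V" and TE: "T \<subseteq> E"
begin

lemma P_ball: "x \<in> K ==> y \<in> K ==> card (P x y) \<le> r ==> y \<in> ball x r"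
proof (induction r arbitrary: y)
  case 0
  then show ?case using P_eq_empty finite_P by auto
next
  case (Suc r)
  show ?case
  proof (cases "x = y")
    case False
    then obtain z where z: "{z, y} \<in> T" "z \<in> K" "{z, y} \<notin> P x z" "P x y = insert {z, y} (P x z)"
      using parent Suc.prems by metis
    then have "card (P x z) \<le> r" using Suc.prems finite_P by simp
    then have "z \<in> ball x r" using Suc.IH z Suc.prems by blast
    moreover have "y \<in> nbr z" using z TE by (auto simp: nbr_def)
    ultimately show ?thesis by auto
  qed simp
qed

lemma card_tree_ball: assumes "a \<in> K" shows "card {w \<in> K. card (P a w) \<le> r} \<le> \<beta> r"
proof -
  have "{w \<in> K. card (P a w) \<le> r} \<subseteq> ball a r" using P_ball assms by blast
  then have "card {w \<in> K. card (P a w) \<le> r} \<le> card (ball a r)"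
    using finite_ball assms KV by (intro card_mono) auto
  also have "... \<le> \<beta> r" using card_ball assms KV by auto
  finally show ?thesis .
qed

lemma tree_degree: assumes "w \<in> K" shows "card {h \<in> T. w \<in> h} \<le> D"
proof -
  have "card {h \<in> T. w \<in> h} \<le> card {h \<in> E. w \<in> h}"
    using TE locfin assms KV by (intro card_mono) auto
  then show ?thesis using degree[of w] assms KV by auto
qed

lemma card_T: "card T \<le> D * card K"
proof -
  have "card T \<le> card {e \<in> E. e \<inter> K \<noteq> {}}"
    using TE edgeE T_subset_Pow finite_incident[OF finite_K KV] tree_axioms
    by (intro card_mono) (auto dest: tree.edgeE)
  then show ?thesis using card_incident[OF finite_K KV] by simp
qed

lemma point_at_depth:
  assumes "a \<in> K" "w \<in> K" "j \<le> card (P a w)"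
  shows "\<exists>z\<in>K. card (P a z) = j \<and> P a z \<subseteq> P a w"
proof (cases "j = card (P a w)")
  case False
  then have "j < card (P a w)" using assms by simp
  then obtain m k where mk: "{m, k} \<in> P a k" "P a k \<subseteq> P a w" "card (P a m) = j"
    using edge_at_depth[OF assms(1,2)] by blast
  have "{m, k} \<in> T" using mk P_subset by blast
  then have K: "m \<in> K" "k \<in> K" using tree.edge_dest[OF tree_axioms] by blast+
  then have "P a m \<subseteq> P a k" using P_split(2)[OF mk(1), of m] assms by simp
  then show ?thesis using mk K by blast
qed (use assms in auto)

lemma same_e_side:
  assumes "e \<in> T" "a \<in> e" "w \<in> K" "y \<in> K" "P a w \<subseteq> P a y" "P a w \<noteq> {}"
  shows "sep e a w \<longleftrightarrow> sep e a y"
proof (cases "e \<in> P a w")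
  case True
  then show ?thesis using assms(5) by (auto simp: P_def)
next
  case False
  have aK: "a \<in> K" using assms(1,2) T_subset_Pow by blast
  obtain h where h: "h \<in> P a w" using assms by blast
  then have h': "h \<in> T" "h \<noteq> e" "sep h a w" "sep h a y" using False assms(5) by (auto simp: P_def)
  have "\<not> sep h w y" using sep_xor[OF h'(1) aK assms(3,4)] h' by simp
  then have "\<not> sep e w y" using cross[OF h'(1) _ assms(2) h'(3)] h' by metis
  then show ?thesis using sep_xor[OF assms(1) aK assms(3,4)] by simp
qed

text \<open>Beyond depth \<open>\<rho>\<close> the branch that starts at \<open>w\<close> never
  returns to the tree ball around \<open>a\<close>, so it survives the deletion of that
  ball.\<close>

lemma subtree_conn:
  assumes "a \<in> K" "w \<in> K" "card (P a w) = Suc \<rho>" "y \<in> K" "P a w \<subseteq> P a y"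
  shows "conn {e \<in> E. e \<inter> {z \<in> K. card (P a z) \<le> \<rho>} = {}} w y"
  using assms(4,5)
proof (induction "card (P a y)" arbitrary: y rule: less_induct)
  case less
  show ?case
  proof (cases "y = w")
    case False
    have "a \<noteq> y" using less.prems assms(3) by auto
    then obtain z where z: "{z, y} \<in> T" "z \<in> K" "{z, y} \<notin> P a z" "P a y = insert {z, y} (P a z)"
      using parent assms(1) less.prems(1) by metis
    have c: "card (P a y) = Suc (card (P a z))" using z finite_P assms(1) by simp
    have "{z, y} \<notin> P a w"
    proof
      assume h: "{z, y} \<in> P a w"
      have "P a y \<subseteq> P a w" using P_split(2)[OF h, of y] assms(1,2) by simp
      then have eq: "P a w = P a y" using less.prems(2) by blast
      have "P w y = {}"
      proof (rule equals0I)
        fix q assume "q \<in> P w y"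
        then have q: "q \<in> T" "sep q w y" by (auto simp: P_def)
        have "sep q a w \<longleftrightarrow> sep q a y" using eq q(1) by (auto simp: P_def)
        then show False using sep_xor[OF q(1) assms(1,2) less.prems(1)] q(2) by simp
      qed
      then show False using P_eq_empty assms(2) less.prems(1) False by blast
    qed
    then have sub: "P a w \<subseteq> P a z" using less.prems(2) z(4) by auto
    then have cz: "Suc \<rho> \<le> card (P a z)" using assms(3) card_mono[OF finite_P[OF assms(1) z(2)] sub] by simp
    have "conn {e \<in> E. e \<inter> {z \<in> K. card (P a z) \<le> \<rho>} = {}} w z"
      using less.hyps[of z] c z(2) sub by simp
    moreover have "{z, y} \<in> {e \<in> E. e \<inter> {z \<in> K. card (P a z) \<le> \<rho>} = {}}"
      using z(1) TE cz c by auto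
    then have "conn {e \<in> E. e \<inter> {z \<in> K. card (P a z) \<le> \<rho>} = {}} z y" by (rule conn_edge)
    ultimately show ?thesis by (rule conn_trans)
  qed simp
qed

text \<open>Pigeonhole: off the tree ball of radius \<open>\<rho>\<close>, the side of
  \<open>e\<close> is distributed over the branches that start at depth \<open>Suc \<rho>\<close>.
  There are at most \<open>\<beta> (Suc \<rho>)\<close> of these, so one holds more than
  \<open>Q\<close> vertices.\<close>

lemma big_branch:
  assumes e: "heavy t e" "a \<in> e" "c \<in> e" and t: "\<beta> \<rho> + \<beta> (Suc \<rho>) * Q < t"
  obtains w where "w \<in> K" "sep e a w \<longleftrightarrow> sep e a c" "card (P a w) = Suc \<rho>"
    "\<exists>W. finite W \<and> Q \<le> card W \<and> (\<forall>y\<in>W. conn {e \<in> E. e \<inter> {z \<in> K. card (P a z) \<le> \<rho>} = {}} w y)"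
proof -
  have eT: "e \<in> T" using e heavyD by blast
  have aK: "a \<in> K" "c \<in> K" using eT e T_subset_Pow by auto
  let ?S = "{z \<in> K. card (P a z) \<le> \<rho>}"
  let ?Y = "side e c - ?S"
  let ?Z = "{w \<in> K. card (P a w) = Suc \<rho>}"
  have "\<exists>w. w \<in> ?Z \<and> P a w \<subseteq> P a y" if "y \<in> ?Y" for y
  proof -
    have y: "y \<in> K" "Suc \<rho> \<le> card (P a y)" using that by (auto simp: side_def not_le)
    then obtain z where "z \<in> K" "card (P a z) = Suc \<rho>" "P a z \<subseteq> P a y"
      using point_at_depth[OF aK(1)] by metis
    then show ?thesis by (intro exI[of _ z]) simp
  qed
  then have "\<forall>y\<in>?Y. \<exists>w. w \<in> ?Z \<and> P a w \<subseteq> P a y" by (rule ballI)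
  from bchoice[OF this] obtain f where f': "\<forall>y\<in>?Y. f y \<in> ?Z \<and> P a (f y) \<subseteq> P a y" by (elim exE)
  then have f: "f y \<in> ?Z \<and> P a (f y) \<subseteq> P a y" if "y \<in> ?Y" for y using that by (rule bspec)
  have cS: "card ?S \<le> \<beta> \<rho>" by (rule card_tree_ball[OF aK(1)])
  have "card ?Z \<le> card {w \<in> K. card (P a w) \<le> Suc \<rho>}" using finite_K by (intro card_mono) auto
  then have cZ: "card ?Z \<le> \<beta> (Suc \<rho>)" using card_tree_ball[OF aK(1), of "Suc \<rho>"] by simp
  have "t \<le> card (side e c)" using e(1) aK by (simp add: heavy_iff)
  also have "... \<le> card (?Y \<union> ?S)" using finite_K by (intro card_mono) auto
  also have "... \<le> card ?Y + card ?S" by (rule card_Un_le)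
  finally have cY: "\<beta> (Suc \<rho>) * Q < card ?Y" using cS t by simp
  have "\<exists>w\<in>?Z. Q < card {y \<in> ?Y. f y = w}"
  proof (rule ccontr)
    assume "\<not> ?thesis"
    then have le: "card {y \<in> ?Y. f y = w} \<le> Q" if "w \<in> ?Z" for w using that by (auto simp: not_less)
    have "?Y = (\<Union>w\<in>?Z. {y \<in> ?Y. f y = w})" using f by blast
    then have "card ?Y = card (\<Union>w\<in>?Z. {y \<in> ?Y. f y = w})" by (rule arg_cong[of _ _ card])
    also have "... \<le> (\<Sum>w\<in>?Z. card {y \<in> ?Y. f y = w})" using finite_K by (intro card_UN_le) auto
    also have "... \<le> (\<Sum>w\<in>?Z. Q)" using le by (intro sum_mono)
    also have "... \<le> \<beta> (Suc \<rho>) * Q" using cZ by simp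
    finally show False using cY by simp
  qed
  then obtain w where w: "w \<in> ?Z" "Q < card {y \<in> ?Y. f y = w}" by blast
  then have "{y \<in> ?Y. f y = w} \<noteq> {}" by (metis card.empty not_less0)
  then obtain y where y: "y \<in> ?Y" "f y = w" by blast
  have yw: "P a w \<subseteq> P a y" "y \<in> K" using f y by (auto simp: side_def)
  have "P a w \<noteq> {}" using w by auto
  then have "sep e a w \<longleftrightarrow> sep e a y" using same_e_side[OF eT e(2) _ yw(2,1)] w by simp
  moreover have "\<not> sep e c y" using y by (simp add: side_def)
  then have "sep e a y \<longleftrightarrow> sep e a c" using sep_xor[OF eT aK(1,2) yw(2)] by simp
  moreover have "\<forall>y\<in>{y \<in> ?Y. f y = w}. conn {e \<in> E. e \<inter> ?S = {}} w y"
  proof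
    fix y assume "y \<in> {y \<in> ?Y. f y = w}"
    then have y: "y \<in> ?Y" "f y = w" by auto
    have "P a w \<subseteq> P a y" "y \<in> K" using f y by (auto simp: side_def)
    then show "conn {e \<in> E. e \<inter> ?S = {}} w y" using w by (intro subtree_conn[OF aK(1)]) auto
  qed
  moreover have "finite {y \<in> ?Y. f y = w}" using finite_K by (simp add: side_def)
  moreover have "Q \<le> card {y \<in> ?Y. f y = w}" using w by simp
  moreover have "w \<in> K" "card (P a w) = Suc \<rho>" using w by auto
  ultimately show thesis by (intro that[of w]) blast+
qed

text \<open>Both sides of a heavy edge have a big branch outside the tree ball around
  \<open>a\<close>, and uniform one-endedness joins the two branches near \<open>a\<close> while
  avoiding that ball. Some edge of the connection changes the side of \<open>e\<close>; its ends are
  more than \<open>\<rho>\<close> away from \<open>a\<close> in the tree, so its tree path is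
  long.\<close>

lemma ex_arch:
  assumes e: "heavy t e" "a \<in> e" and t: "\<beta> \<rho> + \<beta> (Suc \<rho>) * Q < t"
    and U: "uniformly_joined \<rho> R Q" and R: "ball a R \<subseteq> K"
  obtains u v where "{u, v} \<in> E" "u \<in> ball a R" "v \<in> ball a R" "e \<in> P u v" "\<rho> < card (P u v)"
proof -
  have eT: "e \<in> T" using e heavyD by blast
  obtain b where b: "e = {a, b}" "a \<in> K" "b \<in> K" using edge_other[OF _ e(2)] eT TE KV T_subset_Pow by blast
  let ?S = "{z \<in> K. card (P a z) \<le> \<rho>}"
  have sab: "sep e a b" using sep_ends b eT by blast
  obtain w where w: "w \<in> K" "sep e a w \<longleftrightarrow> sep e a a" "card (P a w) = Suc \<rho>"
    "\<exists>W. finite W \<and> Q \<le> card W \<and> (\<forall>y\<in>W. conn {e \<in> E. e \<inter> ?S = {}} w y)"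
    using big_branch[OF e e(2) t] .
  have be: "b \<in> e" using b by simp
  obtain w' where w': "w' \<in> K" "sep e a w' \<longleftrightarrow> sep e a b" "card (P a w') = Suc \<rho>"
    "\<exists>W. finite W \<and> Q \<le> card W \<and> (\<forall>y\<in>W. conn {e \<in> E. e \<inter> ?S = {}} w' y)"
    using big_branch[OF e be t] .
  have "?S \<subseteq> ball a \<rho>" using P_ball b by blast
  moreover have "w \<in> ball a (Suc \<rho>)" "w' \<in> ball a (Suc \<rho>)" using P_ball[of a _ "Suc \<rho>"] b w w' by auto
  moreover have "w \<notin> ?S" "w' \<notin> ?S" using w w' by auto
  moreover have "a \<in> V" using b KV by auto
  ultimately have "conn {e \<in> E. e \<inter> ?S = {} \<and> e \<subseteq> ball a R} w w'"
    using U[unfolded uniformly_joined_def, rule_format, of a ?S w w'] w(4) w'(4) by blast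
  moreover have "sep e a w \<noteq> sep e a w'" using w w' sab by simp
  ultimately obtain u v where uv: "{u, v} \<in> {e \<in> E. e \<inter> ?S = {} \<and> e \<subseteq> ball a R}" "sep e a u \<noteq> sep e a v"
    by (rule conn_cross[where c = "sep e a"]) blast
  then have uK: "u \<in> K" "v \<in> K" using R by auto
  have suv: "sep e u v" using sep_xor[OF eT uK(1) b(2) uK(2)] uv(2) sep_sym[of e u a] by auto
  then have eP: "e \<in> P u v" using eT by (simp add: P_def)
  have "\<rho> < card (P a u)" using uv uK by auto
  also have "card (P a u) = card (P u a)" using P_sym[of a u] by simp
  also have "... \<le> card (P u v)" using P_split(2)[OF eP e(2) uK] finite_P[OF uK] by (rule card_mono[rotated])
  finally show thesis using that[of u v] uv eP by auto
qed

end

section \<open>The supply of heavy edges fit for an exchange\<close>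

context bd_graph
begin

lemma graph_treeI:
  assumes "finite K" "K \<subseteq> V" "tree K T" "T \<subseteq> E"
  shows "graph_tree V E D \<beta> K T"
  using assms bd_graph_axioms
  by (intro graph_tree.intro finite_tree.intro finite_tree_axioms.intro graph_tree_axioms.intro) auto

lemma hv_antimono:
  assumes "finite K" "tree K T" "s \<le> t" shows "hv K T t \<le> hv K T s"
proof -
  interpret finite_tree K T using assms by (intro finite_tree.intro finite_tree_axioms.intro)
  show ?thesis unfolding hv_def using heavy_mono assms(3) finite_heavy by (intro card_mono) auto
qed

lemma hv_diff:
  assumes "finite K" "tree K T" "M \<le> t"
  shows "card {q. tree.heavy K T M q \<and> \<not> tree.heavy K T t q} = hv K T M - hv K T t"
proof -
  interpret finite_tree K T using assms by (intro finite_tree.intro finite_tree_axioms.intro)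
  have "{q. heavy M q \<and> \<not> heavy t q} = {q. heavy M q} - {q. heavy t q}" by auto
  moreover have "{q. heavy t q} \<subseteq> {q. heavy M q}" using heavy_mono assms(3) by auto
  ultimately show ?thesis unfolding hv_def using card_Diff_subset[OF finite_heavy] by simp
qed

end

context graph_tree
begin

lemma finite_far: "finite (far K T s)"
  by (rule finite_subset[of _ "Pow K"]) (auto simp: far_def finite_K)

lemma card_bad_edges:
  assumes "Z \<subseteq> K" shows "card {e. heavy t e \<and> e \<inter> Z \<noteq> {}} \<le> D * card Z"
proof -
  have ZV: "finite Z" "Z \<subseteq> V" using assms finite_K KV finite_subset by auto
  have "{e. heavy t e \<and> e \<inter> Z \<noteq> {}} \<subseteq> {e \<in> E. e \<inter> Z \<noteq> {}}" using heavyD TE by blast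
  then have "card {e. heavy t e \<and> e \<inter> Z \<noteq> {}} \<le> card {e \<in> E. e \<inter> Z \<noteq> {}}"
    using finite_incident[OF ZV] by (intro card_mono)
  then show ?thesis using card_incident[OF ZV] by simp
qed

text \<open>A heavy edge is discarded if it touches a place near the boundary of \<open>K\<close>
  (\<open>Z1\<close>), near a far edge (\<open>Z2\<close>) or near a branching of the heavy subtree
  (\<open>Z3\<close>). There the ball might leave \<open>K\<close>, the arch might have too long a
  tree path, or heavy edges might fork. Everywhere else \<open>ex_arch\<close> applies.\<close>

lemma good_edges:
  assumes U: "uniformly_joined \<rho> R Q" and t: "\<beta> \<rho> + \<beta> (Suc \<rho>) * Q < t"
  shows "\<exists>A u v. card {e. heavy t e} \<le> card A + D * (card (bdry K) * \<beta> R + 2 * card (far K T L) * \<beta> R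
      + card {w \<in> K. 3 \<le> hdeg t w} * \<beta> (2 * L)) \<and>
    (\<forall>e\<in>A. heavy t e \<and> e \<in> P (u e) (v e) \<and> u e \<in> K \<and> v e \<in> K \<and> {u e, v e} \<in> E \<and>
      \<rho> < card (P (u e) (v e)) \<and> card (P (u e) (v e)) \<le> L \<and>
      (\<forall>a\<in>e. \<forall>z\<in>K. card (P a z) \<le> 2 * L --> hdeg t z \<le> 2))"
proof -
  define Z1 where "Z1 = {a \<in> K. \<not> ball a R \<subseteq> K}"
  define Z2 where "Z2 = K \<inter> (\<Union>x\<in>\<Union>(far K T L). ball x R)"
  define Z3 where "Z3 = K \<inter> (\<Union>w\<in>{w \<in> K. 3 \<le> hdeg t w}. ball w (2 * L))"
  define Z where "Z = Z1 \<union> Z2 \<union> Z3"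
  have ZK: "Z \<subseteq> K" by (auto simp: Z_def Z1_def Z2_def Z3_def)
  have farK: "\<Union>(far K T L) \<subseteq> K" by (auto simp: far_def)
  then have farV: "finite (\<Union>(far K T L))" "\<Union>(far K T L) \<subseteq> V" using finite_K KV finite_subset by auto
  have c1: "card Z1 \<le> card (bdry K) * \<beta> R" unfolding Z1_def by (rule card_near_bdry[OF finite_K KV])
  have c2: "card Z2 \<le> 2 * card (far K T L) * \<beta> R"
  proof -
    have "card (\<Union>(far K T L)) \<le> (\<Sum>e\<in>far K T L. card e)" by (rule card_Union_le_sum_card)
    also have "... \<le> (\<Sum>e\<in>far K T L. 2)"
    proof (rule sum_mono)
      fix e assume "e \<in> far K T L"
      then obtain x y where "e = {x, y}" by (auto simp: far_def)
      then show "card e \<le> 2" by (simp add: card_insert_if)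
    qed
    finally have "card (\<Union>(far K T L)) \<le> 2 * card (far K T L)" by simp
    moreover have "card Z2 \<le> card (\<Union>x\<in>\<Union>(far K T L). ball x R)"
      unfolding Z2_def using farV finite_ball by (intro card_mono finite_UN_I) auto
    moreover have "... \<le> card (\<Union>(far K T L)) * \<beta> R" by (rule card_UN_ball[OF farV])
    ultimately show ?thesis by (meson le_trans mult_le_mono1)
  qed
  have c3: "card Z3 \<le> card {w \<in> K. 3 \<le> hdeg t w} * \<beta> (2 * L)"
  proof -
    have f: "finite {w \<in> K. 3 \<le> hdeg t w}" "{w \<in> K. 3 \<le> hdeg t w} \<subseteq> V" using finite_K KV by auto
    have "card Z3 \<le> card (\<Union>w\<in>{w \<in> K. 3 \<le> hdeg t w}. ball w (2 * L))"
      unfolding Z3_def using f finite_ball by (intro card_mono finite_UN_I) auto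
    then show ?thesis using card_UN_ball[OF f, of "2 * L"] by simp
  qed
  have cZ: "card Z \<le> card (bdry K) * \<beta> R + 2 * card (far K T L) * \<beta> R + card {w \<in> K. 3 \<le> hdeg t w} * \<beta> (2 * L)"
    using c1 c2 c3 card_Un_le[of Z1 Z2] card_Un_le[of "Z1 \<union> Z2" Z3] unfolding Z_def by linarith
  let ?A = "{e. heavy t e \<and> e \<inter> Z = {}}"
  have "card {e. heavy t e} = card (?A \<union> {e. heavy t e \<and> e \<inter> Z \<noteq> {}})"
    by (rule arg_cong[of _ _ card]) auto
  also have "... \<le> card ?A + card {e. heavy t e \<and> e \<inter> Z \<noteq> {}}" by (rule card_Un_le)
  also have "card {e. heavy t e \<and> e \<inter> Z \<noteq> {}} \<le> D * card Z" by (rule card_bad_edges[OF ZK])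
  also have "... \<le> D * (card (bdry K) * \<beta> R + 2 * card (far K T L) * \<beta> R + card {w \<in> K. 3 \<le> hdeg t w} * \<beta> (2 * L))"
    using cZ by simp
  finally have 1: "card {e. heavy t e} \<le> card ?A + D * (card (bdry K) * \<beta> R + 2 * card (far K T L) * \<beta> R
      + card {w \<in> K. 3 \<le> hdeg t w} * \<beta> (2 * L))" by simp
  have ex: "\<exists>u v. {u, v} \<in> E \<and> u \<in> K \<and> v \<in> K \<and> e \<in> P u v \<and> \<rho> < card (P u v) \<and> card (P u v) \<le> L" if e: "e \<in> ?A" for e
  proof -
    have h: "heavy t e" using e by simp
    obtain a b where ab: "e = {a, b}" "a \<in> K" using tree.edgeE[OF tree_axioms heavyD[OF h]] by blast
    have aZ: "a \<notin> Z" using e ab by auto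
    then have R: "ball a R \<subseteq> K" using ab by (auto simp: Z_def Z1_def)
    have ae: "a \<in> e" using ab by simp
    obtain u v where uv: "{u, v} \<in> E" "u \<in> ball a R" "v \<in> ball a R" "e \<in> P u v" "\<rho> < card (P u v)"
      using ex_arch[OF h ae t U R] .
    have "card (P u v) \<le> L"
    proof (rule ccontr)
      assume "\<not> card (P u v) \<le> L"
      then have "{u, v} \<in> far K T L" using uv R by (auto simp: far_def not_le)
      then have "u \<in> \<Union>(far K T L)" by blast
      then have "a \<in> Z2" using ball_sym[OF uv(2)] ab(2) unfolding Z2_def by blast
      then show False using aZ by (simp add: Z_def)
    qed
    then show ?thesis using uv R by blast
  qed
  then have "\<forall>e\<in>?A. \<exists>p. {fst p, snd p} \<in> E \<and> fst p \<in> K \<and> snd p \<in> K \<and> e \<in> P (fst p) (snd p) \<and> \<rho> < card (P (fst p) (snd p)) \<and> card (P (fst p) (snd p)) \<le> L"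
    by fastforce
  from bchoice[OF this] obtain p where p: "\<forall>e\<in>?A. {fst (p e), snd (p e)} \<in> E \<and> fst (p e) \<in> K \<and> snd (p e) \<in> K \<and> e \<in> P (fst (p e)) (snd (p e)) \<and>
    \<rho> < card (P (fst (p e)) (snd (p e))) \<and> card (P (fst (p e)) (snd (p e))) \<le> L" by (elim exE)
  have nb: "hdeg t z \<le> 2" if a: "e \<in> ?A" "a \<in> e" "z \<in> K" "card (P a z) \<le> 2 * L" for e a z
  proof -
    have aK: "a \<in> K" using a(1,2) heavyD T_subset_Pow by blast
    have "z \<in> ball a (2 * L)" by (rule P_ball[OF aK a(3,4)])
    then have "a \<in> ball z (2 * L)" by (rule ball_sym)
    moreover have "a \<notin> Z3" using a(1,2) by (auto simp: Z_def)
    ultimately have "\<not> 3 \<le> hdeg t z" using aK a(3) unfolding Z3_def by blast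
    then show ?thesis by simp
  qed
  show ?thesis
    by (rule exI[of _ ?A], rule exI[of _ "\<lambda>e. fst (p e)"], rule exI[of _ "\<lambda>e. snd (p e)"], intro conjI ballI impI)
      (use 1 p nb in blast)+
qed

text \<open>An edge that becomes far had a path of length at most \<open>s\<close> through an
  exchanged edge, hence has an end within \<open>S\<close> of that edge. So an exchange spoils a
  bounded number of edges at each fixed scale.\<close>

lemma card_far_exchange:
  assumes "I \<subseteq> T" "tree K T'" "T' \<subseteq> E"
    and "\<And>x y. x \<in> K ==> y \<in> K ==> P x y \<inter> I = {} ==> tree.P T' x y = P x y" "s \<le> S"
  shows "card (far K T' s) \<le> card (far K T s) + card I * (D * \<beta> S)"
proof -
  have finI: "finite I" using assms(1) finite_T finite_subset by blast
  define a where "a i = (SOME x. x \<in> i)" for i :: "'v set"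
  have a: "a i \<in> i" "a i \<in> K" if "i \<in> I" for i
  proof -
    have iT: "i \<in> T" using that assms by blast
    have "\<exists>x. x \<in> i" using tree.edgeE[OF tree_axioms iT] by blast
    then show "a i \<in> i" unfolding a_def by (rule someI_ex)
    then show "a i \<in> K" using iT T_subset_Pow by blast
  qed
  let ?N = "\<Union>i\<in>I. {e \<in> E. e \<inter> ball (a i) S \<noteq> {}}"
  have "far K T' s \<subseteq> far K T s \<union> ?N"
  proof
    fix e assume e: "e \<in> far K T' s"
    then obtain x y where xy: "e \<in> E" "e \<subseteq> K" "e = {x, y}" "s < card (tree.P T' x y)" by (auto simp: far_def)
    then have K: "x \<in> K" "y \<in> K" by auto
    show "e \<in> far K T s \<union> ?N"
    proof (cases "s < card (P x y)")
      case True
      then show ?thesis using xy by (auto simp: far_def)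
    next
      case False
      then have "P x y \<inter> I \<noteq> {}" using assms(4)[OF K] xy(4) by metis
      then obtain i where i: "i \<in> P x y" "i \<in> I" by blast
      have "P (a i) x \<subseteq> P x y" using P_split(2)[OF i(1) a(1)[OF i(2)] K] P_sym[of x "a i"] by simp
      then have "card (P (a i) x) \<le> card (P x y)" using finite_P[OF K] by (rule card_mono[rotated])
      then have "card (P (a i) x) \<le> S" using False assms(5) by simp
      then have "x \<in> ball (a i) S" using P_ball a i K by blast
      then show ?thesis using xy i by blast
    qed
  qed
  moreover have aV: "a i \<in> V" if "i \<in> I" for i using a(2)[OF that] KV by blast
  have finN: "finite {e \<in> E. e \<inter> ball (a i) S \<noteq> {}}" if "i \<in> I" for i
    using finite_incident[OF finite_ball ball_V] aV[OF that] by blast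
  ultimately have "card (far K T' s) \<le> card (far K T s \<union> ?N)"
    using finite_far finI by (intro card_mono) auto
  also have "... \<le> card (far K T s) + card ?N" by (rule card_Un_le)
  also have "card ?N \<le> (\<Sum>i\<in>I. card {e \<in> E. e \<inter> ball (a i) S \<noteq> {}})" by (rule card_UN_le[OF finI])
  also have "... \<le> (\<Sum>i\<in>I. D * \<beta> S)"
  proof (rule sum_mono)
    fix i assume i: "i \<in> I"
    have "card {e \<in> E. e \<inter> ball (a i) S \<noteq> {}} \<le> D * card (ball (a i) S)"
      using card_incident[OF finite_ball ball_V] aV[OF i] by blast
    also have "... \<le> D * \<beta> S" using card_ball[OF aV[OF i]] by simp
    finally show "card {e \<in> E. e \<inter> ball (a i) S \<noteq> {}} \<le> D * \<beta> S" .
  qed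
  finally show ?thesis by simp
qed

end

section \<open>One round of exchanges and its iteration\<close>

context bd_graph
begin

text \<open>The error \<open>e\<close> holds the edges of intermediate weight until
  \<open>step\<close> disposes of it. The bounds up to \<open>S\<close> protect the scales treated
  earlier, while the last clause keeps a bound on the stretch at all scales, at the price of the
  factor \<open>L\<close>.\<close>

definition step_ok :: "real => nat => nat => nat => real => nat => 'a set => 'a set set => 'a set set => bool" where
  "step_ok \<delta> S L t' e M K T T' \<longleftrightarrow> tree K T' \<and> T' \<subseteq> E \<and>
    (\<forall>s\<le>S. real (card (far K T' s)) \<le> real (card (far K T s)) + \<delta> * real (card K)) \<and>
    (\<forall>s\<le>S. real (hv K T' s) \<le> real (hv K T s) + \<delta> * real (card K)) \<and>
    real (hv K T' t') \<le> 6 / 7 * real (hv K T M) + \<delta> * real (card K) + e \<and>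
    (\<forall>s. card (far K T' (s * L)) \<le> card (far K T s))"

text \<open>The order of the choices matters. First \<open>\<rho>\<close> makes the number of
  exchanges negligible; one-endedness then yields \<open>R\<close> and \<open>Q\<close>; the tail
  bound \<open>H\<close> yields an \<open>L\<close> beyond which few edges are stretched;
  \<open>t\<close> is taken large enough for arches to exist and for branchings to be rare;
  \<open>\<epsilon>\<close> makes the boundary negligible.\<close>

lemma one_scale:
  assumes joined: "\<And>\<rho>. \<exists>R Q. uniformly_joined \<rho> R Q" and \<delta>: "\<delta> > 0"
  shows "\<exists>t t' \<epsilon> L. M \<le> t \<and> 0 < \<epsilon> \<and> (\<forall>K T. finite K \<and> K \<subseteq> V \<and> tree K T \<and> T \<subseteq> E \<and>
      real (card (bdry K)) \<le> \<epsilon> * real (card K) \<and> (\<forall>k. real (card (far K T (H k))) \<le> real (card K) / 2 ^ k) -->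
      (\<exists>T'. step_ok \<delta> S L t' (2 * (real (hv K T M) - real (hv K T t))) M K T T'))"
proof -
  define c where "c = real (Suc (D * (1 + 4 * M + 2 * S + D * \<beta> S)))"
  obtain \<rho> :: nat where \<rho>: "2 * c / \<delta> < real \<rho>" using reals_Archimedean2 by blast
  have c0: "c > 0" by (simp only: c_def of_nat_0_less_iff zero_less_Suc)
  then have "0 < 2 * c / \<delta>" using \<delta> by simp
  then have "0 < real \<rho>" using \<rho> by linarith
  then have \<rho>1: "1 \<le> \<rho>" by simp
  obtain R Q where U: "uniformly_joined \<rho> R Q" using joined by blast
  define B where "B = real (Suc (D * (2 * \<beta> R)))"
  have B0: "B > 0" by (simp only: B_def of_nat_0_less_iff zero_less_Suc)
  obtain k0 where k0: "(1 / 2 :: real) ^ k0 < \<delta> / B" using \<delta> B0 real_arch_pow_inv[of "\<delta> / B" "1 / 2"] by auto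
  define L where "L = H k0"
  obtain t1 :: nat where t1: "real (D * \<beta> (2 * L)) / \<delta> < real t1" using reals_Archimedean2 by blast
  define t where "t = M + \<beta> \<rho> + \<beta> (Suc \<rho>) * Q + t1 + 1"
  have t0: "real (D * \<beta> (2 * L)) \<le> \<delta> * real t"
  proof -
    have "real (D * \<beta> (2 * L)) < \<delta> * real t1" using t1 \<delta> by (simp add: field_simps)
    also have "... \<le> \<delta> * real t" using \<delta> by (simp add: t_def)
    finally show ?thesis by simp
  qed
  define t' where "t' = t + \<beta> L * (1 + D * t) + 1"
  define \<epsilon> where "\<epsilon> = \<delta> / B"
  have \<epsilon>0: "\<epsilon> > 0" using \<delta> B0 by (simp add: \<epsilon>_def)
  have main: "\<exists>T'. step_ok \<delta> S (L + 2) t' (2 * (real (hv K T M) - real (hv K T t))) M K T T'"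
    if KT: "finite K" "K \<subseteq> V" "tree K T" "T \<subseteq> E" and bd: "real (card (bdry K)) \<le> \<epsilon> * real (card K)"
      and H: "\<And>k. real (card (far K T (H k))) \<le> real (card K) / 2 ^ k" for K T
  proof -
    interpret graph_tree V E D \<beta> K T by (rule graph_treeI[OF KT])
    have t\<rho>: "\<beta> \<rho> + \<beta> (Suc \<rho>) * Q < t" by (simp add: t_def)
    let ?br = "card {w \<in> K. 3 \<le> hdeg t w}"
    obtain A u v where A0: "card {e. heavy t e} \<le> card A + D * (card (bdry K) * \<beta> R + 2 * card (far K T L) * \<beta> R
        + ?br * \<beta> (2 * L))"
      and A: "\<And>e. e \<in> A ==> heavy t e \<and> e \<in> P (u e) (v e) \<and> u e \<in> K \<and> v e \<in> K"
      and AE: "\<And>e. e \<in> A ==> {u e, v e} \<in> E"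
      and len: "\<And>e. e \<in> A ==> \<rho> < card (P (u e) (v e)) \<and> card (P (u e) (v e)) \<le> L"
      and nb: "\<And>e a z. e \<in> A ==> a \<in> e ==> z \<in> K ==> card (P a z) \<le> 2 * L ==> hdeg t z \<le> 2"
    proof -
      obtain A u v where "card {e. heavy t e} \<le> card A + D * (card (bdry K) * \<beta> R + 2 * card (far K T L) * \<beta> R
        + ?br * \<beta> (2 * L))" and *: "\<forall>e\<in>A. heavy t e \<and> e \<in> P (u e) (v e) \<and> u e \<in> K \<and> v e \<in> K \<and> {u e, v e} \<in> E \<and>
          \<rho> < card (P (u e) (v e)) \<and> card (P (u e) (v e)) \<le> L \<and>
          (\<forall>a\<in>e. \<forall>z\<in>K. card (P a z) \<le> 2 * L --> hdeg t z \<le> 2)"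
        using good_edges[OF U t\<rho>, of L] by (elim exE conjE)
      then show thesis by (intro that[of A u v]) simp_all
    qed
    let ?k = "real (card K)"
    have \<rho>2: "2 \<le> Suc \<rho>" using \<rho>1 by simp
    have len': "Suc \<rho> \<le> card (P (u e) (v e)) \<and> card (P (u e) (v e)) \<le> L" if "e \<in> A" for e
      using len[OF that] by simp
    have tt': "t \<le> t'" "\<beta> L * (1 + D * t) < t'" by (simp_all add: t'_def)
    let ?F = "\<lambda>I. (T - I) \<union> (\<lambda>e. {u e, v e}) ` I"
    have "\<exists>I. I \<subseteq> A \<and> Suc \<rho> * card I \<le> card T \<and> tree K (?F I) \<and>
      7 * card {q. tree.heavy K (?F I) t' q} + card A
        \<le> 7 * (card {q. heavy t q} + card I * (1 + 4 * M) + 2 * card {q. heavy M q \<and> \<not> heavy t q}) \<and>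
      (\<forall>s. card {q. tree.heavy K (?F I) s q} \<le> card {q. heavy s q} + card I * (1 + 2 * s)) \<and>
      (\<forall>x\<in>K. \<forall>y\<in>K. P x y \<inter> I = {} --> tree.P (?F I) x y = P x y) \<and>
      (\<forall>x\<in>K. \<forall>y\<in>K. card (tree.P (?F I) x y) \<le> card (P x y) * (L + 2))"
      by (rule exchange_step[where A = A and u = u and v = v and M = M, OF A len' \<rho>2 nb tree_degree card_tree_ball tt'])
    then obtain I where I: "I \<subseteq> A" "Suc \<rho> * card I \<le> card T"
      and tr: "tree K (?F I)"
      and h: "7 * card {q. tree.heavy K (?F I) t' q} + card A
        \<le> 7 * (card {q. heavy t q} + card I * (1 + 4 * M) + 2 * card {q. heavy M q \<and> \<not> heavy t q})"
      and hs': "\<forall>s. card {q. tree.heavy K (?F I) s q} \<le> card {q. heavy s q} + card I * (1 + 2 * s)"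
      and PP': "\<forall>x\<in>K. \<forall>y\<in>K. P x y \<inter> I = {} --> tree.P (?F I) x y = P x y"
      and Pc': "\<forall>x\<in>K. \<forall>y\<in>K. card (tree.P (?F I) x y) \<le> card (P x y) * (L + 2)"
      by (elim exE conjE)
    note hs = hs'[rule_format] and PP = PP'[rule_format] and Pc = Pc'[rule_format]
    let ?T' = "?F I"
    have IT: "I \<subseteq> T" using I(1) A heavyD by blast
    have T'E: "?T' \<subseteq> E" using TE AE I(1) by blast
    \<comment> \<open>Disjoint paths of more than \<open>\<rho>\<close> edges fit into the tree at
      most \<open>D * card K / \<rho>\<close> times, and \<open>\<rho>\<close> exceeds
      \<open>2 * c / \<delta>\<close>.\<close>
    have small: "real (card I) * real m \<le> \<delta> * ?k / 2" if "D * m \<le> D * (1 + 4 * M + 2 * S + D * \<beta> S)" for m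
    proof -
      have "real (Suc \<rho> * card I) \<le> real (D * card K)" using I(2) card_T by (metis le_trans of_nat_mono)
      then have "real \<rho> * real (card I) \<le> real D * ?k" by (simp add: algebra_simps)
      then have "real \<rho> * real (card I) * real m \<le> real D * ?k * real m" by (intro mult_right_mono) auto
      also have "... = real (D * m) * ?k" by simp
      also have "... \<le> c * ?k" using that unfolding c_def by (intro mult_right_mono) (simp_all del: of_nat_mult of_nat_add)
      also have "... \<le> \<delta> * real \<rho> / 2 * ?k" using \<rho> \<delta> by (intro mult_right_mono) (simp_all add: field_simps)
      finally have "real \<rho> * (real (card I) * real m) \<le> real \<rho> * (\<delta> * ?k / 2)" by (simp add: algebra_simps)
      then show ?thesis using \<rho>1 by simp
    qed
    have bad1: "real D * real (card (bdry K)) * real (\<beta> R) \<le> \<delta> * ?k / 2"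
    proof -
      have "real D * real (card (bdry K)) * real (\<beta> R) = real (D * \<beta> R) * real (card (bdry K))" by simp
      also have "... \<le> real (D * \<beta> R) * (\<epsilon> * ?k)" using bd by (intro mult_left_mono) auto
      also have "... \<le> (B / 2) * (\<epsilon> * ?k)" using \<epsilon>0 by (intro mult_right_mono) (auto simp: B_def)
      also have "... = \<delta> * ?k / 2" using B0 by (simp add: \<epsilon>_def)
      finally show ?thesis .
    qed
    have bad2: "real D * (2 * real (card (far K T L))) * real (\<beta> R) \<le> \<delta> * ?k"
    proof -
      have "real (card (far K T L)) \<le> ?k / 2 ^ k0" using H unfolding L_def by blast
      also have "... = (1 / 2) ^ k0 * ?k" by (simp add: power_one_over)
      also have "... \<le> \<delta> / B * ?k" using k0 by (intro mult_right_mono) auto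
      finally have f: "real (card (far K T L)) \<le> \<delta> / B * ?k" .
      have "real D * (2 * real (card (far K T L))) * real (\<beta> R) = real (D * (2 * \<beta> R)) * real (card (far K T L))" by simp
      also have "... \<le> B * (\<delta> / B * ?k)" using f B0 \<delta> by (intro mult_mono) (auto simp: B_def)
      also have "... = \<delta> * ?k" using B0 by simp
      finally show ?thesis .
    qed
    have bad3: "real D * real ?br * real (\<beta> (2 * L)) \<le> \<delta> * ?k"
    proof -
      have "real D * real ?br * real (\<beta> (2 * L)) = real (D * \<beta> (2 * L)) * real ?br" by simp
      also have "... \<le> \<delta> * real t * real ?br" using t0 by (intro mult_right_mono) auto
      also have "... = \<delta> * real (t * ?br)" by simp
      also have "... \<le> \<delta> * ?k" using branch_count[of t] \<delta> by (intro mult_left_mono) (auto simp del: of_nat_mult)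
      finally show ?thesis .
    qed
    have Mt: "M \<le> t" by (simp add: t_def)
    have hmono: "hv K T t \<le> hv K T M" by (rule hv_antimono[OF KT(1,3) Mt])
    have diff: "real (card {q. heavy M q \<and> \<not> heavy t q}) = real (hv K T M) - real (hv K T t)"
      using hv_diff[OF KT(1,3) Mt] hmono by simp
    have hA: "real (hv K T t) \<le> real (card A) + 5 / 2 * \<delta> * ?k"
    proof -
      have "real (hv K T t) \<le> real (card A + D * (card (bdry K) * \<beta> R + 2 * card (far K T L) * \<beta> R + ?br * \<beta> (2 * L)))"
        using A0 unfolding hv_def by (rule of_nat_mono)
      also have "... = real (card A) + real D * real (card (bdry K)) * real (\<beta> R) +
        real D * (2 * real (card (far K T L))) * real (\<beta> R) + real D * real ?br * real (\<beta> (2 * L))"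
        by (simp add: algebra_simps)
      finally show ?thesis using bad1 bad2 bad3 by simp
    qed
    have "real (7 * hv K ?T' t' + card A) \<le> real (7 * (hv K T t + card I * (1 + 4 * M) + 2 * card {q. heavy M q \<and> \<not> heavy t q}))"
      using h unfolding hv_def by (rule of_nat_mono)
    then have "7 * real (hv K ?T' t') + real (card A) \<le> 7 * real (hv K T t) + 7 * (real (card I) * real (1 + 4 * M)) +
      14 * (real (hv K T M) - real (hv K T t))"
      using diff by (simp add: algebra_simps)
    moreover have "real (card I) * real (1 + 4 * M) \<le> \<delta> * ?k / 2" by (rule small) simp
    moreover have "real (hv K T t) \<le> real (hv K T M)" using hmono by simp
    moreover have "0 \<le> \<delta> * ?k" using \<delta> by simp
    \<comment> \<open>The discarded edges cost \<open>5 / 2 * \<delta>\<close> and the exchanges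
      \<open>7 / 2 * \<delta>\<close> per vertex, together less than \<open>7 * \<delta>\<close>
      before the division by 7.\<close>
    ultimately have g3: "real (hv K ?T' t') \<le> 6 / 7 * real (hv K T M) + \<delta> * ?k + 2 * (real (hv K T M) - real (hv K T t))"
      using hA by linarith
    have g2: "real (hv K ?T' s) \<le> real (hv K T s) + \<delta> * ?k" if "s \<le> S" for s
    proof -
      have "real (hv K ?T' s) \<le> real (hv K T s + card I * (1 + 2 * s))"
        using hs[of s] unfolding hv_def by (rule of_nat_mono)
      also have "... = real (hv K T s) + real (card I) * real (1 + 2 * s)" by (simp only: of_nat_add of_nat_mult)
      also have "real (card I) * real (1 + 2 * s) \<le> \<delta> * ?k / 2" using that by (intro small) simp
      finally show ?thesis using \<open>0 \<le> \<delta> * ?k\<close> by simp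
    qed
    have g1: "real (card (far K ?T' s)) \<le> real (card (far K T s)) + \<delta> * ?k" if "s \<le> S" for s
    proof -
      have "real (card (far K ?T' s)) \<le> real (card (far K T s) + card I * (D * \<beta> S))"
        using card_far_exchange[OF IT tr T'E PP that] by (rule of_nat_mono)
      also have "... = real (card (far K T s)) + real (card I) * real (D * \<beta> S)" by simp
      also have "real (card I) * real (D * \<beta> S) \<le> \<delta> * ?k / 2" by (intro small mult_le_mono2) simp
      finally show ?thesis using \<open>0 \<le> \<delta> * ?k\<close> by simp
    qed
    have g4: "card (far K ?T' (s * (L + 2))) \<le> card (far K T s)" for s
    proof (rule card_mono[OF finite_far])
      show "far K ?T' (s * (L + 2)) \<subseteq> far K T s"
      proof
        fix e assume "e \<in> far K ?T' (s * (L + 2))"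
        then obtain x y where e: "e \<in> E" "e \<subseteq> K" "e = {x, y}" "s * (L + 2) < card (tree.P ?T' x y)"
          by (auto simp: far_def)
        then have "s * (L + 2) < card (P x y) * (L + 2)" using Pc[of x y] by simp
        then have "s < card (P x y)" by (rule mult_less_cancel2[THEN iffD1, THEN conjunct2])
        then show "e \<in> far K T s" using e by (auto simp: far_def)
      qed
    qed
    show ?thesis
      by (rule exI[of _ ?T']) (use tr T'E g1 g2 g3 g4 in \<open>auto simp: step_ok_def\<close>)
  qed
  show ?thesis
    by (rule exI[of _ t], rule exI[of _ t'], rule exI[of _ \<epsilon>], rule exI[of _ "L + 2"])
      (use main \<epsilon>0 in \<open>auto simp: t_def\<close>)
qed


lemma far_antimono:
  assumes "finite K" "s \<le> t" shows "card (far K T t) \<le> card (far K T s)"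
proof (rule card_mono)
  show "finite (far K T s)" by (rule finite_subset[of _ "Pow K"]) (use assms in \<open>auto simp: far_def\<close>)
  show "far K T t \<subseteq> far K T s" using assms(2) unfolding far_def by (force intro: le_less_trans)
qed

text \<open>Pigeonhole over thresholds. Along the chain \<open>t 0, ..., t J\<close> the number of
  heavy edges drops by at most \<open>D * card K\<close> in total, so some consecutive pair accounts
  for at most \<open>\<delta> / 4 * card K\<close>. Which pair it is depends on the tree; the
  minimum and the maxima over the chain make the constants independent of it.\<close>

lemma step:
  assumes joined: "\<And>\<rho>. \<exists>R Q. uniformly_joined \<rho> R Q" and \<delta>: "\<delta> > 0"
  shows "\<exists>t' \<epsilon> L. 0 < \<epsilon> \<and> (\<forall>K T. finite K \<and> K \<subseteq> V \<and> tree K T \<and> T \<subseteq> E \<and>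
      real (card (bdry K)) \<le> \<epsilon> * real (card K) \<and> (\<forall>k. real (card (far K T (H k))) \<le> real (card K) / 2 ^ k) -->
      (\<exists>T'. step_ok \<delta> S L t' 0 S K T T'))"
proof -
  let ?adm = "\<lambda>\<epsilon> K T. finite K \<and> K \<subseteq> V \<and> tree K T \<and> T \<subseteq> E \<and>
      real (card (bdry K)) \<le> \<epsilon> * real (card K) \<and> (\<forall>k. real (card (far K T (H k))) \<le> real (card K) / 2 ^ k)"
  have "\<forall>M. \<exists>p. M \<le> fst p \<and> 0 < fst (snd (snd p)) \<and> (\<forall>K T. ?adm (fst (snd (snd p))) K T -->
      (\<exists>T'. step_ok (\<delta> / 2) S (snd (snd (snd p))) (fst (snd p)) (2 * (real (hv K T M) - real (hv K T (fst p)))) M K T T'))"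
  proof
    fix M
    have "\<delta> / 2 > 0" using \<delta> by simp
    from one_scale[OF joined this, of M H S] obtain t t' \<epsilon> L where
      "M \<le> t \<and> 0 < \<epsilon> \<and> (\<forall>K T. ?adm \<epsilon> K T -->
      (\<exists>T'. step_ok (\<delta> / 2) S L t' (2 * (real (hv K T M) - real (hv K T t))) M K T T'))"
      by (elim exE)
    then show "\<exists>p. M \<le> fst p \<and> 0 < fst (snd (snd p)) \<and> (\<forall>K T. ?adm (fst (snd (snd p))) K T -->
      (\<exists>T'. step_ok (\<delta> / 2) S (snd (snd (snd p))) (fst (snd p)) (2 * (real (hv K T M) - real (hv K T (fst p)))) M K T T'))"
      by (intro exI[of _ "(t, t', \<epsilon>, L)"]) simp
  qed
  from choice[OF this] obtain p :: "nat => nat \<times> nat \<times> real \<times> nat" where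
    p: "\<forall>M. M \<le> fst (p M) \<and> 0 < fst (snd (snd (p M))) \<and> (\<forall>K T. ?adm (fst (snd (snd (p M)))) K T -->
      (\<exists>T'. step_ok (\<delta> / 2) S (snd (snd (snd (p M)))) (fst (snd (p M)))
        (2 * (real (hv K T M) - real (hv K T (fst (p M))))) M K T T'))"
    by (elim exE)
  define t where "t j = ((\<lambda>M. fst (p M)) ^^ j) S" for j
  have t0: "t 0 = S" and tS: "t (Suc j) = fst (p (t j))" for j by (simp_all add: t_def)
  have tinc: "t j \<le> t (Suc j)" for j unfolding tS using p by blast
  then have tge: "S \<le> t j" for j using lift_Suc_mono_le[of t 0 j] t0 by simp
  define \<epsilon> where "\<epsilon> j = fst (snd (snd (p (t j))))" for j
  define t' where "t' j = fst (snd (p (t j)))" for j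
  define L where "L j = snd (snd (snd (p (t j))))" for j
  have \<epsilon>pos: "0 < \<epsilon> j" for j using p unfolding \<epsilon>_def by blast
  have stepj: "\<exists>T'. step_ok (\<delta> / 2) S (L j) (t' j) (2 * (real (hv K T (t j)) - real (hv K T (t (Suc j))))) (t j) K T T'"
    if "?adm (\<epsilon> j) K T" for j K T
    using p that unfolding \<epsilon>_def t'_def L_def tS by blast
  obtain J :: nat where J: "4 * real D / \<delta> < real J" using reals_Archimedean2 by blast
  have "0 \<le> 4 * real D / \<delta>" using \<delta> by simp
  then have J0: "0 < J" using J by (metis le_less_trans of_nat_0_less_iff)
  define \<epsilon>' where "\<epsilon>' = Min (\<epsilon> ` {..<J})"
  define T1 where "T1 = Max (t' ` {..<J})"
  define L1 where "L1 = Max (L ` {..<J})"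
  have \<epsilon>': "0 < \<epsilon>'" "\<And>j. j < J ==> \<epsilon>' \<le> \<epsilon> j" 
  proof -
    have "{..<J} \<noteq> {}" using J0 by blast
    then have "\<epsilon>' \<in> \<epsilon> ` {..<J}" unfolding \<epsilon>'_def by (intro Min_in) auto
    then show "0 < \<epsilon>'" using \<epsilon>pos by auto
    show "\<And>j. j < J ==> \<epsilon>' \<le> \<epsilon> j" by (simp add: \<epsilon>'_def)
  qed
  have T1: "\<And>j. j < J ==> t' j \<le> T1" and L1: "\<And>j. j < J ==> L j \<le> L1" by (auto simp: T1_def L1_def)
  have "\<exists>T'. step_ok \<delta> S L1 T1 0 S K T T'" if adm: "?adm \<epsilon>' K T" for K T
  proof -
    interpret graph_tree V E D \<beta> K T by (rule graph_treeI) (use adm in auto)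
    let ?k = "real (card K)"
    have "(\<Sum>j<J. real (hv K T (t j)) - real (hv K T (t (Suc j)))) = real (hv K T (t 0)) - real (hv K T (t J))"
      by (rule sum_lessThan_telescope')
    also have "... \<le> real (hv K T (t 0))" by simp
    also have "hv K T (t 0) \<le> card T" unfolding hv_def using finite_T heavyD by (intro card_mono) auto
    also have "... \<le> D * card K" by (rule card_T)
    finally have sum: "(\<Sum>j<J. real (hv K T (t j)) - real (hv K T (t (Suc j)))) \<le> real D * ?k" by simp
    have "\<exists>j<J. real (hv K T (t j)) - real (hv K T (t (Suc j))) \<le> \<delta> / 4 * ?k"
    proof (rule ccontr)
      assume no: "\<not> (\<exists>j<J. real (hv K T (t j)) - real (hv K T (t (Suc j))) \<le> \<delta> / 4 * ?k)"
      then have "(\<Sum>j<J. real (hv K T (t j)) - real (hv K T (t (Suc j)))) \<ge> (\<Sum>j<J. \<delta> / 4 * ?k)"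
        by (intro sum_mono) (auto simp: not_le intro: less_imp_le)
      then have le: "real J * (\<delta> / 4 * ?k) \<le> real D * ?k" using sum by simp
      show False
      proof (cases "card K = 0")
        case True
        then have "K = {}" using finite_K by simp
        then have "T = {}" using T_subset_Pow tree.edgeE[OF tree_axioms] by blast
        then have "{q. heavy s q} = {}" for s using heavyD by blast
        then have "hv K T s = 0" for s unfolding hv_def by (simp only: card.empty)
        then show False using no J0 True by auto
      next
        case False
        have "real D * ?k < real J * (\<delta> / 4) * ?k" using J \<delta> False by (intro mult_strict_right_mono) (simp_all add: field_simps)
        then show False using le by simp
      qed
    qed
    then obtain j where j: "j < J" "real (hv K T (t j)) - real (hv K T (t (Suc j))) \<le> \<delta> / 4 * ?k" by blast
    have "real (card (bdry K)) \<le> \<epsilon> j * ?k"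
      using adm \<epsilon>'(2)[OF j(1)] by (meson mult_right_mono of_nat_0_le_iff order_trans)
    then have "?adm (\<epsilon> j) K T" using adm by blast
    then obtain T' where T': "step_ok (\<delta> / 2) S (L j) (t' j) (2 * (real (hv K T (t j)) - real (hv K T (t (Suc j))))) (t j) K T T'"
      using stepj by blast
    have tr: "tree K T'" "T' \<subseteq> E" using T' by (auto simp: step_ok_def)
    have arith: "a \<le> 6 / 7 * d + x" if "a \<le> b" "c \<le> d" "b \<le> 6 / 7 * c + x / 2 + 2 * (c - e)" "c - e \<le> x / 4"
      for a b c d x e :: real using that by (simp add: field_simps)
    have "real (hv K T' T1) \<le> real (hv K T' (t' j))" using hv_antimono[OF finite_K tr(1) T1[OF j(1)]] by simp
    moreover have "real (hv K T (t j)) \<le> real (hv K T S)" using hv_antimono[OF finite_K tree_axioms tge] by simp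
    moreover have "real (hv K T' (t' j)) \<le> 6 / 7 * real (hv K T (t j)) + \<delta> / 2 * ?k + 2 * (real (hv K T (t j)) - real (hv K T (t (Suc j))))"
      using T' by (simp add: step_ok_def)
    ultimately have 1: "real (hv K T' T1) \<le> 6 / 7 * real (hv K T S) + \<delta> * ?k"
      using j(2) arith[of "real (hv K T' T1)" "real (hv K T' (t' j))" "real (hv K T (t j))" "real (hv K T S)"
          "\<delta> * ?k" "real (hv K T (t (Suc j)))"] by simp
    have 2: "card (far K T' (s * L1)) \<le> card (far K T s)" for s
    proof -
      have "card (far K T' (s * L1)) \<le> card (far K T' (s * L j))" using L1[OF j(1)] by (intro far_antimono finite_K) simp
      also have "... \<le> card (far K T s)" using T' by (simp add: step_ok_def)
      finally show ?thesis .
    qed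
    have le: "x \<le> y + \<delta> / 2 * ?k ==> x \<le> y + \<delta> * ?k" for x y :: real using \<delta>
      by (smt (verit) mult_nonneg_nonneg of_nat_0_le_iff field_sum_of_halves distrib_right divide_pos_pos)
    have "step_ok \<delta> S L1 T1 0 S K T T'"
      using T' 1 2 le unfolding step_ok_def by simp
    then show ?thesis by blast
  qed
  then show ?thesis using \<epsilon>'(1) by blast
qed

text \<open>One function \<open>H\<close> bounds the tails of the stretch for the whole family. This
  tightness is what provides, in every round, a bounded length \<open>L\<close> for the
  cycles.\<close>

definition valid :: "(nat => 'a set) => (nat => 'a set set) => (nat => nat) => bool" where
  "valid K T H \<longleftrightarrow> (\<forall>n. tree (K n) (T n) \<and> T n \<subseteq> E \<and>
    (\<forall>k. real (card (far (K n) (T n) (H k))) \<le> real (card (K n)) / 2 ^ k))"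

lemma family_step:
  assumes joined: "\<And>\<rho>. \<exists>R Q. uniformly_joined \<rho> R Q" and \<delta>: "\<delta> > 0"
    and K: "\<And>n. finite (K n)" "\<And>n. K n \<subseteq> V"
    and folner: "\<And>\<epsilon>. \<epsilon> > 0 ==> \<exists>n0. \<forall>n\<ge>n0. real (card (bdry (K n))) \<le> \<epsilon> * real (card (K n))"
    and T: "valid K T H"
  shows "\<exists>T' H' t' n0. valid K T' H' \<and>
    (\<forall>n. \<forall>s\<le>S. real (card (far (K n) (T' n) s)) \<le> real (card (far (K n) (T n) s)) + \<delta> * real (card (K n)) \<and>
      real (hv (K n) (T' n) s) \<le> real (hv (K n) (T n) s) + \<delta> * real (card (K n))) \<and>
    (\<forall>n\<ge>n0. real (hv (K n) (T' n) t') \<le> 6 / 7 * real (hv (K n) (T n) S) + \<delta> * real (card (K n)))"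
proof -
  obtain t' \<epsilon> L where \<epsilon>: "0 < \<epsilon>" and st: "\<forall>K T. finite K \<and> K \<subseteq> V \<and> tree K T \<and> T \<subseteq> E \<and>
      real (card (bdry K)) \<le> \<epsilon> * real (card K) \<and> (\<forall>k. real (card (far K T (H k))) \<le> real (card K) / 2 ^ k) -->
      (\<exists>T'. step_ok \<delta> S L t' 0 S K T T')"
    using step[OF joined \<delta>, of H S] by blast
  obtain n0 where n0: "\<forall>n\<ge>n0. real (card (bdry (K n))) \<le> \<epsilon> * real (card (K n))" using folner[OF \<epsilon>] by blast
  have "\<exists>T'. step_ok \<delta> S L t' 0 S (K n) (T n) T'" if "n \<ge> n0" for n
  proof (rule st[rule_format])
    show "finite (K n) \<and> K n \<subseteq> V \<and> tree (K n) (T n) \<and> T n \<subseteq> E \<and> real (card (bdry (K n))) \<le> \<epsilon> * real (card (K n)) \<and>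
      (\<forall>k. real (card (far (K n) (T n) (H k))) \<le> real (card (K n)) / 2 ^ k)"
      using K n0 T that by (simp add: valid_def)
  qed
  then obtain F where F: "\<And>n. n \<ge> n0 ==> step_ok \<delta> S L t' 0 S (K n) (T n) (F n)" by metis
  define T' where "T' n = (if n \<ge> n0 then F n else T n)" for n
  \<comment> \<open>The first argument of the maximum serves the unchanged trees with
    \<open>n < n0\<close>, the second the exchanged ones.\<close>
  define H' where "H' k = max (H k) (H k * L)" for k
  have val: "valid K T' H'"
    unfolding valid_def
  proof (intro allI conjI)
    fix n k
    show "tree (K n) (T' n)" "T' n \<subseteq> E" using F[of n] T by (auto simp: T'_def valid_def step_ok_def)
    have "card (far (K n) (T' n) (H' k)) \<le> card (far (K n) (T n) (H k))"
    proof (cases "n \<ge> n0")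
      case True
      have "card (far (K n) (T' n) (H' k)) \<le> card (far (K n) (T' n) (H k * L))"
        by (rule far_antimono[OF K(1)]) (simp add: H'_def)
      also have "... \<le> card (far (K n) (T n) (H k))" using F[OF True] True by (simp add: T'_def step_ok_def)
      finally show ?thesis .
    next
      case False
      then show ?thesis using far_antimono[OF K(1)] by (simp add: T'_def H'_def)
    qed
    then show "real (card (far (K n) (T' n) (H' k))) \<le> real (card (K n)) / 2 ^ k"
      using T unfolding valid_def by (meson le_trans of_nat_le_iff order_trans)
  qed
  have "\<forall>n. \<forall>s\<le>S. real (card (far (K n) (T' n) s)) \<le> real (card (far (K n) (T n) s)) + \<delta> * real (card (K n)) \<and>
      real (hv (K n) (T' n) s) \<le> real (hv (K n) (T n) s) + \<delta> * real (card (K n))"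
    using F \<delta> by (auto simp: T'_def step_ok_def)
  moreover have "\<forall>n\<ge>n0. real (hv (K n) (T' n) t') \<le> 6 / 7 * real (hv (K n) (T n) S) + \<delta> * real (card (K n))"
    using F by (auto simp: T'_def step_ok_def)
  ultimately show ?thesis using val by blast
qed

text \<open>The errors telescope, because \<open>(6 / 7) ^ Suc l\<close> equals
  \<open>6 * ((6 / 7) ^ l - (6 / 7) ^ Suc l)\<close>.\<close>

lemma geometric_slack:
  fixes f :: "nat => real"
  assumes "\<And>l. j \<le> l ==> f (Suc l) \<le> f l + (6 / 7) ^ Suc l * k" "j \<le> i"
  shows "f i \<le> f j + 6 * ((6 / 7) ^ j - (6 / 7) ^ i) * k"
  using assms(2)
proof (induction i rule: dec_induct)
  case (step i)
  have "f (Suc i) \<le> f i + (6 / 7) ^ Suc i * k" using assms(1) step.hyps by simp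
  also have "... \<le> f j + 6 * ((6 / 7) ^ j - (6 / 7) ^ i) * k + (6 / 7) ^ Suc i * k" using step.IH by simp
  also have "... = f j + 6 * ((6 / 7) ^ j - (6 / 7) ^ Suc i) * k" by (simp add: algebra_simps)
  finally show ?case .
qed simp

text \<open>The sequence \<open>(6 / 7) ^ j * (D + j)\<close> solves the recursion in which each
  round multiplies by \<open>6 / 7\<close> and adds \<open>(6 / 7) ^ Suc j\<close>. All later rounds
  add at most \<open>6 * (6 / 7) ^ j\<close>, and 7 also covers the initial stretch bound
  \<open>1 / 2 ^ j\<close>.\<close>

definition rate :: "nat => real" where
  "rate j = (6 / 7) ^ j * (real D + real j + 7)"

lemma rate_tendsto: "rate \<longlonglongrightarrow> 0"
proof -
  have "(\<lambda>j. (6 / 7 :: real) ^ j * (real D + real j + 7)) \<longlonglongrightarrow> 0" by real_asymp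
  then show ?thesis by (simp add: rate_def[abs_def])
qed

text \<open>Round \<open>i\<close> takes effect only for \<open>n\<close> beyond some
  \<open>N i\<close>, and its error on the scales reached before is \<open>(6 / 7) ^ Suc i\<close>.
  For a given \<open>i\<close> an index \<open>n\<close> beyond all thresholds up to
  \<open>i\<close> is chosen, and there the tree of round \<open>i\<close> is still good at every
  scale \<open>S j\<close> with \<open>j \<le> i\<close>.\<close>

lemma light_trees:
  assumes joined: "\<And>\<rho>. \<exists>R Q. uniformly_joined \<rho> R Q"
    and K: "\<And>n. finite (K n)" "\<And>n. K n \<subseteq> V"
    and folner: "\<And>\<epsilon>. \<epsilon> > 0 ==> \<exists>n0. \<forall>n\<ge>n0. real (card (bdry (K n))) \<le> \<epsilon> * real (card (K n))"
    and T0: "valid K T0 H0"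
  obtains S where "\<And>i. \<exists>n\<ge>i. \<exists>T. tree (K n) T \<and> T \<subseteq> E \<and>
    (\<forall>j\<le>i. real (card (far (K n) T (S j))) \<le> rate j * real (card (K n)) \<and>
      real (hv (K n) T (S j)) \<le> rate j * real (card (K n)))"
proof -
  let ?q = "6 / 7 :: real"
  let ?\<gamma> = "\<lambda>i. ?q ^ i * (real D + real i)"
  let ?PP = "\<lambda>i (T, H, S, n0). valid K T H \<and> H i \<le> S \<and> (\<forall>n\<ge>n0. real (hv (K n) (T n) S) \<le> ?\<gamma> i * real (card (K n)))"
  let ?QQ = "\<lambda>i (T, H, S, n0) (T', H', S', n0'). S \<le> S' \<and>
    (\<forall>n. \<forall>s\<le>S. real (card (far (K n) (T' n) s)) \<le> real (card (far (K n) (T n) s)) + ?q ^ Suc i * real (card (K n)) \<and>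
      real (hv (K n) (T' n) s) \<le> real (hv (K n) (T n) s) + ?q ^ Suc i * real (card (K n)))"
  have base: "\<exists>x. ?PP 0 x"
  proof -
    have "real (hv (K n) (T0 n) (H0 0)) \<le> real D * real (card (K n))" for n
    proof -
      interpret graph_tree V E D \<beta> "K n" "T0 n" by (rule graph_treeI) (use K T0 in \<open>auto simp: valid_def\<close>)
      have "hv (K n) (T0 n) (H0 0) \<le> card (T0 n)" unfolding hv_def using finite_T heavyD by (intro card_mono) auto
      also have "... \<le> D * card (K n)" by (rule card_T)
      finally show ?thesis by (metis of_nat_le_iff of_nat_mult)
    qed
    then have "?PP 0 (T0, H0, H0 0, 0)" using T0 by simp
    then show ?thesis by blast
  qed
  have stp: "\<exists>y. ?PP (Suc i) y \<and> ?QQ i x y" if Px: "?PP i x" for x i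
  proof -
    obtain T H S n0 where x: "x = (T, H, S, n0)" by (cases x) auto
    have T: "valid K T H" "H i \<le> S" "\<forall>n\<ge>n0. real (hv (K n) (T n) S) \<le> ?\<gamma> i * real (card (K n))"
      using Px x by auto
    have q: "?q ^ Suc i > 0" by simp
    obtain T' H' t' n1 where T': "valid K T' H'"
      "\<forall>n. \<forall>s\<le>S. real (card (far (K n) (T' n) s)) \<le> real (card (far (K n) (T n) s)) + ?q ^ Suc i * real (card (K n)) \<and>
        real (hv (K n) (T' n) s) \<le> real (hv (K n) (T n) s) + ?q ^ Suc i * real (card (K n))"
      "\<forall>n\<ge>n1. real (hv (K n) (T' n) t') \<le> 6 / 7 * real (hv (K n) (T n) S) + ?q ^ Suc i * real (card (K n))"
      using family_step[where S = S, OF joined q K folner T(1)] by blast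
    \<comment> \<open>At least \<open>t'\<close> for the heavy edges and at least
      \<open>H' (Suc i)\<close> for the far ones; including \<open>S\<close> keeps the scales
      increasing.\<close>
    define S' where "S' = max (max S t') (H' (Suc i))"
    have "real (hv (K n) (T' n) S') \<le> ?\<gamma> (Suc i) * real (card (K n))" if n: "n \<ge> max n0 n1" for n
    proof -
      have "hv (K n) (T' n) S' \<le> hv (K n) (T' n) t'"
        by (rule hv_antimono[OF K(1)]) (use T'(1) in \<open>auto simp: valid_def S'_def\<close>)
      then have "real (hv (K n) (T' n) S') \<le> 6 / 7 * real (hv (K n) (T n) S) + ?q ^ Suc i * real (card (K n))"
        using T'(3) n by (meson le_trans max.bounded_iff of_nat_le_iff order_trans)
      also have "... \<le> 6 / 7 * (?\<gamma> i * real (card (K n))) + ?q ^ Suc i * real (card (K n))" using T(3) n by simp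
      also have "... = ?\<gamma> (Suc i) * real (card (K n))" by (simp add: algebra_simps)
      finally show ?thesis .
    qed
    then have "?PP (Suc i) (T', H', S', max n0 n1)" using T' by (simp add: S'_def)
    moreover have "?QQ i x (T', H', S', max n0 n1)" using T'(2) x by (simp add: S'_def)
    ultimately show ?thesis by blast
  qed
  have "\<exists>f. \<forall>i. ?PP i (f i) \<and> ?QQ i (f i) (f (Suc i))"
    by (rule dependent_nat_choice[of ?PP ?QQ, OF base stp])
  then obtain f where ff: "\<forall>i. ?PP i (f i) \<and> ?QQ i (f i) (f (Suc i))" by (elim exE)
  have f: "?PP i (f i)" "?QQ i (f i) (f (Suc i))" for i
    using ff[rule_format, of i] by (rule conjunct1, rule conjunct2)
  define T where "T i = fst (f i)" for i
  define H where "H i = fst (snd (f i))" for i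
  define S where "S i = fst (snd (snd (f i)))" for i
  define N where "N i = snd (snd (snd (f i)))" for i
  have P: "valid K (T i) (H i)" "H i i \<le> S i" "\<And>n. n \<ge> N i ==> real (hv (K n) (T i n) (S i)) \<le> ?\<gamma> i * real (card (K n))" for i
    using f(1)[of i] by (auto simp: T_def H_def S_def N_def split_beta)
  have Q: "S i \<le> S (Suc i)"
    "\<And>n s. s \<le> S i ==> real (card (far (K n) (T (Suc i) n) s)) \<le> real (card (far (K n) (T i n) s)) + ?q ^ Suc i * real (card (K n))"
    "\<And>n s. s \<le> S i ==> real (hv (K n) (T (Suc i) n) s) \<le> real (hv (K n) (T i n) s) + ?q ^ Suc i * real (card (K n))" for i
    using f(2)[of i] by (auto simp: T_def H_def S_def N_def split_beta)
  have Sm: "S j \<le> S i" if "j \<le> i" for i j using lift_Suc_mono_le[of S] Q(1) that by blast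
  show thesis
  proof (rule that[of S])
    fix i
    define n where "n = i + (\<Sum>j\<le>i. N j)"
    have nN: "N j \<le> n" if "j \<le> i" for j
      using member_le_sum[of j "{..i}" N] that by (simp add: n_def)
    let ?k = "real (card (K n))"
    have "real (card (far (K n) (T i n) (S j))) \<le> rate j * ?k \<and> real (hv (K n) (T i n) (S j)) \<le> rate j * ?k"
      if j: "j \<le> i" for j
    proof
      have slack: "6 * (?q ^ j - ?q ^ i) * ?k \<le> ?q ^ j * 6 * ?k" by (intro mult_right_mono) auto
      have "real (card (far (K n) (T i n) (S j))) \<le> real (card (far (K n) (T j n) (S j))) + 6 * (?q ^ j - ?q ^ i) * ?k"
        by (rule geometric_slack[OF _ j]) (use Q(2) Sm in auto)
      also have "real (card (far (K n) (T j n) (S j))) \<le> real (card (far (K n) (T j n) (H j j)))"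
        using far_antimono[OF K(1) P(2)] by simp
      also have "... \<le> ?k / 2 ^ j" using P(1)[of j] by (simp add: valid_def)
      also have "... = (1 / 2) ^ j * ?k" by (simp add: power_one_over)
      also have "... \<le> ?q ^ j * ?k" by (intro mult_right_mono power_mono) auto
      also have "?q ^ j * ?k + 6 * (?q ^ j - ?q ^ i) * ?k \<le> ?q ^ j * ?k + ?q ^ j * 6 * ?k" using slack by linarith
      also have "... = ?q ^ j * 7 * ?k" by simp
      also have "... \<le> rate j * ?k" unfolding rate_def by (intro mult_right_mono mult_left_mono) auto
      finally show "real (card (far (K n) (T i n) (S j))) \<le> rate j * ?k" by simp
      have "real (hv (K n) (T i n) (S j)) \<le> real (hv (K n) (T j n) (S j)) + 6 * (?q ^ j - ?q ^ i) * ?k"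
        by (rule geometric_slack[OF _ j]) (use Q(3) Sm in auto)
      also have "real (hv (K n) (T j n) (S j)) \<le> ?\<gamma> j * ?k" by (rule P(3)[OF nN[OF j]])
      also have "?\<gamma> j * ?k + 6 * (?q ^ j - ?q ^ i) * ?k \<le> ?\<gamma> j * ?k + ?q ^ j * 6 * ?k" using slack by linarith
      also have "... = ?q ^ j * (real D + real j + 6) * ?k" by (simp add: algebra_simps)
      also have "... \<le> rate j * ?k" unfolding rate_def by (intro mult_right_mono mult_left_mono) auto
      finally show "real (hv (K n) (T i n) (S j)) \<le> rate j * ?k" by simp
    qed
    then show "\<exists>n\<ge>i. \<exists>T. tree (K n) T \<and> T \<subseteq> E \<and>
      (\<forall>j\<le>i. real (card (far (K n) T (S j))) \<le> rate j * real (card (K n)) \<and>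
        real (hv (K n) T (S j)) \<le> rate j * real (card (K n)))"
      using P(1)[of i] by (intro exI[of _ n] conjI exI[of _ "T i n"]) (auto simp: valid_def n_def)
  qed
qed

end

section \<open>Automorphisms and Haar measure\<close>

lemma conn_image: "conn F x y ==> conn ((`) f ` F) (f x) (f y)"
proof (induction rule: conn_induct)
  case (step y z)
  have "{f y, f z} = f ` {y, z}" by simp
  then have "{f y, f z} \<in> (`) f ` F" using step.hyps(2) by blast
  then have "conn ((`) f ` F) (f y) (f z)" by (rule conn_edge)
  with step.IH show ?case by (rule conn_trans)
qed simp

context lf_graph
begin

abbreviation Aut :: "('v => 'v) set" where "Aut \<equiv> automorphisms (V, E)"

lemma autD:
  assumes "f \<in> Aut"
  shows "bij_betw f V V" "f \<in> extensional V" "\<And>u v. u \<in> V ==> v \<in> V ==> {f u, f v} \<in> E \<longleftrightarrow> {u, v} \<in> E"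
    "\<And>x. x \<in> V ==> f x \<in> V" "inj_on f V"
  using assms by (auto simp: automorphisms_def Bij_def bij_betw_def)

lemma aut_eq: "f \<in> Aut ==> x \<in> V ==> y \<in> V ==> f x = f y \<longleftrightarrow> x = y"
  using autD(5) by (auto dest: inj_onD)

lemma aut_id: "(\<lambda>x\<in>V. x) \<in> Aut"
  by (simp add: automorphisms_def id_Bij)

lemma aut_compose:
  assumes "f \<in> Aut" "g \<in> Aut" shows "compose V f g \<in> Aut"
proof -
  have "compose V f g \<in> Bij V" using assms by (intro compose_Bij) (auto simp: automorphisms_def)
  moreover have "{compose V f g u, compose V f g v} \<in> E \<longleftrightarrow> {u, v} \<in> E" if "u \<in> V" "v \<in> V" for u v
    using that autD(3,4)[OF assms(1)] autD(3,4)[OF assms(2)] by (simp add: compose_def)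
  ultimately show ?thesis by (simp add: automorphisms_def)
qed

text \<open>Automorphisms are extensional functions, so an inverse is an automorphism only after
  restriction to \<open>V\<close>.\<close>

definition ainv :: "('v => 'v) => 'v => 'v" where "ainv f = (\<lambda>x\<in>V. inv_into V f x)"

lemma ainv:
  assumes "f \<in> Aut"
  shows "ainv f \<in> Aut" "\<And>x. x \<in> V ==> f (ainv f x) = x" "\<And>x. x \<in> V ==> ainv f (f x) = x"
proof -
  have bij: "bij_betw f V V" using autD(1)[OF assms] .
  show 1: "f (ainv f x) = x" if "x \<in> V" for x
    using that bij by (simp add: ainv_def bij_betw_inv_into_right)
  show "ainv f (f x) = x" if "x \<in> V" for x
    using that bij autD(4)[OF assms] by (simp add: ainv_def bij_betw_inv_into_left)
  have B: "ainv f \<in> Bij V" unfolding ainv_def using assms by (intro restrict_inv_into_Bij) (simp add: automorphisms_def)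
  then have V: "ainv f x \<in> V" if "x \<in> V" for x using that Bij_imp_funcset by blast
  have "{ainv f u, ainv f v} \<in> E \<longleftrightarrow> {u, v} \<in> E" if "u \<in> V" "v \<in> V" for u v
    using autD(3)[OF assms V[OF that(1)] V[OF that(2)]] 1 that by simp
  then show "ainv f \<in> Aut" using B by (simp add: automorphisms_def)
qed

lemma ainv_compose:
  assumes "f \<in> Aut" "g \<in> Aut"
  shows "compose V (compose V g f) (ainv f) = g" "compose V (compose V g (ainv f)) f = g"
  using ainv[OF assms(1)] autD(2)[OF assms(2)] autD(4)[OF assms(1)] autD(4)[OF ainv(1)[OF assms(1)]]
  by (auto simp: compose_def fun_eq_iff extensional_def)

lemma aut_edge: "f \<in> Aut ==> e \<subseteq> V ==> f ` e \<in> E \<longleftrightarrow> e \<in> E"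
proof -
  assume f: "f \<in> Aut" and e: "e \<subseteq> V"
  show ?thesis
  proof
    assume "e \<in> E"
    then obtain u v where "u \<in> V" "v \<in> V" "e = {u, v}" using edgeE by blast
    then show "f ` e \<in> E" using autD(3)[OF f] \<open>e \<in> E\<close> by auto
  next
    assume a: "f ` e \<in> E"
    then obtain u v where uv: "u \<noteq> v" "f ` e = {u, v}" using edgeE by blast
    have "card e = 2" using card_image[OF inj_on_subset[OF autD(5)[OF f] e]] uv by simp
    then obtain p q where "e = {p, q}" by (auto simp: card_2_iff)
    then show "e \<in> E" using a autD(3)[OF f, of p q] e by auto
  qed
qed

lemma aut_inj_edge: "f \<in> Aut ==> e \<subseteq> V ==> e' \<subseteq> V ==> f ` e = f ` e' \<longleftrightarrow> e = e'"
  using inj_on_image_eq_iff[OF autD(5)] by blast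

lemma aut_nbr: assumes "f \<in> Aut" "x \<in> V" shows "nbr (f x) = f ` nbr x"
proof
  show "f ` nbr x \<subseteq> nbr (f x)"
    using autD(3)[OF assms(1)] nbr_V by (auto simp: nbr_def)
  show "nbr (f x) \<subseteq> f ` nbr x"
  proof
    fix y assume "y \<in> nbr (f x)"
    then have y: "{f x, y} \<in> E" "y \<in> V" using nbr_V by (auto simp: nbr_def)
    let ?z = "ainv f y"
    have z: "?z \<in> V" "f ?z = y" using autD(4)[OF ainv(1)] ainv(2) assms y by auto
    then have "{x, ?z} \<in> E" using autD(3)[OF assms(1,2) z(1)] y by simp
    then have "?z \<in> nbr x" by (simp add: nbr_def)
    then show "y \<in> f ` nbr x" using z(2) by (metis image_eqI)
  qed
qed

lemma aut_ball: assumes "f \<in> Aut" "x \<in> V" shows "ball (f x) r = f ` ball x r"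
proof (induction r)
  case (Suc r)
  have "nbr (f y) = f ` nbr y" if "y \<in> ball x r" for y
    using that ball_V[OF assms(2)] aut_nbr[OF assms(1)] by blast
  then show ?case using Suc by (auto simp: image_Un image_UN)
qed simp

lemma aut_bdry: assumes "f \<in> Aut" "K \<subseteq> V" shows "bdry (f ` K) = (`) f ` bdry K"
proof
  have c: "card (f ` e \<inter> f ` K) = card (e \<inter> K)" if "e \<subseteq> V" for e
  proof -
    have "f ` e \<inter> f ` K = f ` (e \<inter> K)" using inj_on_image_Int[OF autD(5)[OF assms(1)] that assms(2)] by simp
    then show ?thesis using card_image[OF inj_on_subset[OF autD(5)[OF assms(1)]], of "e \<inter> K"] that by auto
  qed
  show "(`) f ` bdry K \<subseteq> bdry (f ` K)"
    using c aut_edge[OF assms(1)] edges_Pow by (auto simp: bdry_def)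
  show "bdry (f ` K) \<subseteq> (`) f ` bdry K"
  proof
    fix e assume e: "e \<in> bdry (f ` K)"
    then have eV: "e \<subseteq> V" "e \<in> E" using edges_Pow by (auto simp: bdry_def)
    let ?d = "ainv f ` e"
    have d: "?d \<subseteq> V" "f ` ?d = e" using eV ainv[OF assms(1)] autD(4)[OF ainv(1)[OF assms(1)]] by (auto simp: image_image subset_iff)
    then have "?d \<in> bdry K" using e c[OF d(1)] aut_edge[OF assms(1) d(1)] by (simp add: bdry_def)
    then show "e \<in> (`) f ` bdry K" using d(2) by (metis image_eqI)
  qed
qed

lemma card_aut_bdry: assumes "f \<in> Aut" "K \<subseteq> V" shows "card (bdry (f ` K)) = card (bdry K)"
proof -
  have "inj_on ((`) f) (bdry K)"
    using aut_inj_edge[OF assms(1)] edges_Pow by (auto simp: inj_on_def bdry_def)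
  then show ?thesis using aut_bdry[OF assms] by (simp add: card_image)
qed

definition same_orbit :: "'v => 'v => bool" where
  "same_orbit x y \<longleftrightarrow> (\<exists>f\<in>Aut. f x = y)"

lemma same_orbit_sym: "x \<in> V ==> same_orbit x y ==> same_orbit y x"
  unfolding same_orbit_def using ainv by metis

lemma same_orbit_trans: "x \<in> V ==> same_orbit x y ==> same_orbit y z ==> same_orbit x z"
  unfolding same_orbit_def using aut_compose by (metis compose_eq)

section \<open>The topology of the automorphism group and Haar weights\<close>

abbreviation PT :: "('v => 'v) topology" where
  "PT \<equiv> product_topology (\<lambda>_. discrete_topology V) V"

lemma openin_coord:
  assumes "x \<in> V" shows "openin PT {f \<in> PiE V (\<lambda>_. V). f x \<in> A}"
proof -
  have "continuous_map PT (discrete_topology V) (\<lambda>f. f x)"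
    using assms by (rule continuous_map_product_projection)
  then have "openin PT {f \<in> topspace PT. f x \<in> V \<inter> A}"
    by (rule openin_continuous_map_preimage) simp
  moreover have "{f \<in> topspace PT. f x \<in> V \<inter> A} = {f \<in> PiE V (\<lambda>_. V). f x \<in> A}"
    using assms by auto
  ultimately show ?thesis by simp
qed

lemma openin_coord2:
  assumes "x \<in> V" "y \<in> V" shows "openin PT {f \<in> PiE V (\<lambda>_. V). R (f x) (f y)}"
proof -
  have "{f \<in> PiE V (\<lambda>_. V). R (f x) (f y)} =
    (\<Union>a\<in>V. {f \<in> PiE V (\<lambda>_. V). f x \<in> {a}} \<inter> {f \<in> PiE V (\<lambda>_. V). f y \<in> {b. R a b}})"
    using assms by auto
  moreover have "openin PT (\<Union>a\<in>V. {f \<in> PiE V (\<lambda>_. V). f x \<in> {a}} \<inter> {f \<in> PiE V (\<lambda>_. V). f y \<in> {b. R a b}})"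
  proof (rule openin_Union, clarify)
    fix a
    show "openin PT ({f \<in> PiE V (\<lambda>_. V). f x \<in> {a}} \<inter> {f \<in> PiE V (\<lambda>_. V). f y \<in> {b. R a b}})"
      using assms by (intro openin_Int openin_coord)
  qed
  ultimately show ?thesis by simp
qed

lemma closedin_coord2:
  assumes "x \<in> V" "y \<in> V" shows "closedin PT {f \<in> PiE V (\<lambda>_. V). R (f x) (f y)}"
proof -
  have "topspace PT - {f \<in> PiE V (\<lambda>_. V). R (f x) (f y)} = {f \<in> PiE V (\<lambda>_. V). \<not> R (f x) (f y)}" by auto
  then show ?thesis using openin_coord2[OF assms, of "\<lambda>a b. \<not> R a b"] by (auto simp: closedin_def)
qed

lemma Aut_PiE: "Aut \<subseteq> PiE V (\<lambda>_. V)"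
  using autD(2,4) by (auto simp: PiE_def)

lemma openin_transporter: "y \<in> V ==> openin (aut_topology (V, E)) {g \<in> Aut. g y = z}"
  unfolding aut_topology_def openin_subtopology fst_conv
  using openin_coord[of y "{z}"] Aut_PiE by (intro exI[of _ "{f \<in> PiE V (\<lambda>_. V). f y \<in> {z}}"]) auto

text \<open>An element fixing \<open>y\<close> moves each vertex within a finite ball around
  \<open>y\<close>, so the stabilizer lies in a compact product. Injectivity and preservation of
  edges are closed conditions. Surjectivity need not be imposed on the closed set: an injective map
  of a finite ball into itself is onto.\<close>

lemma compactin_stabilizer:
  assumes "y \<in> V" shows "compactin (aut_topology (V, E)) {g \<in> Aut. g y = y}"
proof -
  define r where "r v = (SOME r. v \<in> ball y r)" for v
  have r: "v \<in> ball y (r v)" if "v \<in> V" for v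
    unfolding r_def using someI_ex[OF ex_ball[OF assms that]] .
  have comp: "compactin PT (PiE V (\<lambda>v. ball y (r v)))"
    using finite_ball[OF assms] ball_V[OF assms] by (simp add: compactin_PiE compactin_discrete_topology)
  define C where "C = (\<Inter>p\<in>V \<times> V. {f \<in> PiE V (\<lambda>_. V). ({f (fst p), f (snd p)} \<in> E \<longleftrightarrow> {fst p, snd p} \<in> E) \<and>
    (f (fst p) = f (snd p) --> fst p = snd p)}) \<inter> {f \<in> PiE V (\<lambda>_. V). f y = y}"
  have "closedin PT C"
    unfolding C_def
  proof (intro closedin_Int closedin_INT)
    show "V \<times> V \<noteq> {}" using assms by blast
    show "closedin PT {f \<in> PiE V (\<lambda>_. V). f y = y}" using closedin_coord2[OF assms assms, of "\<lambda>a b. a = y"] by simp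
    fix p assume "p \<in> V \<times> V"
    then show "closedin PT {f \<in> PiE V (\<lambda>_. V). ({f (fst p), f (snd p)} \<in> E \<longleftrightarrow> {fst p, snd p} \<in> E) \<and>
      (f (fst p) = f (snd p) --> fst p = snd p)}"
      using closedin_coord2[of "fst p" "snd p" "\<lambda>a b. ({a, b} \<in> E \<longleftrightarrow> {fst p, snd p} \<in> E) \<and> (a = b --> fst p = snd p)"] by auto
  qed
  then have "compactin PT (C \<inter> PiE V (\<lambda>v. ball y (r v)))" by (rule closed_Int_compactin[OF _ comp])
  moreover have "C \<inter> PiE V (\<lambda>v. ball y (r v)) = {g \<in> Aut. g y = y}"
  proof
    show "{g \<in> Aut. g y = y} \<subseteq> C \<inter> PiE V (\<lambda>v. ball y (r v))"
    proof
      fix g assume "g \<in> {g \<in> Aut. g y = y}"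
      then have g: "g \<in> Aut" "g y = y" by auto
      have "g v \<in> ball y (r v)" if "v \<in> V" for v
        using aut_ball[OF g(1) assms, of "r v"] g(2) r[OF that] by auto
      moreover have "g \<in> PiE V (\<lambda>_. V)" using g Aut_PiE by blast
      ultimately show "g \<in> C \<inter> PiE V (\<lambda>v. ball y (r v))"
        using g autD(3)[OF g(1)] aut_eq[OF g(1)] by (auto simp: C_def PiE_def)
    qed
    show "C \<inter> PiE V (\<lambda>v. ball y (r v)) \<subseteq> {g \<in> Aut. g y = y}"
    proof
      fix g assume "g \<in> C \<inter> PiE V (\<lambda>v. ball y (r v))"
      then have "g \<in> C" by blast
      then have gP: "g \<in> PiE V (\<lambda>_. V)" "g y = y"
        and ge: "\<And>u v. u \<in> V ==> v \<in> V ==> {g u, g v} \<in> E \<longleftrightarrow> {u, v} \<in> E"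
        and gi: "inj_on g V" by (auto simp: C_def inj_on_def)
      have sub: "g ` ball y k \<subseteq> ball y k" for k
      proof (induction k)
        case (Suc k)
        have "g z \<in> nbr (g x)" if "x \<in> ball y k" "z \<in> nbr x" for x z
          using that ge[of x z] nbr_V[of z x] by (auto simp: nbr_def)
        then show ?case using Suc by fastforce
      qed (use gP in simp)
      have "g ` ball y k = ball y k" for k
        by (rule endo_inj_surj[OF finite_ball[OF assms] sub inj_on_subset[OF gi ball_V[OF assms]]])
      then have "V \<subseteq> g ` V" using r ball_V[OF assms] by blast
      moreover have "g ` V \<subseteq> V" using gP by auto
      ultimately have "bij_betw g V V" using gi by (simp add: bij_betw_def)
      then show "g \<in> {g \<in> Aut. g y = y}"
        using gP ge by (auto simp: automorphisms_def Bij_def PiE_def)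
    qed
  qed
  ultimately show ?thesis by (auto simp: aut_topology_def compactin_subtopology)
qed

lemma aut_group_mult: "f \<in> Aut ==> g \<in> Aut ==> f \<otimes>\<^bsub>aut_group (V, E)\<^esub> g = compose V f g"
  by (simp add: aut_group_def BijGroup_def automorphisms_def)

lemma carrier_aut [simp]: "carrier (aut_group (V, E)) = Aut"
  by (simp add: aut_group_def)

text \<open>The facts about Haar measure that the counting uses, freed from topology. The weight
  \<open>w y\<close> is the measure of the stabilizer of \<open>y\<close>, and each nonempty
  transporter is a left coset of it with the same measure. Right invariance, and with it the
  constancy of \<open>w\<close> on orbits, is where unimodularity enters.\<close>

definition haar :: "('v => 'v) measure => ('v => real) => bool" where
  "haar \<mu> w \<longleftrightarrow> space \<mu> = Aut \<and> (\<forall>y\<in>V. \<forall>z. {g \<in> Aut. g y = z} \<in> sets \<mu>) \<and>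
    (\<forall>y\<in>V. 0 < w y) \<and> (\<forall>y\<in>V. \<forall>f\<in>Aut. w (f y) = w y) \<and>
    (\<forall>y\<in>V. \<forall>f\<in>Aut. emeasure \<mu> {g \<in> Aut. g y = f y} = ennreal (w y)) \<and>
    (\<forall>A\<in>sets \<mu>. \<forall>f\<in>Aut. {g \<in> Aut. compose V g f \<in> A} \<in> sets \<mu> \<and>
      emeasure \<mu> {g \<in> Aut. compose V g f \<in> A} = emeasure \<mu> A)"

lemma ex_haar:
  assumes "unimodular (V, E)" obtains \<mu> w where "haar \<mu> w"
proof -
  let ?G = "aut_group (V, E)" and ?X = "aut_topology (V, E)"
  obtain \<mu> where H: "left_haar_measure ?G ?X \<mu>"
    and R: "\<forall>g\<in>Aut. \<forall>A\<in>sets \<mu>. emeasure \<mu> (A #>\<^bsub>?G\<^esub> g) = emeasure \<mu> A"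
    using assms unfolding unimodular_def unimodular_group_def by auto
  have sp: "space \<mu> = Aut" and se: "sets \<mu> = sigma_sets Aut {U. openin ?X U}"
    and nz: "emeasure \<mu> Aut \<noteq> 0" and fin: "\<And>K. compactin ?X K ==> emeasure \<mu> K < \<infinity>"
    and L: "\<And>g A. g \<in> Aut ==> A \<in> sets \<mu> ==> emeasure \<mu> (g <#\<^bsub>?G\<^esub> A) = emeasure \<mu> A"
    using H unfolding left_haar_measure_def by auto
  have open_Aut: "U \<subseteq> Aut" if "openin ?X U" for U
    using openin_subset[OF that] by (simp add: aut_topology_def)
  have open_sets: "U \<in> sets \<mu>" if "openin ?X U" for U using that se by auto
  have tr_sets: "{g \<in> Aut. g y = z} \<in> sets \<mu>" if "y \<in> V" for y z
    using open_sets openin_transporter that by blast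
  define w where "w y = enn2real (emeasure \<mu> {g \<in> Aut. g y = y})" for y
  have w: "emeasure \<mu> {g \<in> Aut. g y = y} = ennreal (w y)" if "y \<in> V" for y
    using fin[OF compactin_stabilizer[OF that]] by (simp add: w_def less_top)
  have lc: "f <#\<^bsub>?G\<^esub> {g \<in> Aut. g y = y} = {g \<in> Aut. g y = f y}" if f: "f \<in> Aut" and y: "y \<in> V" for f y
  proof
    show "f <#\<^bsub>?G\<^esub> {g \<in> Aut. g y = y} \<subseteq> {g \<in> Aut. g y = f y}"
      using f y aut_compose aut_group_mult by (auto simp: l_coset_def compose_def)
    show "{g \<in> Aut. g y = f y} \<subseteq> f <#\<^bsub>?G\<^esub> {g \<in> Aut. g y = y}"
    proof
      fix g assume g: "g \<in> {g \<in> Aut. g y = f y}"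
      let ?h = "compose V (ainv f) g"
      have h: "?h \<in> Aut" using aut_compose ainv(1)[OF f] g by blast
      moreover have "?h y = y" using g y ainv(3)[OF f] by (simp add: compose_def)
      moreover have "compose V f ?h = g"
        using ainv(2)[OF f] autD(2,4)[of g] g by (auto simp: compose_def fun_eq_iff extensional_def)
      ultimately show "g \<in> f <#\<^bsub>?G\<^esub> {g \<in> Aut. g y = y}"
        using aut_group_mult[OF f h] by (auto simp: l_coset_def)
    qed
  qed
  have rc: "A #>\<^bsub>?G\<^esub> ainv f = {g \<in> Aut. compose V g f \<in> A}" if f: "f \<in> Aut" and A: "A \<subseteq> Aut" for f A
  proof
    show "A #>\<^bsub>?G\<^esub> ainv f \<subseteq> {g \<in> Aut. compose V g f \<in> A}"
    proof
      fix g assume "g \<in> A #>\<^bsub>?G\<^esub> ainv f"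
      then obtain h where h: "h \<in> A" "g = h \<otimes>\<^bsub>?G\<^esub> ainv f" unfolding r_coset_def by blast
      have hA: "h \<in> Aut" using h A by blast
      have "g = compose V h (ainv f)" using h(2) aut_group_mult[OF hA ainv(1)[OF f]] by simp
      then show "g \<in> {g \<in> Aut. compose V g f \<in> A}"
        using ainv_compose(2)[OF f hA] h(1) aut_compose[OF hA ainv(1)[OF f]] by simp
    qed
    show "{g \<in> Aut. compose V g f \<in> A} \<subseteq> A #>\<^bsub>?G\<^esub> ainv f"
    proof
      fix g assume g: "g \<in> {g \<in> Aut. compose V g f \<in> A}"
      then have "compose V g f \<otimes>\<^bsub>?G\<^esub> ainv f = g"
        using aut_group_mult[OF aut_compose[OF _ f] ainv(1)[OF f], of g] ainv_compose(1)[OF f, of g] by simp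
      then have "g \<in> {compose V g f \<otimes>\<^bsub>?G\<^esub> ainv f}" by simp
      moreover have "compose V g f \<in> A" using g by simp
      ultimately show "g \<in> A #>\<^bsub>?G\<^esub> ainv f" unfolding r_coset_def by (rule UN_I[rotated])
    qed
  qed
  have left: "emeasure \<mu> {g \<in> Aut. g y = f y} = ennreal (w y)" if "f \<in> Aut" "y \<in> V" for f y
    using L[OF that(1) tr_sets[OF that(2)], of y] unfolding lc[OF that] w[OF that(2)] .
  have sub: "A \<subseteq> Aut" if "A \<in> sets \<mu>" for A using sets.sets_into_space[OF that] sp by simp
  have right: "emeasure \<mu> {g \<in> Aut. compose V g f \<in> A} = emeasure \<mu> A" if "f \<in> Aut" "A \<in> sets \<mu>" for f A
    using R[rule_format, OF ainv(1)[OF that(1)] that(2)] unfolding rc[OF that(1) sub[OF that(2)]] .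
  \<comment> \<open>A right translate of the coset of elements taking \<open>y\<close> to
    \<open>f y\<close> is the stabilizer of \<open>f y\<close>; right invariance equates the two
    measures.\<close>
  have wconst: "w (f y) = w y" if "f \<in> Aut" "y \<in> V" for f y
  proof -
    have fy: "f y \<in> V" using autD(4) that by blast
    have "{g \<in> Aut. compose V g f \<in> {g \<in> Aut. g y = f y}} = {g \<in> Aut. g (f y) = f y}"
      using that aut_compose by (auto simp: compose_def)
    then have "emeasure \<mu> {g \<in> Aut. g (f y) = f y} = emeasure \<mu> {g \<in> Aut. g y = f y}"
      using right[OF that(1) tr_sets[OF that(2), of "f y"]] by simp
    then show ?thesis using left[OF that] w[OF fy] unfolding w_def by simp
  qed
  \<comment> \<open>Otherwise the whole group would be a countable union of null
    transporters.\<close>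
  have wpos: "0 < w y" if "y \<in> V" for y
  proof (rule ccontr)
    assume "\<not> 0 < w y"
    then have "w y = 0" using enn2real_nonneg[of "emeasure \<mu> {g \<in> Aut. g y = y}"] by (simp add: w_def)
    then have z: "emeasure \<mu> {g \<in> Aut. g y = z} = 0" for z
    proof (cases "\<exists>f\<in>Aut. f y = z")
      case True
      then show ?thesis using left[OF _ that] \<open>w y = 0\<close> by auto
    next
      case False
      then have "{g \<in> Aut. g y = z} = {}" by auto
      then show ?thesis by (simp only: emeasure_empty)
    qed
    have "Aut = (\<Union>z\<in>V. {g \<in> Aut. g y = z})" using autD(4) that by auto
    moreover have "emeasure \<mu> (\<Union>z\<in>V. {g \<in> Aut. g y = z}) = 0"
    proof -
      have "(\<Union>z\<in>V. {g \<in> Aut. g y = z}) \<in> null_sets \<mu>"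
        using z tr_sets[OF that] countable_V by (intro null_sets_UN') auto
      then show ?thesis by auto
    qed
    ultimately show False using nz by simp
  qed
  have rsets: "{g \<in> Aut. compose V g f \<in> A} \<in> sets \<mu>" if "f \<in> Aut" "A \<in> sets \<mu>" for f A
  proof -
    have cont: "openin ?X {g \<in> Aut. compose V g f \<in> U}" if U: "openin ?X U" for U
    proof -
      obtain W where W: "openin PT W" "U = W \<inter> Aut" using U by (auto simp: aut_topology_def openin_subtopology)
      have "continuous_map PT PT (\<lambda>g. compose V g f)"
        unfolding continuous_map_componentwise
      proof (intro conjI ballI)
        show "(\<lambda>g. compose V g f) ` topspace PT \<subseteq> extensional V" by auto
        fix x assume x: "x \<in> V"
        have fx: "f x \<in> V" using autD(4)[OF \<open>f \<in> Aut\<close> x] .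
        have "continuous_map PT (discrete_topology V) (\<lambda>g. g (f x))"
          using fx by (rule continuous_map_product_projection)
        then show "continuous_map PT (discrete_topology V) (\<lambda>g. compose V g f x)"
          using x by (simp add: compose_def)
      qed
      then have "openin PT {g \<in> topspace PT. compose V g f \<in> W}" using W(1) by (rule openin_continuous_map_preimage)
      moreover have "{g \<in> Aut. compose V g f \<in> U} = {g \<in> topspace PT. compose V g f \<in> W} \<inter> Aut"
        using W Aut_PiE aut_compose[OF _ \<open>f \<in> Aut\<close>] by auto
      ultimately show ?thesis by (auto simp: aut_topology_def openin_subtopology)
    qed
    have sg: "sets \<mu> = sets (sigma Aut {U. openin ?X U})"
      using se open_Aut by (subst sets_measure_of) auto
    have "(\<lambda>g. compose V g f) \<in> measurable \<mu> (sigma Aut {U. openin ?X U})"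
    proof (rule measurable_measure_of)
      show "{U. openin ?X U} \<subseteq> Pow Aut" using open_Aut by blast
      show "(\<lambda>g. compose V g f) \<in> space \<mu> \<rightarrow> Aut" using sp aut_compose[OF _ \<open>f \<in> Aut\<close>] by auto
      fix U assume "U \<in> {U. openin ?X U}"
      then have "{g \<in> Aut. compose V g f \<in> U} \<in> sets \<mu>" using cont open_sets by blast
      moreover have "{g \<in> Aut. compose V g f \<in> U} = (\<lambda>g. compose V g f) -` U \<inter> space \<mu>" using sp by auto
      ultimately show "(\<lambda>g. compose V g f) -` U \<inter> space \<mu> \<in> sets \<mu>" by simp
    qed
    then have "(\<lambda>g. compose V g f) -` A \<inter> space \<mu> \<in> sets \<mu>"
      using that(2) sg by (intro measurable_sets) auto
    moreover have "(\<lambda>g. compose V g f) -` A \<inter> space \<mu> = {g \<in> Aut. compose V g f \<in> A}" using sp by auto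
    ultimately show ?thesis by simp
  qed
  have "haar \<mu> w"
    unfolding haar_def using sp tr_sets wpos wconst left right rsets by blast
  then show thesis by (rule that)
qed

end

section \<open>Quasi-transitive graphs\<close>

text \<open>\<open>Rep\<close> meets every orbit but may do so several times;
  \<open>transversal\<close> later selects one point per orbit.\<close>

locale qt_graph = lf_graph V E for V :: "'v set" and E :: "'v set set" +
  fixes Rep :: "'v set"
  assumes finite_Rep: "finite Rep" and Rep_V: "Rep \<subseteq> V"
    and Rep_reps: "x \<in> V ==> \<exists>ro\<in>Rep. \<exists>f\<in>automorphisms (V, E). x = f ro"
begin

lemma Rep_nonempty: "Rep \<noteq> {}" using Rep_reps infinite_V by (metis ball_empty finite.emptyI ex_in_conv)

text \<open>A sum over the representatives instead of a maximum: any bound that is uniform over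
  \<open>V\<close> will do, and sums are easier to compare with.\<close>

definition bnd :: "nat => nat" where "bnd r = (\<Sum>ro\<in>Rep. card (ball ro r))"
definition deg :: nat where "deg = (\<Sum>ro\<in>Rep. card {e \<in> E. ro \<in> e})"

lemma card_ball_le: assumes "x \<in> V" shows "card (ball x r) \<le> bnd r"
proof -
  obtain ro f where ro: "ro \<in> Rep" "f \<in> Aut" "x = f ro" using Rep_reps[OF assms] by blast
  then have roV: "ro \<in> V" using Rep_V by blast
  have "card (ball x r) = card (f ` ball ro r)" using aut_ball[OF ro(2) roV] ro by simp
  also have "... \<le> card (ball ro r)" using finite_ball[OF roV] by (rule card_image_le)
  also have "... \<le> bnd r" unfolding bnd_def using ro finite_Rep by (intro member_le_sum) auto
  finally show ?thesis .
qed

lemma degree_le: assumes "x \<in> V" shows "card {e \<in> E. x \<in> e} \<le> deg"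
proof -
  obtain ro f where ro: "ro \<in> Rep" "f \<in> Aut" "x = f ro" using Rep_reps[OF assms] by blast
  then have roV: "ro \<in> V" using Rep_V by blast
  have "{e \<in> E. x \<in> e} \<subseteq> (`) f ` {e \<in> E. ro \<in> e}"
  proof
    fix e assume e: "e \<in> {e \<in> E. x \<in> e}"
    then have eV: "e \<subseteq> V" using edges_Pow by auto
    let ?d = "ainv f ` e"
    have d: "?d \<subseteq> V" "f ` ?d = e" using eV ainv[OF ro(2)] autD(4)[OF ainv(1)[OF ro(2)]] by (auto simp: image_image subset_iff)
    have "?d \<in> E" using aut_edge[OF ro(2) d(1)] d(2) e by simp
    moreover have "ro \<in> ?d" using e ro(3) ainv(3)[OF ro(2) roV] by force
    ultimately show "e \<in> (`) f ` {e \<in> E. ro \<in> e}" using d(2) by blast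
  qed
  then have "card {e \<in> E. x \<in> e} \<le> card ((`) f ` {e \<in> E. ro \<in> e})"
    using locfin[OF roV] by (intro card_mono) auto
  also have "... \<le> card {e \<in> E. ro \<in> e}" using locfin[OF roV] by (rule card_image_le)
  also have "... \<le> deg" unfolding deg_def using ro finite_Rep by (intro member_le_sum) auto
  finally show ?thesis .
qed

sublocale bd: bd_graph V E deg bnd
  by unfold_locales (use card_ball_le degree_le in auto)

section \<open>Uniform one-endedness\<close>

definition joined_at :: "nat => nat => 'v => 'v set => 'v => 'v => bool" where
  "joined_at R Q a S w w' \<longleftrightarrow>
    (\<exists>W. finite W \<and> Q \<le> card W \<and> (\<forall>y\<in>W. conn {e \<in> E. e \<inter> S = {}} w y)) \<and>
    (\<exists>W. finite W \<and> Q \<le> card W \<and> (\<forall>y\<in>W. conn {e \<in> E. e \<inter> S = {}} w' y)) \<and> w \<notin> S \<and> w' \<notin> S -->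
    conn {e \<in> E. e \<inter> S = {} \<and> e \<subseteq> ball a R} w w'"

lemma joined_at_mono:
  assumes "joined_at R Q a S w w'" "R \<le> R'" "Q \<le> Q'"
  shows "joined_at R' Q' a S w w'"
proof -
  have sub: "{e \<in> E. e \<inter> S = {} \<and> e \<subseteq> ball a R} \<subseteq> {e \<in> E. e \<inter> S = {} \<and> e \<subseteq> ball a R'}"
    using ball_mono[OF assms(2)] by blast
  show ?thesis
    using assms(1) conn_mono[OF _ sub] le_trans[OF assms(3)] unfolding joined_at_def by blast
qed

text \<open>If both points lie in infinite components, these coincide by one-endedness, and a
  connecting walk lies in some ball. Otherwise a point is in \<open>S\<close>, or \<open>Q\<close>
  exceeds the size of a finite component, so that the premise in \<open>joined_at\<close>
  fails.\<close>

lemma ex_joined_at: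
  assumes one: "one_ended (V, E)" and a: "a \<in> V" and S: "S \<subseteq> V" "finite S" and w: "w \<in> V" "w' \<in> V"
  shows "\<exists>R Q. joined_at R Q a S w w'"
proof -
  let ?F = "{e \<in> E. e \<inter> S = {}}"
  have reach: "reachable (delete_verts (V, E) S) = conn ?F"
    by (simp add: reachable_def conn_def delete_verts_def)
  let ?C = "\<lambda>w. {v \<in> V - S. conn ?F w v}"
  have inC: "v \<in> ?C w" if "conn ?F w v" "w \<in> V" "w \<notin> S" for w v
    using that(1)
  proof (induction rule: conn_induct)
    case (step y z)
    have "z \<in> V - S" using step.hyps(2) edges_Pow by auto
    moreover have "conn ?F w z" using conn_trans[OF step.hyps(1) conn_edge[OF step.hyps(2)]] .
    ultimately show ?case by blast
  qed (use that in simp)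
  have bigC: "infinite (?C w) \<or> card W \<le> card (?C w)"
    if "\<forall>y\<in>W. conn ?F w y" "w \<in> V" "w \<notin> S" for w W
  proof -
    have "W \<subseteq> ?C w" using inC that by blast
    then show ?thesis by (meson card_mono)
  qed
  show ?thesis
  proof (cases "w \<notin> S \<and> w' \<notin> S \<and> infinite (?C w) \<and> infinite (?C w')")
    case True
    have cw: "?C w \<in> components_of (delete_verts (V, E) S)" "?C w' \<in> components_of (delete_verts (V, E) S)"
      using True w unfolding components_of_def reach by (auto simp: delete_verts_def)
    have ex1: "\<exists>!C. C \<in> components_of (delete_verts (V, E) S) \<and> infinite C"
      using one S by (auto simp: one_ended_def)
    have uniq: "C = C'" if "C \<in> components_of (delete_verts (V, E) S)" "infinite C"
      "C' \<in> components_of (delete_verts (V, E) S)" "infinite C'" for C C'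
      using ex1 that by blast
    have "infinite (?C w)" "infinite (?C w')" using True by simp_all
    then have eq: "?C w' = ?C w" using uniq[OF cw(2) _ cw(1)] by simp
    have "w' \<in> ?C w'" using w True by simp
    then have "w' \<in> ?C w" by (simp only: eq)
    then have "conn ?F w w'" by blast
    then have "\<exists>R. conn {e \<in> E. e \<inter> S = {} \<and> e \<subseteq> ball a R} w w'"
    proof (induction rule: conn_induct)
      case (step y z)
      then obtain R where R: "conn {e \<in> E. e \<inter> S = {} \<and> e \<subseteq> ball a R} w y" by blast
      have yz: "y \<in> V" "z \<in> V" using step.hyps(2) edges_Pow by auto
      obtain r1 r2 where r: "y \<in> ball a r1" "z \<in> ball a r2" using ex_ball[OF a] yz by metis
      let ?R = "R + r1 + r2"
      have "{y, z} \<subseteq> ball a ?R" using r ball_mono[of r1 ?R a] ball_mono[of r2 ?R a] by auto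
      then have e: "conn {e \<in> E. e \<inter> S = {} \<and> e \<subseteq> ball a ?R} y z" using step.hyps(2) by (intro conn_edge) auto
      have "{e \<in> E. e \<inter> S = {} \<and> e \<subseteq> ball a R} \<subseteq> {e \<in> E. e \<inter> S = {} \<and> e \<subseteq> ball a ?R}"
        using ball_mono[of R ?R a] by auto
      then have "conn {e \<in> E. e \<inter> S = {} \<and> e \<subseteq> ball a ?R} w y" by (rule conn_mono[OF R])
      then show ?case using conn_trans[OF _ e] by blast
    qed auto
    then show ?thesis by (auto simp: joined_at_def)
  next
    case False
    let ?Q = "Suc (card (?C w) + card (?C w'))"
    have "joined_at 0 ?Q a S w w'"
      unfolding joined_at_def
    proof (intro impI, elim conjE exE)
      fix W W' assume W: "?Q \<le> card W" "\<forall>y\<in>W. conn ?F w y" "?Q \<le> card W'" "\<forall>y\<in>W'. conn ?F w' y" "w \<notin> S" "w' \<notin> S"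
      have "infinite (?C w)" using bigC[OF W(2) w(1) W(5)] W(1) by auto
      moreover have "infinite (?C w')" using bigC[OF W(4) w(2) W(6)] W(3) by auto
      ultimately show "conn {e \<in> E. e \<inter> S = {} \<and> e \<subseteq> ball a 0} w w'" using False W by blast
    qed
    then show ?thesis by blast
  qed
qed

lemma joined_at_aut:
  assumes f: "f \<in> Aut" and a: "a \<in> V" and S: "S \<subseteq> V" and w: "w \<in> V" "w' \<in> V"
    and j: "joined_at R Q a S w w'"
  shows "joined_at R Q (f a) (f ` S) (f w) (f w')"
  unfolding joined_at_def
proof (intro impI, elim conjE exE)
  let ?h = "ainv f"
  have h: "?h \<in> Aut" by (rule ainv(1)[OF f])
  have hf: "?h (f x) = x" if "x \<in> V" for x using ainv(3)[OF f that] .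
  have hfS: "?h ` f ` S = S" using hf S by (force simp: image_image)
  have sub: "(`) ?h ` {e \<in> E. e \<inter> f ` S = {}} \<subseteq> {e \<in> E. e \<inter> S = {}}"
  proof
    fix d assume "d \<in> (`) ?h ` {e \<in> E. e \<inter> f ` S = {}}"
    then obtain e where e: "e \<in> E" "e \<inter> f ` S = {}" "d = ?h ` e" by auto
    then have eV: "e \<subseteq> V" using edges_Pow by blast
    have "d \<in> E" using aut_edge[OF h eV] e by simp
    moreover have "d \<inter> S = {}"
    proof (rule equals0I)
      fix x assume "x \<in> d \<inter> S"
      then obtain y where y: "y \<in> e" "x = ?h y" "x \<in> S" using e by auto
      then have "f x = y" using ainv(2)[OF f, of y] eV by auto
      then show False using e(2) y by blast
    qed
    ultimately show "d \<in> {e \<in> E. e \<inter> S = {}}" by simp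
  qed
  have tr: "\<exists>W'. finite W' \<and> Q \<le> card W' \<and> (\<forall>y\<in>W'. conn {e \<in> E. e \<inter> S = {}} x y)"
    if W: "finite W" "Q \<le> card W" "\<forall>y\<in>W. conn {e \<in> E. e \<inter> f ` S = {}} (f x) y" and x: "x \<in> V" for W x
  proof -
    have WV: "W \<subseteq> V"
    proof
      fix y assume "y \<in> W"
      then have "conn {e \<in> E. e \<inter> f ` S = {}} (f x) y" using W by blast
      then show "y \<in> V"
        by (induction rule: conn_induct) (use autD(4)[OF f x] edges_Pow in auto)
    qed
    have "conn {e \<in> E. e \<inter> S = {}} x (?h y)" if "y \<in> W" for y
      using conn_mono[OF conn_image[OF W(3)[rule_format, OF that], of ?h] sub] hf[OF x] by simp
    moreover have "card (?h ` W) = card W" using inj_on_subset[OF autD(5)[OF h] WV] by (rule card_image)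
    ultimately show ?thesis using W by (intro exI[of _ "?h ` W"]) auto
  qed
  fix W W' assume W: "finite W" "Q \<le> card W" "\<forall>y\<in>W. conn {e \<in> E. e \<inter> f ` S = {}} (f w) y"
    "finite W'" "Q \<le> card W'" "\<forall>y\<in>W'. conn {e \<in> E. e \<inter> f ` S = {}} (f w') y" "f w \<notin> f ` S" "f w' \<notin> f ` S"
  have "conn {e \<in> E. e \<inter> S = {} \<and> e \<subseteq> ball a R} w w'"
    using j tr[OF W(1-3) w(1)] tr[OF W(4-6) w(2)] W(7,8) unfolding joined_at_def by blast
  then have "conn ((`) f ` {e \<in> E. e \<inter> S = {} \<and> e \<subseteq> ball a R}) (f w) (f w')" by (rule conn_image)
  moreover have "(`) f ` {e \<in> E. e \<inter> S = {} \<and> e \<subseteq> ball a R} \<subseteq> {e \<in> E. e \<inter> f ` S = {} \<and> e \<subseteq> ball (f a) R}"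
  proof
    fix d assume "d \<in> (`) f ` {e \<in> E. e \<inter> S = {} \<and> e \<subseteq> ball a R}"
    then obtain e where e: "e \<in> E" "e \<inter> S = {}" "e \<subseteq> ball a R" "d = f ` e" by auto
    then have eV: "e \<subseteq> V" using edges_Pow by blast
    have "d \<inter> f ` S = f ` (e \<inter> S)" using inj_on_image_Int[OF autD(5)[OF f] eV S] e(4) by simp
    then show "d \<in> {e \<in> E. e \<inter> f ` S = {} \<and> e \<subseteq> ball (f a) R}"
      using aut_edge[OF f eV] aut_ball[OF f a] e by auto
  qed
  ultimately show "conn {e \<in> E. e \<inter> f ` S = {} \<and> e \<subseteq> ball (f a) R} (f w) (f w')" by (rule conn_mono)
qed

text \<open>Up to automorphisms there are only finitely many configurations of a centre, a subset of
  its ball and two nearby points, and the constants of a configuration may be enlarged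
  freely.\<close>

lemma uniformly_joined:
  assumes one: "one_ended (V, E)" shows "\<exists>R Q. bd.uniformly_joined \<rho> R Q"
proof -
  let ?I = "{(a, S, w, w'). a \<in> Rep \<and> S \<subseteq> ball a \<rho> \<and> w \<in> ball a (Suc \<rho>) \<and> w' \<in> ball a (Suc \<rho>)}"
  have finI: "finite ?I"
  proof (rule finite_subset)
    show "?I \<subseteq> (\<Union>a\<in>Rep. {a} \<times> Pow (ball a \<rho>) \<times> ball a (Suc \<rho>) \<times> ball a (Suc \<rho>))" by auto
    show "finite (\<Union>a\<in>Rep. {a} \<times> Pow (ball a \<rho>) \<times> ball a (Suc \<rho>) \<times> ball a (Suc \<rho>))"
      using finite_Rep Rep_V finite_ball by blast
  qed
  have "\<forall>p\<in>?I. \<exists>q. joined_at (fst q) (snd q) (fst p) (fst (snd p)) (fst (snd (snd p))) (snd (snd (snd p)))"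
  proof
    fix p assume "p \<in> ?I"
    then obtain a S w w' where p: "p = (a, S, w, w')" "a \<in> Rep" "S \<subseteq> ball a \<rho>" "w \<in> ball a (Suc \<rho>)" "w' \<in> ball a (Suc \<rho>)"
      by (cases p) (auto simp del: ball.simps)
    have aV: "a \<in> V" using p Rep_V by blast
    have "S \<subseteq> V" "finite S" "w \<in> V" "w' \<in> V"
      using p ball_V[OF aV] finite_ball[OF aV] finite_subset by (blast, metis, blast, blast)
    then obtain R Q where "joined_at R Q a S w w'" using ex_joined_at[OF one aV] by metis
    then show "\<exists>q. joined_at (fst q) (snd q) (fst p) (fst (snd p)) (fst (snd (snd p))) (snd (snd (snd p)))"
      using p(1) by (intro exI[of _ "(R, Q)"]) simp
  qed
  from bchoice[OF this] obtain q where
    q: "\<forall>p\<in>?I. joined_at (fst (q p)) (snd (q p)) (fst p) (fst (snd p)) (fst (snd (snd p))) (snd (snd (snd p)))"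
    by (elim exE)
  define R where "R = (\<Sum>p\<in>?I. fst (q p))"
  define Q where "Q = (\<Sum>p\<in>?I. snd (q p))"
  have J: "joined_at R Q a S w w'" if "a \<in> Rep" "S \<subseteq> ball a \<rho>" "w \<in> ball a (Suc \<rho>)" "w' \<in> ball a (Suc \<rho>)" for a S w w'
  proof (rule joined_at_mono)
    have p: "(a, S, w, w') \<in> ?I" using that by auto
    show "joined_at (fst (q (a, S, w, w'))) (snd (q (a, S, w, w'))) a S w w'" using q[rule_format, OF p] by simp
    show "fst (q (a, S, w, w')) \<le> R" unfolding R_def by (rule member_le_sum[OF p]) (use finI in auto)
    show "snd (q (a, S, w, w')) \<le> Q" unfolding Q_def by (rule member_le_sum[OF p]) (use finI in auto)
  qed
  have "joined_at R Q a S w w'" if a: "a \<in> V" "S \<subseteq> ball a \<rho>" "w \<in> ball a (Suc \<rho>)" "w' \<in> ball a (Suc \<rho>)" for a S w w'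
  proof -
    obtain ro f where ro: "ro \<in> Rep" "f \<in> Aut" "a = f ro" using Rep_reps[OF a(1)] by blast
    then have roV: "ro \<in> V" using Rep_V by blast
    have b: "ball a r = f ` ball ro r" for r using aut_ball[OF ro(2) roV] ro by simp
    obtain S0 where S0: "S0 \<subseteq> ball ro \<rho>" "S = f ` S0" using a(2) unfolding b by (meson subset_imageE)
    obtain w0 where w0: "w0 \<in> ball ro (Suc \<rho>)" "w = f w0" using a(3) unfolding b by blast
    obtain w1 where w1: "w1 \<in> ball ro (Suc \<rho>)" "w' = f w1" using a(4) unfolding b by blast
    have "S0 \<subseteq> V" "w0 \<in> V" "w1 \<in> V" using S0 w0 w1 ball_V[OF roV] by blast+
    then show ?thesis
      using joined_at_aut[OF ro(2) roV _ _ _ J[OF ro(1) S0(1) w0(1) w1(1)]] S0 w0 w1 ro(3) by simp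
  qed
  then have "bd.uniformly_joined \<rho> R Q" unfolding bd.uniformly_joined_def joined_at_def by blast
  then show ?thesis by blast
qed

end

section \<open>Foelner sets and spanning trees of bounded stretch\<close>

context lf_graph
begin

definition inside :: "'v set => 'v set set" where "inside K = {e \<in> E. e \<subseteq> K}"

text \<open>A Foelner set of least cardinality is connected. If it fell into two parts without edges
  between them, the boundaries of the parts would be disjoint subsets of its boundary, and one part
  would again have ratio below \<open>\<epsilon>\<close>.\<close>

lemma connected_folner:
  assumes am: "amenable (V, E)" and \<epsilon>: "\<epsilon> > 0"
  obtains K where "finite K" "K \<noteq> {}" "K \<subseteq> V" "real (card (bdry K)) < \<epsilon> * real (card K)"
    "\<forall>x\<in>K. \<forall>y\<in>K. conn (inside K) x y"
proof -
  let ?A = "{K. finite K \<and> K \<noteq> {} \<and> K \<subseteq> V}"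
  let ?P = "\<lambda>K. K \<in> ?A \<and> real (card (bdry K)) < \<epsilon> * real (card K)"
  have bd: "edge_boundary (V, E) K = bdry K" for K by (simp add: edge_boundary_def bdry_def)
  have "?A \<noteq> {}" using infinite_V by (metis (mono_tags, lifting) bot_least empty_Collect_eq ex_in_conv finite.emptyI finite.insertI insert_not_empty insert_subset)
  moreover have "bdd_below ((\<lambda>K. real (card (bdry K)) / real (card K)) ` ?A)" by (intro bdd_belowI[of _ 0]) auto
  moreover have "(INF K\<in>?A. real (card (bdry K)) / real (card K)) < \<epsilon>" using am \<epsilon> by (simp add: amenable_def bd)
  ultimately obtain K0 where K0: "K0 \<in> ?A" "real (card (bdry K0)) / real (card K0) < \<epsilon>"
    by (subst (asm) cINF_less_iff) auto
  have "?P K0" using K0 by (auto simp: field_simps card_gt_0_iff)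
  then obtain K where K: "?P K" and min: "\<forall>K'. ?P K' --> card K \<le> card K'"
    using ex_has_least_nat[of ?P K0 card] by blast
  have Kf: "finite K" "K \<noteq> {}" "K \<subseteq> V" using K by auto
  have "conn (inside K) x y" if xy: "x \<in> K" "y \<in> K" for x y
  proof (rule ccontr)
    assume n: "\<not> conn (inside K) x y"
    let ?K1 = "{z \<in> K. conn (inside K) x z}" and ?K2 = "{z \<in> K. \<not> conn (inside K) x z}"
    have disj: "\<not> (p \<in> ?K1 \<and> q \<in> ?K2)" if "{p, q} \<in> E" for p q
    proof
      assume a: "p \<in> ?K1 \<and> q \<in> ?K2"
      then have "conn (inside K) p q" using that by (intro conn_edge) (auto simp: inside_def)
      then have "conn (inside K) x q" using a conn_trans[of "inside K" x p q] by blast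
      then show False using a by blast
    qed
    have inter: "e \<in> bdry K \<and> (e \<in> bdry ?K1 --> e \<inter> ?K1 \<noteq> {} \<and> e \<inter> ?K2 = {}) \<and> (e \<in> bdry ?K2 --> e \<inter> ?K2 \<noteq> {} \<and> e \<inter> ?K1 = {})"
      if in12: "e \<in> bdry ?K1 \<or> e \<in> bdry ?K2" for e
    proof -
      obtain p q where e: "e = {p, q}" "e \<in> E" "p \<in> ?K1 \<and> q \<notin> ?K1 \<or> p \<in> ?K2 \<and> q \<notin> ?K2"
      proof (cases "e \<in> bdry ?K1")
        case True
        then obtain p q where "e = {p, q}" "p \<in> ?K1" "q \<notin> ?K1" "e \<in> E" by (rule bdry_dest)
        then show thesis using that by blast
      next
        case False
        then have "e \<in> bdry ?K2" using in12 by blast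
        then obtain p q where "e = {p, q}" "p \<in> ?K2" "q \<notin> ?K2" "e \<in> E" by (rule bdry_dest)
        then show thesis using that by blast
      qed
      have "q \<notin> K" using e disj[of p q] disj[of q p] by (auto simp: insert_commute)
      moreover have meets: "p \<in> L \<or> q \<in> L" if "e \<in> bdry L" for L
        using bdry_dest[OF that] e(1) by (metis insert_iff singletonD)
      have "e \<in> bdry ?K1 --> p \<in> ?K1 \<or> q \<in> ?K1" by (rule impI) (rule meets)
      moreover have "e \<in> bdry ?K2 --> p \<in> ?K2 \<or> q \<in> ?K2" by (rule impI) (rule meets)
      ultimately show ?thesis using e bdryI[of p q K] by auto
    qed
    have K12: "K = ?K1 \<union> ?K2" "?K1 \<inter> ?K2 = {}" by auto
    have ne: "?K1 \<noteq> {}" "?K2 \<noteq> {}" using xy n by auto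
    have finb: "finite (bdry K)" using finite_bdry Kf by blast
    have sub: "bdry ?K1 \<union> bdry ?K2 \<subseteq> bdry K" "bdry ?K1 \<inter> bdry ?K2 = {}" using inter by blast+
    have "card (bdry ?K1) + card (bdry ?K2) = card (bdry ?K1 \<union> bdry ?K2)"
      using sub finb finite_subset by (intro card_Un_disjoint[symmetric]) (blast intro: finite_subset)+
    also have "... \<le> card (bdry K)" using sub finb by (intro card_mono)
    finally have cb: "real (card (bdry ?K1)) + real (card (bdry ?K2)) \<le> real (card (bdry K))" by simp
    have cK: "card K = card ?K1 + card ?K2"
      using card_Un_disjoint[of ?K1 ?K2] K12 Kf by auto
    have "real (card (bdry ?K1)) + real (card (bdry ?K2)) < \<epsilon> * real (card ?K1) + \<epsilon> * real (card ?K2)"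
      using cb cK K by (simp add: algebra_simps)
    then have "real (card (bdry ?K1)) < \<epsilon> * real (card ?K1) \<or> real (card (bdry ?K2)) < \<epsilon> * real (card ?K2)" by linarith
    then have "?P ?K1 \<or> ?P ?K2" using ne Kf by auto
    moreover have "0 < card ?K1" "0 < card ?K2" using ne Kf by (auto simp: card_gt_0_iff)
    ultimately show False using min cK by fastforce
  qed
  then show thesis using that[of K] K by blast
qed

end

lemma ex_greatest_measure:
  fixes m :: "'a => nat"
  assumes "P k" "\<forall>y. P y --> m y \<le> b"
  shows "\<exists>x. P x \<and> (\<forall>y. P y --> m y \<le> m x)"
proof -
  obtain x where "P x" "\<forall>y. P y --> b - m x \<le> b - m y"
    using ex_has_least_nat[of P k "\<lambda>x. b - m x"] assms(1) by blast
  then show ?thesis using assms(2) by (metis diff_le_mono2 diff_diff_cancel)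
qed

section \<open>Nested spanning forests\<close>

definition forest :: "'v set set => bool" where
  "forest F \<longleftrightarrow> (\<forall>u v. {u, v} \<in> F --> \<not> conn (F - {{u, v}}) u v)"

lemma forest_insert:
  assumes F: "forest F" and xy: "\<not> conn F x y"
  shows "forest (insert {x, y} F)"
  unfolding forest_def
proof (intro allI impI)
  fix u v assume uv: "{u, v} \<in> insert {x, y} F"
  have nF: "{x, y} \<notin> F" using xy conn_edge[of x y F] by auto
  show "\<not> conn (insert {x, y} F - {{u, v}}) u v"
  proof (cases "{u, v} = {x, y}")
    case True
    then have "u = x \<and> v = y \<or> u = y \<and> v = x" by (simp add: doubleton_eq_iff)
    moreover have "insert {x, y} F - {{u, v}} = F" using nF True by auto
    moreover have "\<not> conn F y x" using xy conn_sym by metis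
    ultimately show ?thesis using xy by auto
  next
    case False
    then have uvF: "{u, v} \<in> F" using uv by simp
    then have no: "\<not> conn (F - {{u, v}}) u v" using F by (simp add: forest_def)
    have eq: "insert {x, y} F - {{u, v}} = insert {x, y} (F - {{u, v}})" using False by auto
    have up: "conn F p q" if "conn (F - {{u, v}}) p q" for p q using conn_mono[OF that] by blast
    have uvc: "conn F u v" "conn F v u" using conn_edge[OF uvF] conn_sym by metis+
    show ?thesis
    proof
      assume "conn (insert {x, y} F - {{u, v}}) u v"
      then have "conn (insert {x, y} (F - {{u, v}})) u v" by (simp only: eq)
      from conn_insert[OF this] consider "conn (F - {{u, v}}) u v"
        | "conn (F - {{u, v}}) u x" "conn (F - {{u, v}}) y v"
        | "conn (F - {{u, v}}) u y" "conn (F - {{u, v}}) x v"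
        by blast
      then show False
      proof cases
        case 2
        have "conn F x u" "conn F v y" using up[OF 2(1)] up[OF 2(2)] conn_sym by metis+
        then show False using conn_trans[OF conn_trans[of F x u v] , of y] uvc xy by simp
      next
        case 3
        have "conn F x v" "conn F u y" using up[OF 3(1)] up[OF 3(2)] by simp_all
        then show False using conn_trans[OF conn_trans[of F x v u], of y] uvc xy by simp
      qed (use no in simp)
    qed
  qed
qed

lemma forest_extend:
  assumes "finite F" "A \<subseteq> F" "forest A" "\<forall>e\<in>F. \<exists>x y. e = {x, y}"
  shows "\<exists>B. A \<subseteq> B \<and> B \<subseteq> F \<and> forest B \<and> (\<forall>x y. conn F x y --> conn B x y)"
proof -
  let ?P = "\<lambda>B. A \<subseteq> B \<and> B \<subseteq> F \<and> forest B"
  have "?P A" using assms by blast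
  moreover have "\<forall>B. ?P B --> card B \<le> card F" using assms(1) by (simp add: card_mono)
  ultimately have "\<exists>B. ?P B \<and> (\<forall>B'. ?P B' --> card B' \<le> card B)" by (rule ex_greatest_measure)
  then obtain B where B: "?P B" "\<forall>B'. ?P B' --> card B' \<le> card B" by (elim exE conjE) simp
  have "conn B x y" if e: "{x, y} \<in> F" for x y
  proof (rule ccontr)
    assume n: "\<not> conn B x y"
    then have "{x, y} \<notin> B" using conn_edge by metis
    moreover have "?P (insert {x, y} B)" using B(1) forest_insert[OF _ n] e by auto
    moreover have "finite B" using B(1) assms(1) finite_subset by blast
    ultimately have "card (insert {x, y} B) = Suc (card B)" "card (insert {x, y} B) \<le> card B"
      using B(2)[rule_format, of "insert {x, y} B"] by simp_all
    then show False by simp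
  qed
  then have "conn B x y" if "conn F x y" for x y
    using that by (rule_tac conn_least[of F x y "conn B"]) (auto intro: conn_trans)
  then show ?thesis using B(1) by blast
qed

text \<open>A maximal forest of one graph extends to a maximal forest of a larger one. Hence a
  single tree can contain a spanning forest at every level of an increasing sequence of
  graphs.\<close>

lemma forest_chain:
  assumes "\<And>k. finite (F k)" "\<And>k. F k \<subseteq> F (Suc k)" "\<And>k. \<forall>e\<in>F k. \<exists>x y. e = {x, y}"
  shows "\<exists>B. \<forall>k. forest (B k) \<and> B k \<subseteq> F k \<and> (\<forall>x y. conn (F k) x y --> conn (B k) x y) \<and> B k \<subseteq> B (Suc k)"
proof -
  have "\<exists>B. \<forall>k. (forest (B k) \<and> B k \<subseteq> F k \<and> (\<forall>x y. conn (F k) x y --> conn (B k) x y)) \<and> B k \<subseteq> B (Suc k)"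
  proof (rule dependent_nat_choice)
    show "\<exists>B. forest B \<and> B \<subseteq> F 0 \<and> (\<forall>x y. conn (F 0) x y --> conn B x y)"
      using forest_extend[of "F 0" "{}"] assms by (auto simp: forest_def)
    fix B k assume B: "forest B \<and> B \<subseteq> F k \<and> (\<forall>x y. conn (F k) x y --> conn B x y)"
    then have "B \<subseteq> F (Suc k)" using assms(2) by blast
    moreover have "forest B" using B by simp
    ultimately show "\<exists>C. (forest C \<and> C \<subseteq> F (Suc k) \<and> (\<forall>x y. conn (F (Suc k)) x y --> conn C x y)) \<and> B \<subseteq> C"
      using forest_extend[OF assms(1) _ _ assms(3), of B "Suc k"] by metis
  qed
  then show ?thesis by blast
qed

section \<open>Counting in Foelner sets with Haar measure\<close>

context qt_graph
begin

lemma haarD: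
  assumes "haar \<mu> w"
  shows "space \<mu> = Aut" "\<And>y z. y \<in> V ==> {g \<in> Aut. g y = z} \<in> sets \<mu>"
    "\<And>y. y \<in> V ==> 0 < w y" "\<And>y f. y \<in> V ==> f \<in> Aut ==> w (f y) = w y"
    "\<And>y f. y \<in> V ==> f \<in> Aut ==> emeasure \<mu> {g \<in> Aut. g y = f y} = ennreal (w y)"
    "\<And>A f. A \<in> sets \<mu> ==> f \<in> Aut ==> {g \<in> Aut. compose V g f \<in> A} \<in> sets \<mu>"
    "\<And>A f. A \<in> sets \<mu> ==> f \<in> Aut ==> emeasure \<mu> {g \<in> Aut. compose V g f \<in> A} = emeasure \<mu> A"
  using assms unfolding haar_def by blast+

lemma haar_bounds:
  assumes "haar \<mu> w"
  shows "\<exists>m M. 0 < m \<and> m \<le> M \<and> (\<forall>y\<in>V. m \<le> w y \<and> w y \<le> M)"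
proof -
  have ne: "w ` Rep \<noteq> {}" "finite (w ` Rep)" using Rep_nonempty finite_Rep by auto
  have "w y \<in> w ` Rep" if y: "y \<in> V" for y
  proof -
    obtain a f where a: "a \<in> Rep" "f \<in> Aut" "y = f a" using Rep_reps[OF y] by blast
    then have "w y = w a" using haarD(4)[OF assms] Rep_V by blast
    then show ?thesis using a by simp
  qed
  then have "\<forall>y\<in>V. Min (w ` Rep) \<le> w y \<and> w y \<le> Max (w ` Rep)" using ne by simp
  moreover have "0 < Min (w ` Rep)" using ne haarD(3)[OF assms] Rep_V by (subst Min_gr_iff) auto
  moreover have "Min (w ` Rep) \<le> Max (w ` Rep)" using ne Min_in Max_ge by blast
  ultimately show ?thesis by blast
qed

lemma ex_orbit_radius: "\<exists>r. \<forall>x\<in>V. \<forall>z\<in>V. \<exists>y\<in>ball x r. same_orbit y z"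
proof -
  have "\<forall>p\<in>Rep \<times> Rep. \<exists>r. snd p \<in> ball (fst p) r" using ex_ball Rep_V by force
  from bchoice[OF this] obtain r where r: "\<forall>p\<in>Rep \<times> Rep. snd p \<in> ball (fst p) (r p)" by (elim exE)
  define r0 where "r0 = (\<Sum>p\<in>Rep \<times> Rep. r p)"
  have b: "b \<in> ball a r0" if "a \<in> Rep" "b \<in> Rep" for a b
  proof -
    have p: "(a, b) \<in> Rep \<times> Rep" using that by simp
    have "r (a, b) \<le> r0" unfolding r0_def by (rule member_le_sum[OF p]) (use finite_Rep in auto)
    then show ?thesis using r[rule_format, OF p] ball_mono by auto
  qed
  have "\<exists>y\<in>ball x r0. same_orbit y z" if xz: "x \<in> V" "z \<in> V" for x z
  proof -
    obtain a f where a: "a \<in> Rep" "f \<in> Aut" "x = f a" using Rep_reps[OF xz(1)] by blast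
    obtain c g where c: "c \<in> Rep" "g \<in> Aut" "z = g c" using Rep_reps[OF xz(2)] by blast
    have V: "a \<in> V" "c \<in> V" using a c Rep_V by auto
    have "f c \<in> ball x r0" using aut_ball[OF a(2) V(1), of r0] b[OF a(1) c(1)] a(3) by auto
    moreover have "same_orbit (f c) z"
    proof -
      have "same_orbit c (f c)" "same_orbit c z" using a c by (auto simp: same_orbit_def)
      then show ?thesis using same_orbit_trans[OF autD(4)[OF a(2) V(2)]] same_orbit_sym[OF V(2)] by blast
    qed
    ultimately show ?thesis by blast
  qed
  then show ?thesis by blast
qed

text \<open>Balls of a fixed radius meet every orbit, so the balls around the points of one orbit in
  \<open>K\<close> cover all of \<open>K\<close> except the part near its boundary.\<close>

lemma ex_orbit_share:
  "\<exists>r. \<forall>K. finite K \<and> K \<subseteq> V \<and> 2 * card (bdry K) * bnd r \<le> card K -->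
    (\<forall>z\<in>V. card K \<le> 2 * bnd r * card {y \<in> K. same_orbit y z})"
proof -
  obtain r where r: "\<forall>x\<in>V. \<forall>z\<in>V. \<exists>y\<in>ball x r. same_orbit y z" using ex_orbit_radius by blast
  have "card K \<le> 2 * bnd r * card {y \<in> K. same_orbit y z}"
    if K: "finite K" "K \<subseteq> V" "2 * card (bdry K) * bnd r \<le> card K" and z: "z \<in> V" for K z
  proof -
    let ?A = "{y \<in> K. same_orbit y z}" and ?N = "{a \<in> K. \<not> ball a r \<subseteq> K}"
    have A: "finite ?A" "?A \<subseteq> V" using K by auto
    have "K \<subseteq> ?N \<union> (\<Union>y\<in>?A. ball y r)"
    proof
      fix x assume x: "x \<in> K"
      show "x \<in> ?N \<union> (\<Union>y\<in>?A. ball y r)"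
      proof (cases "ball x r \<subseteq> K")
        case True
        obtain y where "y \<in> ball x r" "same_orbit y z" using r x K(2) z by blast
        then show ?thesis using True ball_sym[of y x r] by blast
      qed (use x in simp)
    qed
    moreover have "finite (\<Union>y\<in>?A. ball y r)" using A finite_ball by (intro finite_UN_I) auto
    ultimately have "card K \<le> card (?N \<union> (\<Union>y\<in>?A. ball y r))" using K by (intro card_mono) auto
    also have "... \<le> card ?N + card (\<Union>y\<in>?A. ball y r)" by (rule card_Un_le)
    also have "card ?N \<le> card (bdry K) * bnd r" by (rule bd.card_near_bdry[OF K(1,2)])
    also have "card (\<Union>y\<in>?A. ball y r) \<le> card ?A * bnd r" by (rule bd.card_UN_ball[OF A])
    finally show ?thesis using K(3) by (simp add: algebra_simps)
  qed
  then show ?thesis by blast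
qed

text \<open>The number of points of \<open>U\<close> covered by the translate of \<open>F\<close>
  under \<open>g\<close> is integrated over \<open>g\<close>. From below, each pair of
  \<open>y \<in> F\<close> and \<open>z \<in> U\<close> in a common orbit contributes at least
  \<open>m\<close>. From above, the integrand is at most \<open>c\<close> and vanishes unless
  \<open>g y0\<close> lies in \<open>B\<close>, which has measure at most
  \<open>M * card B\<close>.\<close>

lemma transport_count:
  assumes H: "haar \<mu> w" and m: "0 < m" "\<forall>y\<in>V. m \<le> w y \<and> w y \<le> M"
    and F: "finite F" "F \<subseteq> V" "y0 \<in> F" and U: "finite U" "U \<subseteq> V" and B: "finite B" "B \<subseteq> V"
    and c: "0 \<le> c" "\<And>g. g \<in> Aut ==> real (card (g ` F \<inter> U)) \<le> c"
    and gB: "\<And>g. g \<in> Aut ==> g ` F \<inter> U \<noteq> {} ==> g y0 \<in> B"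
  shows "m * real (\<Sum>z\<in>U. card {y \<in> F. same_orbit y z}) \<le> c * M * real (card B)"
proof -
  note hd = haarD[OF H]
  have y0: "y0 \<in> V" using F by blast
  have M0: "0 \<le> M" using m y0 by force
  let ?S = "\<lambda>y z. {g \<in> Aut. g y = z}"
  have Sm: "?S y z \<in> sets \<mu>" if "y \<in> F" for y z using hd(2) that F by blast
  have cnt: "(\<Sum>z\<in>U. \<Sum>y\<in>F. indicator (?S y z) g :: ennreal) = ennreal (real (card (g ` F \<inter> U)))" if g: "g \<in> Aut" for g
  proof -
    have "(\<Sum>y\<in>F. indicator (?S y z) g :: ennreal) = indicator (g ` F) z" for z
    proof (cases "z \<in> g ` F")
      case True
      then obtain x where x: "x \<in> F" "z = g x" by blast
      have "(\<Sum>y\<in>F. indicator (?S y z) g :: ennreal) = (\<Sum>y\<in>F. if y = x then 1 else 0)"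
        using x g aut_eq[OF g] F by (intro sum.cong) (auto simp: indicator_def subset_iff)
      also have "... = 1" using x F by simp
      finally show ?thesis using True by simp
    next
      case False
      then have "(\<Sum>y\<in>F. indicator (?S y z) g :: ennreal) = 0" by (intro sum.neutral) (auto simp: indicator_def)
      then show ?thesis using False by simp
    qed
    then have "(\<Sum>z\<in>U. \<Sum>y\<in>F. indicator (?S y z) g :: ennreal) = (\<Sum>z\<in>U. indicator (g ` F) z)" by simp
    also have "... = of_nat (card (g ` F \<inter> U))"
      using U by (simp add: indicator_def sum.If_cases Int_commute)
    finally show ?thesis by (simp add: ennreal_of_nat_eq_real_of_nat)
  qed
  have lower: "ennreal (m * real (\<Sum>z\<in>U. card {y \<in> F. same_orbit y z})) \<le>
    (\<integral>\<^sup>+g. (\<Sum>z\<in>U. \<Sum>y\<in>F. indicator (?S y z) g) \<partial>\<mu>)"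
  proof -
    have "(\<integral>\<^sup>+g. (\<Sum>z\<in>U. \<Sum>y\<in>F. indicator (?S y z) g) \<partial>\<mu>) = (\<Sum>z\<in>U. \<Sum>y\<in>F. emeasure \<mu> (?S y z))"
      using Sm by (simp add: nn_integral_sum)
    also have "... \<ge> (\<Sum>z\<in>U. \<Sum>y\<in>F. if same_orbit y z then ennreal m else 0)"
    proof (intro sum_mono)
      fix z y assume "z \<in> U" "y \<in> F"
      then have "y \<in> V" using F by blast
      show "(if same_orbit y z then ennreal m else 0) \<le> emeasure \<mu> (?S y z)"
        using hd(5)[OF \<open>y \<in> V\<close>] m \<open>y \<in> V\<close> by (auto simp: same_orbit_def ennreal_leI)
    qed
    also have "(\<Sum>z\<in>U. \<Sum>y\<in>F. if same_orbit y z then ennreal m else 0) =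
      (\<Sum>z\<in>U. of_nat (card {y \<in> F. same_orbit y z}) * ennreal m)"
      using F by (intro sum.cong) (auto simp: sum.If_cases Int_def)
    also have "... = of_nat (\<Sum>z\<in>U. card {y \<in> F. same_orbit y z}) * ennreal m"
      by (simp add: sum_distrib_right)
    also have "... = ennreal (m * real (\<Sum>z\<in>U. card {y \<in> F. same_orbit y z}))"
      using m by (simp add: ennreal_of_nat_eq_real_of_nat ennreal_mult' mult.commute)
    finally show ?thesis .
  qed
  have BM: "{g \<in> Aut. g y0 \<in> B} = (\<Union>z\<in>B. ?S y0 z)" by auto
  have upper: "(\<integral>\<^sup>+g. (\<Sum>z\<in>U. \<Sum>y\<in>F. indicator (?S y z) g) \<partial>\<mu>) \<le> ennreal (c * M * real (card B))"
  proof -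
    have "(\<integral>\<^sup>+g. (\<Sum>z\<in>U. \<Sum>y\<in>F. indicator (?S y z) g) \<partial>\<mu>) \<le> (\<integral>\<^sup>+g. ennreal c * indicator {g \<in> Aut. g y0 \<in> B} g \<partial>\<mu>)"
    proof (rule nn_integral_mono)
      fix g assume "g \<in> space \<mu>"
      then have g: "g \<in> Aut" using hd(1) by simp
      show "(\<Sum>z\<in>U. \<Sum>y\<in>F. indicator (?S y z) g) \<le> ennreal c * indicator {g \<in> Aut. g y0 \<in> B} g"
      proof (cases "g ` F \<inter> U = {}")
        case True
        then show ?thesis using cnt[OF g] by simp
      next
        case False
        then have "g y0 \<in> B" by (rule gB[OF g])
        then show ?thesis unfolding cnt[OF g] using c(2)[OF g] g by (simp add: ennreal_leI)
      qed
    qed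
    also have "... = ennreal c * emeasure \<mu> {g \<in> Aut. g y0 \<in> B}"
      using Sm[OF F(3)] B unfolding BM by (intro nn_integral_cmult_indicator sets.finite_UN) auto
    also have "emeasure \<mu> {g \<in> Aut. g y0 \<in> B} \<le> (\<Sum>z\<in>B. emeasure \<mu> (?S y0 z))"
      unfolding BM using Sm[OF F(3)] B by (intro emeasure_subadditive_finite) auto
    also have "... \<le> (\<Sum>z\<in>B. ennreal M)"
    proof (rule sum_mono)
      fix z
      show "emeasure \<mu> (?S y0 z) \<le> ennreal M"
      proof (cases "\<exists>f\<in>Aut. f y0 = z")
        case True
        then show ?thesis using hd(5)[OF y0] m y0 by (auto simp: ennreal_leI)
      next
        case False
        then have "?S y0 z = {}" by auto
        then show ?thesis by (simp only: emeasure_empty zero_le)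
      qed
    qed
    also have "... = ennreal (real (card B) * M)" using M0 by (simp add: ennreal_of_nat_eq_real_of_nat ennreal_mult')
    finally have "(\<integral>\<^sup>+g. (\<Sum>z\<in>U. \<Sum>y\<in>F. indicator (?S y z) g) \<partial>\<mu>) \<le> ennreal c * ennreal (real (card B) * M)"
      by (simp add: mult_left_mono)
    also have "... = ennreal (c * M * real (card B))" using c M0 by (simp add: ennreal_mult'[symmetric] mult_ac)
    finally show ?thesis .
  qed
  have "ennreal (m * real (\<Sum>z\<in>U. card {y \<in> F. same_orbit y z})) \<le> ennreal (c * M * real (card B))"
    using lower upper by (rule order_trans)
  moreover have "0 \<le> c * M * real (card B)" using c M0 by simp
  ultimately show ?thesis by (subst (asm) ennreal_le_iff) auto
qed

text \<open>Greedy packing with translates of \<^term>\<open>F\<close> that each cover a proportion \<^term>\<open>\<eta>\<close> of new vertices.\<close>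

lemma greedy_cover:
  assumes "finite K" "finite F" "F \<noteq> {}" "0 < \<eta>"
  shows "\<exists>Z C. Z \<subseteq> K \<and> finite C \<and> C \<subseteq> (\<lambda>g. g ` F) ` Aut \<and> Z \<subseteq> \<Union>C \<and> real (card C) * (\<eta> * real (card F)) \<le> real (card Z) \<and>
    (\<forall>g\<in>Aut. real (card (g ` F \<inter> (K - Z))) \<le> \<eta> * real (card F))"
proof -
  let ?P = "\<lambda>p. fst p \<subseteq> K \<and> finite (snd p) \<and> snd p \<subseteq> (\<lambda>g. g ` F) ` Aut \<and> fst p \<subseteq> \<Union>(snd p) \<and>
    real (card (snd p)) * (\<eta> * real (card F)) \<le> real (card (fst p))"
  have "?P ({}, {})" by simp
  moreover have "\<forall>p. ?P p --> card (fst p) \<le> card K" using assms(1) by (auto intro: card_mono)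
  ultimately have "\<exists>p. ?P p \<and> (\<forall>q. ?P q --> card (fst q) \<le> card (fst p))" by (rule ex_greatest_measure)
  then obtain p where p: "?P p" "\<forall>q. ?P q --> card (fst q) \<le> card (fst p)" by (elim exE conjE) simp
  obtain Z C where ZC: "p = (Z, C)" by (cases p)
  have P: "Z \<subseteq> K" "finite C" "C \<subseteq> (\<lambda>g. g ` F) ` Aut" "Z \<subseteq> \<Union>C" "real (card C) * (\<eta> * real (card F)) \<le> real (card Z)"
    using p(1) ZC by simp_all
  have finZ: "finite Z" using P(1) assms(1) finite_subset by blast
  have "real (card (g ` F \<inter> (K - Z))) \<le> \<eta> * real (card F)" if g: "g \<in> Aut" for g
  proof (rule ccontr)
    assume n: "\<not> ?thesis"
    let ?N = "g ` F \<inter> (K - Z)"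
    have finN: "finite ?N" using assms by auto
    have c: "card (Z \<union> ?N) = card Z + card ?N" using finZ finN by (intro card_Un_disjoint) auto
    have "card (insert (g ` F) C) \<le> Suc (card C)" using P(2) by (simp add: card_insert_if)
    then have "real (card (insert (g ` F) C)) \<le> real (card C) + 1" by simp
    then have "real (card (insert (g ` F) C)) * (\<eta> * real (card F)) \<le> (real (card C) + 1) * (\<eta> * real (card F))"
      using assms(4) by (intro mult_right_mono) auto
    also have "... \<le> real (card (Z \<union> ?N))" using P(5) n c by (simp add: algebra_simps)
    finally have "?P (Z \<union> ?N, insert (g ` F) C)" using P g by auto
    then have "card (Z \<union> ?N) \<le> card Z" using p(2)[rule_format, of "(Z \<union> ?N, insert (g ` F) C)"] ZC by simp
    then have "card ?N = 0" using c by simp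
    then show False using n assms by simp
  qed
  then have "\<forall>g\<in>Aut. real (card (g ` F \<inter> (K - Z))) \<le> \<eta> * real (card F)" by (rule ballI)
  with P show ?thesis by (intro exI[of _ Z] exI[of _ C] conjI)
qed

lemma card_boundary_ends:
  assumes "finite K" "K \<subseteq> V" shows "card {p \<in> K. \<exists>e\<in>bdry K. p \<in> e} \<le> card (bdry K)"
proof -
  have "{p \<in> K. \<exists>e\<in>bdry K. p \<in> e} \<subseteq> (\<lambda>e. SOME p. p \<in> e \<inter> K) ` bdry K"
  proof
    fix p assume "p \<in> {p \<in> K. \<exists>e\<in>bdry K. p \<in> e}"
    then obtain e where e: "e \<in> bdry K" "p \<in> e \<inter> K" by blast
    then have "card (e \<inter> K) = 1" by (simp add: bdry_def)
    then obtain x where "e \<inter> K = {x}" by (rule card_1_singletonE)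
    then have "p = (SOME p. p \<in> e \<inter> K)" using e(2) by simp
    then show "p \<in> (\<lambda>e. SOME p. p \<in> e \<inter> K) ` bdry K" using e(1) by blast
  qed
  then have "card {p \<in> K. \<exists>e\<in>bdry K. p \<in> e} \<le> card ((\<lambda>e. SOME p. p \<in> e \<inter> K) ` bdry K)"
    using finite_bdry[OF assms] by (intro card_mono) auto
  also have "... \<le> card (bdry K)" using finite_bdry[OF assms] by (rule card_image_le)
  finally show ?thesis .
qed

text \<open>A quasi-tiling by translates of one Foelner set \<open>F\<close>. Cutting the boundaries
  of the chosen translates is cheap, because each is charged to \<open>\<eta> * card F\<close>
  points of its own. No translate meets the uncovered rest in more points than that, so
  \<open>transport_count\<close> makes the rest small, and all edges at it are cut as well. A
  remaining piece lies inside one translate or is a single point.\<close>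

lemma cut_into_pieces:
  assumes H: "haar \<mu> w"
    and folner: "\<And>\<epsilon>. 0 < \<epsilon> ==> \<exists>F. finite F \<and> F \<noteq> {} \<and> F \<subseteq> V \<and> real (card (bdry F)) \<le> \<epsilon> * real (card F)"
    and \<epsilon>: "0 < \<epsilon>"
  shows "\<exists>s \<epsilon>'. 0 < \<epsilon>' \<and> (\<forall>K. finite K \<and> K \<subseteq> V \<and> real (card (bdry K)) \<le> \<epsilon>' * real (card K) -->
    (\<exists>Z\<subseteq>E. finite Z \<and> real (card Z) \<le> \<epsilon> * real (card K) \<and>
      (\<forall>x\<in>K. finite {y. conn (inside K - Z) x y} \<and> card {y. conn (inside K - Z) x y} \<le> s)))"
proof -
  obtain m M where mM: "0 < m" "m \<le> M" "\<forall>y\<in>V. m \<le> w y \<and> w y \<le> M" using haar_bounds[OF H] by blast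
  obtain r0 where r0: "\<forall>K. finite K \<and> K \<subseteq> V \<and> 2 * card (bdry K) * bnd r0 \<le> card K -->
    (\<forall>z\<in>V. card K \<le> 2 * bnd r0 * card {y \<in> K. same_orbit y z})"
    using ex_orbit_share by blast
  define b where "b = real (bnd r0) + 1"
  define D where "D = real deg + 1"
  have b0: "0 < b" and D0: "0 < D" by (simp_all add: b_def D_def)
  have M0: "0 < M" using mM by simp
  \<comment> \<open>Chosen so that the edges at uncovered points use up half of
    \<open>\<epsilon>\<close>; the other half is for the boundaries of the translates.\<close>
  define \<eta> where "\<eta> = \<epsilon> * m / (8 * D * b * M)"
  have \<eta>: "0 < \<eta>" using \<epsilon> mM b0 D0 M0 by (simp add: \<eta>_def)
  obtain F where F: "finite F" "F \<noteq> {}" "F \<subseteq> V" "real (card (bdry F)) \<le> min (1 / (2 * b)) (\<eta> * \<epsilon> / 2) * real (card F)"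
    using folner[of "min (1 / (2 * b)) (\<eta> * \<epsilon> / 2)"] \<eta> \<epsilon> b0 by auto
  have F1: "real (card (bdry F)) \<le> 1 / (2 * b) * real (card F)"
    using F(4) by (rule order_trans) (intro mult_right_mono, auto)
  have F2: "real (card (bdry F)) \<le> \<eta> * \<epsilon> / 2 * real (card F)"
    using F(4) by (rule order_trans) (intro mult_right_mono, auto)
  have share: "real (card F) \<le> 2 * b * real (card {y \<in> F. same_orbit y z})" if "z \<in> V" for z
  proof -
    have "2 * real (card (bdry F)) * real (bnd r0) \<le> 2 * real (card (bdry F)) * b"
      by (intro mult_left_mono) (auto simp: b_def)
    also have "... \<le> real (card F)" using F1 b0 by (simp add: field_simps)
    finally have "real (2 * card (bdry F) * bnd r0) \<le> real (card F)" by simp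
    then have "2 * card (bdry F) * bnd r0 \<le> card F" by (simp only: of_nat_le_iff)
    then have "card F \<le> 2 * bnd r0 * card {y \<in> F. same_orbit y z}"
      using r0[rule_format, OF _ that, of F] F by simp
    then have "real (card F) \<le> real (2 * bnd r0 * card {y \<in> F. same_orbit y z})" by (rule of_nat_mono)
    also have "... = 2 * real (bnd r0) * real (card {y \<in> F. same_orbit y z})" by simp
    also have "... \<le> 2 * b * real (card {y \<in> F. same_orbit y z})"
      unfolding b_def by (intro mult_right_mono) simp_all
    finally show ?thesis .
  qed
  obtain y0 where y0: "y0 \<in> F" using F by blast
  have y0V: "y0 \<in> V" using y0 F by blast
  have "\<forall>y\<in>F. \<exists>r. y \<in> ball y0 r" using ex_ball[OF y0V] F by blast
  from bchoice[OF this] obtain rr where rr: "\<forall>y\<in>F. y \<in> ball y0 (rr y)" by (elim exE)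
  define r where "r = (\<Sum>y\<in>F. rr y)"
  have Fr: "F \<subseteq> ball y0 r"
  proof
    fix y assume y: "y \<in> F"
    have "rr y \<le> r" unfolding r_def by (rule member_le_sum[OF y]) (use F in auto)
    then show "y \<in> ball y0 r" using bspec[OF rr y] ball_mono[of "rr y" r y0] by blast
  qed
  define \<epsilon>' where "\<epsilon>' = 1 / (real (bnd (r + r)) + 1)"
  have main: "\<exists>Z\<subseteq>E. finite Z \<and> real (card Z) \<le> \<epsilon> * real (card K) \<and>
      (\<forall>x\<in>K. finite {y. conn (inside K - Z) x y} \<and> card {y. conn (inside K - Z) x y} \<le> card F)"
    if K: "finite K" "K \<subseteq> V" "real (card (bdry K)) \<le> \<epsilon>' * real (card K)" for K
  proof -
    obtain W C where W: "W \<subseteq> K" "finite C" "C \<subseteq> (\<lambda>g. g ` F) ` Aut" "W \<subseteq> \<Union>C"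
      "real (card C) * (\<eta> * real (card F)) \<le> real (card W)"
      and gr: "\<forall>g\<in>Aut. real (card (g ` F \<inter> (K - W))) \<le> \<eta> * real (card F)"
      using greedy_cover[OF K(1) F(1,2) \<eta>] by (elim exE conjE)
    let ?U = "K - W"
    have U: "finite ?U" "?U \<subseteq> V" using K by auto
    let ?pb = "{p \<in> K. \<exists>e\<in>bdry K. p \<in> e}"
    \<comment> \<open>All possible positions of \<open>g y0\<close> when the translate of
      \<open>F\<close> meets the rest: inside \<open>K\<close>, or within \<open>r + r\<close> of
      the inner end of a boundary edge. By the choice of \<open>\<epsilon>'\<close> this is at most
      twice as large as \<open>K\<close>.\<close>
    let ?B = "K \<union> (\<Union>p\<in>?pb. ball p (r + r))"
    have pb: "finite ?pb" "?pb \<subseteq> V" using K by auto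
    have B: "finite ?B" "?B \<subseteq> V" using K pb finite_ball ball_V by (auto, blast)
    have "card ?B \<le> card K + card (\<Union>p\<in>?pb. ball p (r + r))" by (rule card_Un_le)
    also have "card (\<Union>p\<in>?pb. ball p (r + r)) \<le> card ?pb * bnd (r + r)" by (rule bd.card_UN_ball[OF pb])
    also have "... \<le> card (bdry K) * bnd (r + r)" using card_boundary_ends[OF K(1,2)] by simp
    finally have "real (card ?B) \<le> real (card K) + real (card (bdry K)) * real (bnd (r + r))"
      by (simp flip: of_nat_mult of_nat_add)
    also have "real (card (bdry K)) * real (bnd (r + r)) \<le> \<epsilon>' * real (card K) * real (bnd (r + r))"
      using K(3) by (rule mult_right_mono) simp
    also have "... \<le> real (card K)" 
    proof -
      have "\<epsilon>' * real (bnd (r + r)) \<le> 1" by (simp add: \<epsilon>'_def field_simps)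
      then have "(\<epsilon>' * real (bnd (r + r))) * real (card K) \<le> 1 * real (card K)" by (intro mult_right_mono) auto
      then show ?thesis by (simp add: mult_ac)
    qed
    finally have cB: "real (card ?B) \<le> 2 * real (card K)" by simp
    have gB: "g y0 \<in> ?B" if g: "g \<in> Aut" "g ` F \<inter> ?U \<noteq> {}" for g
    proof -
      obtain z where z: "z \<in> g ` F" "z \<in> ?U" using g by blast
      then have "z \<in> ball (g y0) r" using Fr aut_ball[OF g(1) y0V, of r] by blast
      then have y: "g y0 \<in> ball z r" by (rule ball_sym)
      show ?thesis
      proof (cases "g y0 \<in> K")
        case False
        obtain e p where e: "e \<in> bdry K" "p \<in> e \<inter> K" "z \<in> ball p r" using ball_bdry[OF y _ False] z by blast
        then have "g y0 \<in> ball p (r + r)" using ball_trans[OF e(3) y] by simp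
        then show ?thesis using e by blast
      qed simp
    qed
    have tc: "m * real (\<Sum>z\<in>?U. card {y \<in> F. same_orbit y z}) \<le> (\<eta> * real (card F)) * M * real (card ?B)"
    proof (rule transport_count[OF H mM(1,3) F(1,3) y0 U B])
      show "0 \<le> \<eta> * real (card F)" using \<eta> by simp
      show "real (card (g ` F \<inter> ?U)) \<le> \<eta> * real (card F)" if "g \<in> Aut" for g using gr that by blast
      show "g y0 \<in> ?B" if "g \<in> Aut" "g ` F \<inter> ?U \<noteq> {}" for g by (rule gB[OF that])
    qed
    have "real (card ?U) * real (card F) = (\<Sum>z\<in>?U. real (card F))" by simp
    also have "... \<le> (\<Sum>z\<in>?U. 2 * b * real (card {y \<in> F. same_orbit y z}))" using share U by (intro sum_mono) blast
    also have "... = 2 * b * real (\<Sum>z\<in>?U. card {y \<in> F. same_orbit y z})" by (simp add: sum_distrib_left)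
    finally have "m * (real (card ?U) * real (card F)) \<le> 2 * b * (m * real (\<Sum>z\<in>?U. card {y \<in> F. same_orbit y z}))"
      using mM(1) by (simp add: mult_left_mono)
    also have "... \<le> 2 * b * ((\<eta> * real (card F)) * M * real (card ?B))" using tc b0 by (intro mult_left_mono) auto
    also have "... \<le> 2 * b * ((\<eta> * real (card F)) * M * (2 * real (card K)))"
      using cB b0 \<eta> M0 by (intro mult_left_mono) auto
    finally have "(m * real (card ?U)) * real (card F) \<le> (4 * b * \<eta> * M * real (card K)) * real (card F)"
      by (simp add: mult_ac)
    then have "m * real (card ?U) \<le> 4 * b * \<eta> * M * real (card K)"
      using F(1,2) by (simp add: card_gt_0_iff)
    also have "... = \<epsilon> * m / (2 * D) * real (card K)" using b0 D0 M0 by (simp add: \<eta>_def field_simps)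
    finally have "m * (D * real (card ?U)) \<le> m * (\<epsilon> / 2 * real (card K))" using D0 by (simp add: field_simps)
    then have cU: "D * real (card ?U) \<le> \<epsilon> / 2 * real (card K)" using mM(1) by simp
    let ?Z = "\<Union>(bdry ` C) \<union> {e \<in> E. e \<inter> ?U \<noteq> {}}"
    have CV: "finite A \<and> A \<subseteq> V \<and> card (bdry A) = card (bdry F) \<and> card A \<le> card F" if AC: "A \<in> C" for A
    proof -
      obtain g where g: "g \<in> Aut" "A = g ` F" using AC W(3) by blast
      then show ?thesis using F autD(4)[OF g(1)] card_aut_bdry[OF g(1) F(3)] card_image_le[OF F(1), of g] by auto
    qed
    have "card ?Z \<le> card (\<Union>(bdry ` C)) + card {e \<in> E. e \<inter> ?U \<noteq> {}}" by (rule card_Un_le)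
    also have "card (\<Union>(bdry ` C)) \<le> (\<Sum>A\<in>C. card (bdry A))" by (rule card_UN_le[OF W(2)])
    also have "... = card C * card (bdry F)" using CV by simp
    also have "card {e \<in> E. e \<inter> ?U \<noteq> {}} \<le> deg * card ?U" by (rule bd.card_incident[OF U])
    finally have "real (card ?Z) \<le> real (card C) * real (card (bdry F)) + real deg * real (card ?U)"
      by (simp flip: of_nat_mult of_nat_add)
    also have "real (card C) * real (card (bdry F)) \<le> real (card C) * (\<eta> * \<epsilon> / 2 * real (card F))"
      using F2 by (rule mult_left_mono) simp
    also have "... = \<epsilon> / 2 * (real (card C) * (\<eta> * real (card F)))" by simp
    also have "... \<le> \<epsilon> / 2 * real (card K)"
    proof (rule mult_left_mono)
      have "real (card W) \<le> real (card K)" using W(1) K(1) by (simp add: card_mono)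
      then show "real (card C) * (\<eta> * real (card F)) \<le> real (card K)" using W(5) by simp
    qed (use \<epsilon> in simp)
    also have "real deg * real (card ?U) \<le> D * real (card ?U)" by (intro mult_right_mono) (auto simp: D_def)
    also have "\<epsilon> / 2 * real (card K) + D * real (card ?U) \<le> \<epsilon> * real (card K)" using cU by simp
    finally have 1: "real (card ?Z) \<le> \<epsilon> * real (card K)" by simp
    have 2: "finite {y. conn (inside K - ?Z) x y} \<and> card {y. conn (inside K - ?Z) x y} \<le> card F" if x: "x \<in> K" for x
    proof (cases "x \<in> W")
      case True
      then obtain A where A: "A \<in> C" "x \<in> A" using W(4) by blast
      have "y \<in> A" if "conn (inside K - ?Z) x y" for y
        using that
      proof (induction rule: conn_induct)
        case (step y z)
        show ?case
        proof (rule ccontr)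
          assume "z \<notin> A"
          then have "{y, z} \<in> bdry A" using step by (intro bdryI) (auto simp: inside_def)
          then show False using step.hyps(2) A(1) by blast
        qed
      qed (use A in simp)
      then have sub: "{y. conn (inside K - ?Z) x y} \<subseteq> A" by blast
      have "finite A" "card A \<le> card F" using CV[OF A(1)] by auto
      then show ?thesis using sub by (meson card_mono finite_subset le_trans)
    next
      case False
      have "y = x" if "conn (inside K - ?Z) x y" for y
        using that
      proof (induction rule: conn_induct)
        case (step y z)
        then have "{y, z} \<in> ?Z" using False x by (auto simp: inside_def)
        then show ?case using step.hyps(2) by blast
      qed simp
      then have sub: "{y. conn (inside K - ?Z) x y} \<subseteq> {x}" by blast
      have "1 \<le> card F" using F by (simp add: Suc_leI card_gt_0_iff)
      moreover have "card {y. conn (inside K - ?Z) x y} \<le> card {x}" by (rule card_mono[OF _ sub]) simp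
      moreover have "finite {y. conn (inside K - ?Z) x y}" by (rule finite_subset[OF sub]) simp
      ultimately show ?thesis by simp
    qed
    have "?Z \<subseteq> E" by (auto simp: bdry_def)
    moreover have "finite ?Z" using W(2) CV finite_bdry finite_incident[OF U] by auto
    ultimately show ?thesis using 1 2 by blast
  qed
  have \<epsilon>': "0 < \<epsilon>'" by (simp add: \<epsilon>'_def)
  show ?thesis
    by (rule exI[of _ "card F"], rule exI[of _ \<epsilon>'], intro conjI allI impI, rule \<epsilon>', elim conjE, rule main)
qed

section \<open>Spanning trees with uniformly tight stretch\<close>

text \<open>At level \<open>k\<close> a set \<open>Z n k\<close> of density at most
  \<open>1 / 2 ^ Suc k\<close> is removed, leaving pieces of at most \<open>s k\<close> vertices.
  The graphs \<open>F n k\<close> lacking all \<open>Z n j\<close> with \<open>j \<ge> k\<close>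
  increase with \<open>k\<close>, and the tree is grown through spanning forests of them. An edge
  present in \<open>F n k\<close> has its tree path inside one piece, so only edges of the removed
  sets, of total density at most \<open>1 / 2 ^ k\<close>, can be far.\<close>

lemma bounded_stretch_trees:
  assumes H: "haar \<mu> w"
    and K: "\<And>n. finite (K n)" "\<And>n. K n \<subseteq> V" "\<And>n. \<forall>x\<in>K n. \<forall>y\<in>K n. conn (inside (K n)) x y" "\<And>n. K n \<noteq> {}"
    and folner: "\<And>\<epsilon>. 0 < \<epsilon> ==> \<exists>n0. \<forall>n\<ge>n0. real (card (bdry (K n))) \<le> \<epsilon> * real (card (K n))"
  shows "\<exists>T H. bd.valid K T H"
proof -
  have fol: "\<exists>F. finite F \<and> F \<noteq> {} \<and> F \<subseteq> V \<and> real (card (bdry F)) \<le> \<epsilon> * real (card F)" if pos: "0 < \<epsilon>" for \<epsilon>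
  proof -
    obtain n0 where "\<forall>n\<ge>n0. real (card (bdry (K n))) \<le> \<epsilon> * real (card (K n))" using folner[OF pos] by (elim exE)
    then show ?thesis using K by (intro exI[of _ "K n0"]) simp
  qed
  let ?Q = "\<lambda>\<epsilon> \<epsilon>' s. 0 < \<epsilon>' \<and> (\<forall>K. finite K \<and> K \<subseteq> V \<and> real (card (bdry K)) \<le> \<epsilon>' * real (card K) -->
    (\<exists>Z\<subseteq>E. finite Z \<and> real (card Z) \<le> \<epsilon> * real (card K) \<and>
      (\<forall>x\<in>K. finite {y. conn (inside K - Z) x y} \<and> card {y. conn (inside K - Z) x y} \<le> s)))"
  have "\<forall>k. \<exists>p. ?Q (1 / 2 ^ Suc k) (snd p) (fst p)"
  proof
    fix k :: nat
    have "\<exists>s \<epsilon>'. ?Q (1 / 2 ^ Suc k) \<epsilon>' s" by (rule cut_into_pieces[OF H]) (rule fol, assumption, simp)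
    then obtain s \<epsilon>' where "?Q (1 / 2 ^ Suc k) \<epsilon>' s" by (elim exE)
    then show "\<exists>p. ?Q (1 / 2 ^ Suc k) (snd p) (fst p)" by (intro exI[of _ "(s, \<epsilon>')"]) simp
  qed
  from choice[OF this] obtain p where p: "\<forall>k. ?Q (1 / 2 ^ Suc k) (snd (p k)) (fst (p k))" by (elim exE)
  define s where "s k = fst (p k)" for k
  have "\<forall>k. \<exists>n0. \<forall>n\<ge>n0. real (card (bdry (K n))) \<le> snd (p k) * real (card (K n))" using folner p by blast
  from choice[OF this] obtain n0 where n0: "\<forall>k. \<forall>n\<ge>n0 k. real (card (bdry (K n))) \<le> snd (p k) * real (card (K n))" by (elim exE)
  \<comment> \<open>The summand \<open>k\<close> leaves \<open>Z n j\<close> empty for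
    \<open>j > n\<close>, so that the level \<open>Suc n\<close> already contains all edges inside
    \<open>K n\<close>.\<close>
  define N where "N k = n0 k + k" for k
  have "\<exists>Z\<subseteq>E. finite Z \<and> real (card Z) \<le> 1 / 2 ^ Suc k * real (card (K n)) \<and>
      (\<forall>x\<in>K n. finite {y. conn (inside (K n) - Z) x y} \<and> card {y. conn (inside (K n) - Z) x y} \<le> s k)"
    if "N k \<le> n" for n k
  proof -
    have "finite (K n) \<and> K n \<subseteq> V \<and> real (card (bdry (K n))) \<le> snd (p k) * real (card (K n))"
      using K n0 that by (auto simp: N_def)
    then show ?thesis using p[rule_format, of k, THEN conjunct2, rule_format, of "K n"] unfolding s_def by blast
  qed
  then have "\<forall>q. N (snd q) \<le> fst q --> (\<exists>Z\<subseteq>E. finite Z \<and> real (card Z) \<le> 1 / 2 ^ Suc (snd q) * real (card (K (fst q))) \<and>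
      (\<forall>x\<in>K (fst q). finite {y. conn (inside (K (fst q)) - Z) x y} \<and> card {y. conn (inside (K (fst q)) - Z) x y} \<le> s (snd q)))"
    by blast
  then have "\<forall>q. \<exists>Z. N (snd q) \<le> fst q --> (Z \<subseteq> E \<and> finite Z \<and> real (card Z) \<le> 1 / 2 ^ Suc (snd q) * real (card (K (fst q))) \<and>
      (\<forall>x\<in>K (fst q). finite {y. conn (inside (K (fst q)) - Z) x y} \<and> card {y. conn (inside (K (fst q)) - Z) x y} \<le> s (snd q)))"
    by blast
  from choice[OF this] obtain z where z: "\<forall>q. N (snd q) \<le> fst q --> (z q \<subseteq> E \<and> finite (z q) \<and> real (card (z q)) \<le> 1 / 2 ^ Suc (snd q) * real (card (K (fst q))) \<and>
      (\<forall>x\<in>K (fst q). finite {y. conn (inside (K (fst q)) - z q) x y} \<and> card {y. conn (inside (K (fst q)) - z q) x y} \<le> s (snd q)))"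
    by (elim exE)
  define Z where "Z n k = (if N k \<le> n then z (n, k) \<inter> inside (K n) else {})" for n k
  define F where "F n k = inside (K n) - (\<Union>j\<in>{k..}. Z n j)" for n k
  have fin_in: "finite (inside (K n))" for n
    by (rule finite_subset[of _ "Pow (K n)"]) (auto simp: inside_def K)
  have edge2: "\<forall>e\<in>F n k. \<exists>x y. e = {x, y}" for n k
  proof
    fix e assume "e \<in> F n k"
    then have "e \<in> E" by (simp add: F_def inside_def)
    then show "\<exists>x y. e = {x, y}" using edgeE[of e] by metis
  qed
  have "\<exists>B. \<forall>k. forest (B k) \<and> B k \<subseteq> F n k \<and> (\<forall>x y. conn (F n k) x y --> conn (B k) x y) \<and> B k \<subseteq> B (Suc k)" for n
  proof (rule forest_chain[OF _ _ edge2])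
    show "finite (F n k)" for k using fin_in by (simp add: F_def)
    show "F n k \<subseteq> F n (Suc k)" for k unfolding F_def by force
  qed
  then have "\<forall>n. \<exists>B. \<forall>k. forest (B k) \<and> B k \<subseteq> F n k \<and> (\<forall>x y. conn (F n k) x y --> conn (B k) x y) \<and> B k \<subseteq> B (Suc k)" by blast
  from choice[OF this] obtain B where B: "\<forall>n k. forest (B n k) \<and> B n k \<subseteq> F n k \<and> (\<forall>x y. conn (F n k) x y --> conn (B n k) x y) \<and> B n k \<subseteq> B n (Suc k)"
    by (elim exE)
  have Bm: "B n k \<subseteq> B n l" if "k \<le> l" for n k l using lift_Suc_mono_le[of "B n" k l] B that by blast
  define T where "T n = B n (Suc n)" for n
  have Ftop: "F n (Suc n) = inside (K n)" for n by (auto simp: F_def Z_def N_def)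
  have TE: "T n \<subseteq> inside (K n)" for n using B Ftop unfolding T_def by blast
  have TE': "T n \<subseteq> E" for n using TE[of n] by (simp add: inside_def subset_iff)
  have tr: "tree (K n) (T n)" for n
  proof
    show "\<exists>u v. u \<in> K n \<and> v \<in> K n \<and> u \<noteq> v \<and> e = {u, v}" if "e \<in> T n" for e
    proof -
      have "e \<in> E" "e \<subseteq> K n" using TE that by (auto simp: inside_def)
      then show ?thesis using edgeE[of e] by auto
    qed
    show "conn (T n) x y" if "x \<in> K n" "y \<in> K n" for x y
      using K(3) that B[rule_format, of n "Suc n"] Ftop unfolding T_def by metis
    show "\<not> conn (T n - {{u, v}}) u v" if "{u, v} \<in> T n" for u v
      using B[rule_format, of n "Suc n"] that unfolding T_def forest_def by blast
  qed
  \<comment> \<open>The sum takes care of the finitely many \<open>n\<close> below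
    \<open>N k\<close>, where the number of all tree edges serves as the bound.\<close>
  define H' where "H' k = deg * s k + (\<Sum>n<N k. deg * card (K n))" for k
  have far: "real (card (bd.far (K n) (T n) (H' k))) \<le> real (card (K n)) / 2 ^ k" for n k
  proof -
    interpret G: graph_tree V E deg bnd "K n" "T n"
      by (rule bd.graph_treeI[OF K(1,2) tr TE'])
    show ?thesis
    proof (cases "N k \<le> n")
      case False
      have "card (G.P x y) \<le> H' k" for x y
      proof -
        have "card (G.P x y) \<le> card (T n)" using G.finite_T G.P_subset by (intro card_mono)
        also have "... \<le> deg * card (K n)" by (rule G.card_T)
        also have "... \<le> (\<Sum>n<N k. deg * card (K n))" using False by (intro member_le_sum) auto
        finally show ?thesis by (simp add: H'_def)
      qed
      then have "bd.far (K n) (T n) (H' k) = {}" by (auto simp: bd.far_def not_less)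
      then show ?thesis by simp
    next
      case True
      have "bd.far (K n) (T n) (H' k) \<subseteq> (\<Union>j\<in>{k..n}. Z n j)"
      proof
        fix e assume "e \<in> bd.far (K n) (T n) (H' k)"
        then obtain x y where e: "e \<in> E" "e \<subseteq> K n" "e = {x, y}" "H' k < card (G.P x y)" by (auto simp: bd.far_def)
        show "e \<in> (\<Union>j\<in>{k..n}. Z n j)"
        proof (rule ccontr)
          assume no: "e \<notin> (\<Union>j\<in>{k..n}. Z n j)"
          have "Z n j = {}" if "n < j" for j using that by (auto simp: Z_def N_def)
          then have "e \<notin> (\<Union>j\<in>{k..}. Z n j)" using no by (metis (no_types, lifting) UN_iff atLeastAtMost_iff atLeast_iff empty_iff not_le)
          then have eF: "{x, y} \<in> F n k" using e by (auto simp: F_def inside_def)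
          let ?C = "{v. conn (F n k) x v}"
          let ?A = "{h \<in> B n k. h \<inter> ?C \<noteq> {}}"
          have BF: "B n k \<subseteq> F n k" using B by blast
          have "conn (B n k) x y" using B conn_edge[OF eF] by blast
          then have "conn ?A x y \<and> conn (F n k) x y"
          proof (induction rule: conn_induct)
            case (step v u)
            then have h: "{v, u} \<in> ?A" by auto
            have "conn ?A x u" using conn_trans[OF conjunct1[OF step.IH] conn_edge[OF h]] .
            moreover have "{v, u} \<in> F n k" using step.hyps BF by blast
            then have "conn (F n k) x u" by (rule conn_trans[OF conjunct2[OF step.IH] conn_edge])
            ultimately show ?case by (rule conjI)
          qed simp
          moreover have "?A \<subseteq> T n" using Bm[of k "Suc n" n] True unfolding T_def by (auto simp: N_def)
          ultimately have "G.P x y \<subseteq> ?A" using G.P_mono_conn by blast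
          have "k \<in> {k..}" by simp
          then have "F n k \<subseteq> inside (K n) - Z n k" unfolding F_def by blast
          also have "... \<subseteq> inside (K n) - z (n, k)" using True by (auto simp: Z_def)
          finally have Fsub: "F n k \<subseteq> inside (K n) - z (n, k)" .
          have "?C \<subseteq> {v. conn (inside (K n) - z (n, k)) x v}"
          proof
            fix v assume "v \<in> ?C"
            then have "conn (F n k) x v" by simp
            then have "conn (inside (K n) - z (n, k)) x v" using Fsub by (rule conn_mono)
            then show "v \<in> {v. conn (inside (K n) - z (n, k)) x v}" by simp
          qed
          moreover have "finite {v. conn (inside (K n) - z (n, k)) x v}" "card {v. conn (inside (K n) - z (n, k)) x v} \<le> s k"
            using z[rule_format, of "(n, k)"] True e by auto
          ultimately have "finite ?C \<and> card ?C \<le> s k" by (meson card_mono finite_subset le_trans)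
          then have C: "finite ?C" "card ?C \<le> s k" by simp_all
          have CV: "?C \<subseteq> V"
          proof
            fix v assume "v \<in> ?C"
            then have "conn (F n k) x v" by simp
            then show "v \<in> V"
              by (induction rule: conn_induct) (use e K(2) edges_Pow in \<open>auto simp: F_def inside_def\<close>)
          qed
          have "?A \<subseteq> {h \<in> E. h \<inter> ?C \<noteq> {}}" using BF by (auto simp: F_def inside_def)
          then have "G.P x y \<subseteq> {h \<in> E. h \<inter> ?C \<noteq> {}}" using \<open>G.P x y \<subseteq> ?A\<close> by blast
          then have "card (G.P x y) \<le> card {h \<in> E. h \<inter> ?C \<noteq> {}}" by (rule card_mono[OF finite_incident[OF C(1) CV]])
          also have "... \<le> deg * card ?C" by (rule bd.card_incident[OF C(1) CV])
          also have "... \<le> deg * s k" using C(2) by simp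
          finally show False using e(4) by (simp add: H'_def)
        qed
      qed
      moreover have "finite (Z n j)" for j using fin_in by (simp add: Z_def)
      ultimately have "card (bd.far (K n) (T n) (H' k)) \<le> card (\<Union>j\<in>{k..n}. Z n j)" by (intro card_mono) auto
      also have "... \<le> (\<Sum>j\<in>{k..n}. card (Z n j))" by (rule card_UN_le) simp
      finally have "real (card (bd.far (K n) (T n) (H' k))) \<le> (\<Sum>j\<in>{k..n}. real (card (Z n j)))"
        by (simp flip: of_nat_sum)
      also have "... \<le> (\<Sum>j\<in>{k..n}. 1 / 2 ^ Suc j * real (card (K n)))"
      proof (rule sum_mono)
        fix j
        show "real (card (Z n j)) \<le> 1 / 2 ^ Suc j * real (card (K n))"
        proof (cases "N j \<le> n")
          case True
          have "card (Z n j) \<le> card (z (n, j)) \<or> infinite (z (n, j))" using True by (auto simp: Z_def card_mono)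
          moreover have "finite (z (n, j))" using z[rule_format, of "(n, j)"] True by simp
          ultimately have "real (card (Z n j)) \<le> real (card (z (n, j)))" by simp
          then show ?thesis using z[rule_format, of "(n, j)"] True by simp
        qed (simp add: Z_def)
      qed
      also have "... = (\<Sum>j\<in>{k..n}. 1 / 2 ^ Suc j) * real (card (K n))" by (simp add: sum_distrib_right)
      also have "... \<le> 1 / 2 ^ k * real (card (K n))"
      proof (rule mult_right_mono)
        have "k \<le> n" using True by (simp add: N_def)
        then have "(\<Sum>j\<in>{k..n}. 1 / 2 ^ Suc j :: real) = 1 / 2 ^ k - 1 / 2 ^ Suc n"
        proof (induction n rule: dec_induct)
          case (step n)
          have "(\<Sum>j\<in>{k..Suc n}. 1 / 2 ^ Suc j :: real) = (\<Sum>j\<in>{k..n}. 1 / 2 ^ Suc j) + 1 / 2 ^ Suc (Suc n)"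
            using step.hyps by simp
          also have "... = 1 / 2 ^ k - 1 / 2 ^ Suc n + 1 / 2 ^ Suc (Suc n)" by (simp only: step.IH)
          also have "... = 1 / 2 ^ k - 1 / 2 ^ Suc (Suc n)" by simp
          finally show ?case .
        qed (simp add: field_simps)
        also have "... \<le> 1 / 2 ^ k" by simp
        finally show "(\<Sum>j\<in>{k..n}. 1 / 2 ^ Suc j :: real) \<le> 1 / 2 ^ k" .
      qed simp
      finally show ?thesis by simp
    qed
  qed
  have "bd.valid K T H'"
    unfolding bd.valid_def using tr far TE' by blast
  then show ?thesis by blast
qed

end

section \<open>Limits of random subgraphs\<close>

lemma trace_eq_iff: "A \<subseteq> J ==> B \<inter> J = A \<longleftrightarrow> (\<forall>e\<in>J. e \<in> B \<longleftrightarrow> e \<in> A)"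
  by auto

lemma sets_trace:
  assumes J: "finite J" and m: "\<And>e. e \<in> J ==> {\<omega> \<in> space M. e \<in> X \<omega>} \<in> sets M"
  shows "{\<omega> \<in> space M. Q (X \<omega> \<inter> J)} \<in> sets M"
proof -
  have 1: "{\<omega> \<in> space M. X \<omega> \<inter> J = A} \<in> sets M" if "A \<subseteq> J" for A
  proof -
    have "{\<omega> \<in> space M. \<forall>e\<in>J. e \<in> X \<omega> \<longleftrightarrow> e \<in> A} \<in> sets M"
    proof (rule sets.sets_Collect_finite_All[OF _ J])
      fix e assume e: "e \<in> J"
      show "{\<omega> \<in> space M. (e \<in> X \<omega>) = (e \<in> A)} \<in> sets M"
        using m[OF e] sets.sets_Collect_neg[OF m[OF e]] by (cases "e \<in> A") auto
    qed
    then show ?thesis by (simp add: trace_eq_iff[OF that])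
  qed
  have "{\<omega> \<in> space M. Q (X \<omega> \<inter> J)} = (\<Union>A\<in>{A \<in> Pow J. Q A}. {\<omega> \<in> space M. X \<omega> \<inter> J = A})" by auto
  also have "... \<in> sets M" using 1 J by (intro sets.finite_UN) auto
  finally show ?thesis .
qed

lemma (in prob_space) prob_trace:
  assumes J: "finite J" and m: "\<And>e. e \<in> J ==> {\<omega> \<in> space M. e \<in> X \<omega>} \<in> events"
  shows "prob {\<omega> \<in> space M. Q (X \<omega> \<inter> J)} = (\<Sum>A\<in>{A \<in> Pow J. Q A}. prob {\<omega> \<in> space M. X \<omega> \<inter> J = A})"
proof -
  have "{\<omega> \<in> space M. Q (X \<omega> \<inter> J)} = (\<Union>A\<in>{A \<in> Pow J. Q A}. {\<omega> \<in> space M. X \<omega> \<inter> J = A})" by auto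
  also have "prob ... = (\<Sum>A\<in>{A \<in> Pow J. Q A}. prob {\<omega> \<in> space M. X \<omega> \<inter> J = A})"
    using J sets_trace[OF J m] by (intro finite_measure_finite_Union) (auto simp: disjoint_family_on_def)
  finally show ?thesis .
qed

text \<open>A diagonal subsequence makes all finite marginals converge. The limits are consistent,
  since restriction to a smaller window is a finite sum, and Kolmogorov's extension theorem turns
  them into a measure.\<close>

lemma weak_limit:
  fixes N :: "nat => 'b measure" and X :: "nat => 'b => 'v set set" and V :: "'v set" and E :: "'v set set"
  assumes V: "countable V" and E: "countable E" "\<And>e. e \<in> E ==> e \<subseteq> V \<and> card e = 2"
    and N: "\<And>n. prob_space (N n)"
    and m: "\<And>n e. e \<in> E ==> {\<omega> \<in> space (N n). e \<in> X n \<omega>} \<in> sets (N n)"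
  obtains r P where "strict_mono (r :: nat => nat)" "prob_space P" "sets P = sets (subgraph_space (V, E))"
    "AE H in P. verts H = V"
    "\<And>J Q. finite J ==> J \<subseteq> E ==> (\<lambda>k. measure (N (r k)) {\<omega> \<in> space (N (r k)). Q (X (r k) \<omega> \<inter> J)}) \<longlonglongrightarrow>
      measure P {H \<in> space P. Q (edges H \<inter> J)}"
proof -
  define \<pi> where "\<pi> n p = measure (N n) {\<omega> \<in> space (N n). X n \<omega> \<inter> fst p = snd p}" for n and p :: "'v set set \<times> 'v set set"
  let ?Fin = "{J. J \<subseteq> E \<and> finite J}"
  have cnt: "countable (?Fin \<times> ?Fin)" using E(1) by (simp add: countable_Collect_finite_subset conj_commute)
  have bound: "norm (\<pi> n p) \<le> 1" for n p
    unfolding \<pi>_def using prob_space.prob_le_1[OF N] by simp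
  obtain r where r: "strict_mono (r :: nat => nat)" "\<And>p. p \<in> ?Fin \<times> ?Fin ==> \<exists>l. (\<lambda>n. \<pi> (r n) p) \<longlonglongrightarrow> l"
    by (rule function_convergent_subsequence[of "?Fin \<times> ?Fin" \<pi> 1, OF cnt bound]) blast
  define L where "L J A = lim (\<lambda>n. \<pi> (r n) (J, A))" for J A
  have L: "(\<lambda>n. \<pi> (r n) (J, A)) \<longlonglongrightarrow> L J A" if "finite J" "J \<subseteq> E" "A \<subseteq> J" for J A
  proof -
    have "(J, A) \<in> ?Fin \<times> ?Fin" using that finite_subset by auto
    then obtain l where "(\<lambda>n. \<pi> (r n) (J, A)) \<longlonglongrightarrow> l" using r(2) by blast
    then show ?thesis unfolding L_def by (simp add: limI)
  qed
  have L0: "0 \<le> L J A" if "finite J" "J \<subseteq> E" "A \<subseteq> J" for J A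
    by (rule LIMSEQ_le_const[OF L[OF that]]) (auto simp: \<pi>_def)
  have Lsum: "(\<lambda>n. measure (N (r n)) {\<omega> \<in> space (N (r n)). Q (X (r n) \<omega> \<inter> J)}) \<longlonglongrightarrow> (\<Sum>A\<in>{A \<in> Pow J. Q A}. L J A)"
    if J: "finite J" "J \<subseteq> E" for J Q
  proof -
    have "measure (N (r n)) {\<omega> \<in> space (N (r n)). Q (X (r n) \<omega> \<inter> J)} = (\<Sum>A\<in>{A \<in> Pow J. Q A}. \<pi> (r n) (J, A))" for n
      unfolding \<pi>_def fst_conv snd_conv by (rule prob_space.prob_trace[OF N J(1)]) (use m J in blast)
    then show ?thesis using L[OF J] by (auto intro!: tendsto_sum)
  qed
  have L1: "(\<Sum>A\<in>Pow J. L J A) = 1" if J: "finite J" "J \<subseteq> E" for J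
  proof -
    have "(\<lambda>n. 1 :: real) \<longlonglongrightarrow> (\<Sum>A\<in>{A \<in> Pow J. True}. L J A)"
      using Lsum[OF J, of "\<lambda>_. True"] prob_space.prob_space[OF N] by simp
    then have "1 = (\<Sum>A\<in>{A \<in> Pow J. True}. L J A)" using LIMSEQ_unique tendsto_const by blast
    then show ?thesis by (simp add: Pow_def)
  qed
  have Lproj: "L J A = (\<Sum>B\<in>{B \<in> Pow H. B \<inter> J = A}. L H B)" if "finite H" "H \<subseteq> E" "J \<subseteq> H" "A \<subseteq> J" for J H A
  proof -
    have J: "finite J" "J \<subseteq> E" using that finite_subset by auto
    have "X (r n) \<omega> \<inter> H \<inter> J = X (r n) \<omega> \<inter> J" for n \<omega> using that by auto
    then have "(\<lambda>n. \<pi> (r n) (J, A)) \<longlonglongrightarrow> (\<Sum>B\<in>{B \<in> Pow H. B \<inter> J = A}. L H B)"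
      using Lsum[OF that(1,2), of "\<lambda>B. B \<inter> J = A"] by (simp add: \<pi>_def)
    then show ?thesis using L[OF J that(4)] LIMSEQ_unique by blast
  qed
  define p where "p J = embed_pmf (\<lambda>A. if A \<subseteq> J then L J A else 0)" for J
  have pmf_p: "pmf (p J) A = (if A \<subseteq> J then L J A else 0)" if J: "finite J" "J \<subseteq> E" for J A
    unfolding p_def
  proof (rule pmf_embed_pmf)
    show "0 \<le> (if A \<subseteq> J then L J A else 0)" for A using L0[OF J] by simp
    have "(\<integral>\<^sup>+A. ennreal (if A \<subseteq> J then L J A else 0) \<partial>count_space UNIV) = (\<Sum>A\<in>Pow J. ennreal (if A \<subseteq> J then L J A else 0))"
      using J by (intro nn_integral_count_space') auto
    also have "... = (\<Sum>A\<in>Pow J. ennreal (L J A))" by (intro sum.cong) auto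
    also have "... = ennreal (\<Sum>A\<in>Pow J. L J A)" using L0[OF J] by (intro sum_ennreal) auto
    finally show "(\<integral>\<^sup>+A. ennreal (if A \<subseteq> J then L J A else 0) \<partial>count_space UNIV) = 1" using L1[OF J] by simp
  qed
  have set_p: "set_pmf (p J) \<subseteq> Pow J" if J: "finite J" "J \<subseteq> E" for J
    using pmf_p[OF J] by (auto simp: set_pmf_iff split: if_splits)
  have map_p: "map_pmf (\<lambda>B. B \<inter> J) (p H) = p J" if H: "finite H" "H \<subseteq> E" "J \<subseteq> H" for J H
  proof (rule pmf_eqI)
    fix A
    have J: "finite J" "J \<subseteq> E" using H finite_subset by auto
    have "pmf (map_pmf (\<lambda>B. B \<inter> J) (p H)) A = measure (p H) {B. B \<inter> J = A}"
      by (simp add: pmf_map vimage_def)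
    also have "... = measure (p H) {B \<in> Pow H. B \<inter> J = A}"
    proof -
      have "measure (p H) {B. B \<inter> J = A} = measure (p H) ({B. B \<inter> J = A} \<inter> set_pmf (p H))"
        by (simp add: measure_Int_set_pmf)
      also have "{B. B \<inter> J = A} \<inter> set_pmf (p H) = {B \<in> Pow H. B \<inter> J = A} \<inter> set_pmf (p H)"
        using set_p[OF H(1,2)] by auto
      finally show ?thesis by (simp add: measure_Int_set_pmf)
    qed
    also have "... = (\<Sum>B\<in>{B \<in> Pow H. B \<inter> J = A}. pmf (p H) B)"
      using H by (intro measure_measure_pmf_finite) auto
    also have "... = (\<Sum>B\<in>{B \<in> Pow H. B \<inter> J = A}. L H B)" using pmf_p[OF H(1,2)] by (intro sum.cong) auto
    also have "... = pmf (p J) A"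
    proof (cases "A \<subseteq> J")
      case True
      then show ?thesis using Lproj[OF H True] pmf_p[OF J] by simp
    next
      case False
      then have "{B \<in> Pow H. B \<inter> J = A} = {}" by auto
      then show ?thesis using pmf_p[OF J] False by (simp only: sum.empty if_False)
    qed
    finally show "pmf (map_pmf (\<lambda>B. B \<inter> J) (p H)) A = pmf (p J) A" .
  qed
  \<comment> \<open>Edge sets are coded as real vectors with entries 0 and 1, so that the projective
    limit over Polish spaces applies; \<open>Y\<close> decodes them.\<close>
  define enc where "enc J A = restrict (indicator A :: 'v set => real) J" for J A
  define PJ where "PJ J = distr (measure_pmf (p J)) (PiM J (\<lambda>_. borel)) (enc J)" for J
  have enc_meas: "enc J \<in> measurable (measure_pmf (p J')) (PiM J (\<lambda>_. borel))" for J J'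
    unfolding enc_def by (simp add: space_PiM)
  interpret F: polish_projective E PJ
  proof (unfold polish_projective_def, rule projective_family.intro)
    fix J H assume H: "J \<subseteq> H" "finite H" "H \<subseteq> E"
    have "PJ J = distr (measure_pmf (map_pmf (\<lambda>B. B \<inter> J) (p H))) (PiM J (\<lambda>_. borel)) (enc J)"
      unfolding PJ_def map_p[OF H(2,3,1)] ..
    also have "... = distr (measure_pmf (p H)) (PiM J (\<lambda>_. borel)) (\<lambda>B. enc J (B \<inter> J))"
      unfolding map_pmf_rep_eq by (subst distr_distr) (auto simp: space_PiM enc_def comp_def)
    also have "(\<lambda>B. enc J (B \<inter> J)) = (\<lambda>B. restrict (enc H B) J)"
      using H(1) by (auto simp: enc_def fun_eq_iff indicator_def)
    also have "distr (measure_pmf (p H)) (PiM J (\<lambda>_. borel)) (\<lambda>B. restrict (enc H B) J) =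
      distr (PJ H) (PiM J (\<lambda>_. borel)) (\<lambda>f. restrict f J)"
      unfolding PJ_def by (subst distr_distr) (use H in \<open>auto intro: measurable_restrict_subset enc_meas simp: comp_def space_PiM enc_def\<close>)
    finally show "PJ J = distr (PJ H) (PiM J (\<lambda>_. borel)) (\<lambda>f. restrict f J)" .
  next
    fix J assume "finite J" "J \<subseteq> E"
    show "prob_space (PJ J)" unfolding PJ_def by (rule prob_space.prob_space_distr[OF prob_space_measure_pmf enc_meas])
  qed
  let ?S = "subgraph_space (V, E)"
  have spS: "space ?S = subgraphs (V, E)" by (auto simp: subgraph_space_def space_measure_of_conv)
  define Y where "Y x = {e \<in> E. x e = (1 :: real)}" for x
  have Ysub: "(V, Y x) \<in> subgraphs (V, E)" for x using E(2) by (auto simp: subgraphs_def simple_graph_def Y_def)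
  have Ymeas: "{x \<in> space F.lim. e \<in> Y x} \<in> sets F.lim" if "e \<in> E" for e
  proof -
    have "(\<lambda>x. x e) \<in> borel_measurable (PiM E (\<lambda>_. borel :: real measure))" using that by (rule measurable_component_singleton)
    then have "{x \<in> space (PiM E (\<lambda>_. borel)). x e = (1::real)} \<in> sets (PiM E (\<lambda>_. borel))" by measurable
    then show ?thesis using that by (simp add: Y_def)
  qed
  have f_meas: "(\<lambda>x. (V, Y x)) \<in> measurable F.lim ?S"
    unfolding subgraph_space_def
  proof (rule measurable_measure_of)
    show "(\<lambda>v. {H \<in> subgraphs (V, E). v \<in> verts H}) ` verts (V, E) \<union> (\<lambda>e. {H \<in> subgraphs (V, E). e \<in> edges H}) ` edges (V, E)
      \<subseteq> Pow (subgraphs (V, E))" by auto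
    show "(\<lambda>x. (V, Y x)) \<in> space F.lim \<rightarrow> subgraphs (V, E)" using Ysub by auto
    fix A assume "A \<in> (\<lambda>v. {H \<in> subgraphs (V, E). v \<in> verts H}) ` verts (V, E) \<union> (\<lambda>e. {H \<in> subgraphs (V, E). e \<in> edges H}) ` edges (V, E)"
    then consider v where "v \<in> V" "A = {H \<in> subgraphs (V, E). v \<in> verts H}"
      | e where "e \<in> E" "A = {H \<in> subgraphs (V, E). e \<in> edges H}" by auto
    then show "(\<lambda>x. (V, Y x)) -` A \<inter> space F.lim \<in> sets F.lim"
    proof cases
      case 1
      then have "(\<lambda>x. (V, Y x)) -` A \<inter> space F.lim = space F.lim" using Ysub by auto
      then show ?thesis using sets.top by metis
    next
      case 2
      then have "(\<lambda>x. (V, Y x)) -` A \<inter> space F.lim = {x \<in> space F.lim. e \<in> Y x}" using Ysub by auto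
      then show ?thesis using Ymeas 2 by simp
    qed
  qed
  define P where "P = distr F.lim ?S (\<lambda>x. (V, Y x))"
  have prP: "prob_space P" unfolding P_def by (rule F.P.prob_space_distr[OF f_meas])
  have setsP: "sets P = sets ?S" by (simp add: P_def)
  have spP: "space P = subgraphs (V, E)" by (simp add: P_def spS)
  have em: "{H \<in> space P. e \<in> edges H} \<in> sets P" if "e \<in> E" for e
    unfolding spP setsP subgraph_space_def using that by (intro in_measure_of) auto
  have PL: "measure P {H \<in> space P. edges H \<inter> J = A} = L J A" if J: "finite J" "J \<subseteq> E" and A: "A \<subseteq> J" for J A
  proof -
    have cyl_sets: "{f \<in> space (PiM J (\<lambda>_. borel)). {e \<in> J. f e = (1::real)} = A} \<in> sets (PiM J (\<lambda>_. borel))"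
    proof -
      have "{f \<in> space (PiM J (\<lambda>_. borel)). (\<lambda>f. {e \<in> J. f e = (1::real)}) f \<inter> J = A} \<in> sets (PiM J (\<lambda>_. borel))"
      proof (rule sets_trace[OF J(1)])
        fix e assume e: "e \<in> J"
        have "(\<lambda>x. x e) \<in> borel_measurable (PiM J (\<lambda>_. borel :: real measure))" using e by (rule measurable_component_singleton)
        then have "{x \<in> space (PiM J (\<lambda>_. borel)). x e = (1::real)} \<in> sets (PiM J (\<lambda>_. borel))" by measurable
        then show "{f \<in> space (PiM J (\<lambda>_. borel)). e \<in> {e \<in> J. f e = (1::real)}} \<in> sets (PiM J (\<lambda>_. borel))" using e by simp
      qed
      moreover have "{e \<in> J. f e = (1::real)} \<inter> J = {e \<in> J. f e = 1}" for f by auto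
      ultimately show ?thesis by simp
    qed
    have ev: "{H \<in> space P. edges H \<inter> J = A} \<in> sets P"
      by (rule sets_trace[OF J(1)]) (use em J in blast)
    have "measure P {H \<in> space P. edges H \<inter> J = A} = measure F.lim ((\<lambda>x. (V, Y x)) -` {H \<in> space P. edges H \<inter> J = A} \<inter> space F.lim)"
      unfolding P_def using ev[unfolded setsP P_def] by (intro measure_distr[OF f_meas]) (simp add: P_def)
    also have "(\<lambda>x. (V, Y x)) -` {H \<in> space P. edges H \<inter> J = A} \<inter> space F.lim = {x \<in> space F.lim. Y x \<inter> J = A}"
      using Ysub by (auto simp: spP)
    also have "... = prod_emb E (\<lambda>_. borel) J {f \<in> space (PiM J (\<lambda>_. borel)). {e \<in> J. f e = 1} = A}" 
      using J by (auto simp: prod_emb_def Y_def space_PiM PiE_def)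
    also have "measure F.lim ... = measure (PJ J) {f \<in> space (PiM J (\<lambda>_. borel)). {e \<in> J. f e = 1} = A}"
      by (rule F.measure_lim_emb[OF J(2,1) cyl_sets])
    also have "... = measure (measure_pmf (p J)) (enc J -` {f \<in> space (PiM J (\<lambda>_. borel)). {e \<in> J. f e = 1} = A})"
      unfolding PJ_def using cyl_sets by (subst measure_distr[OF enc_meas]) auto
    also have "enc J -` {f \<in> space (PiM J (\<lambda>_. borel)). {e \<in> J. f e = 1} = A} = {B. B \<inter> J = A}"
      by (auto simp: enc_def space_PiM indicator_def)
    also have "measure (measure_pmf (p J)) {B. B \<inter> J = A} = pmf (map_pmf (\<lambda>B. B \<inter> J) (p J)) A"
      by (simp add: pmf_map vimage_def)
    also have "... = L J A" using map_p[OF J subset_refl] pmf_p[OF J] A by simp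
    finally show ?thesis .
  qed
  have lim: "(\<lambda>k. measure (N (r k)) {\<omega> \<in> space (N (r k)). Q (X (r k) \<omega> \<inter> J)}) \<longlonglongrightarrow> measure P {H \<in> space P. Q (edges H \<inter> J)}"
    if J: "finite J" "J \<subseteq> E" for J Q
  proof -
    have "measure P {H \<in> space P. Q (edges H \<inter> J)} = (\<Sum>A\<in>{A \<in> Pow J. Q A}. measure P {H \<in> space P. edges H \<inter> J = A})"
      by (rule prob_space.prob_trace[OF prP J(1)]) (use em J in blast)
    also have "... = (\<Sum>A\<in>{A \<in> Pow J. Q A}. L J A)" using PL[OF J] by (intro sum.cong) auto
    finally show ?thesis using Lsum[OF J, of Q] by simp
  qed
  have "AE H in P. verts H = V"
  proof -
    have "AE x in F.lim. verts (V, Y x) = V" by simp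
    moreover have "{H \<in> space ?S. verts H = V} \<in> sets ?S"
    proof -
      have "{H \<in> space ?S. verts H = V} = {H \<in> space ?S. \<forall>v\<in>V. v \<in> verts H}"
        by (auto simp: spS subgraphs_def)
      also have "... \<in> sets ?S"
      proof (rule sets.sets_Collect_countable_All'[OF _ V])
        fix v assume v: "v \<in> V"
        have "{H \<in> subgraphs (V, E). v \<in> verts H} \<in> sets ?S"
          unfolding subgraph_space_def using v by (intro in_measure_of) auto
        then show "{H \<in> space ?S. v \<in> verts H} \<in> sets ?S" unfolding spS .
      qed
      finally show ?thesis .
    qed
    ultimately show ?thesis unfolding P_def using f_meas by (subst AE_distr_iff) auto
  qed
  then show thesis using that[OF r(1) prP setsP _ lim] by blast
qed

lemma (in prob_space) AE_ex_of_small: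
  assumes m: "\<And>j::nat. {\<omega> \<in> space M. B j \<omega>} \<in> events" and le: "\<And>j. prob {\<omega> \<in> space M. B j \<omega>} \<le> c j" and c: "c \<longlonglongrightarrow> 0"
  shows "AE \<omega> in M. \<exists>j. \<not> B j \<omega>"
proof -
  let ?N = "{\<omega> \<in> space M. \<forall>j. B j \<omega>}"
  have N: "?N \<in> events" using m by (intro sets.sets_Collect_countable_All) auto
  have "prob ?N \<le> c j" for j
  proof -
    have "prob ?N \<le> prob {\<omega> \<in> space M. B j \<omega>}" using m by (intro finite_measure_mono) auto
    then show ?thesis using le[of j] by simp
  qed
  then have "prob ?N \<le> 0" using LIMSEQ_le_const[OF c] by blast
  then have "prob ?N = 0" by (simp add: measure_le_0_iff)
  then have "?N \<in> null_sets M" using N by (simp add: emeasure_eq_measure null_setsI)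
  then show ?thesis by (rule AE_I') auto
qed

lemma conn_finite:
  assumes "conn F x y" shows "\<exists>J. finite J \<and> J \<subseteq> F \<and> conn J x y"
  using assms
proof (induction rule: conn_induct)
  case (step y z)
  then obtain J where J: "finite J" "J \<subseteq> F" "conn J x y" by blast
  have "conn (insert {y, z} J) x y" by (rule conn_mono[OF J(3)]) blast
  moreover have "conn (insert {y, z} J) y z" by (rule conn_edge) simp
  ultimately have "conn (insert {y, z} J) x z" by (rule conn_trans)
  then show ?case using J step.hyps by (intro exI[of _ "insert {y, z} J"]) simp
qed (auto intro: exI[of _ "{}"])

section \<open>Light edges as seen in a bounded window\<close>

context tree
begin

lemma conn_P: "x \<in> K ==> y \<in> K ==> conn (P x y) x y"
proof (induction "card (P x y)" arbitrary: y rule: less_induct)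
  case less
  show ?case
  proof (cases "x = y")
    case False
    then obtain z where z: "{z, y} \<in> T" "z \<in> K" "{z, y} \<notin> P x z" "P x y = insert {z, y} (P x z)"
      using parent[OF less.prems] by blast
    have "card (P x z) < card (P x y)" using z finite_P[OF less.prems(1) z(2)] by simp
    then have c: "conn (P x z) x z" by (rule less.hyps[OF _ less.prems(1) z(2)])
    have "conn (P x y) x z" by (rule conn_mono[OF c]) (use z(4) in blast)
    moreover have "conn (P x y) z y" using z(4) by (intro conn_edge) simp
    ultimately show ?thesis by (rule conn_trans)
  qed simp
qed

text \<open>The sides containing \<open>v\<close> of the edges on the path from \<open>v\<close> to
  \<open>p\<close> are nested proper subsets of the side of \<open>e\<close>, so there are no more
  of them than this side has vertices. A small side therefore lies in a ball of bounded
  radius.\<close>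

lemma card_P_side:
  assumes e: "e \<in> T" "p \<in> e" "v \<in> side e p" "finite (side e p)"
  shows "card (P v p) \<le> card (side e p)"
proof -
  have pK: "p \<in> K" using edge_other[OF e(1,2)] by blast
  have vK: "v \<in> K" and ns: "\<not> sep e p v" using e(3) by (auto simp: side_def)
  have "P v p \<subseteq> {h \<in> P v p. finite (side h v) \<and> card (side h v) < card (side e p)}"
  proof
    fix h assume h: "h \<in> P v p"
    then have h': "h \<in> T" "sep h p v" using sep_sym by (auto simp: P_def)
    have "e \<noteq> h" using h' ns by auto
    have "side h v \<subseteq> side e p"
    proof
      fix q assume q: "q \<in> side h v"
      then have "\<not> sep e v q" using cross[OF h'(1) \<open>e \<noteq> h\<close> e(2) h'(2)] by (simp add: side_def)
      from not_sep_trans[OF ns this] have "\<not> sep e p q" .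
      then show "q \<in> side e p" using q by (simp add: side_def)
    qed
    moreover have "p \<in> side e p" using pK by (simp add: side_def)
    moreover have "p \<notin> side h v" using h'(2) sep_sym[of h p v] by (simp add: side_def)
    ultimately have ss: "side h v \<subset> side e p" by blast
    have "finite (side h v)" using ss e(4) by (meson finite_subset psubset_imp_subset)
    moreover have "card (side h v) < card (side e p)" by (rule psubset_card_mono[OF e(4) ss])
    ultimately show "h \<in> {h \<in> P v p. finite (side h v) \<and> card (side h v) < card (side e p)}" using h by blast
  qed
  then have "card (P v p) \<le> card {h \<in> P v p. finite (side h v) \<and> card (side h v) < card (side e p)}"
    using finite_P[OF vK pK] by (intro card_mono) auto
  also have "... \<le> card (side e p)" by (rule card_light_le[OF vK pK])
  finally show ?thesis .
qed

text \<open>This is the property of a side that survives in the limit: when the side is finite, it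
  can be checked in a finite window and does not mention connectivity.\<close>

lemma side_boundary:
  assumes e: "e \<in> T" and x: "x \<in> K"
  shows "{h \<in> T. card (h \<inter> side e x) = 1} = {e}"
proof -
  have "card (h \<inter> side e x) = 1 \<longleftrightarrow> h = e" if h: "h \<in> T" for h
  proof -
    obtain a b where ab: "h = {a, b}" "a \<in> K" "b \<in> K" "a \<noteq> b" using edgeE[OF h] by blast
    have s: "a \<in> side e x \<longleftrightarrow> \<not> sep e x a" "b \<in> side e x \<longleftrightarrow> \<not> sep e x b" using ab by (auto simp: side_def)
    have x1: "sep e x b \<longleftrightarrow> (sep e x a \<noteq> sep e a b)" using sep_xor[OF e x ab(2,3)] .
    have "sep e a b \<longleftrightarrow> h = e" using not_sep_edge[of a b e] sep_ends[OF ab(1) h] ab(1) h by auto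
    then show ?thesis using s x1 ab(1,4) by (cases "sep e x a") (auto simp: Int_insert_left)
  qed
  then show ?thesis using e by blast
qed

end

section \<open>Hitting probabilities and a sequence of good trees\<close>

context qt_graph
begin

lemma hit_upper:
  assumes H: "haar \<mu> w" and M: "\<forall>y\<in>V. w y \<le> M" and x: "x \<in> V" and B: "finite B"
  shows "{g \<in> Aut. g x \<in> B} \<in> sets \<mu>" "emeasure \<mu> {g \<in> Aut. g x \<in> B} \<le> ennreal (M * real (card B))"
proof -
  note hd = haarD[OF H]
  have M0: "0 \<le> M" using M hd(3)[OF x] x by force
  have eq: "{g \<in> Aut. g x \<in> B} = (\<Union>z\<in>B. {g \<in> Aut. g x = z})" by auto
  show "{g \<in> Aut. g x \<in> B} \<in> sets \<mu>" unfolding eq using hd(2)[OF x] B by (intro sets.finite_UN) auto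
  have "emeasure \<mu> {g \<in> Aut. g x \<in> B} \<le> (\<Sum>z\<in>B. emeasure \<mu> {g \<in> Aut. g x = z})"
    unfolding eq using hd(2)[OF x] B by (intro emeasure_subadditive_finite) auto
  also have "... \<le> (\<Sum>z\<in>B. ennreal M)"
  proof (rule sum_mono)
    fix z
    show "emeasure \<mu> {g \<in> Aut. g x = z} \<le> ennreal M"
    proof (cases "\<exists>f\<in>Aut. f x = z")
      case True
      then show ?thesis using hd(5)[OF x] M x by (auto simp: ennreal_leI)
    next
      case False
      then have "{g \<in> Aut. g x = z} = {}" by auto
      then show ?thesis by (simp only: emeasure_empty zero_le)
    qed
  qed
  also have "... = ennreal (M * real (card B))" using M0 by (simp add: ennreal_of_nat_eq_real_of_nat ennreal_mult' mult.commute)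
  finally show "emeasure \<mu> {g \<in> Aut. g x \<in> B} \<le> ennreal (M * real (card B))" .
qed

lemma hit_lower:
  assumes H: "haar \<mu> w" and m: "\<forall>y\<in>V. m \<le> w y" and x: "x \<in> V" and B: "finite B" and m0: "0 \<le> m"
  shows "ennreal (m * real (card {z \<in> B. same_orbit x z})) \<le> emeasure \<mu> {g \<in> Aut. g x \<in> B}"
proof -
  note hd = haarD[OF H]
  let ?B = "{z \<in> B. same_orbit x z}"
  have "ennreal (m * real (card ?B)) = (\<Sum>z\<in>?B. ennreal m)"
    using m0 by (simp add: ennreal_of_nat_eq_real_of_nat ennreal_mult' mult.commute)
  also have "... \<le> (\<Sum>z\<in>?B. emeasure \<mu> {g \<in> Aut. g x = z})"
    using hd(5)[OF x] m x by (intro sum_mono) (auto simp: same_orbit_def ennreal_leI)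
  also have "... = emeasure \<mu> (\<Union>z\<in>?B. {g \<in> Aut. g x = z})"
    using hd(2)[OF x] B by (intro sum_emeasure) (auto simp: disjoint_family_on_def)
  also have "... \<le> emeasure \<mu> {g \<in> Aut. g x \<in> B}"
  proof (rule emeasure_mono)
    have "{g \<in> Aut. g x \<in> B} = (\<Union>z\<in>B. {g \<in> Aut. g x = z})" by auto
    then show "{g \<in> Aut. g x \<in> B} \<in> sets \<mu>" using hd(2)[OF x] B by (auto intro!: sets.finite_UN)
  qed auto
  finally show ?thesis .
qed

lemma light_sequence:
  assumes H: "haar \<mu> w" and am: "amenable (V, E)" and one: "one_ended (V, E)"
  shows "\<exists>K T S. \<forall>i. finite (K i) \<and> K i \<noteq> {} \<and> K i \<subseteq> V \<and> tree (K i) (T i) \<and> T i \<subseteq> E \<and>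
    real (card (bdry (K i))) * real (Suc i) \<le> real (card (K i)) \<and>
    (\<forall>j\<le>i. real (card (bd.far (K i) (T i) (S j))) \<le> bd.rate j * real (card (K i)) \<and>
      real (bd.hv (K i) (T i) (S j)) \<le> bd.rate j * real (card (K i)))"
proof -
  have "\<forall>n::nat. \<exists>K. finite K \<and> K \<noteq> {} \<and> K \<subseteq> V \<and> real (card (bdry K)) < 1 / real (Suc n) * real (card K) \<and>
    (\<forall>x\<in>K. \<forall>y\<in>K. conn (inside K) x y)"
  proof
    fix n :: nat
    have "0 < 1 / real (Suc n)" by simp
    from connected_folner[OF am this] show "\<exists>K. finite K \<and> K \<noteq> {} \<and> K \<subseteq> V \<and>
      real (card (bdry K)) < 1 / real (Suc n) * real (card K) \<and> (\<forall>x\<in>K. \<forall>y\<in>K. conn (inside K) x y)" by metis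
  qed
  from choice[OF this] obtain K where K: "\<forall>n. finite (K n) \<and> K n \<noteq> {} \<and> K n \<subseteq> V \<and>
    real (card (bdry (K n))) < 1 / real (Suc n) * real (card (K n)) \<and> (\<forall>x\<in>K n. \<forall>y\<in>K n. conn (inside (K n)) x y)"
    by (elim exE)
  have Kf: "finite (K n)" "K n \<subseteq> V" "\<forall>x\<in>K n. \<forall>y\<in>K n. conn (inside (K n)) x y" "K n \<noteq> {}" for n using K by simp_all
  have fol: "\<exists>n0. \<forall>n\<ge>n0. real (card (bdry (K n))) \<le> \<epsilon> * real (card (K n))" if \<epsilon>: "0 < \<epsilon>" for \<epsilon>
  proof -
    obtain n0 :: nat where n0: "1 / \<epsilon> < real n0" using reals_Archimedean2 by blast
    have "real (card (bdry (K n))) \<le> \<epsilon> * real (card (K n))" if "n \<ge> n0" for n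
    proof -
      have "1 / \<epsilon> < real (Suc n)" using n0 that by simp
      then have "1 / real (Suc n) \<le> \<epsilon>" using \<epsilon> by (simp add: field_simps)
      then have "1 / real (Suc n) * real (card (K n)) \<le> \<epsilon> * real (card (K n))" by (rule mult_right_mono) simp
      then show ?thesis using K[rule_format, of n] by linarith
    qed
    then show ?thesis by blast
  qed
  obtain T0 H0 where T0: "bd.valid K T0 H0" using bounded_stretch_trees[OF H Kf fol] by blast
  have j: "\<exists>R Q. bd.uniformly_joined \<rho> R Q" for \<rho> by (rule uniformly_joined[OF one])
  obtain S where S: "\<And>i. \<exists>n\<ge>i. \<exists>T. tree (K n) T \<and> T \<subseteq> E \<and>
    (\<forall>j\<le>i. real (card (bd.far (K n) T (S j))) \<le> bd.rate j * real (card (K n)) \<and>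
      real (bd.hv (K n) T (S j)) \<le> bd.rate j * real (card (K n)))"
    using bd.light_trees[OF j Kf(1,2) fol T0] by blast
  have "\<forall>i. \<exists>q. i \<le> fst q \<and> tree (K (fst q)) (snd q) \<and> snd q \<subseteq> E \<and>
    (\<forall>j\<le>i. real (card (bd.far (K (fst q)) (snd q) (S j))) \<le> bd.rate j * real (card (K (fst q))) \<and>
      real (bd.hv (K (fst q)) (snd q) (S j)) \<le> bd.rate j * real (card (K (fst q))))"
    using S by (metis fst_conv snd_conv)
  from choice[OF this] obtain q where q: "\<forall>i. i \<le> fst (q i) \<and> tree (K (fst (q i))) (snd (q i)) \<and> snd (q i) \<subseteq> E \<and>
    (\<forall>j\<le>i. real (card (bd.far (K (fst (q i))) (snd (q i)) (S j))) \<le> bd.rate j * real (card (K (fst (q i)))) \<and>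
      real (bd.hv (K (fst (q i))) (snd (q i)) (S j)) \<le> bd.rate j * real (card (K (fst (q i)))))" by (elim exE)
  have bb: "real (card (bdry (K (fst (q i))))) * real (Suc i) \<le> real (card (K (fst (q i))))" for i
  proof -
    let ?n = "fst (q i)"
    have "real (card (bdry (K ?n))) * real (Suc i) \<le> real (card (bdry (K ?n))) * real (Suc ?n)"
      using q[rule_format, of i] by (intro mult_left_mono) auto
    also have "... \<le> real (card (K ?n))" using K[rule_format, of ?n] by (simp add: field_simps)
    finally show ?thesis .
  qed
  show ?thesis
    by (rule exI[of _ "\<lambda>i. K (fst (q i))"], rule exI[of _ "\<lambda>i. snd (q i)"], rule exI[of _ S]) (use Kf q bb in blast)
qed

lemma near_bdry_rate:
  assumes K: "finite K" "K \<subseteq> V" "0 < card K"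
    and folner: "real (card (bdry K)) * real (Suc i) \<le> real (card K)" and C: "0 \<le> C"
  shows "C * real (card {a \<in> K. \<not> ball a \<rho> \<subseteq> K}) / real (card K) \<le> C * real (bnd \<rho>) / real (Suc i)"
proof -
  have "card {a \<in> K. \<not> ball a \<rho> \<subseteq> K} \<le> card (bdry K) * bnd \<rho>" by (rule bd.card_near_bdry[OF K(1,2)])
  then have "real (card {a \<in> K. \<not> ball a \<rho> \<subseteq> K}) * real (Suc i) \<le> real (card (bdry K) * bnd \<rho>) * real (Suc i)"
    by (intro mult_right_mono) (simp_all only: of_nat_le_iff of_nat_0_le_iff)
  also have "... \<le> real (card K) * real (bnd \<rho>)"
    using mult_right_mono[OF folner, of "real (bnd \<rho>)"] by (simp add: mult_ac)
  finally have "real (card {a \<in> K. \<not> ball a \<rho> \<subseteq> K}) / real (card K) \<le> real (bnd \<rho>) / real (Suc i)"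
    using K(3) by (simp add: field_simps del: of_nat_Suc)
  from mult_left_mono[OF this C] show ?thesis by simp
qed

lemma pullback_event:
  assumes T: "tree K T" "finite K" and N: "\<And>x z. x \<in> V ==> {g \<in> Aut. g x = z} \<in> sets N" and e: "e \<in> E"
  shows "{g \<in> Aut. g ` e \<in> T} \<in> sets N"
proof -
  obtain x y where xy: "e = {x, y}" "x \<in> V" "y \<in> V" using edgeE[OF e] by blast
  have "{a, b} \<in> T ==> a \<in> K \<and> b \<in> K" for a b using tree.edge_dest[OF T(1)] by blast
  then have "{g \<in> Aut. g ` e \<in> T} =
    (\<Union>p\<in>{p \<in> K \<times> K. {fst p, snd p} \<in> T}. {g \<in> Aut. g x = fst p} \<inter> {g \<in> Aut. g y = snd p})" by (auto simp: xy(1))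
  also have "... \<in> sets N" using T(2) N xy by (intro sets.finite_UN) auto
  finally show ?thesis .
qed

lemma ball_aut: "g \<in> Aut ==> x \<in> V ==> y \<in> ball x \<rho> ==> g y \<in> ball (g x) \<rho>"
  using aut_ball by simp

end

lemma sets_trace_pred:
  assumes J: "finite J" and m: "\<And>e. e \<in> J ==> {\<omega> \<in> space M. e \<in> X \<omega>} \<in> sets M"
  shows "{\<omega> \<in> space M. Q (X \<omega> \<inter> J)} \<in> sets M"
proof -
  have "{\<omega> \<in> space M. Q (X \<omega> \<inter> J)} = (\<Union>A\<in>{A \<in> Pow J. Q A}. {\<omega> \<in> space M. X \<omega> \<inter> J = A})" by auto
  also have "... \<in> sets M" using J sets_trace[OF J m] by (intro sets.finite_UN) auto
  finally show ?thesis .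
qed

section \<open>The sigma-algebra of subgraphs and its symmetries\<close>

context lf_graph
begin

lemma edge_V: "e \<in> E ==> e \<subseteq> V" using edges_Pow by blast

text \<open>Cylinders over finite sets are closed under intersection and pulled back to cylinders by
  automorphisms; the generating events for single vertices and edges lack the first property, which
  uniqueness of measures requires.\<close>

definition cyl :: "'v set => 'v set set => 'v graph set" where
  "cyl W J = {H \<in> subgraphs (V, E). W \<subseteq> verts H \<and> J \<subseteq> edges H}"

lemma subgraphs_sets:
  "sets (subgraph_space (V, E)) = sigma_sets (subgraphs (V, E)) {cyl W J |W J. finite W \<and> W \<subseteq> V \<and> finite J \<and> J \<subseteq> E}"
    (is "_ = sigma_sets ?Om ?G")
proof -
  let ?B = "(\<lambda>v. {H \<in> ?Om. v \<in> verts H}) ` V \<union> (\<lambda>e. {H \<in> ?Om. e \<in> edges H}) ` E"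
  have B: "sets (subgraph_space (V, E)) = sigma_sets ?Om ?B"
    unfolding subgraph_space_def by (subst sets_measure_of) auto
  interpret sigma_algebra ?Om "sigma_sets ?Om ?B" by (rule sigma_algebra_sigma_sets) auto
  show ?thesis unfolding B
  proof (rule sigma_sets_eqI)
    fix a assume "a \<in> ?B"
    then consider v where "v \<in> V" "a = {H \<in> ?Om. v \<in> verts H}" | e where "e \<in> E" "a = {H \<in> ?Om. e \<in> edges H}" by auto
    then show "a \<in> sigma_sets ?Om ?G"
    proof cases
      case 1
      then have "a = cyl {v} {}" by (simp add: cyl_def)
      then show ?thesis using 1 by (intro sigma_sets.Basic) blast
    next
      case 2
      then have "a = cyl {} {e}" by (simp add: cyl_def)
      then show ?thesis using 2 by (intro sigma_sets.Basic) blast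
    qed
  next
    fix b assume "b \<in> ?G"
    then obtain W J where WJ: "b = cyl W J" "finite W" "W \<subseteq> V" "finite J" "J \<subseteq> E" by blast
    have "b = {H \<in> ?Om. \<forall>v\<in>W. v \<in> verts H} \<inter> {H \<in> ?Om. \<forall>e\<in>J. e \<in> edges H}" using WJ(1) by (auto simp: cyl_def)
    also have "... \<in> sigma_sets ?Om ?B"
    proof (rule Int)
      show "{H \<in> ?Om. \<forall>v\<in>W. v \<in> verts H} \<in> sigma_sets ?Om ?B"
        by (rule sets_Collect_countable_All'[OF _ countable_finite[OF WJ(2)]]) (use WJ(3) in \<open>intro sigma_sets.Basic, blast\<close>)
      show "{H \<in> ?Om. \<forall>e\<in>J. e \<in> edges H} \<in> sigma_sets ?Om ?B"
        by (rule sets_Collect_countable_All'[OF _ countable_finite[OF WJ(4)]]) (use WJ(5) in \<open>intro sigma_sets.Basic, blast\<close>)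
    qed
    finally show "b \<in> sigma_sets ?Om ?B" .
  qed
qed

lemma image_subgraph:
  assumes f: "f \<in> Aut" and H: "H \<in> subgraphs (V, E)"
  shows "graph_image f H \<in> subgraphs (V, E)"
    "W \<subseteq> V ==> W \<subseteq> verts (graph_image f H) \<longleftrightarrow> ainv f ` W \<subseteq> verts H"
    "J \<subseteq> E ==> J \<subseteq> edges (graph_image f H) \<longleftrightarrow> (`) (ainv f) ` J \<subseteq> edges H"
proof -
  note i = ainv[OF f]
  have HV: "verts H \<subseteq> V" "edges H \<subseteq> E" and sg: "\<And>e. e \<in> edges H ==> e \<subseteq> verts H \<and> card e = 2"
    using H by (auto simp: subgraphs_def simple_graph_def)
  have "card (f ` e) = 2" if "e \<in> edges H" for e
    using card_image[OF inj_on_subset[OF autD(5)[OF f]], of e] sg[OF that] HV by auto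
  moreover have "f ` e \<in> E" if "e \<in> edges H" for e using aut_edge[OF f, of e] that HV edge_V by blast
  ultimately show "graph_image f H \<in> subgraphs (V, E)"
    using HV sg autD(4)[OF f] by (auto simp: subgraphs_def simple_graph_def graph_image_def) (blast+)?
  show "W \<subseteq> verts (graph_image f H) \<longleftrightarrow> ainv f ` W \<subseteq> verts H" if "W \<subseteq> V"
  proof -
    have "v \<in> f ` verts H \<longleftrightarrow> ainv f v \<in> verts H" if "v \<in> V" for v
      using i(2)[OF that] i(3) HV(1) by (metis image_iff subsetD)
    then show ?thesis using that by (auto simp: graph_image_def subset_iff)
  qed
  show "J \<subseteq> edges (graph_image f H) \<longleftrightarrow> (`) (ainv f) ` J \<subseteq> edges H" if "J \<subseteq> E"
  proof -
    have "e \<in> (`) f ` edges H \<longleftrightarrow> ainv f ` e \<in> edges H" if "e \<in> E" for e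
    proof -
      have "f ` ainv f ` e = (\<lambda>x. x) ` e"
        unfolding image_image by (rule image_cong[OF refl]) (use i(2) edge_V[OF that] in blast)
      then have a: "f ` ainv f ` e = e" by simp
      have b: "ainv f ` f ` h = h" if "h \<in> edges H" for h
      proof -
        have "h \<subseteq> V" using edge_V HV(2) that by blast
        then have "ainv f ` f ` h = (\<lambda>x. x) ` h"
          unfolding image_image by (intro image_cong[OF refl]) (use i(3) in blast)
        then show ?thesis by simp
      qed
      show ?thesis
      proof
        assume "e \<in> (`) f ` edges H"
        then obtain h where "h \<in> edges H" "e = f ` h" by blast
        then show "ainv f ` e \<in> edges H" using b by simp
      next
        assume "ainv f ` e \<in> edges H"
        then have "f ` ainv f ` e \<in> (`) f ` edges H" by (rule imageI)
        then show "e \<in> (`) f ` edges H" unfolding a .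
      qed
    qed
    then show ?thesis using that by (auto simp: graph_image_def subset_iff)
  qed
qed

lemma cyl_vimage:
  assumes f: "f \<in> Aut" and WJ: "W \<subseteq> V" "J \<subseteq> E"
  shows "graph_image f -` cyl W J \<inter> subgraphs (V, E) = cyl (ainv f ` W) ((`) (ainv f) ` J)"
proof (intro equalityI subsetI)
  fix H
  show "H \<in> cyl (ainv f ` W) ((`) (ainv f) ` J)" if H: "H \<in> graph_image f -` cyl W J \<inter> subgraphs (V, E)"
    using H image_subgraph(2,3)[OF f, of H] WJ by (simp add: cyl_def)
  show "H \<in> graph_image f -` cyl W J \<inter> subgraphs (V, E)" if H: "H \<in> cyl (ainv f ` W) ((`) (ainv f) ` J)"
  proof -
    have sg: "H \<in> subgraphs (V, E)" using H by (simp add: cyl_def)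
    show ?thesis using H image_subgraph[OF f sg] WJ sg by (simp add: cyl_def)
  qed
qed

lemma graph_image_measurable:
  assumes f: "f \<in> Aut"
  shows "graph_image f \<in> measurable (subgraph_space (V, E)) (subgraph_space (V, E))"
proof (rule measurable_sigma_sets[OF subgraphs_sets])
  let ?Om = "subgraphs (V, E)" and ?G = "{cyl W J |W J. finite W \<and> W \<subseteq> V \<and> finite J \<and> J \<subseteq> E}"
  have sp: "space (subgraph_space (V, E)) = ?Om" by (simp add: subgraph_space_def space_measure_of_conv)
  show "?G \<subseteq> Pow ?Om" by (auto simp: cyl_def)
  show "graph_image f \<in> space (subgraph_space (V, E)) \<rightarrow> ?Om" using image_subgraph(1)[OF f] by (auto simp: sp)
  fix A assume "A \<in> ?G"
  then obtain W J where WJ: "A = cyl W J" "finite W" "W \<subseteq> V" "finite J" "J \<subseteq> E" by blast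
  have ai: "ainv f \<in> Aut" by (rule ainv(1)[OF f])
  have "ainv f ` W \<subseteq> V" "(`) (ainv f) ` J \<subseteq> E" using WJ autD(4)[OF ai] aut_edge[OF ai] edge_V by auto
  then have "cyl (ainv f ` W) ((`) (ainv f) ` J) \<in> ?G" using WJ by blast
  then show "graph_image f -` A \<inter> space (subgraph_space (V, E)) \<in> sets (subgraph_space (V, E))"
    unfolding WJ(1) sp cyl_vimage[OF f WJ(3,5)] subgraphs_sets by (rule sigma_sets.Basic)
qed

end

text \<open>
  \<open>N i\<close> is the law of an automorphism moving the base point \<open>a0\<close> to a uniformly chosen place of
  \<open>K i\<close>; pulling \<open>T i\<close> back_eq along it gives a random forest, and \<open>P\<close> is a weak limit of these.
\<close>

locale weak_trees = qt_graph V E Rep for V :: "'v set" and E Rep +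
  fixes N :: "nat => ('v => 'v) measure" and K :: "nat => 'v set" and T :: "nat => 'v set set" and S :: "nat => nat"
    and a0 :: 'v and C :: real and P :: "'v graph measure" and r :: "nat => nat"
  assumes K: "finite (K i)" "K i \<subseteq> V" "K i \<noteq> {}" and T: "tree (K i) (T i)" "T i \<subseteq> E" and a0: "a0 \<in> V"
    and folner: "real (card (bdry (K i))) * real (Suc i) \<le> real (card (K i))"
    and light: "j \<le> i ==> real (card (bd.far (K i) (T i) (S j))) \<le> bd.rate j * real (card (K i)) \<and>
      real (bd.hv (K i) (T i) (S j)) \<le> bd.rate j * real (card (K i))"
    and N: "prob_space (N i)" "space (N i) = Aut" and N_sets: "x \<in> V ==> {g \<in> Aut. g x = z} \<in> sets (N i)"
    and base: "AE g in N i. g a0 \<in> K i"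
    and hit: "x \<in> V ==> finite B ==> measure (N i) {g \<in> Aut. g x \<in> B} \<le> C * real (card B) / real (card (K i))"
    and shift: "f \<in> Aut ==> f a0 \<in> ball a0 \<rho> ==> A \<in> sets (N i) ==>
      {g \<in> Aut. compose V g f \<in> A} \<in> sets (N i) \<and>
      \<bar>measure (N i) {g \<in> Aut. compose V g f \<in> A} - measure (N i) A\<bar> \<le> C * real (bnd \<rho>) / real (Suc i)"
    and C: "0 \<le> C" and r: "strict_mono r"
    and P: "prob_space P" "sets P = sets (subgraph_space (V, E))" "AE H in P. verts H = V"
    and lim: "finite J ==> J \<subseteq> E ==> (\<lambda>k. measure (N (r k)) {g \<in> Aut. Q ({e \<in> E. g ` e \<in> T (r k)} \<inter> J)}) \<longlonglongrightarrow>
      measure P {H \<in> space P. Q (edges H \<inter> J)}"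
begin

definition X :: "nat => ('v => 'v) => 'v set set" where "X i g = {e \<in> E. g ` e \<in> T i}"

lemma lim_X: "finite J ==> J \<subseteq> E ==> (\<lambda>k. measure (N (r k)) {g \<in> Aut. Q (X (r k) g \<inter> J)}) \<longlonglongrightarrow>
    measure P {H \<in> space P. Q (edges H \<inter> J)}"
  unfolding X_def by (rule lim)

lemma space_P: "space P = subgraphs (V, E)"
  using sets_eq_imp_space_eq[OF P(2)] by (simp add: subgraph_space_def space_measure_of_conv)

lemma X_sets: "e \<in> E ==> {g \<in> Aut. e \<in> X i g} \<in> sets (N i)"
  using pullback_event[OF T(1) K(1) N_sets] by (simp add: X_def)

lemma event_N: "finite J ==> J \<subseteq> E ==> {g \<in> Aut. Q (X i g \<inter> J)} \<in> sets (N i)"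
  using sets_trace_pred[of J "N i" "X i" Q] X_sets by (auto simp: N(2))

lemma event_P1: "e \<in> E ==> {H \<in> space P. e \<in> edges H} \<in> sets P"
  unfolding space_P P(2) subgraph_space_def by (intro in_measure_of) auto

lemma event_P: "finite J ==> J \<subseteq> E ==> {H \<in> space P. Q (edges H \<inter> J)} \<in> sets P"
  by (rule sets_trace_pred) (use event_P1 in auto)

lemma card_K: "0 < card (K i)" using K card_gt_0_iff by blast

text \<open>A bad event is charged to the positions in \<open>K i\<close> at which it can occur. Two
  lists of positions are allowed, because one defect, closeness to the boundary, is seen at the base
  point and the other at a vertex of the window.\<close>

lemma base_bound:
  assumes J: "finite J" "J \<subseteq> E" and x: "x \<in> V" "y \<in> V" and B: "finite B" "finite B'"
    and sub: "\<And>g. g \<in> Aut ==> g a0 \<in> K i ==> Q (X i g \<inter> J) ==> g x \<in> B \<or> g y \<in> B'"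
  shows "measure (N i) {g \<in> Aut. Q (X i g \<inter> J)} \<le> C * real (card B) / real (card (K i)) + C * real (card B') / real (card (K i))"
proof -
  interpret N: prob_space "N i" by (rule N)
  have s: "{g \<in> Aut. g x \<in> B} \<in> sets (N i)" if "x \<in> V" "finite B" for x B
  proof -
    have "{g \<in> Aut. g x \<in> B} = (\<Union>z\<in>B. {g \<in> Aut. g x = z})" by auto
    then show ?thesis using that N_sets by (auto intro!: sets.finite_UN)
  qed
  have "measure (N i) {g \<in> Aut. Q (X i g \<inter> J)} \<le> measure (N i) ({g \<in> Aut. g x \<in> B} \<union> {g \<in> Aut. g y \<in> B'})"
  proof (rule N.finite_measure_mono_AE)
    show "AE g in N i. g \<in> {g \<in> Aut. Q (X i g \<inter> J)} --> g \<in> {g \<in> Aut. g x \<in> B} \<union> {g \<in> Aut. g y \<in> B'}"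
      using base by eventually_elim (use sub in auto)
  qed (use s x B in auto)
  also have "... \<le> measure (N i) {g \<in> Aut. g x \<in> B} + measure (N i) {g \<in> Aut. g y \<in> B'}"
    by (intro measure_Un_le s x B)
  also have "... \<le> C * real (card B) / real (card (K i)) + C * real (card B') / real (card (K i))"
    using hit x B by (intro add_mono) auto
  finally show ?thesis .
qed

lemma vanish: "(\<lambda>k. c / real (Suc (r k))) \<longlonglongrightarrow> 0"
proof -
  have "(\<lambda>n. c / real (Suc n)) \<longlonglongrightarrow> 0" by real_asymp
  from LIMSEQ_subseq_LIMSEQ[OF this r] show ?thesis by (simp add: comp_def)
qed

lemma limit_bound:
  assumes J: "finite J" "J \<subseteq> E"
    and le: "\<And>i. j \<le> i ==> measure (N i) {g \<in> Aut. Q (X i g \<inter> J)} \<le> c / real (Suc i) + d"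
  shows "measure P {H \<in> space P. Q (edges H \<inter> J)} \<le> d"
proof (rule LIMSEQ_le[OF lim_X[OF J]])
  show "(\<lambda>k. c / real (Suc (r k)) + d) \<longlonglongrightarrow> d" using tendsto_add[OF vanish tendsto_const[of d]] by simp
  show "\<exists>n. \<forall>k\<ge>n. measure (N (r k)) {g \<in> Aut. Q (X (r k) g \<inter> J)} \<le> c / real (Suc (r k)) + d"
    using le seq_suble[OF r] order_trans by blast
qed

lemma card_ends: "finite A ==> (\<And>e. e \<in> A ==> e \<in> E) ==> finite (\<Union>A) \<and> card (\<Union>A) \<le> 2 * card A"
proof -
  assume A: "finite A" "\<And>e. e \<in> A ==> e \<in> E"
  have c2: "finite e \<and> card e = 2" if "e \<in> A" for e using edgeE[OF A(2)[OF that]] by auto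
  have "card (\<Union>A) \<le> (\<Sum>e\<in>A. card e)" by (rule card_Union_le_sum_card) 
  also have "... = 2 * card A" using c2 by simp
  finally show ?thesis using A c2 by auto
qed

section \<open>Almost sure properties of the limit\<close>

text \<open>A failure to be a forest is visible on finitely many edges, no sample shows one, and
  there are only countably many finite windows.\<close>

lemma AE_forest: "AE H in P. forest (edges H)"
proof -
  interpret P: prob_space P by (rule P)
  have fX: "forest (X i g \<inter> J)" if g: "g \<in> Aut" for i g J
    unfolding forest_def
  proof (intro allI impI notI)
    fix u v assume uv: "{u, v} \<in> X i g \<inter> J" and c: "conn (X i g \<inter> J - {{u, v}}) u v"
    have "(`) g ` (X i g \<inter> J - {{u, v}}) \<subseteq> T i - {{g u, g v}}"
    proof
      fix h assume "h \<in> (`) g ` (X i g \<inter> J - {{u, v}})"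
      then obtain h' where h': "h = g ` h'" "h' \<in> X i g" "h' \<noteq> {u, v}" by blast
      then have "g ` h' \<noteq> g ` {u, v}" using aut_inj_edge[OF g edge_V edge_V, of h' "{u, v}"] uv by (auto simp: X_def)
      then show "h \<in> T i - {{g u, g v}}" using h' by (auto simp: X_def)
    qed
    with conn_image[OF c, of g] have "conn (T i - {{g u, g v}}) (g u) (g v)" by (rule conn_mono)
    moreover have "{g u, g v} \<in> T i" using uv by (simp add: X_def)
    ultimately show False using tree.bridge[OF T(1)] by blast
  qed
  have z: "AE H in P. forest (edges H \<inter> J)" if J: "finite J" "J \<subseteq> E" for J
  proof -
    have "measure (N i) {g \<in> Aut. \<not> forest (X i g \<inter> J)} \<le> 0 / real (Suc i) + 0" for i
      using fX by (simp add: Collect_conj_eq[symmetric] conj_commute cong: conj_cong)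
    from limit_bound[OF J this] have m0: "measure P {H \<in> space P. \<not> forest (edges H \<inter> J)} \<le> 0" .
    have "measure P {H \<in> space P. \<not> forest (edges H \<inter> J)} = 0" using m0 by (simp add: measure_le_0_iff)
    then have "emeasure P {H \<in> space P. \<not> forest (edges H \<inter> J)} = 0" by (simp add: P.emeasure_eq_measure)
    then have "{H \<in> space P. \<not> forest (edges H \<inter> J)} \<in> null_sets P"
      using event_P[OF J, of "\<lambda>A. \<not> forest A"] by (rule null_setsI)
    then show ?thesis by (rule AE_I') auto
  qed
  have cnt: "countable {J. finite J \<and> J \<subseteq> E}" using countable_E by (rule countable_Collect_finite_subset)
  have "AE H in P. \<forall>J\<in>{J. finite J \<and> J \<subseteq> E}. forest (edges H \<inter> J)"
    unfolding AE_ball_countable[OF cnt] using z by blast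
  moreover have "AE H in P. H \<in> space P" by simp
  ultimately show ?thesis
  proof eventually_elim
    case (elim H)
    then have HE: "edges H \<subseteq> E" by (simp add: space_P subgraphs_def)
    show ?case
      unfolding forest_def
    proof (intro allI impI notI)
      fix u v assume uv: "{u, v} \<in> edges H" and c: "conn (edges H - {{u, v}}) u v"
      obtain J where J: "finite J" "J \<subseteq> edges H - {{u, v}}" "conn J u v" using conn_finite[OF c] by blast
      let ?J = "insert {u, v} J"
      have sub: "?J \<subseteq> edges H" using J(2) uv by blast
      then have "?J \<in> {J. finite J \<and> J \<subseteq> E}" using J(1) HE by blast
      then have "forest (edges H \<inter> ?J)" using elim(1) by (rule bspec[rotated])
      then have f: "forest ?J" using sub by (simp only: Int_absorb1)
      have "conn (?J - {{u, v}}) u v" by (rule conn_mono[OF J(3)]) (use J(2) in blast)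
      then show False using f unfolding forest_def by blast
    qed
  qed
qed

lemma AE_of_rates:
  assumes J: "\<And>j. finite (J j)" "\<And>j. J j \<subseteq> E"
    and le: "\<And>i j. j \<le> i ==> measure (N i) {g \<in> Aut. Q j (X i g \<inter> J j)} \<le> c / real (Suc i) + 2 * C * bd.rate j"
  shows "AE H in P. \<exists>j. \<not> Q j (edges H \<inter> J j)"
proof (rule prob_space.AE_ex_of_small[OF P(1)])
  show "{H \<in> space P. Q j (edges H \<inter> J j)} \<in> sets P" for j by (rule event_P[OF J])
  show "measure P {H \<in> space P. Q j (edges H \<inter> J j)} \<le> 2 * C * bd.rate j" for j
    by (rule limit_bound[OF J]) (rule le)
  show "(\<lambda>j. 2 * C * bd.rate j) \<longlonglongrightarrow> 0" using tendsto_mult_right_zero[OF bd.rate_tendsto, of "2 * C"] by simp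
qed

lemma gt: "graph_tree V E deg bnd (K i) (T i)"
  by (rule bd.graph_treeI[OF K(1,2) T])

text \<open>Inside the window the two neighbours fail to be joined only if the place is near the
  boundary of \<open>K i\<close> or the image of their edge is far. Otherwise the tree path between
  the images has at most \<open>S j\<close> edges, and its pullback stays among the edges meeting
  \<open>ball x (S j)\<close>.\<close>

lemma AE_conn:
  assumes e: "{x, y} \<in> E" shows "AE H in P. conn (edges H) x y"
proof -
  define J where "J j = {h \<in> E. h \<inter> ball x (S j) \<noteq> {}}" for j
  have xy: "x \<in> V" "y \<in> V" using edge_dest[OF e] by auto
  have J: "finite (J j)" "J j \<subseteq> E" for j
    unfolding J_def by (intro finite_incident finite_ball ball_V xy) blast
  obtain \<rho>1 \<rho>2 where "x \<in> ball a0 \<rho>1" "y \<in> ball a0 \<rho>2" using ex_ball[OF a0] xy by meson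
  then obtain \<rho> where \<rho>: "x \<in> ball a0 \<rho>" "y \<in> ball a0 \<rho>" 
    using ball_mono[of \<rho>1 "max \<rho>1 \<rho>2" a0] ball_mono[of \<rho>2 "max \<rho>1 \<rho>2" a0] by auto
  have le: "measure (N i) {g \<in> Aut. \<not> conn (X i g \<inter> J j) x y} \<le> C * real (bnd \<rho>) / real (Suc i) + 2 * C * bd.rate j"
    if ji: "j \<le> i" for i j
  proof -
    interpret t: graph_tree V E deg bnd "K i" "T i" by (rule gt)
    let ?B = "{a \<in> K i. \<not> ball a \<rho> \<subseteq> K i}" and ?F = "bd.far (K i) (T i) (S j)"
    have F: "finite (\<Union>?F) \<and> card (\<Union>?F) \<le> 2 * card ?F"
      by (rule card_ends[OF t.finite_far]) (simp add: bd.far_def)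
    have "measure (N i) {g \<in> Aut. \<not> conn (X i g \<inter> J j) x y} \<le>
        C * real (card ?B) / real (card (K i)) + C * real (card (\<Union>?F)) / real (card (K i))"
    proof (rule base_bound[OF J a0 xy(1)])
      show "finite ?B" using K(1) by simp
      show "finite (\<Union>?F)" using F by blast
      fix g assume g: "g \<in> Aut" "g a0 \<in> K i" and nc: "\<not> conn (X i g \<inter> J j) x y"
      show "g a0 \<in> ?B \<or> g x \<in> \<Union>?F"
      proof (rule ccontr)
        assume no: "\<not> (g a0 \<in> ?B \<or> g x \<in> \<Union>?F)"
        then have "ball (g a0) \<rho> \<subseteq> K i" using g by blast
        then have gK: "g x \<in> K i" "g y \<in> K i" using ball_aut[OF g(1) a0 \<rho>(1)] ball_aut[OF g(1) a0 \<rho>(2)] by auto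
        have gE: "{g x, g y} \<in> E" using autD(3)[OF g(1) xy] e by blast
        have "{g x, g y} \<notin> ?F" using no by blast
        then have short: "card (t.P (g x) (g y)) \<le> S j" using gK gE unfolding bd.far_def by (auto simp: not_less)
        let ?P = "t.P (g x) (g y)"
        have "(`) (ainv g) ` ?P \<subseteq> X i g \<inter> J j"
        proof
          fix h assume "h \<in> (`) (ainv g) ` ?P"
          then obtain h' where h': "h' \<in> ?P" "h = ainv g ` h'" by blast
          have hT: "h' \<in> T i" using h'(1) t.P_subset by blast
          then have hE: "h' \<in> E" using T(2) by blast
          obtain p q where pq: "h' = {p, q}" "p \<in> K i" "q \<in> K i" using tree.edgeE[OF T(1) hT] by metis
          have pV: "p \<in> V" "q \<in> V" using pq K(2) by auto
          have back_eq: "g ` h = h'" using h'(2) pq(1) ainv(2)[OF g(1)] pV by simp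
          have "h \<in> E" using aut_edge[OF ainv(1)[OF g(1)], of h'] hE edge_V[OF hE] h'(2) by blast
          then have hX: "h \<in> X i g" using back_eq hT by (simp add: X_def)
          have "t.P (g x) p \<subseteq> ?P" using t.P_split(2)[OF h'(1) _ gK, of p] pq(1) by blast
          then have "card (t.P (g x) p) \<le> S j" using short card_mono[OF t.finite_P[OF gK]] le_trans by blast
          then have "p \<in> ball (g x) (S j)" using t.P_ball[OF gK(1) pq(2)] by blast
          then have "p \<in> g ` ball x (S j)" using aut_ball[OF g(1) xy(1)] by simp
          then obtain p' where p': "p' \<in> ball x (S j)" "p = g p'" by blast
          have "ainv g p = p'" using p' ainv(3)[OF g(1)] ball_V[OF xy(1)] by blast
          then have "p' \<in> h" using h'(2) pq(1) by auto
          then show "h \<in> X i g \<inter> J j" using hX p'(1) \<open>h \<in> E\<close> unfolding J_def by blast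
        qed
        with conn_image[OF t.conn_P[OF gK], of "ainv g"]
        have "conn (X i g \<inter> J j) (ainv g (g x)) (ainv g (g y))" by (rule conn_mono)
        then show False using nc ainv(3)[OF g(1)] xy by simp
      qed
    qed
    also have "C * real (card (\<Union>?F)) / real (card (K i)) \<le> 2 * C * bd.rate j"
    proof -
      have "real (card (\<Union>?F)) \<le> 2 * (bd.rate j * real (card (K i)))" using F light[OF ji] by linarith
      then have "C * real (card (\<Union>?F)) \<le> C * (2 * (bd.rate j * real (card (K i))))" using C by (rule mult_left_mono)
      then show ?thesis using card_K[of i] by (simp add: field_simps)
    qed
    also have "C * real (card ?B) / real (card (K i)) \<le> C * real (bnd \<rho>) / real (Suc i)"
      by (rule near_bdry_rate[OF K(1,2) card_K folner C])
    finally show ?thesis by simp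
  qed
  have "AE H in P. \<exists>j. \<not> \<not> conn (edges H \<inter> J j) x y" by (rule AE_of_rates[OF J le])
  then show ?thesis
  proof eventually_elim
    case (elim H)
    then obtain j where "conn (edges H \<inter> J j) x y" by blast
    then show ?case by (rule conn_mono) blast
  qed
qed

text \<open>The boundary of \<open>K i\<close> causes no error here, since the event requires the
  image of the edge to lie in the tree. If the image is not heavy, its small side lies within
  \<open>S j\<close> of one of its ends, hence within \<open>S j + 1\<close> of the image of
  \<open>x\<close>, whichever end that is.\<close>

lemma AE_light:
  assumes e: "{x, y} \<in> E"
  shows "AE H in P. {x, y} \<in> edges H --> (\<exists>D. finite D \<and> D \<subseteq> V \<and> {h \<in> edges H. card (h \<inter> D) = 1} = {{x, y}})"
proof -
  define J where "J j = {h \<in> E. h \<inter> ball x (S j + 1) \<noteq> {}}" for j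
  have xy: "x \<in> V" "y \<in> V" using edge_dest[OF e] by auto
  have eV: "{x, y} \<subseteq> V" using xy by simp
  have J: "finite (J j)" "J j \<subseteq> E" for j
    unfolding J_def by (intro finite_incident finite_ball ball_V xy) blast
  let ?Q = "\<lambda>j A. {x, y} \<in> A \<and> \<not> (\<exists>D\<subseteq>ball x (S j + 1). {h \<in> A. card (h \<inter> D) = 1} = {{x, y}})"
  have le: "measure (N i) {g \<in> Aut. ?Q j (X i g \<inter> J j)} \<le> 0 / real (Suc i) + 2 * C * bd.rate j"
    if ji: "j \<le> i" for i j
  proof -
    interpret t: graph_tree V E deg bnd "K i" "T i" by (rule gt)
    let ?F = "{q. t.heavy (S j) q}"
    have F: "finite (\<Union>?F) \<and> card (\<Union>?F) \<le> 2 * card ?F"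
      by (rule card_ends[OF t.finite_heavy]) (use T(2) t.heavyD in blast)
    have "measure (N i) {g \<in> Aut. ?Q j (X i g \<inter> J j)} \<le>
        C * real (card ({} :: 'v set)) / real (card (K i)) + C * real (card (\<Union>?F)) / real (card (K i))"
    proof (rule base_bound[OF J a0 xy(1)])
      show "finite (\<Union>?F)" using F by blast
      fix g assume g: "g \<in> Aut" "g a0 \<in> K i" and q: "?Q j (X i g \<inter> J j)"
      show "g a0 \<in> {} \<or> g x \<in> \<Union>?F"
      proof (rule ccontr)
        assume no: "\<not> (g a0 \<in> {} \<or> g x \<in> \<Union>?F)"
        have eX: "{x, y} \<in> X i g \<inter> J j" using q by blast
        have eT: "{g x, g y} \<in> T i" using eX by (simp add: X_def)
        let ?e = "{g x, g y}"
        have gK: "g x \<in> K i" "g y \<in> K i" using tree.edge_dest[OF T(1) eT] by auto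
        have "\<not> t.heavy (S j) ?e" using no by blast
        then obtain z where z: "z \<in> K i" "card (t.side ?e z) < S j" using eT unfolding t.heavy_iff by (auto simp: not_le)
        have "\<exists>p\<in>?e. t.side ?e z = t.side ?e p"
          using t.two_sides[OF eT z(1)] t.side_eq[of ?e "g x" z] t.side_eq[of ?e "g y" z] by blast
        then obtain p where p: "p \<in> ?e" "t.side ?e z = t.side ?e p" by blast
        have pK: "p \<in> K i" using p(1) gK by blast
        let ?D' = "t.side ?e p"
        have "?D' \<subseteq> ball (g x) (S j + 1)"
        proof
          fix v assume v: "v \<in> ?D'"
          then have vK: "v \<in> K i" by (simp add: t.side_def)
          have "card (t.P v p) \<le> S j" using t.card_P_side[OF eT p(1) v t.finite_side] z(2) p(2) by simp
          then have "p \<in> ball v (S j)" using t.P_ball[OF vK pK] by blast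
          moreover have "g x \<in> ball p 1"
          proof (cases "p = g x")
            case False
            then have "{p, g x} \<in> E" using p(1) eT T(2) by (auto simp: insert_commute)
            then show ?thesis by (intro nbr_ball) (simp add: nbr_def)
          qed simp
          ultimately have "g x \<in> ball v (S j + 1)" by (rule ball_trans)
          then show "v \<in> ball (g x) (S j + 1)" by (rule ball_sym)
        qed
        then have D'b: "?D' \<subseteq> g ` ball x (S j + 1)" unfolding aut_ball[OF g(1) xy(1)] .
        define D where "D = {v \<in> ball x (S j + 1). g v \<in> ?D'}"
        have gD: "g ` D = ?D'" using D'b unfolding D_def by blast
        have DV: "D \<subseteq> V" using ball_V[OF xy(1)] unfolding D_def by blast
        have cd: "card (h \<inter> D) = card (g ` h \<inter> ?D')" if h: "h \<subseteq> V" for h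
        proof -
          have inj: "inj_on g V" by (rule autD(5)[OF g(1)])
          have "g ` h \<inter> ?D' = g ` (h \<inter> D)" unfolding gD[symmetric] using inj_on_image_Int[OF inj h DV] by simp
          then show ?thesis using card_image[OF inj_on_subset[OF inj]] h by (metis Int_lower1 subset_trans)
        qed
        have sb: "{h \<in> T i. card (h \<inter> ?D') = 1} = {?e}" by (rule t.side_boundary[OF eT pK])
        have "{h \<in> X i g \<inter> J j. card (h \<inter> D) = 1} = {{x, y}}"
        proof (intro equalityI subsetI)
          fix h assume h: "h \<in> {h \<in> X i g \<inter> J j. card (h \<inter> D) = 1}"
          then have hV: "h \<subseteq> V" using edge_V by (auto simp: X_def)
          have "g ` h \<in> {h \<in> T i. card (h \<inter> ?D') = 1}" using h cd[OF hV] by (simp add: X_def)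
          then have "g ` h = g ` {x, y}" unfolding sb by simp
          then show "h \<in> {{x, y}}" using aut_inj_edge[OF g(1) hV eV] by simp
        next
          fix h assume "h \<in> {{x, y}}"
          then have h: "h = {x, y}" by simp
          have "?e \<in> {h \<in> T i. card (h \<inter> ?D') = 1}" unfolding sb by simp
          then have "card ({x, y} \<inter> D) = 1" using cd[OF eV] by simp
          then show "h \<in> {h \<in> X i g \<inter> J j. card (h \<inter> D) = 1}" using eX h by simp
        qed
        moreover have "D \<subseteq> ball x (S j + 1)" unfolding D_def by blast
        ultimately show False using q by blast
      qed
    qed simp
    also have "C * real (card (\<Union>?F)) / real (card (K i)) \<le> 2 * C * bd.rate j"
    proof -
      have "real (card (\<Union>?F)) \<le> 2 * (bd.rate j * real (card (K i)))" using F light[OF ji] unfolding bd.hv_def by linarith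
      then have "C * real (card (\<Union>?F)) \<le> C * (2 * (bd.rate j * real (card (K i))))" using C by (rule mult_left_mono)
      then show ?thesis using card_K[of i] by (simp add: field_simps)
    qed
    finally show ?thesis by simp
  qed
  have "AE H in P. \<exists>j. \<not> ?Q j (edges H \<inter> J j)" by (rule AE_of_rates[OF J le])
  moreover have "AE H in P. H \<in> space P" by simp
  ultimately show ?thesis
  proof eventually_elim
    case (elim H)
    show ?case
    proof
      assume eH: "{x, y} \<in> edges H"
      have HE: "edges H \<subseteq> E" using elim by (simp add: space_P subgraphs_def)
      obtain j where j: "\<not> ?Q j (edges H \<inter> J j)" using elim(1) by blast
      have "{x, y} \<in> J j" using e by (simp add: J_def)
      then obtain D where D: "D \<subseteq> ball x (S j + 1)" "{h \<in> edges H \<inter> J j. card (h \<inter> D) = 1} = {{x, y}}" using j eH by blast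
      \<comment> \<open>Edges outside the window do not meet \<open>D\<close>, so the boundary of
        \<open>D\<close> is decided within the window.\<close>
      have "h \<in> J j" if "h \<in> edges H" "card (h \<inter> D) = 1" for h
      proof -
        have "h \<inter> D \<noteq> {}" using that(2) by auto
        then show ?thesis using that(1) HE D(1) unfolding J_def by blast
      qed
      then have "{h \<in> edges H. card (h \<inter> D) = 1} = {{x, y}}" using D(2) by blast
      moreover have "finite D" by (rule finite_subset[OF D(1) finite_ball[OF xy(1)]])
      moreover have "D \<subseteq> V" by (rule subset_trans[OF D(1) ball_V[OF xy(1)]])
      ultimately show "\<exists>D. finite D \<and> D \<subseteq> V \<and> {h \<in> edges H. card (h \<inter> D) = 1} = {{x, y}}" by blast
    qed
  qed
qed

lemma AE_all:
  "AE H in P. verts H = V \<and> forest (edges H) \<and> (\<forall>x y. {x, y} \<in> E --> conn (edges H) x y) \<and>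
    (\<forall>e\<in>edges H. \<exists>D. finite D \<and> D \<subseteq> V \<and> {h \<in> edges H. card (h \<inter> D) = 1} = {e})"
proof -
  have "AE H in P. \<forall>e\<in>E. \<forall>x y. e = {x, y} --> conn (edges H) x y"
    unfolding AE_ball_countable[OF countable_E]
  proof
    fix e assume e: "e \<in> E"
    then obtain x y where xy: "e = {x, y}" using edgeE by blast
    show "AE H in P. \<forall>x y. e = {x, y} --> conn (edges H) x y"
      using AE_conn[OF e[unfolded xy]]
      by eventually_elim (auto simp: xy doubleton_eq_iff intro: conn_sym)
  qed
  moreover have "AE H in P. \<forall>e\<in>E. e \<in> edges H --> (\<exists>D. finite D \<and> D \<subseteq> V \<and> {h \<in> edges H. card (h \<inter> D) = 1} = {e})"
    unfolding AE_ball_countable[OF countable_E]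
  proof
    fix e assume e: "e \<in> E"
    then obtain x y where xy: "e = {x, y}" using edgeE by blast
    show "AE H in P. e \<in> edges H --> (\<exists>D. finite D \<and> D \<subseteq> V \<and> {h \<in> edges H. card (h \<inter> D) = 1} = {e})"
      using AE_light[OF e[unfolded xy]] by (simp add: xy)
  qed
  moreover have "AE H in P. H \<in> space P" by simp
  moreover note P(3) AE_forest
  ultimately show ?thesis
  proof eventually_elim
    case (elim H)
    have HE: "edges H \<subseteq> E" using elim(3) by (simp add: space_P subgraphs_def)
    show ?case
    proof (intro conjI ballI allI impI)
      show "verts H = V" "forest (edges H)" by (rule elim)+
      show "conn (edges H) x y" if "{x, y} \<in> E" for x y using elim(1) that by blast
      show "\<exists>D. finite D \<and> D \<subseteq> V \<and> {h \<in> edges H. card (h \<inter> D) = 1} = {e}" if "e \<in> edges H" for e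
        using elim(2) HE that by blast
    qed
  qed
qed

section \<open>Invariance of the limit\<close>

text \<open>Moving the window by \<open>f\<close> amounts to translating the random place by
  \<open>f\<close>, and this changes its law by an amount that vanishes along the Foelner
  sequence.\<close>

lemma law_invariant:
  assumes f: "f \<in> Aut" and J: "finite J" "J \<subseteq> E"
  shows "measure P {H \<in> space P. (`) f ` J \<subseteq> edges H} = measure P {H \<in> space P. J \<subseteq> edges H}"
proof -
  have fJ: "finite ((`) f ` J)" "(`) f ` J \<subseteq> E" using J aut_edge[OF f] edge_V by auto
  obtain \<rho> where \<rho>: "f a0 \<in> ball a0 \<rho>" using ex_ball[OF a0 autD(4)[OF f a0]] by blast
  have eq: "{g \<in> Aut. (`) f ` J \<subseteq> X i g} = {g \<in> Aut. compose V g f \<in> {g \<in> Aut. J \<subseteq> X i g}}" for i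
  proof -
    have "(`) f ` J \<subseteq> X i g \<longleftrightarrow> J \<subseteq> X i (compose V g f)" if "g \<in> Aut" for g
    proof -
      have "compose V g f ` e = g ` f ` e" if "e \<in> J" for e using edge_V[of e] that J(2) by (auto simp: compose_def image_image)
      then show ?thesis using fJ(2) J(2) by (auto simp: X_def image_subset_iff)
    qed
    moreover have "compose V g f \<in> Aut" if "g \<in> Aut" for g by (rule aut_compose[OF that f])
    ultimately show ?thesis by (simp cong: conj_cong)
  qed
  have ev: "{g \<in> Aut. J \<subseteq> X i g} \<in> sets (N i)" for i
    using event_N[OF J, of "\<lambda>A. J \<subseteq> A" i] by simp
  have l1: "(\<lambda>k. measure (N (r k)) {g \<in> Aut. (`) f ` J \<subseteq> X (r k) g}) \<longlonglongrightarrow> measure P {H \<in> space P. (`) f ` J \<subseteq> edges H}"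
    using lim_X[OF fJ, of "\<lambda>A. (`) f ` J \<subseteq> A"] by simp
  have l2: "(\<lambda>k. measure (N (r k)) {g \<in> Aut. J \<subseteq> X (r k) g}) \<longlonglongrightarrow> measure P {H \<in> space P. J \<subseteq> edges H}"
    using lim_X[OF J, of "\<lambda>A. J \<subseteq> A"] by simp
  have "(\<lambda>k. measure (N (r k)) {g \<in> Aut. (`) f ` J \<subseteq> X (r k) g} - measure (N (r k)) {g \<in> Aut. J \<subseteq> X (r k) g}) \<longlonglongrightarrow> 0"
    by (rule Lim_null_comparison[OF _ vanish[of "C * real (bnd \<rho>)"]])
      (use shift[OF f \<rho> ev] in \<open>simp add: eq\<close>)
  moreover note tendsto_diff[OF l1 l2]
  ultimately show ?thesis using LIMSEQ_unique by fastforce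
qed

lemma invariant: "invariant_random_subgraph (V, E) P"
  unfolding invariant_random_subgraph_def
proof (intro conjI ballI P(1,2))
  fix f assume f: "f \<in> Aut"
  interpret P: prob_space P by (rule P)
  let ?S = "subgraph_space (V, E)" and ?Om = "subgraphs (V, E)"
  let ?G = "{cyl W J |W J. finite W \<and> W \<subseteq> V \<and> finite J \<and> J \<subseteq> E}"
  have spS: "space ?S = ?Om" by (simp add: subgraph_space_def space_measure_of_conv)
  have GP: "A \<in> sets P" if "A \<in> ?G" for A
    unfolding P(2) subgraphs_sets using that by (rule sigma_sets.Basic)
  have ai: "ainv f \<in> Aut" by (rule ainv(1)[OF f])
  have imG: "ainv f ` W \<subseteq> V" "(`) (ainv f) ` J \<subseteq> E" if "W \<subseteq> V" "J \<subseteq> E" for W J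
    using that autD(4)[OF ai] aut_edge[OF ai] edge_V by auto
  have meas: "graph_image f \<in> measurable P ?S"
    using graph_image_measurable[OF f] measurable_cong_sets[OF P(2) refl] by blast
  have cylP: "emeasure P (cyl W J) = ennreal (measure P {H \<in> space P. J \<subseteq> edges H})"
    if "finite W" "W \<subseteq> V" "finite J" "J \<subseteq> E" for W J
  proof -
    \<comment> \<open>Almost surely all vertices are present, so the vertex part of a cylinder does
      not affect its measure.\<close>
    have "emeasure P (cyl W J) = emeasure P {H \<in> space P. J \<subseteq> edges H}"
    proof (rule emeasure_eq_AE)
      show "AE H in P. H \<in> cyl W J \<longleftrightarrow> H \<in> {H \<in> space P. J \<subseteq> edges H}"
        using P(3) by eventually_elim (use that in \<open>auto simp: cyl_def space_P\<close>)
      show "cyl W J \<in> sets P" using that by (intro GP) blast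
      show "{H \<in> space P. J \<subseteq> edges H} \<in> sets P" using event_P[OF that(3,4), of "\<lambda>A. J \<subseteq> A"] by simp
    qed
    then show ?thesis by (simp add: P.emeasure_eq_measure)
  qed
  have fin: "cyl {} {} = ?Om" by (simp add: cyl_def)
  show "distr P ?S (graph_image f) = P"
  proof (rule measure_eqI_generator_eq[where E="?G" and \<Omega>="?Om" and A="\<lambda>_. ?Om"])
    show "Int_stable ?G"
    proof (rule Int_stableI)
      fix a b assume "a \<in> ?G" "b \<in> ?G"
      then obtain W J W' J' where w: "a = cyl W J" "finite W" "W \<subseteq> V" "finite J" "J \<subseteq> E"
        "b = cyl W' J'" "finite W'" "W' \<subseteq> V" "finite J'" "J' \<subseteq> E" by blast
      have "a \<inter> b = cyl (W \<union> W') (J \<union> J')" by (auto simp: w cyl_def)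
      then show "a \<inter> b \<in> ?G" using w by blast
    qed
    show "?G \<subseteq> Pow ?Om" by (auto simp: cyl_def)
    show "sets (distr P ?S (graph_image f)) = sigma_sets ?Om ?G" by (simp add: subgraphs_sets)
    show "sets P = sigma_sets ?Om ?G" by (simp add: P(2) subgraphs_sets)
    show "range (\<lambda>_::nat. ?Om) \<subseteq> ?G" using fin by blast
    show "(\<Union>i::nat. ?Om) = ?Om" by simp
    show "emeasure (distr P ?S (graph_image f)) ?Om \<noteq> \<infinity>" 
      using prob_space.emeasure_space_1[OF P.prob_space_distr[OF meas]] by (simp add: spS)
    fix A assume "A \<in> ?G"
    then obtain W J where WJ: "A = cyl W J" "finite W" "W \<subseteq> V" "finite J" "J \<subseteq> E" by blast
    let ?J = "(`) (ainv f) ` J"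
    have J': "finite ?J" "?J \<subseteq> E" "finite (ainv f ` W)" "ainv f ` W \<subseteq> V" using WJ imG[OF WJ(3,5)] by auto
    have back_eq: "(`) f ` ?J = J"
    proof -
      have "f ` ainv f ` e = e" if "e \<in> J" for e
      proof -
        have "e \<subseteq> V" using edge_V WJ(5) that by blast
        then have "f ` ainv f ` e = (\<lambda>x. x) ` e"
          unfolding image_image by (intro image_cong[OF refl]) (use ainv(2)[OF f] in blast)
        then show ?thesis by simp
      qed
      then show ?thesis unfolding image_image[of _ _ J] by simp
    qed
    have "A \<in> sets ?S" using GP[of A] \<open>A \<in> ?G\<close> P(2) by blast
    then have "emeasure (distr P ?S (graph_image f)) A = emeasure P (cyl (ainv f ` W) ?J)"
      using meas by (simp add: emeasure_distr WJ(1) space_P cyl_vimage[OF f WJ(3,5)])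
    also have "... = ennreal (measure P {H \<in> space P. ?J \<subseteq> edges H})" by (rule cylP[OF J'(3,4,1,2)])
    also have "... = ennreal (measure P {H \<in> space P. J \<subseteq> edges H})"
      using law_invariant[OF f J'(1,2)] by (simp add: back_eq)
    also have "... = emeasure P A" unfolding WJ(1) by (rule cylP[OF WJ(2-5), symmetric])
    finally show "emeasure (distr P ?S (graph_image f)) A = emeasure P A" .
  qed
qed

end

section \<open>Random places from Haar measure\<close>

text \<open>\<open>N i\<close> is Haar measure conditioned on \<open>g a0 \<in> K i\<close>. This
  event has measure of the order of \<open>card (K i)\<close>, because the orbit of
  \<open>a0\<close> fills a fixed share of \<open>K i\<close> and the stabilizer weights lie between
  \<open>m\<close> and \<open>M\<close>; hence the constant \<open>C\<close>.\<close>

lemma (in qt_graph) ex_weak_trees: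
  assumes un: "unimodular (V, E)" and am: "amenable (V, E)" and one: "one_ended (V, E)"
  shows "\<exists>N K T S a0 C P r. weak_trees V E Rep N K T S a0 C P r"
proof -
  obtain \<mu> w where H: "haar \<mu> w" using ex_haar[OF un] by blast
  note hd = haarD[OF H]
  obtain m M where mM: "0 < m" "m \<le> M" "\<forall>y\<in>V. m \<le> w y \<and> w y \<le> M" using haar_bounds[OF H] by blast
  then have M: "\<forall>y\<in>V. w y \<le> M" and m: "\<forall>y\<in>V. m \<le> w y" by auto
  obtain a0 where a0: "a0 \<in> V" using Rep_nonempty Rep_V by blast
  obtain rr where rr: "\<forall>K. finite K \<and> K \<subseteq> V \<and> 2 * card (bdry K) * bnd rr \<le> card K -->
    (\<forall>z\<in>V. card K \<le> 2 * bnd rr * card {y \<in> K. same_orbit y z})" using ex_orbit_share by blast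
  obtain K0 T0 S where L: "\<forall>i. finite (K0 i) \<and> K0 i \<noteq> {} \<and> K0 i \<subseteq> V \<and> tree (K0 i) (T0 i) \<and> T0 i \<subseteq> E \<and>
    real (card (bdry (K0 i))) * real (Suc i) \<le> real (card (K0 i)) \<and>
    (\<forall>j\<le>i. real (card (bd.far (K0 i) (T0 i) (S j))) \<le> bd.rate j * real (card (K0 i)) \<and>
      real (bd.hv (K0 i) (T0 i) (S j)) \<le> bd.rate j * real (card (K0 i)))"
    using light_sequence[OF H am one] by (elim exE)
  \<comment> \<open>Dropping the first \<open>c0\<close> sets of the sequence makes the boundaries
    small enough for the orbit share.\<close>
  define c0 where "c0 = 2 * bnd rr"
  define K where "K i = K0 (i + c0)" for i
  define T where "T i = T0 (i + c0)" for i
  have Kp: "finite (K i)" "K i \<noteq> {}" "K i \<subseteq> V" "tree (K i) (T i)" "T i \<subseteq> E" for i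
    unfolding K_def T_def using L[rule_format, of "i + c0"] by simp_all
  have fol0: "real (card (bdry (K i))) * real (Suc (i + c0)) \<le> real (card (K i))" for i
    unfolding K_def using L[rule_format, of "i + c0"] by simp
  have fol: "real (card (bdry (K i))) * real (Suc i) \<le> real (card (K i))" for i
    using order_trans[OF mult_left_mono fol0, of "real (Suc i)"] by simp
  have light: "real (card (bd.far (K i) (T i) (S j))) \<le> bd.rate j * real (card (K i)) \<and>
      real (bd.hv (K i) (T i) (S j)) \<le> bd.rate j * real (card (K i))" if "j \<le> i" for i j
    unfolding K_def T_def using L[rule_format, of "i + c0"] that by (meson trans_le_add1)
  have share: "real (card (K i)) \<le> real c0 * real (card {z \<in> K i. same_orbit a0 z})" for i
  proof -
    have "real (card (bdry (K i))) * real c0 \<le> real (card (bdry (K i))) * real (Suc (i + c0))"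
      by (intro mult_left_mono) auto
    with fol0[of i] have "real (card (bdry (K i)) * c0) \<le> real (card (K i))" by simp
    then have "card (bdry (K i)) * c0 \<le> card (K i)" by (simp only: of_nat_le_iff)
    then have "2 * card (bdry (K i)) * bnd rr \<le> card (K i)" by (simp add: c0_def mult_ac)
    then have "card (K i) \<le> c0 * card {y \<in> K i. same_orbit y a0}"
      unfolding c0_def using rr[rule_format, of "K i" a0] Kp(1,3) a0 by simp
    also have "{y \<in> K i. same_orbit y a0} = {z \<in> K i. same_orbit a0 z}"
    proof (rule Collect_cong, rule conj_cong[OF refl])
      fix z assume "z \<in> K i"
      then have z: "z \<in> V" using Kp(3) by blast
      show "same_orbit z a0 = same_orbit a0 z" by (rule iffI[OF same_orbit_sym[OF z] same_orbit_sym[OF a0]])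
    qed
    finally have "real (card (K i)) \<le> real (c0 * card {z \<in> K i. same_orbit a0 z})" by (simp only: of_nat_le_iff)
    then show ?thesis by simp
  qed
  define U where "U i = {g \<in> Aut. g a0 \<in> K i}" for i
  define C where "C = real c0 * M / m"
  have cK: "0 < card (K i)" for i using Kp card_gt_0_iff by blast
  have C0: "0 \<le> C" using mM by (simp add: C_def)
  have U: "U i \<in> sets \<mu>" "emeasure \<mu> (U i) \<le> ennreal (M * real (card (K i)))"
    "ennreal (m * real (card {z \<in> K i. same_orbit a0 z})) \<le> emeasure \<mu> (U i)" for i
    unfolding U_def using hit_upper[OF H M a0 Kp(1)] hit_lower[OF H m a0 Kp(1)] mM(1) by simp_all
  have fin: "emeasure \<mu> {g \<in> Aut. g x \<in> B} < \<infinity>" if "x \<in> V" "finite B" for x B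
    using le_less_trans[OF hit_upper(2)[OF H M that]] by simp
  have Ufin: "emeasure \<mu> (U i) < \<infinity>" for i unfolding U_def by (rule fin[OF a0 Kp(1)])
  have low: "m * real (card (K i)) / real c0 \<le> measure \<mu> (U i) \<and> 0 < real c0" for i
  proof -
    have c: "0 < real c0" using share[of i] cK[of i] by (cases "c0 = 0") auto
    have "m * real (card {z \<in> K i. same_orbit a0 z}) \<le> measure \<mu> (U i)"
      using enn2real_mono[OF U(3)] Ufin mM(1) by (simp add: measure_def)
    moreover have "real (card (K i)) / real c0 \<le> real (card {z \<in> K i. same_orbit a0 z})"
      using share[of i] c by (simp add: field_simps)
    then have "m * (real (card (K i)) / real c0) \<le> m * real (card {z \<in> K i. same_orbit a0 z})"
      using mM(1) by (intro mult_left_mono) auto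
    ultimately show ?thesis using c by simp
  qed
  have mpos: "0 < measure \<mu> (U i)" for i
  proof -
    have "0 < m * real (card (K i)) / real c0" using low[of i] mM(1) cK[of i] by simp
    then show ?thesis using low[of i] by linarith
  qed
  have Une: "emeasure \<mu> (U i) \<noteq> 0" "emeasure \<mu> (U i) \<noteq> \<infinity>" for i
    using mpos[of i] Ufin[of i] by (auto simp: measure_def)
  have ratio: "b / measure \<mu> (U i) \<le> C * real k / real (card (K i))"
    if b: "b \<le> M * real k" for b i and k :: nat
  proof -
    have p: "0 < m * real (card (K i)) / real c0" using low[of i] mM(1) cK[of i] by simp
    have "b / measure \<mu> (U i) \<le> M * real k / measure \<mu> (U i)"
      using b mpos[of i] by (intro divide_right_mono) auto
    also have "... \<le> M * real k / (m * real (card (K i)) / real c0)"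
      using low[of i] mM p by (intro divide_left_mono mult_nonneg_nonneg mult_pos_pos) auto
    also have "... = C * real k / real (card (K i))" by (simp add: C_def)
    finally show ?thesis .
  qed
  define N where "N i = uniform_measure \<mu> (U i)" for i
  have Nm: "measure (N i) A = measure \<mu> (U i \<inter> A) / measure \<mu> (U i)" if "A \<in> sets \<mu>" for i A
    unfolding N_def by (rule measure_uniform_measure[OF Une that])
  have NP: "prob_space (N i)" for i unfolding N_def by (rule prob_space_uniform_measure[OF Une])
  have Nsp: "space (N i) = Aut" "sets (N i) = sets \<mu>" for i by (simp_all add: N_def hd(1))
  have hitN: "measure (N i) {g \<in> Aut. g x \<in> B} \<le> C * real (card B) / real (card (K i))"
    if xB: "x \<in> V" "finite B" for i x B
  proof -
    let ?A = "{g \<in> Aut. g x \<in> B}"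
    have A: "?A \<in> sets \<mu>" by (rule hit_upper(1)[OF H M xB])
    have "measure \<mu> (U i \<inter> ?A) \<le> measure \<mu> ?A"
      using A U(1) fin[OF xB] by (intro measure_mono_fmeasurable) (auto simp: fmeasurable_def)
    also have "... \<le> M * real (card B)"
      using enn2real_mono[OF hit_upper(2)[OF H M xB]] mM by (simp add: measure_def)
    finally show ?thesis unfolding Nm[OF A] by (rule ratio)
  qed
  have baseN: "AE g in N i. g a0 \<in> K i" for i
    unfolding N_def by (rule AE_uniform_measureI[OF U(1)]) (simp add: U_def)
  \<comment> \<open>The conditioning event and its translate by \<open>f\<close> differ only where
    \<open>g a0\<close> or \<open>g (f a0)\<close> lies in \<open>K i\<close> within
    \<open>\<rho>\<close> of its complement. Right invariance of the Haar measure identifies the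
    translated part with \<open>U i \<inter> A\<close>.\<close>
  have shiftN: "{g \<in> Aut. compose V g f \<in> A} \<in> sets (N i) \<and>
      \<bar>measure (N i) {g \<in> Aut. compose V g f \<in> A} - measure (N i) A\<bar> \<le> C * real (bnd \<rho>) / real (Suc i)"
    if f: "f \<in> Aut" and \<rho>: "f a0 \<in> ball a0 \<rho>" and A: "A \<in> sets (N i)" for f \<rho> A i
  proof -
    have Am: "A \<in> sets \<mu>" using A Nsp by simp
    let ?A' = "{g \<in> Aut. compose V g f \<in> A}" and ?U' = "{g \<in> Aut. compose V g f \<in> U i}"
    let ?B = "{a \<in> K i. \<not> ball a \<rho> \<subseteq> K i}"
    let ?D1 = "{g \<in> Aut. g a0 \<in> ?B}" and ?D2 = "{g \<in> Aut. g (f a0) \<in> ?B}"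
    have fa: "f a0 \<in> V" by (rule autD(4)[OF f a0])
    have A': "?A' \<in> sets \<mu>" by (rule hd(6)[OF Am f])
    have B: "finite ?B" using Kp(1) by simp
    note D1 = hit_upper[OF H M a0 B] note D2 = hit_upper[OF H M fa B]
    have cf: "compose V g f a0 = g (f a0)" for g :: "'v => 'v" using a0 by (simp add: compose_def)
    have U'eq: "?U' = {g \<in> Aut. g (f a0) \<in> K i}" unfolding U_def using aut_compose f cf by auto
    have UA: "{g \<in> Aut. compose V g f \<in> U i \<inter> A} = ?U' \<inter> ?A'" by auto
    have U'A: "measure \<mu> (?U' \<inter> ?A') = measure \<mu> (U i \<inter> A)"
      using hd(7)[OF _ f, of "U i \<inter> A"] U(1) Am unfolding UA measure_def by simp
    have U'm: "?U' \<in> sets \<mu>" by (rule hd(6)[OF U(1) f])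
    have U'fin: "emeasure \<mu> ?U' < \<infinity>" unfolding U'eq by (rule fin[OF fa Kp(1)])
    have d1: "U i \<inter> ?A' \<subseteq> (?U' \<inter> ?A') \<union> ?D1"
    proof
      fix g assume g: "g \<in> U i \<inter> ?A'"
      then have gA: "g \<in> Aut" "g a0 \<in> K i" by (auto simp: U_def)
      have "g (f a0) \<in> ball (g a0) \<rho>" by (rule ball_aut[OF gA(1) a0 \<rho>])
      then show "g \<in> (?U' \<inter> ?A') \<union> ?D1" unfolding U'eq using g gA by blast
    qed
    have d2: "?U' \<inter> ?A' \<subseteq> (U i \<inter> ?A') \<union> ?D2"
    proof
      fix g assume g: "g \<in> ?U' \<inter> ?A'"
      then have gA: "g \<in> Aut" "g (f a0) \<in> K i" unfolding U'eq by auto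
      have "g a0 \<in> ball (g (f a0)) \<rho>" by (rule ball_aut[OF gA(1) fa ball_sym[OF \<rho>]])
      then show "g \<in> (U i \<inter> ?A') \<union> ?D2" unfolding U_def using g gA by blast
    qed
    have D: "measure \<mu> ?D1 \<le> M * real (card ?B)" "measure \<mu> ?D2 \<le> M * real (card ?B)"
      using enn2real_mono[OF D1(2)] enn2real_mono[OF D2(2)] mM by (simp_all add: measure_def)
    have fm: "U i \<inter> ?A' \<in> fmeasurable \<mu>" "?U' \<inter> ?A' \<in> fmeasurable \<mu>" "?D1 \<in> fmeasurable \<mu>" "?D2 \<in> fmeasurable \<mu>"
      using U(1) A' U'm Ufin U'fin fin[OF a0 B] fin[OF fa B] D1(1) D2(1)
      by (auto intro!: fmeasurable_Int_fmeasurable simp: fmeasurableI)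
    have "measure \<mu> (U i \<inter> ?A') \<le> measure \<mu> ((?U' \<inter> ?A') \<union> ?D1)"
      using d1 fm by (intro measure_mono_fmeasurable) (auto intro: fmeasurable.Un)
    also have "... \<le> measure \<mu> (?U' \<inter> ?A') + measure \<mu> ?D1" using fm by (intro measure_Un_le) auto
    finally have le1: "measure \<mu> (U i \<inter> ?A') - measure \<mu> (U i \<inter> A) \<le> M * real (card ?B)" using U'A D by linarith
    have "measure \<mu> (?U' \<inter> ?A') \<le> measure \<mu> ((U i \<inter> ?A') \<union> ?D2)"
      using d2 fm by (intro measure_mono_fmeasurable) (auto intro: fmeasurable.Un)
    also have "... \<le> measure \<mu> (U i \<inter> ?A') + measure \<mu> ?D2" using fm by (intro measure_Un_le) auto
    finally have le2: "measure \<mu> (U i \<inter> A) - measure \<mu> (U i \<inter> ?A') \<le> M * real (card ?B)" using U'A D by linarith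
    have "\<bar>measure \<mu> (U i \<inter> ?A') - measure \<mu> (U i \<inter> A)\<bar> \<le> M * real (card ?B)" using le1 le2 by linarith
    from ratio[OF this, of i]
    have "\<bar>measure (N i) ?A' - measure (N i) A\<bar> \<le> C * real (card ?B) / real (card (K i))"
      unfolding Nm[OF A'] Nm[OF Am] diff_divide_distrib[symmetric] abs_divide using mpos[of i] by simp
    also have "... \<le> C * real (bnd \<rho>) / real (Suc i)" by (rule near_bdry_rate[OF Kp(1,3) cK fol C0])
    finally show ?thesis using A' Nsp by simp
  qed
  have Ns: "{g \<in> Aut. g x = z} \<in> sets (N i)" if "x \<in> V" for x z i using hd(2)[OF that] Nsp by simp
  have ev: "{g \<in> space (N i). e \<in> {e \<in> E. g ` e \<in> T i}} \<in> sets (N i)" if e: "e \<in> E" for i e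
    using pullback_event[OF Kp(4,1) Ns e] e by (simp add: Nsp)
  have E2: "e \<subseteq> V \<and> card e = 2" if "e \<in> E" for e using edgeE[OF that] by auto
  obtain r P where rP: "strict_mono (r :: nat => nat)" "prob_space P" "sets P = sets (subgraph_space (V, E))"
    "AE H in P. verts H = V"
    "\<And>J Q. finite J ==> J \<subseteq> E ==> (\<lambda>k. measure (N (r k)) {g \<in> space (N (r k)). Q ({e \<in> E. g ` e \<in> T (r k)} \<inter> J)}) \<longlonglongrightarrow>
      measure P {H \<in> space P. Q (edges H \<inter> J)}"
    using weak_limit[of V E N "\<lambda>i g. {e \<in> E. g ` e \<in> T i}", OF countable_V countable_E E2 NP ev] by blast
  have "weak_trees V E Rep N K T S a0 C P r"
    by (rule weak_trees.intro[OF qt_graph_axioms], rule weak_trees_axioms.intro)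
      (rule Kp a0 fol light NP Nsp Ns baseN hitN shiftN C0 rP(1-4) rP(5)[unfolded Nsp] | assumption)+
  then show ?thesis by (intro exI)
qed

section \<open>From invariant trees to amenability\<close>

lemma reachable_conn: "reachable G = conn (edges G)"
  by (simp add: reachable_def conn_def)

lemma conn_leave:
  assumes "conn F x y" "x \<in> D" "y \<notin> D"
  obtains p q where "{p, q} \<in> F" "p \<in> D" "q \<notin> D"
proof -
  have ne: "(x \<in> D) \<noteq> (y \<in> D)" using assms by simp
  obtain p q where pq: "{p, q} \<in> F" "conn F x p" "(p \<in> D) \<noteq> (q \<in> D)" by (rule conn_cross[OF assms(1) ne])
  show thesis
  proof (cases "p \<in> D")
    case True
    then show ?thesis using that pq by blast
  next
    case False
    then show ?thesis using that[of q p] pq by (simp add: insert_commute)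
  qed
qed

lemma forest_no_cycle:
  assumes F: "forest (edges G)" shows "\<not> is_cycle G p"
proof
  assume p: "is_cycle G p"
  then have n: "3 \<le> length p" and d: "distinct p"
    and ed: "\<And>i. i < length p ==> {p ! i, p ! (Suc i mod length p)} \<in> edges G" by (auto simp: is_cycle_def)
  let ?n = "length p - 1"
  let ?e = "{p ! ?n, p ! 0}"
  have "Suc ?n = length p" using n by linarith
  then have "Suc ?n mod length p = 0" by (simp only: mod_self)
  then have e: "?e \<in> edges G" using ed[of ?n] n by (metis diff_less less_le_trans zero_less_numeral zero_less_one)
  have "conn (edges G - {?e}) (p ! i) (p ! 0)" if "i \<le> ?n" for i
    using that
  proof (induction i)
    case (Suc i)
    have i: "Suc i < length p" using Suc.prems n by linarith
    have "{p ! Suc i, p ! i} \<in> edges G" using ed[of i] i by (simp add: insert_commute)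
    moreover have "{p ! Suc i, p ! i} \<noteq> ?e"
    proof
      assume "{p ! Suc i, p ! i} = ?e"
      then have "p ! Suc i = p ! ?n \<and> p ! i = p ! 0 \<or> p ! Suc i = p ! 0 \<and> p ! i = p ! ?n"
        by (auto simp: doubleton_eq_iff)
      moreover have "p ! Suc i \<noteq> p ! 0" 
      proof -
        have "0 < length p" using i by linarith
        from nth_eq_iff_index_eq[OF d i this] show ?thesis by simp
      qed
      moreover have "p ! i = p ! 0 \<longleftrightarrow> i = 0" by (rule nth_eq_iff_index_eq[OF d]) (use i in auto)
      moreover have "p ! Suc i = p ! ?n \<longleftrightarrow> Suc i = ?n" by (rule nth_eq_iff_index_eq[OF d]) (use i in auto)
      ultimately show False using n by linarith
    qed
    ultimately have "conn (edges G - {?e}) (p ! Suc i) (p ! i)" by (intro conn_edge) simp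
    from conn_trans[OF this Suc.IH] show ?case using Suc.prems by simp
  qed simp
  then have "conn (edges G - {?e}) (p ! ?n) (p ! 0)" by blast
  then show False using F e unfolding forest_def by blast
qed

text \<open>A shortest detour between the ends of an edge repeats no vertex, since the stretch
  between two occurrences could be cut out. Closed up by the edge it would be a cycle.\<close>

lemma tree_of_is_tree:
  assumes "is_tree G" shows "tree (verts G) (edges G)"
proof
  have sg: "\<And>e. e \<in> edges G ==> e \<subseteq> verts G \<and> card e = 2" and cg: "connected_graph G" and nc: "\<And>p. \<not> is_cycle G p"
    using assms by (auto simp: is_tree_def simple_graph_def)
  show "\<exists>u v. u \<in> verts G \<and> v \<in> verts G \<and> u \<noteq> v \<and> e = {u, v}" if "e \<in> edges G" for e
    using sg[OF that] by (auto simp: card_2_iff)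
  show "conn (edges G) x y" if "x \<in> verts G" "y \<in> verts G" for x y
    using cg that by (simp add: connected_graph_def reachable_conn)
  fix u v assume uv: "{u, v} \<in> edges G"
  show "\<not> conn (edges G - {{u, v}}) u v"
  proof
    let ?R = "\<lambda>x y. {x, y} \<in> edges G - {{u, v}}"
    assume "conn (edges G - {{u, v}}) u v"
    then have "\<exists>n. (?R ^^ n) u v" by (simp add: conn_def rtranclp_imp_relpowp)
    then obtain n where n: "(?R ^^ n) u v" "\<forall>m<n. \<not> (?R ^^ m) u v" using exists_least_iff[of "\<lambda>n. (?R ^^ n) u v"] by blast
    then obtain f where f: "f 0 = u" "f n = v" "\<forall>i<n. ?R (f i) (f (Suc i))"
      unfolding relpowp_fun_conv by blast
    have inj: "f i \<noteq> f j" if ij: "i < j" "j \<le> n" for i j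
    proof
      assume eq: "f i = f j"
      let ?g = "\<lambda>k. if k \<le> i then f k else f (k + (j - i))"
      have "(?R ^^ (n - (j - i))) u v"
        unfolding relpowp_fun_conv
      proof (rule exI[of _ ?g], intro conjI allI impI)
        show "?g 0 = u" using f by simp
        show "?g (n - (j - i)) = v"
        proof (cases "j = n")
          case True
          then show ?thesis using eq ij f(2) by simp
        next
          case False
          then have "\<not> n - (j - i) \<le> i" "n - (j - i) + (j - i) = n" using ij by auto
          then show ?thesis using f(2) by simp
        qed
        fix k assume k: "k < n - (j - i)"
        show "?R (?g k) (?g (Suc k))"
        proof (cases "Suc k \<le> i")
          case True
          then show ?thesis using f(3) ij by simp
        next
          case False
          show ?thesis
          proof (cases "k = i")
            case True
            then have "j < n" using k ij by linarith
            moreover have "?g (Suc k) = f (Suc j)" using True ij by (simp add: Suc_diff_le)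
            moreover have "?g k = f j" using True eq by simp
            ultimately show ?thesis using f(3) by simp
          next
            case ki: False
            then have "?g k = f (k + (j - i))" "?g (Suc k) = f (Suc (k + (j - i)))" using False by auto
            moreover have "k + (j - i) < n" using k by linarith
            ultimately show ?thesis using f(3) by simp
          qed
        qed
      qed
      moreover have "n - (j - i) < n" using ij by linarith
      ultimately show False using n(2) by blast
    qed
    have n2: "2 \<le> n"
    proof (rule ccontr)
      assume "\<not> 2 \<le> n"
      then consider "n = 0" | "n = 1" by linarith
      then show False
      proof cases
        case 1
        then have "u = v" using f by simp
        then show False using sg[OF uv] by simp
      next
        case 2
        then show False using f by auto
      qed
    qed
    define p where "p = map f [0..<Suc n]"
    have len: "length p = Suc n" by (simp add: p_def)
    have nth: "p ! i = f i" if "i \<le> n" for i using that unfolding p_def by (simp del: upt_Suc add: less_Suc_eq_le)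
    have "is_cycle G p"
      unfolding is_cycle_def
    proof (intro conjI allI impI)
      show "3 \<le> length p" using n2 len by simp
      have "inj_on f {0..<Suc n}"
      proof (rule inj_onI)
        fix i j assume "i \<in> {0..<Suc n}" "j \<in> {0..<Suc n}" "f i = f j"
        then show "i = j" using inj[of i j] inj[of j i] by (cases i j rule: linorder_cases) auto
      qed
      then show "distinct p" unfolding p_def distinct_map by (simp del: upt_Suc)
      fix i assume i: "i < length p"
      show "{p ! i, p ! (Suc i mod length p)} \<in> edges G"
      proof (cases "i = n")
        case True
        then show ?thesis using nth[of n] nth[of 0] f uv len by (simp add: insert_commute)
      next
        case False
        then have "i < n" using i len by simp
        then show ?thesis using nth[of i] nth[of "Suc i"] f(3) len by simp
      qed
    qed
    then show False using nc by blast
  qed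
qed

section \<open>Ends of graphs and of spanning subgraphs\<close>

context lf_graph
begin

definition away :: "'v set set => 'v set => 'v set set" where "away F S = {e \<in> F. e \<inter> S = {}}"

definition comp :: "'v set set => 'v set => 'v => 'v set" where
  "comp F S u = {v \<in> V - S. conn (away F S) u v}"

definition connects :: "'v set set => bool" where
  "connects F \<longleftrightarrow> F \<subseteq> E \<and> (\<forall>x\<in>V. \<forall>y\<in>V. conn F x y)"

lemma components_comp: "components_of (delete_verts (V, F) S) = comp F S ` (V - S)"
  by (simp add: components_of_def delete_verts_def comp_def away_def reachable_conn)

text \<open>A walk from any remaining vertex to a point of the deleted set leaves its component at a
  neighbour of that set, and there are finitely many such neighbours.\<close>

lemma comps_cover:
  assumes F: "connects F" and S: "finite S" "S \<subseteq> V"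
  obtains N where "finite N" "N \<subseteq> V - S" "\<And>x. x \<in> V - S ==> \<exists>p\<in>N. conn (away F S) x p"
proof (cases "S = {}")
  case True
  obtain v0 where v0: "v0 \<in> V" using infinite_V by (metis ex_in_conv finite.emptyI)
  have "away F S = F" using True by (simp add: away_def)
  then have "\<exists>p\<in>{v0}. conn (away F S) x p" if "x \<in> V - S" for x using F v0 that by (simp add: connects_def)
  with that[of "{v0}"] True v0 show thesis by simp
next
  case False
  then obtain s where s: "s \<in> S" by blast
  let ?N = "{p \<in> V - S. \<exists>q\<in>S. {p, q} \<in> F}"
  have FE: "F \<subseteq> E" using F by (simp add: connects_def)
  have "?N \<subseteq> (\<Union>q\<in>S. nbr q)" 
  proof
    fix p assume "p \<in> ?N"
    then obtain q where "q \<in> S" "{q, p} \<in> E" using FE by (auto simp: insert_commute)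
    then show "p \<in> (\<Union>q\<in>S. nbr q)" by (auto simp: nbr_def)
  qed
  then have fin: "finite ?N" by (rule finite_subset) (use S finite_nbr in auto)
  have "\<exists>p\<in>?N. conn (away F S) x p" if x: "x \<in> V - S" for x
  proof -
    let ?c = "\<lambda>z. z \<in> comp F S x"
    have c: "?c x" "\<not> ?c s" using x s by (auto simp: comp_def)
    have xs: "conn F x s" using F x s S by (auto simp: connects_def)
    obtain p q where pq: "{p, q} \<in> F" "?c p" "\<not> ?c q" by (rule conn_leave[OF xs c])
    have V: "p \<in> V" "q \<in> V" using pq(1) FE edge_dest by auto
    have p: "p \<notin> S" "conn (away F S) x p" using pq(2) by (auto simp: comp_def)
    have "q \<in> S"
    proof (rule ccontr)
      assume q: "q \<notin> S"
      then have "{p, q} \<in> away F S" using pq(1) p(1) by (simp add: away_def)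
      from conn_trans[OF p(2) conn_edge[OF this]] show False using pq(3) q V by (simp add: comp_def)
    qed
    then have "p \<in> ?N" using pq(1) V p(1) by blast
    then show ?thesis using p(2) by blast
  qed
  with that[of ?N] fin show thesis by blast
qed

lemma infinite_comp:
  assumes F: "connects F" and S: "finite S" "S \<subseteq> V"
    and Y: "infinite Y" "Y \<subseteq> V - S"
  obtains p z where "p \<in> V - S" "infinite (comp F S p)" "z \<in> Y" "conn (away F S) p z"
proof -
  obtain N where N: "finite N" "N \<subseteq> V - S" "\<And>x. x \<in> V - S ==> \<exists>p\<in>N. conn (away F S) x p"
    using comps_cover[OF F S] by blast
  have "Y \<subseteq> (\<Union>p\<in>N. comp F S p \<inter> Y)"
  proof
    fix x assume x: "x \<in> Y"
    then have xV: "x \<in> V - S" using Y by blast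
    obtain p where p: "p \<in> N" "conn (away F S) x p" using N(3)[OF xV] by blast
    have "x \<in> comp F S p" using conn_sym[OF p(2)] xV by (simp add: comp_def)
    then show "x \<in> (\<Union>p\<in>N. comp F S p \<inter> Y)" using p(1) x by blast
  qed
  then have "infinite (\<Union>p\<in>N. comp F S p \<inter> Y)" using Y(1) finite_subset by blast
  then obtain p where p: "p \<in> N" "infinite (comp F S p \<inter> Y)" using N(1) by blast
  then obtain z where z: "z \<in> comp F S p \<inter> Y" by (metis ex_in_conv finite.emptyI)
  have "infinite (comp F S p)" using p(2) by (metis finite_Int)
  then show thesis using that[of p z] p(1) N(2) z by (auto simp: comp_def)
qed

lemma one_endedD:
  assumes "one_ended (V, F)" "finite S" "S \<subseteq> V" "u \<in> V - S" "v \<in> V - S"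
    "infinite (comp F S u)" "infinite (comp F S v)"
  shows "conn (away F S) u v"
proof -
  have "\<exists>!C. C \<in> comp F S ` (V - S) \<and> infinite C"
    using assms(1-3) unfolding one_ended_def components_comp by simp
  then have "comp F S u = comp F S v" using assms(4-7) by blast
  moreover have "v \<in> comp F S v" using assms(5) by (simp add: comp_def)
  ultimately have "v \<in> comp F S u" by simp
  then show ?thesis by (simp add: comp_def)
qed

lemma one_endedI:
  assumes F: "connects F"
    and u: "\<And>S u v. finite S ==> S \<subseteq> V ==> u \<in> V - S ==> v \<in> V - S ==> infinite (comp F S u) ==>
      infinite (comp F S v) ==> conn (away F S) u v"
  shows "one_ended (V, F)"
  unfolding one_ended_def components_comp
proof (intro allI impI)
  fix S assume "finite S \<and> S \<subseteq> verts (V, F)"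
  then have S: "finite S" "S \<subseteq> V" by auto
  have inf: "infinite (V - S)" using infinite_V S by simp
  obtain p where p: "p \<in> V - S" "infinite (comp F S p)" by (rule infinite_comp[OF F S inf subset_refl])
  show "\<exists>!C. C \<in> comp F S ` (V - S) \<and> infinite C"
  proof (rule ex1I[of _ "comp F S p"])
    show "comp F S p \<in> comp F S ` (V - S) \<and> infinite (comp F S p)" using p by blast
    fix C assume "C \<in> comp F S ` (V - S) \<and> infinite C"
    then obtain q where q: "q \<in> V - S" "C = comp F S q" "infinite (comp F S q)" by blast
    have c: "conn (away F S) p q" by (rule u[OF S p(1) q(1) p(2) q(3)])
    have "conn (away F S) q v = conn (away F S) p v" for v
      by (rule iffI[OF conn_trans[OF c] conn_trans[OF conn_sym[OF c]]])
    then show "C = comp F S p" unfolding q(2) comp_def by simp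
  qed
qed

text \<open>Since deleting a finite set leaves only finitely many components of the subgraph, each
  infinite component of the larger graph meets an infinite one of the subgraph, and the latter are
  all joined.\<close>

lemma one_ended_supergraph:
  assumes F: "connects F" and one: "one_ended (V, F)"
  shows "one_ended (V, E)"
proof (rule one_endedI)
  show "connects E" using connected by (simp add: connects_def)
  fix S u v assume S: "finite S" "S \<subseteq> V" and uv: "u \<in> V - S" "v \<in> V - S"
    and inf: "infinite (comp E S u)" "infinite (comp E S v)"
  have sub: "away F S \<subseteq> away E S" using F by (auto simp: away_def connects_def)
  have cV: "comp E S x \<subseteq> V - S" for x by (auto simp: comp_def)
  obtain p z where p: "p \<in> V - S" "infinite (comp F S p)" "z \<in> comp E S u" "conn (away F S) p z"
    by (rule infinite_comp[OF F S inf(1) cV])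
  obtain q y where q: "q \<in> V - S" "infinite (comp F S q)" "y \<in> comp E S v" "conn (away F S) q y"
    by (rule infinite_comp[OF F S inf(2) cV])
  have pq: "conn (away F S) p q" by (rule one_endedD[OF one S p(1) q(1) p(2) q(2)])
  have "conn (away F S) z y" by (rule conn_trans[OF conn_trans[OF conn_sym[OF p(4)] pq] q(4)])
  then have zy: "conn (away E S) z y" by (rule conn_mono[OF _ sub])
  have uz: "conn (away E S) u z" and vy: "conn (away E S) v y" using p(3) q(3) by (auto simp: comp_def)
  show "conn (away E S) u v" by (rule conn_trans[OF conn_trans[OF uz zy] conn_sym[OF vy]])
qed

lemma tree_connects: "tree V F ==> F \<subseteq> E ==> connects F"
  by (simp add: connects_def tree.connected)

lemma bdry_Int: "F \<subseteq> E ==> {h \<in> F. card (h \<inter> D) = 1} = F \<inter> bdry D"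
  by (auto simp: bdry_def)

lemma no_cross:
  assumes "conn F x y" "x \<in> D" "F \<subseteq> E" "F \<inter> bdry D = {}" shows "y \<in> D"
proof (rule ccontr)
  assume y: "y \<notin> D"
  obtain p q where pq: "{p, q} \<in> F" "p \<in> D" "q \<notin> D" by (rule conn_leave[OF assms(1,2) y])
  have "{p, q} \<in> bdry D" using pq assms(3) by (intro bdryI) auto
  then show False using pq(1) assms(4) by blast
qed

text \<open>If two infinite components were separated by \<open>S\<close>, some edge on the tree
  path between them would meet \<open>S\<close> and have them on different sides. One of the two
  would then lie inside the finite set cut off by this edge.\<close>

lemma tree_one_ended:
  assumes t: "tree V F" and FE: "F \<subseteq> E" and fin: "\<And>e. e \<in> F ==> \<exists>D. finite D \<and> F \<inter> bdry D = {e}"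
  shows "one_ended (V, F)"
proof (rule one_endedI[OF tree_connects[OF t FE]])
  interpret t: tree V F by (rule t)
  fix S u v assume S: "finite S" "S \<subseteq> V" and uv: "u \<in> V - S" "v \<in> V - S"
    and inf: "infinite (comp F S u)" "infinite (comp F S v)"
  show "conn (away F S) u v"
  proof (rule ccontr)
    assume nc: "\<not> conn (away F S) u v"
    have V: "u \<in> V" "v \<in> V" using uv by auto
    have c: "u \<in> comp F S u" "v \<notin> comp F S u" using nc uv by (auto simp: comp_def)
    obtain p q where pq: "{p, q} \<in> t.P u v" "p \<in> comp F S u" "q \<notin> comp F S u"
      by (rule conn_leave[OF t.conn_P[OF V] c])
    let ?e = "{p, q}"
    have eF: "?e \<in> F" and sep: "t.sep ?e u v" using pq(1) by (auto simp: t.P_def)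
    have "?e \<inter> S \<noteq> {}"
    proof
      assume no: "?e \<inter> S = {}"
      then have a: "?e \<in> away F S" using eF by (simp add: away_def)
      have c1: "conn (away F S) p q" by (rule conn_edge[OF a])
      have pqV: "p \<in> V - S" "q \<in> V - S" using no FE eF edge_dest[of p q] by auto
      have "conn (away F S) u p = conn (away F S) u q"
        by (rule iffI[OF conn_trans[OF _ c1] conn_trans[OF _ conn_sym[OF c1]]])
      then show False using pq(2,3) pqV by (simp add: comp_def)
    qed
    then have sub: "away F S \<subseteq> F - {?e}" by (auto simp: away_def)
    obtain D where D: "finite D" "F \<inter> bdry D = {?e}" using fin[OF eF] by blast
    have "u \<in> D \<or> v \<in> D"
    proof (rule ccontr)
      assume no: "\<not> (u \<in> D \<or> v \<in> D)"
      have "?e \<in> bdry D" using D(2) by blast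
      then obtain a b where ab: "?e = {a, b}" "a \<in> D" "b \<notin> D" "a \<in> V" using bdry_dest by metis
      have abF: "{a, b} \<in> F" using eF ab(1) by simp
      have "\<not> t.sep {a, b} a u \<or> \<not> t.sep {a, b} b u" by (rule t.two_sides[OF abF V(1)])
      moreover have "\<not> t.sep {a, b} a v \<or> \<not> t.sep {a, b} b v" by (rule t.two_sides[OF abF V(2)])
      moreover have "\<not> (\<not> t.sep {a, b} b u \<and> \<not> t.sep {a, b} b v)"
      proof
        assume c: "\<not> t.sep {a, b} b u \<and> \<not> t.sep {a, b} b v"
        then have "\<not> t.sep {a, b} u b" using t.sep_sym[of "{a, b}" u b] by simp
        from t.not_sep_trans[OF this conjunct2[OF c]] show False using sep ab(1) by simp
      qed
      ultimately have "\<not> t.sep {a, b} a u \<or> \<not> t.sep {a, b} a v" by argo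
      then have "\<not> t.sep ?e a u \<or> \<not> t.sep ?e a v" unfolding ab(1) .
      then have "conn (F - {?e}) a u \<or> conn (F - {?e}) a v" by (simp add: t.sep_def)
      moreover have nb: "(F - {?e}) \<inter> bdry D = {}" "F - {?e} \<subseteq> E" using D(2) FE by auto
      ultimately show False using no_cross[OF _ ab(2) nb(2,1)] no by blast
    qed
    moreover have "comp F S w \<subseteq> D" if "w \<in> D" for w
    proof
      fix z assume "z \<in> comp F S w"
      then have "conn (F - {?e}) w z" using conn_mono[OF _ sub] by (simp add: comp_def)
      then show "z \<in> D" by (rule no_cross[OF _ that]) (use D(2) FE in auto)
    qed
    ultimately show False using inf D(1) finite_subset by blast
  qed
qed

text \<open>If both sides of the edge were infinite, deleting its end \<open>a\<close> would leave
  an infinite component on either side. One-endedness would join them without the edge, although the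
  edge separates the sides.\<close>

lemma finite_side:
  assumes t: "tree V F" and FE: "F \<subseteq> E" and one: "one_ended (V, F)" and e: "e \<in> F"
  shows "\<exists>D. finite D \<and> D \<subseteq> V \<and> F \<inter> bdry D = {e}"
proof -
  interpret t: tree V F by (rule t)
  obtain a b where ab: "e = {a, b}" "a \<in> V" "b \<in> V" "a \<noteq> b" using tree.edgeE[OF t e] by blast
  have sV: "t.side e x \<subseteq> V" for x by (auto simp: t.side_def)
  have "finite (t.side e a) \<or> finite (t.side e b)"
  proof (rule ccontr)
    assume "\<not> (finite (t.side e a) \<or> finite (t.side e b))"
    then have inf: "infinite (t.side e a)" "infinite (t.side e b)" by auto
    let ?S = "{a}"
    have S: "finite ?S" "?S \<subseteq> V" using ab by auto
    have na: "away F ?S \<subseteq> F - {e}" using ab by (auto simp: away_def)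
    have ns: "\<not> t.sep e x y" if "conn (away F ?S) x y" for x y
      using conn_mono[OF that na] by (simp add: t.sep_def)
    have sab: "t.sep e a b" by (rule t.sep_ends[OF ab(1) e])
    have cn: "connects F" by (rule tree_connects[OF t FE])
    have nb: "a \<notin> t.side e b" using sab t.sep_sym[of e a b] by (simp add: t.side_def)
    have i1: "infinite (t.side e a - ?S)" "t.side e a - ?S \<subseteq> V - ?S" using inf sV by auto
    have i2: "infinite (t.side e b)" "t.side e b \<subseteq> V - ?S" using inf nb sV[of b] by auto
    obtain p z where p: "p \<in> V - ?S" "infinite (comp F ?S p)" "z \<in> t.side e a - ?S" "conn (away F ?S) p z"
      by (rule infinite_comp[OF cn S i1])
    obtain q y where q: "q \<in> V - ?S" "infinite (comp F ?S q)" "y \<in> t.side e b" "conn (away F ?S) q y"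
      by (rule infinite_comp[OF cn S i2])
    have pq: "conn (away F ?S) p q" by (rule one_endedD[OF one S p(1) q(1) p(2) q(2)])
    have zy: "\<not> t.sep e z y" by (rule ns[OF conn_trans[OF conn_trans[OF conn_sym[OF p(4)] pq] q(4)]])
    have az: "\<not> t.sep e a z" and yb: "\<not> t.sep e y b" using p(3) q(3) t.sep_sym[of e y b] by (auto simp: t.side_def)
    show False using t.not_sep_trans[OF t.not_sep_trans[OF az zy] yb] sab by blast
  qed
  then obtain x where x: "x \<in> V" "finite (t.side e x)" using ab by blast
  show ?thesis
    using t.side_boundary[OF e x(1)] x(2) sV bdry_Int[OF FE] by (intro exI[of _ "t.side e x"]) simp
qed

lemma big_connected_set:
  assumes F: "connects F" and x: "x \<in> V"
  shows "\<exists>S. finite S \<and> S \<subseteq> V \<and> x \<in> S \<and> n \<le> card S \<and> (\<forall>u\<in>S. conn {e \<in> F. e \<subseteq> S} x u)"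
proof (induction n)
  case 0
  then show ?case using x by (intro exI[of _ "{x}"]) simp
next
  case (Suc n)
  then obtain S where S: "finite S" "S \<subseteq> V" "x \<in> S" "n \<le> card S" "\<forall>u\<in>S. conn {e \<in> F. e \<subseteq> S} x u" by blast
  have "V - S \<noteq> {}" using Diff_infinite_finite[OF S(1) infinite_V] by (metis finite.emptyI)
  then obtain y where y: "y \<in> V" "y \<notin> S" by blast
  have xy: "conn F x y" using F x y by (simp add: connects_def)
  obtain p q where pq: "{p, q} \<in> F" "p \<in> S" "q \<notin> S" by (rule conn_leave[OF xy S(3) y(2)])
  let ?S = "insert q S"
  have q: "q \<in> V" using pq(1) F edge_dest by (auto simp: connects_def)
  have m: "conn {e \<in> F. e \<subseteq> ?S} x u" if "u \<in> S" for u
    by (rule conn_mono[OF S(5)[rule_format, OF that]]) blast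
  have "{p, q} \<in> {e \<in> F. e \<subseteq> ?S}" using pq by simp
  from conn_trans[OF m[OF pq(2)] conn_edge[OF this]] have "conn {e \<in> F. e \<subseteq> ?S} x q" .
  then show ?case using S pq q m by (intro exI[of _ ?S]) auto
qed

section \<open>Clusters of light edges\<close>

text \<open>Any finite set with \<open>e\<close> as its only boundary edge in \<open>F\<close> may
  serve as a witness; in a spanning tree such a set is one of the two sides of \<open>e\<close>. In
  this form measurability in \<open>F\<close> and equivariance under automorphisms are
  immediate.\<close>

definition light :: "nat => 'v set set => 'v set set" where
  "light n F = {e. \<exists>D. finite D \<and> D \<subseteq> V \<and> card D < n \<and> F \<inter> bdry D = {e}}"

lemma light_subset: "light n F \<subseteq> F" by (auto simp: light_def)

lemma light_mono: "m \<le> n ==> light m F \<subseteq> light n F"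
  unfolding light_def by (auto dest: less_le_trans)

lemma finite_cluster:
  assumes t: "tree V F" and FE: "F \<subseteq> E" and one: "one_ended (V, F)" and x: "x \<in> V"
  shows "finite {y \<in> V. conn (light n F) x y}"
proof (rule ccontr)
  assume inf: "infinite {y \<in> V. conn (light n F) x y}"
  have cn: "connects F" by (rule tree_connects[OF t FE])
  obtain S where S: "finite S" "S \<subseteq> V" "x \<in> S" "n \<le> card S" "\<forall>u\<in>S. conn {e \<in> F. e \<subseteq> S} x u"
    using big_connected_set[OF cn x, of n] by blast
  have i: "infinite ({y \<in> V. conn (light n F) x y} - S)" using inf S(1) by simp
  have iS: "{y \<in> V. conn (light n F) x y} - S \<subseteq> V - S" by blast
  obtain p y where p: "p \<in> V - S" "infinite (comp F S p)" "y \<in> {y \<in> V. conn (light n F) x y} - S" "conn (away F S) p y"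
    by (rule infinite_comp[OF cn S(1,2) i iS])
  let ?C = "comp F S p"
  have y: "y \<in> ?C" "conn (light n F) x y" using p by (auto simp: comp_def)
  have xC: "x \<notin> ?C" using S(3) by (simp add: comp_def)
  obtain b a where "{b, a} \<in> light n F" "b \<in> ?C" "a \<notin> ?C" by (rule conn_leave[OF conn_sym[OF y(2)] y(1) xC])
  then have ab: "{a, b} \<in> light n F" "a \<notin> ?C" "b \<in> ?C" by (simp_all add: insert_commute)
  have abF: "{a, b} \<in> F" using ab(1) light_subset by blast
  have aV: "a \<in> V" using abF FE edge_dest by blast
  have b: "b \<notin> S" "conn (away F S) p b" using ab(3) by (auto simp: comp_def)
  have aS: "a \<in> S"
  proof (rule ccontr)
    assume a: "a \<notin> S"
    then have "{b, a} \<in> away F S" using abF b(1) by (simp add: away_def insert_commute)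
    from conn_trans[OF b(2) conn_edge[OF this]] show False using ab(2) a aV by (simp add: comp_def)
  qed
  obtain D where D: "finite D" "card D < n" "F \<inter> bdry D = {{a, b}}" using ab(1) by (auto simp: light_def)
  have "{a, b} \<in> bdry D" using D(3) by blast
  then obtain u v where "{a, b} = {u, v}" "u \<in> D" "v \<notin> D" by (rule bdry_dest)
  then have ed: "(a \<in> D) \<noteq> (b \<in> D)" by (auto simp: doubleton_eq_iff)
  show False
  \<comment> \<open>The witness \<open>D\<close> contains either the infinite component at
    \<open>b\<close> or, through \<open>a\<close>, the whole connected set \<open>S\<close>. It is
    too small for both.\<close>
  proof (cases "b \<in> D")
    case True
    have "?C \<subseteq> D"
    proof
      fix z assume "z \<in> ?C"
      then have "conn (away F S) b z" using conn_trans[OF conn_sym[OF b(2)]] by (simp add: comp_def)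
      then show "z \<in> D"
      proof (rule no_cross[OF _ True])
        show "away F S \<subseteq> E" using FE by (auto simp: away_def)
        show "away F S \<inter> bdry D = {}" using D(3) aS unfolding away_def by blast
      qed
    qed
    then show False using p(2) D(1) finite_subset by blast
  next
    case False
    then have aD: "a \<in> D" using ed by blast
    have "S \<subseteq> D"
    proof
      fix z assume z: "z \<in> S"
      have "conn {e \<in> F. e \<subseteq> S} a z"
        by (rule conn_trans[OF conn_sym[OF S(5)[rule_format, OF aS]] S(5)[rule_format, OF z]])
      then show "z \<in> D"
      proof (rule no_cross[OF _ aD])
        show "{e \<in> F. e \<subseteq> S} \<subseteq> E" using FE by auto
        show "{e \<in> F. e \<subseteq> S} \<inter> bdry D = {}" using D(3) b(1) by blast
      qed
    qed
    then have "card S \<le> card D" by (rule card_mono[OF D(1)])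
    then show False using S(4) D(2) by simp
  qed
qed

lemma eventually_light:
  assumes t: "tree V F" and FE: "F \<subseteq> E" and one: "one_ended (V, F)" and xy: "x \<in> V" "y \<in> V"
  shows "\<exists>n. conn (light n F) x y"
proof -
  interpret t: tree V F by (rule t)
  have "conn F x y" using xy by (rule t.connected)
  then show ?thesis
  proof (induction rule: conn_induct)
    case base
    show ?case by simp
  next
    case (step y z)
    then obtain n where n: "conn (light n F) x y" by blast
    obtain D where D: "finite D" "D \<subseteq> V" "F \<inter> bdry D = {{y, z}}" using finite_side[OF t FE one step.hyps(2)] by blast
    let ?m = "max n (Suc (card D))"
    have "{y, z} \<in> light (Suc (card D)) F" unfolding light_def using D by blast
    then have e: "{y, z} \<in> light ?m F" by (rule rev_subsetD[OF _ light_mono]) simp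
    have "conn (light ?m F) x y" by (rule conn_mono[OF n light_mono]) simp
    from conn_trans[OF this conn_edge[OF e]] show ?case by (rule exI)
  qed
qed

end
context lf_graph
begin

lemma inj_image_edges: "f \<in> Aut ==> inj_on ((`) f) (Pow V)"
  by (rule inj_on_image_Pow[OF autD(5)])

lemma light_image:
  assumes f: "f \<in> Aut" and F: "F \<subseteq> E"
  shows "(`) f ` light n F \<subseteq> light n ((`) f ` F)"
proof
  fix e assume "e \<in> (`) f ` light n F"
  then obtain e' D where e: "e = f ` e'" and D: "finite D" "D \<subseteq> V" "card D < n" "F \<inter> bdry D = {e'}"
    by (auto simp: light_def)
  have "(`) f ` F \<inter> bdry (f ` D) = (`) f ` F \<inter> (`) f ` bdry D" by (simp only: aut_bdry[OF f D(2)])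
  also have "... = (`) f ` (F \<inter> bdry D)"
  proof (rule inj_on_image_Int[OF inj_image_edges[OF f], symmetric])
    show "F \<subseteq> Pow V" "bdry D \<subseteq> Pow V" using F edges_Pow by (auto simp: bdry_def)
  qed
  finally have "(`) f ` F \<inter> bdry (f ` D) = {e}" using D(4) e by simp
  moreover have "f ` D \<subseteq> V" using D(2) autD(4)[OF f] by blast
  moreover have "card (f ` D) < n" using card_image_le[OF D(1), of f] D(3) by simp
  ultimately show "e \<in> light n ((`) f ` F)" unfolding light_def using D(1) by blast
qed

lemma ainv_image: "f \<in> Aut ==> F \<subseteq> E ==> (`) (ainv f) ` (`) f ` F = F"
proof -
  assume f: "f \<in> Aut" and F: "F \<subseteq> E"
  have "ainv f ` f ` h = h" if "h \<in> F" for h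
  proof -
    have "h \<subseteq> V" using edge_V F that by blast
    then have "ainv f ` f ` h = (\<lambda>x. x) ` h"
      unfolding image_image by (intro image_cong[OF refl]) (use ainv(3)[OF f] in blast)
    then show ?thesis by simp
  qed
  then show ?thesis unfolding image_image[of _ _ F] by simp
qed

lemma conn_light_image:
  assumes f: "f \<in> Aut" and F: "F \<subseteq> E" and xy: "x \<in> V" "y \<in> V"
  shows "conn (light n ((`) f ` F)) (f x) (f y) \<longleftrightarrow> conn (light n F) x y"
proof
  assume "conn (light n F) x y"
  from conn_image[OF this, of f] show "conn (light n ((`) f ` F)) (f x) (f y)"
    by (rule conn_mono) (rule light_image[OF f F])
next
  have fF: "(`) f ` F \<subseteq> E" using F aut_edge[OF f] edge_V by blast
  assume "conn (light n ((`) f ` F)) (f x) (f y)"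
  from conn_image[OF this, of "ainv f"]
  have "conn (light n ((`) (ainv f) ` (`) f ` F)) (ainv f (f x)) (ainv f (f y))"
    by (rule conn_mono) (rule light_image[OF ainv(1)[OF f] fF])
  then show "conn (light n F) x y" unfolding ainv_image[OF f F] using ainv(3)[OF f] xy by simp
qed

definition bdeg :: "'v set => 'v => nat" where "bdeg C x = card {e \<in> bdry C. x \<in> e}"

lemma bdeg_aut:
  assumes f: "f \<in> Aut" and C: "C \<subseteq> V" and x: "x \<in> V"
  shows "bdeg (f ` C) (f x) = bdeg C x"
proof -
  have "{e \<in> bdry (f ` C). f x \<in> e} = (`) f ` {e \<in> bdry C. x \<in> e}"
  proof -
    have "f x \<in> f ` e \<longleftrightarrow> x \<in> e" if "e \<in> bdry C" for e
    proof -
      have "e \<subseteq> V" using that edge_V by (auto simp: bdry_def)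
      then show ?thesis using inj_on_image_mem_iff[OF autD(5)[OF f] x] by blast
    qed
    then show ?thesis unfolding aut_bdry[OF f C] by auto
  qed
  moreover have "inj_on ((`) f) {e \<in> bdry C. x \<in> e}"
    by (rule inj_on_subset[OF inj_image_edges[OF f]]) (use edges_Pow in \<open>auto simp: bdry_def\<close>)
  ultimately show ?thesis unfolding bdeg_def by (simp add: card_image)
qed

lemma sum_bdeg: assumes "finite C" "C \<subseteq> V" shows "(\<Sum>x\<in>C. bdeg C x) = card (bdry C)"
proof -
  have "(\<Sum>x\<in>C. bdeg C x) = (\<Sum>e\<in>bdry C. card {x \<in> C. x \<in> e})"
    unfolding bdeg_def by (rule sum_card_rel_swap[OF assms(1) finite_bdry[OF assms]])
  also have "... = (\<Sum>e\<in>bdry C. 1)"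
  proof (rule sum.cong[OF refl])
    fix e assume "e \<in> bdry C"
    then have "card (e \<inter> C) = 1" by (simp add: bdry_def)
    moreover have "e \<inter> C = {x \<in> C. x \<in> e}" by blast
    ultimately show "card {x \<in> C. x \<in> e} = 1" by simp
  qed
  finally show ?thesis by simp
qed

lemma bdeg_le: assumes "x \<in> V" "x \<in> C" shows "bdeg C x \<le> card {y \<in> nbr x. y \<notin> C}"
proof -
  have "{e \<in> bdry C. x \<in> e} \<subseteq> (\<lambda>y. {x, y}) ` {y \<in> nbr x. y \<notin> C}"
  proof
    fix e assume e: "e \<in> {e \<in> bdry C. x \<in> e}"
    then obtain p q where pq: "e = {p, q}" "p \<in> C" "q \<notin> C" "e \<in> E" using bdry_dest by (metis mem_Collect_eq)
    have "x = p" using e pq assms(2) by auto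
    then show "e \<in> (\<lambda>y. {x, y}) ` {y \<in> nbr x. y \<notin> C}" using pq by (auto simp: nbr_def)
  qed
  moreover have "finite {y \<in> nbr x. y \<notin> C}" using finite_nbr[OF assms(1)] by simp
  ultimately have "bdeg C x \<le> card ((\<lambda>y. {x, y}) ` {y \<in> nbr x. y \<notin> C})"
    unfolding bdeg_def by (intro card_mono) auto
  also have "... \<le> card {y \<in> nbr x. y \<notin> C}"
    using finite_nbr[OF assms(1)] by (intro card_image_le) simp
  finally show ?thesis .
qed

end

section \<open>The mass-transport principle with several orbits\<close>

context qt_graph
begin

text \<open>The integral of \<open>F (g a) b\<close> over the group is computed in two ways.
  Splitting by the value of \<open>g a\<close> gives the left side. Invariance rewrites the
  integrand as \<open>F a (ainv g b)\<close>, and splitting by the preimage of \<open>b\<close>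
  gives the right side. The weights are the measures of the transporters.\<close>

lemma mass_transport:
  assumes H: "haar \<mu> w" and ab: "a \<in> V" "b \<in> V"
    and inv: "\<And>f x y. f \<in> Aut ==> x \<in> V ==> y \<in> V ==> F (f x) (f y) = (F x y :: ennreal)"
  shows "ennreal (w a) * (\<integral>\<^sup>+x. (if same_orbit a x then F x b else 0) \<partial>count_space V) =
    ennreal (w b) * (\<integral>\<^sup>+y. (if same_orbit b y then F a y else 0) \<partial>count_space V)"
proof -
  note hd = haarD[OF H]
  let ?I = "\<lambda>x z g. indicator {g \<in> Aut. g x = z} g :: ennreal"
  have tr: "emeasure \<mu> {g \<in> Aut. g x = z} = (if same_orbit x z then ennreal (w x) else 0)" if "x \<in> V" for x z
  proof (cases "same_orbit x z")
    case True
    then show ?thesis using hd(5)[OF that] by (auto simp: same_orbit_def)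
  next
    case False
    then have "{g \<in> Aut. g x = z} = {}" by (auto simp: same_orbit_def)
    then show ?thesis using False by (simp only: emeasure_empty if_False)
  qed
  have swap: "(\<integral>\<^sup>+z. c z * emeasure \<mu> (A z) \<partial>count_space V) = (\<integral>\<^sup>+g. (\<integral>\<^sup>+z. c z * indicator (A z) g \<partial>count_space V) \<partial>\<mu>)"
    if "\<And>z. z \<in> V ==> A z \<in> sets \<mu>" for A c
  proof -
    have "(\<integral>\<^sup>+g. (\<integral>\<^sup>+z. c z * indicator (A z) g \<partial>count_space V) \<partial>\<mu>) = (\<integral>\<^sup>+z. (\<integral>\<^sup>+g. c z * indicator (A z) g \<partial>\<mu>) \<partial>count_space V)"
      by (rule nn_integral_count_space_nn_integral[OF countable_V]) (use that in measurable)
    also have "... = (\<integral>\<^sup>+z. c z * emeasure \<mu> (A z) \<partial>count_space V)"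
      by (rule nn_integral_cong) (use that in \<open>simp add: nn_integral_cmult_indicator\<close>)
    finally show ?thesis by simp
  qed
  have one_pt: "(\<integral>\<^sup>+z. c z * indicator (A z) g \<partial>count_space V) = c z0"
    if "z0 \<in> V" "\<And>z. z \<in> V ==> g \<in> A z \<longleftrightarrow> z = z0" for A and c :: "'v => ennreal" and g :: "'v => 'v" and z0
  proof -
    have "(\<integral>\<^sup>+z. c z * indicator (A z) g \<partial>count_space V) = (\<Sum>z\<in>{z0}. c z * indicator (A z) g)"
      by (rule nn_integral_count_space') (use that in \<open>auto simp: indicator_def\<close>)
    then show ?thesis using that by simp
  qed
  have "ennreal (w a) * (\<integral>\<^sup>+x. (if same_orbit a x then F x b else 0) \<partial>count_space V) =
    (\<integral>\<^sup>+x. ennreal (w a) * (if same_orbit a x then F x b else 0) \<partial>count_space V)"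
    by (rule nn_integral_cmult[symmetric]) simp
  also have "... = (\<integral>\<^sup>+x. F x b * emeasure \<mu> {g \<in> Aut. g a = x} \<partial>count_space V)"
    by (rule nn_integral_cong) (simp add: tr[OF ab(1)] mult.commute)
  also have "... = (\<integral>\<^sup>+g. (\<integral>\<^sup>+x. F x b * ?I a x g \<partial>count_space V) \<partial>\<mu>)"
    by (rule swap) (rule hd(2)[OF ab(1)])
  also have "... = (\<integral>\<^sup>+g. F (g a) b \<partial>\<mu>)"
  proof (rule nn_integral_cong)
    fix g assume "g \<in> space \<mu>"
    then have g: "g \<in> Aut" by (simp add: hd(1))
    show "(\<integral>\<^sup>+x. F x b * ?I a x g \<partial>count_space V) = F (g a) b"
      by (rule one_pt) (use g autD(4)[OF g ab(1)] in auto)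
  qed
  also have "... = (\<integral>\<^sup>+g. F a (ainv g b) \<partial>\<mu>)"
  proof (rule nn_integral_cong)
    fix g assume "g \<in> space \<mu>"
    then have g: "g \<in> Aut" by (simp add: hd(1))
    have "F (ainv g (g a)) (ainv g b) = F (g a) b" by (rule inv[OF ainv(1)[OF g] autD(4)[OF g ab(1)] ab(2)])
    then show "F (g a) b = F a (ainv g b)" using ainv(3)[OF g ab(1)] by simp
  qed
  also have "... = (\<integral>\<^sup>+g. (\<integral>\<^sup>+y. F a y * ?I y b g \<partial>count_space V) \<partial>\<mu>)"
  proof (rule nn_integral_cong)
    fix g assume "g \<in> space \<mu>"
    then have g: "g \<in> Aut" by (simp add: hd(1))
    have iV: "ainv g b \<in> V" by (rule autD(4)[OF ainv(1)[OF g] ab(2)])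
    have "g y = b \<longleftrightarrow> y = ainv g b" if "y \<in> V" for y using ainv(2)[OF g ab(2)] ainv(3)[OF g that] by auto
    then show "F a (ainv g b) = (\<integral>\<^sup>+y. F a y * ?I y b g \<partial>count_space V)"
      using g iV by (intro one_pt[symmetric]) auto
  qed
  also have "... = (\<integral>\<^sup>+y. F a y * emeasure \<mu> {g \<in> Aut. g y = b} \<partial>count_space V)"
    by (rule swap[symmetric]) (rule hd(2))
  also have "... = (\<integral>\<^sup>+y. ennreal (w b) * (if same_orbit b y then F a y else 0) \<partial>count_space V)"
  proof (rule nn_integral_cong)
    fix y assume "y \<in> space (count_space V)"
    then have y: "y \<in> V" by simp
    have so: "same_orbit y b \<longleftrightarrow> same_orbit b y" by (rule iffI[OF same_orbit_sym[OF y] same_orbit_sym[OF ab(2)]])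
    have "w y = w b" if "same_orbit b y" using that hd(4)[OF ab(2)] by (auto simp: same_orbit_def)
    then show "F a y * emeasure \<mu> {g \<in> Aut. g y = b} = ennreal (w b) * (if same_orbit b y then F a y else 0)"
      using so by (simp add: tr[OF y] mult.commute)
  qed
  also have "... = ennreal (w b) * (\<integral>\<^sup>+y. (if same_orbit b y then F a y else 0) \<partial>count_space V)"
    by (rule nn_integral_cmult) simp
  finally show ?thesis .
qed

text \<open>A choice that depends only on the orbit thins out \<open>Rep\<close> to one point per
  orbit, so that a sum over \<open>V\<close> splits into sums over orbits without
  repetition.\<close>

lemma transversal:
  obtains R where "finite R" "R \<subseteq> V" "R \<noteq> {}" "\<And>x. x \<in> V ==> \<exists>!a. a \<in> R \<and> same_orbit a x"
proof -
  define rp where "rp x = (SOME a. a \<in> Rep \<and> same_orbit a x)" for x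
  have rp: "rp x \<in> Rep \<and> same_orbit (rp x) x" if x: "x \<in> V" for x
  proof -
    have "\<exists>a. a \<in> Rep \<and> same_orbit a x" using Rep_reps[OF x] by (auto simp: same_orbit_def)
    then show ?thesis unfolding rp_def by (rule someI_ex)
  qed
  have eq: "rp x = rp y" if xy: "x \<in> V" "y \<in> V" "same_orbit x y" for x y
  proof -
    have "same_orbit a x \<longleftrightarrow> same_orbit a y" if "a \<in> Rep" for a
    proof
      have a: "a \<in> V" using that Rep_V by blast
      show "same_orbit a y" if "same_orbit a x" by (rule same_orbit_trans[OF a that xy(3)])
      show "same_orbit a x" if "same_orbit a y" by (rule same_orbit_trans[OF a that same_orbit_sym[OF xy(1,3)]])
    qed
    then show ?thesis unfolding rp_def by (metis (no_types, lifting))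
  qed
  show thesis
  proof (rule that[of "rp ` V"])
    show "finite (rp ` V)" using rp finite_Rep by (metis finite_subset image_subsetI)
    show sV: "rp ` V \<subseteq> V" using rp Rep_V by blast
    show "rp ` V \<noteq> {}" using infinite_V by auto
    fix x assume x: "x \<in> V"
    show "\<exists>!a. a \<in> rp ` V \<and> same_orbit a x"
    proof (rule ex1I[of _ "rp x"])
      show "rp x \<in> rp ` V \<and> same_orbit (rp x) x" using rp[OF x] x by blast
      fix a assume a: "a \<in> rp ` V \<and> same_orbit a x"
      then obtain y where y: "y \<in> V" "a = rp y" by blast
      have aV: "a \<in> V" using a sV by blast
      have "rp a = rp y" by (rule eq[OF aV y(1)]) (use rp[OF y(1)] y(2) in simp)
      moreover have "rp a = rp x" by (rule eq[OF aV x]) (use a in blast)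
      ultimately show "a = rp x" using y(2) by simp
    qed
  qed
qed

end

section \<open>Clusters of a random one-ended spanning tree\<close>

locale random_tree = qt_graph V E Rep for V :: "'v set" and E Rep +
  fixes P :: "'v graph measure"
  assumes prob: "prob_space P" and sets_P: "sets P = sets (subgraph_space (V, E))"
    and invariant: "f \<in> Aut ==> distr P (subgraph_space (V, E)) (graph_image f) = P"
    and trees: "AE T in P. spanning_tree (V, E) T \<and> one_ended T"
begin

sublocale prob_space P by (rule prob)

lemma space_P: "space P = subgraphs (V, E)"
  using sets_eq_imp_space_eq[OF sets_P] by (simp add: subgraph_space_def space_measure_of_conv)

lemma AE_tree: "AE H in P. tree V (edges H) \<and> edges H \<subseteq> E \<and> one_ended (V, edges H)"
  using trees
proof eventually_elim
  case (elim H)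
  then have v: "verts H = V" and s: "H \<in> subgraphs (V, E)" and t: "is_tree H" by (auto simp: spanning_tree_def)
  have "H = (V, edges H)" using v by (metis prod.collapse)
  then show ?case using tree_of_is_tree[OF t] elim s v by (simp add: subgraphs_def)
qed

lemma edge_event: "e \<in> E ==> {H \<in> space P. e \<in> edges H} \<in> events"
  unfolding space_P sets_P subgraph_space_def by (intro in_measure_of) auto

lemma countable_finite_sets: "countable {D. finite D \<and> D \<subseteq> V}" "countable {J. finite J \<and> J \<subseteq> E}"
  by (intro countable_Collect_finite_subset countable_V countable_E)+

lemma light_event: "{H \<in> space P. e \<in> light n (edges H)} \<in> events"
proof -
  have "{H \<in> space P. \<exists>D\<in>{D. finite D \<and> D \<subseteq> V}. card D < n \<and> edges H \<inter> bdry D = {e}} \<in> events"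
  proof (rule sets.sets_Collect_countable_Ex'[OF _ countable_finite_sets(1)])
    fix D assume "D \<in> {D. finite D \<and> D \<subseteq> V}"
    then have D: "finite (bdry D)" "bdry D \<subseteq> E" using finite_bdry by (auto simp: bdry_def)
    show "{H \<in> space P. card D < n \<and> edges H \<inter> bdry D = {e}} \<in> events"
      by (rule sets_trace_pred[OF D(1), of P edges "\<lambda>A. card D < n \<and> A = {e}"]) (use edge_event D(2) in blast)
  qed
  then show ?thesis by (simp add: light_def conj_assoc)
qed

lemma conn_event: "{H \<in> space P. conn (light n (edges H)) x y} \<in> events"
proof -
  have "{H \<in> space P. conn (light n (edges H)) x y} =
    {H \<in> space P. \<exists>J\<in>{J. finite J \<and> J \<subseteq> E}. (\<forall>e\<in>J. e \<in> light n (edges H)) \<and> conn J x y}"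
  proof (intro Collect_cong conj_cong refl iffI)
    fix H assume "H \<in> space P" "conn (light n (edges H)) x y"
    moreover have "light n (edges H) \<subseteq> E" using \<open>H \<in> space P\<close> light_subset by (force simp: space_P subgraphs_def)
    ultimately show "\<exists>J\<in>{J. finite J \<and> J \<subseteq> E}. (\<forall>e\<in>J. e \<in> light n (edges H)) \<and> conn J x y"
      using conn_finite[of "light n (edges H)" x y] by blast
  next
    fix H assume "\<exists>J\<in>{J. finite J \<and> J \<subseteq> E}. (\<forall>e\<in>J. e \<in> light n (edges H)) \<and> conn J x y"
    then obtain J where "conn J x y" "J \<subseteq> light n (edges H)" by blast
    then show "conn (light n (edges H)) x y" by (rule conn_mono)
  qed
  also have "... \<in> events"
  proof (rule sets.sets_Collect_countable_Ex'[OF _ countable_finite_sets(2)])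
    fix J assume "J \<in> {J. finite J \<and> J \<subseteq> E}"
    then have "countable J" by (simp add: countable_finite)
    then show "{H \<in> space P. (\<forall>e\<in>J. e \<in> light n (edges H)) \<and> conn J x y} \<in> events"
      by (intro sets.sets_Collect_conj sets.sets_Collect_countable_All' light_event sets.sets_Collect_const)
  qed
  finally show ?thesis .
qed

text \<open>The event that \<open>C\<close> is a cluster. For distinct sets sharing a vertex these
  events are disjoint, so the random cluster of a vertex is treated as a countable sum over finite
  sets.\<close>

definition cluster :: "nat => 'v set => 'v graph set" where
  "cluster n C = {H \<in> space P. \<forall>x\<in>C. \<forall>y\<in>V. conn (light n (edges H)) x y \<longleftrightarrow> y \<in> C}"

lemma cluster_event: "C \<subseteq> V ==> cluster n C \<in> events"
proof -
  assume "C \<subseteq> V"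
  then have "countable C" using countable_V countable_subset by blast
  then show ?thesis
    unfolding cluster_def
    by (intro sets.sets_Collect_countable_All' countable_V sets.sets_Collect(1-4) conn_event)
      (auto simp: iff_conv_conj_imp intro!: sets.sets_Collect conn_event)
qed

lemma cluster_unique: "H \<in> cluster n C ==> H \<in> cluster n C' ==> x \<in> C ==> x \<in> C' ==> C \<subseteq> V ==> C' \<subseteq> V ==> C = C'"
  unfolding cluster_def by blast

lemma cluster_aut:
  assumes f: "f \<in> Aut" and C: "C \<subseteq> V"
  shows "emeasure P (cluster n (f ` C)) = emeasure P (cluster n C)"
proof -
  have fC: "f ` C \<subseteq> V" using C autD(4)[OF f] by blast
  have m: "graph_image f \<in> measurable P (subgraph_space (V, E))"
    using graph_image_measurable[OF f] measurable_cong_sets[OF sets_P refl] by blast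
  have "emeasure P (cluster n (f ` C)) = emeasure (distr P (subgraph_space (V, E)) (graph_image f)) (cluster n (f ` C))"
    by (simp add: invariant[OF f])
  also have "... = emeasure P (graph_image f -` cluster n (f ` C) \<inter> space P)"
    by (rule emeasure_distr[OF m]) (use cluster_event[OF fC] sets_P in blast)
  also have "graph_image f -` cluster n (f ` C) \<inter> space P = cluster n C"
  proof (rule Set.set_eqI)
    fix H
    show "H \<in> graph_image f -` cluster n (f ` C) \<inter> space P \<longleftrightarrow> H \<in> cluster n C"
    proof (cases "H \<in> space P")
      case True
      then have H: "H \<in> subgraphs (V, E)" "edges H \<subseteq> E" by (auto simp: space_P subgraphs_def)
      have g: "graph_image f H \<in> space P" "edges (graph_image f H) = (`) f ` edges H"
        using image_subgraph(1)[OF f H(1)] by (auto simp: space_P graph_image_def)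
      have V: "V = f ` V" using autD(1)[OF f] by (simp add: bij_betw_def)
      have "H \<in> graph_image f -` cluster n (f ` C) \<inter> space P \<longleftrightarrow>
        (\<forall>x\<in>C. \<forall>y\<in>f ` V. conn (light n ((`) f ` edges H)) (f x) y \<longleftrightarrow> y \<in> f ` C)"
        using True g V[symmetric] by (simp add: cluster_def)
      also have "... \<longleftrightarrow> (\<forall>x\<in>C. \<forall>y\<in>V. conn (light n ((`) f ` edges H)) (f x) (f y) \<longleftrightarrow> f y \<in> f ` C)" by simp
      also have "... \<longleftrightarrow> (\<forall>x\<in>C. \<forall>y\<in>V. conn (light n (edges H)) x y \<longleftrightarrow> y \<in> C)"
      proof (intro ball_cong refl)
        fix x y assume "x \<in> C" "y \<in> V"
        moreover have "f y \<in> f ` C \<longleftrightarrow> y \<in> C" by (rule inj_on_image_mem_iff[OF autD(5)[OF f] \<open>y \<in> V\<close> C])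
        ultimately show "(conn (light n ((`) f ` edges H)) (f x) (f y) \<longleftrightarrow> f y \<in> f ` C) =
          (conn (light n (edges H)) x y \<longleftrightarrow> y \<in> C)"
          using conn_light_image[OF f H(2), of x y n] C by auto
      qed
      finally show ?thesis using True by (simp add: cluster_def)
    qed (simp add: cluster_def)
  qed
  finally show ?thesis .
qed

abbreviation Fin :: "'v set set" where "Fin \<equiv> {C. finite C \<and> C \<subseteq> V}"

text \<open>By \<open>finite_cluster\<close> a vertex almost surely has a finite cluster, and it has
  only one.\<close>

lemma cluster_total:
  assumes y: "y \<in> V"
  shows "(\<integral>\<^sup>+C. (if y \<in> C then emeasure P (cluster n C) else 0) \<partial>count_space Fin) = 1"
proof -
  let ?A = "\<lambda>C. if y \<in> C then cluster n C else {}"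
  have "(\<integral>\<^sup>+C. (if y \<in> C then emeasure P (cluster n C) else 0) \<partial>count_space Fin) = (\<integral>\<^sup>+C. emeasure P (?A C) \<partial>count_space Fin)"
    by (rule nn_integral_cong) simp
  also have "... = emeasure P (\<Union>C\<in>Fin. ?A C)"
  proof (rule emeasure_UN_countable[symmetric])
    show "countable Fin" by (rule countable_finite_sets)
    show "?A C \<in> events" if "C \<in> Fin" for C using cluster_event that by simp
    show "disjoint_family_on ?A Fin"
      unfolding disjoint_family_on_def using cluster_unique[of _ n _ _ y] by (auto split: if_splits)
  qed
  also have "... = 1"
  proof (rule emeasure_eq_1_AE)
    show "(\<Union>C\<in>Fin. ?A C) \<in> events" using cluster_event by (intro sets.countable_UN' countable_finite_sets) auto
    show "AE H in P. H \<in> (\<Union>C\<in>Fin. ?A C)"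
      using AE_tree AE_space
    proof eventually_elim
      case (elim H)
      let ?C = "{z \<in> V. conn (light n (edges H)) y z}"
      have "finite ?C" using finite_cluster[of "edges H" y n] elim(1) y by blast
      moreover have "H \<in> cluster n ?C"
        unfolding cluster_def
      proof (intro CollectI conjI ballI)
        fix x z assume x: "x \<in> ?C" and z: "z \<in> V"
        have yx: "conn (light n (edges H)) y x" using x by blast
        show "conn (light n (edges H)) x z \<longleftrightarrow> z \<in> ?C"
        proof
          show "z \<in> ?C" if "conn (light n (edges H)) x z" using conn_trans[OF yx that] z by simp
          show "conn (light n (edges H)) x z" if "z \<in> ?C" using conn_trans[OF conn_sym[OF yx], of z] that by simp
        qed
      qed (rule elim(2))
      ultimately show ?case using y by (intro UN_I[of ?C]) auto
    qed
  qed
  finally show ?thesis .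
qed

lemma split_probability:
  "(\<integral>\<^sup>+C. (if x \<in> C \<and> y \<notin> C then emeasure P (cluster n C) else 0) \<partial>count_space Fin)
    \<le> ennreal (prob {H \<in> space P. \<not> conn (light n (edges H)) x y})" if xy: "x \<in> V" "y \<in> V"
proof -
  let ?A = "\<lambda>C. if x \<in> C \<and> y \<notin> C then cluster n C else {}"
  have "(\<integral>\<^sup>+C. (if x \<in> C \<and> y \<notin> C then emeasure P (cluster n C) else 0) \<partial>count_space Fin) =
      (\<integral>\<^sup>+C. emeasure P (?A C) \<partial>count_space Fin)"
    by (rule nn_integral_cong) simp
  also have "... = emeasure P (\<Union>C\<in>Fin. ?A C)"
  proof (rule emeasure_UN_countable[symmetric])
    show "countable Fin" by (rule countable_finite_sets)
    show "?A C \<in> events" if "C \<in> Fin" for C using cluster_event that by simp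
    show "disjoint_family_on ?A Fin"
      unfolding disjoint_family_on_def using cluster_unique[of _ n _ _ x] by (auto split: if_splits)
  qed
  also have "... \<le> emeasure P {H \<in> space P. \<not> conn (light n (edges H)) x y}"
  proof (rule emeasure_mono)
    show "(\<Union>C\<in>Fin. ?A C) \<subseteq> {H \<in> space P. \<not> conn (light n (edges H)) x y}"
      using xy(2) by (auto simp: cluster_def split: if_splits)
    show "{H \<in> space P. \<not> conn (light n (edges H)) x y} \<in> events"
      by (intro sets.sets_Collect_neg conn_event)
  qed
  finally show ?thesis by (simp add: emeasure_eq_measure)
qed

lemma split_probability_tendsto:
  assumes xy: "x \<in> V" "y \<in> V"
  shows "(\<lambda>n. prob {H \<in> space P. \<not> conn (light n (edges H)) x y}) \<longlonglongrightarrow> 0"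
proof -
  let ?B = "\<lambda>n. {H \<in> space P. \<not> conn (light n (edges H)) x y}"
  have ev: "?B n \<in> events" for n by (intro sets.sets_Collect_neg conn_event)
  have "decseq ?B"
    unfolding decseq_def
  proof (intro allI impI subsetI)
    fix m n :: nat and H assume mn: "m \<le> n" and H: "H \<in> ?B n"
    have "\<not> conn (light m (edges H)) x y"
    proof
      assume "conn (light m (edges H)) x y"
      from conn_mono[OF this light_mono[OF mn]] show False using H by blast
    qed
    then show "H \<in> ?B m" using H by blast
  qed
  then have "(\<lambda>n. prob (?B n)) \<longlonglongrightarrow> prob (\<Inter>n. ?B n)" using ev by (intro finite_Lim_measure_decseq) auto
  moreover have "prob (\<Inter>n. ?B n) = 0"
  proof -
    have "AE H in P. H \<notin> (\<Inter>n. ?B n)"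
      using AE_tree
    proof eventually_elim
      case (elim H)
      then obtain n where "conn (light n (edges H)) x y" using eventually_light[of "edges H" x y] xy by blast
      then have "H \<notin> ?B n" by blast
      then show ?case by blast
    qed
    moreover have "(\<Inter>n. ?B n) \<in> events" using ev by (intro sets.countable_INT) auto
    ultimately have "emeasure P (\<Inter>n. ?B n) = emeasure P {}" by (intro emeasure_eq_AE) auto
    then show ?thesis by (simp add: measure_def)
  qed
  ultimately show ?thesis by simp
qed

text \<open>
  Each vertex spreads the number of boundary edges of its cluster at it evenly over the cluster,
  so a vertex receives the boundary-to-volume ratio of its cluster.
\<close>

definition mass :: "nat => 'v => 'v => ennreal" where
  "mass n x y = (\<integral>\<^sup>+C. (if x \<in> C \<and> y \<in> C then emeasure P (cluster n C) * ennreal (real (bdeg C x) / real (card C)) else 0)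
    \<partial>count_space Fin)"

lemma mass_invariant:
  assumes f: "f \<in> Aut" and xy: "x \<in> V" "y \<in> V"
  shows "mass n (f x) (f y) = mass n x y"
proof -
  have bij: "bij_betw ((`) f) Fin Fin"
  proof (rule bij_betwI[where g="(`) (ainv f)"])
    show "(`) f \<in> Fin \<rightarrow> Fin" using autD(4)[OF f] by auto
    show "(`) (ainv f) \<in> Fin \<rightarrow> Fin" using autD(4)[OF ainv(1)[OF f]] by auto
    show "ainv f ` f ` C = C" if "C \<in> Fin" for C
    proof -
      have "ainv f ` f ` C = (\<lambda>x. x) ` C"
        unfolding image_image by (intro image_cong[OF refl]) (use that ainv(3)[OF f] in blast)
      then show ?thesis by simp
    qed
    show "f ` ainv f ` C = C" if "C \<in> Fin" for C
    proof -
      have "f ` ainv f ` C = (\<lambda>x. x) ` C"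
        unfolding image_image by (intro image_cong[OF refl]) (use that ainv(2)[OF f] in blast)
      then show ?thesis by simp
    qed
  qed
  let ?h = "\<lambda>x y C. if x \<in> C \<and> y \<in> C then emeasure P (cluster n C) * ennreal (real (bdeg C x) / real (card C)) else 0"
  have "mass n (f x) (f y) = (\<integral>\<^sup>+C. ?h (f x) (f y) (f ` C) \<partial>count_space Fin)"
    unfolding mass_def by (rule nn_integral_bij_count_space[OF bij, symmetric])
  also have "... = mass n x y"
    unfolding mass_def
  proof (rule nn_integral_cong)
    fix C assume "C \<in> space (count_space Fin)"
    then have C: "finite C" "C \<subseteq> V" by auto
    note inj = autD(5)[OF f]
    have "f x \<in> f ` C \<longleftrightarrow> x \<in> C" "f y \<in> f ` C \<longleftrightarrow> y \<in> C" using inj_on_image_mem_iff[OF inj _ C(2)] xy by auto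
    moreover have "card (f ` C) = card C" by (rule card_image[OF inj_on_subset[OF inj C(2)]])
    ultimately show "?h (f x) (f y) (f ` C) = ?h x y C"
      by (simp add: cluster_aut[OF f C(2)] bdeg_aut[OF f C(2) xy(1)])
  qed
  finally show ?thesis .
qed

lemma swap_Fin:
  "(\<integral>\<^sup>+x. (\<integral>\<^sup>+C. h C x \<partial>count_space Fin) \<partial>count_space V) = (\<integral>\<^sup>+C. (\<integral>\<^sup>+x. h C x \<partial>count_space V) \<partial>count_space Fin)"
  for h :: "'v set => 'v => ennreal"
  by (rule nn_integral_count_space_nn_integral[OF countable_finite_sets(1)]) simp

text \<open>The total mass sent by a vertex is the number of boundary edges at it, each of which
  leads to a neighbour outside its cluster.\<close>

lemma mass_out:
  assumes x: "x \<in> V"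
  shows "(\<integral>\<^sup>+y. mass n x y \<partial>count_space V) \<le> ennreal (\<Sum>y\<in>nbr x. prob {H \<in> space P. \<not> conn (light n (edges H)) x y})"
proof -
  let ?p = "\<lambda>C. emeasure P (cluster n C)"
  have nf: "finite (nbr x)" by (rule finite_nbr[OF x])
  have "(\<integral>\<^sup>+y. mass n x y \<partial>count_space V) =
      (\<integral>\<^sup>+C. (\<integral>\<^sup>+y. (if x \<in> C \<and> y \<in> C then ?p C * ennreal (real (bdeg C x) / real (card C)) else 0) \<partial>count_space V) \<partial>count_space Fin)"
    unfolding mass_def by (rule swap_Fin)
  also have "... \<le> (\<integral>\<^sup>+C. (\<Sum>y\<in>nbr x. if x \<in> C \<and> y \<notin> C then ?p C else 0) \<partial>count_space Fin)"
  proof (rule nn_integral_mono)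
    fix C assume "C \<in> space (count_space Fin)"
    then have C: "finite C" "C \<subseteq> V" by auto
    show "(\<integral>\<^sup>+y. (if x \<in> C \<and> y \<in> C then ?p C * ennreal (real (bdeg C x) / real (card C)) else 0) \<partial>count_space V)
      \<le> (\<Sum>y\<in>nbr x. if x \<in> C \<and> y \<notin> C then ?p C else 0)"
    proof (cases "x \<in> C")
      case True
      then have c0: "0 < card C" using C(1) card_gt_0_iff by blast
      have "(\<integral>\<^sup>+y. (if x \<in> C \<and> y \<in> C then ?p C * ennreal (real (bdeg C x) / real (card C)) else 0) \<partial>count_space V) =
          (\<Sum>y\<in>C. ?p C * ennreal (real (bdeg C x) / real (card C)))"
        using True C by (subst nn_integral_count_space'[where A=C]) auto
      also have "... = ?p C * (\<Sum>y\<in>C. ennreal (real (bdeg C x) / real (card C)))" by (rule sum_distrib_left[symmetric])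
      also have "(\<Sum>y\<in>C. ennreal (real (bdeg C x) / real (card C))) = ennreal (\<Sum>y\<in>C. real (bdeg C x) / real (card C))"
        by (rule sum_ennreal) simp
      also have "... = ennreal (real (bdeg C x))" using c0 by simp
      also have "?p C * ... \<le> ?p C * ennreal (real (card {y \<in> nbr x. y \<notin> C}))"
        using bdeg_le[OF x True] by (intro mult_left_mono ennreal_leI) auto
      also have "... = (\<Sum>y\<in>{y \<in> nbr x. y \<notin> C}. ?p C)"
        by (subst mult.commute) (simp only: sum_constant ennreal_of_nat_eq_real_of_nat)
      also have "... = (\<Sum>y\<in>nbr x. if y \<notin> C then ?p C else 0)" by (rule sum.inter_filter[OF nf])
      also have "... = (\<Sum>y\<in>nbr x. if x \<in> C \<and> y \<notin> C then ?p C else 0)" by (simp only: True simp_thms)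
      finally show ?thesis .
    qed simp
  qed
  also have "... = (\<Sum>y\<in>nbr x. \<integral>\<^sup>+C. (if x \<in> C \<and> y \<notin> C then ?p C else 0) \<partial>count_space Fin)"
    by (rule nn_integral_sum) simp
  also have "... \<le> (\<Sum>y\<in>nbr x. ennreal (prob {H \<in> space P. \<not> conn (light n (edges H)) x y}))"
    by (intro sum_mono split_probability x) (use nbr_V in blast)
  also have "... = ennreal (\<Sum>y\<in>nbr x. prob {H \<in> space P. \<not> conn (light n (edges H)) x y})"
    by (rule sum_ennreal) simp
  finally show ?thesis .
qed

text \<open>The mass received is the mean of the isoperimetric ratio of the cluster, which is at
  least \<open>c\<close> for every finite nonempty set.\<close>

lemma mass_in:
  assumes y: "y \<in> V" and c: "\<And>C. finite C ==> C \<subseteq> V ==> C \<noteq> {} ==> c * real (card C) \<le> real (card (bdry C))"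
  shows "ennreal c \<le> (\<integral>\<^sup>+x. mass n x y \<partial>count_space V)"
proof -
  let ?p = "\<lambda>C. emeasure P (cluster n C)"
  have "ennreal c = ennreal c * (\<integral>\<^sup>+C. (if y \<in> C then ?p C else 0) \<partial>count_space Fin)" by (simp add: cluster_total[OF y])
  also have "... = (\<integral>\<^sup>+C. ennreal c * (if y \<in> C then ?p C else 0) \<partial>count_space Fin)"
    by (rule nn_integral_cmult[symmetric]) simp
  also have "... \<le> (\<integral>\<^sup>+C. (\<integral>\<^sup>+x. (if x \<in> C \<and> y \<in> C then ?p C * ennreal (real (bdeg C x) / real (card C)) else 0) \<partial>count_space V) \<partial>count_space Fin)"
  proof (rule nn_integral_mono)
    fix C assume "C \<in> space (count_space Fin)"
    then have C: "finite C" "C \<subseteq> V" by auto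
    show "ennreal c * (if y \<in> C then ?p C else 0)
      \<le> (\<integral>\<^sup>+x. (if x \<in> C \<and> y \<in> C then ?p C * ennreal (real (bdeg C x) / real (card C)) else 0) \<partial>count_space V)"
    proof (cases "y \<in> C")
      case True
      then have c0: "0 < card C" "C \<noteq> {}" using C(1) card_gt_0_iff by blast+
      have "(\<integral>\<^sup>+x. (if x \<in> C \<and> y \<in> C then ?p C * ennreal (real (bdeg C x) / real (card C)) else 0) \<partial>count_space V) =
          (\<Sum>x\<in>C. ?p C * ennreal (real (bdeg C x) / real (card C)))"
        using True C by (subst nn_integral_count_space'[where A=C]) auto
      also have "... = ?p C * (\<Sum>x\<in>C. ennreal (real (bdeg C x) / real (card C)))" by (rule sum_distrib_left[symmetric])
      also have "(\<Sum>x\<in>C. ennreal (real (bdeg C x) / real (card C))) = ennreal (\<Sum>x\<in>C. real (bdeg C x) / real (card C))"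
        by (rule sum_ennreal) simp
      also have "(\<Sum>x\<in>C. real (bdeg C x) / real (card C)) = real (card (bdry C)) / real (card C)"
        using sum_bdeg[OF C] by (simp add: sum_divide_distrib[symmetric] of_nat_sum[symmetric] del: of_nat_sum)
      finally have eq: "(\<integral>\<^sup>+x. (if x \<in> C \<and> y \<in> C then ?p C * ennreal (real (bdeg C x) / real (card C)) else 0) \<partial>count_space V) =
          ?p C * ennreal (real (card (bdry C)) / real (card C))" .
      have "c \<le> real (card (bdry C)) / real (card C)" using c[OF C c0(2)] c0(1) by (simp add: field_simps)
      then have "?p C * ennreal c \<le> ?p C * ennreal (real (card (bdry C)) / real (card C))"
        by (intro mult_left_mono ennreal_leI) auto
      then show ?thesis unfolding eq using True by (simp add: mult.commute)
    qed simp
  qed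
  also have "... = (\<integral>\<^sup>+x. mass n x y \<partial>count_space V)"
    unfolding mass_def by (rule swap_Fin[symmetric])
  finally show ?thesis .
qed

lemma graph_one_ended: "one_ended (V, E)"
proof -
  have "\<not> (AE H in P. False)" using AE_False by (simp add: emeasure_space_1 null_sets_def)
  moreover have "AE H in P. False" if no: "\<not> one_ended (V, E)"
    using AE_tree
  proof eventually_elim
    case (elim H)
    then show ?case using one_ended_supergraph[OF tree_connects, of "edges H"] no by blast
  qed
  ultimately show ?thesis by blast
qed

text \<open>With several orbits the mass sent and the mass received balance once the representatives
  are weighted by \<open>1 / w\<close>. A positive isoperimetric constant would bound the mass
  received from below, while the mass sent tends to 0.\<close>

lemma graph_amenable:
  assumes H: "haar \<mu> w" shows "amenable (V, E)"
proof (rule ccontr)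
  assume na: "\<not> amenable (V, E)"
  let ?r = "\<lambda>K. real (card (bdry K)) / real (card K)"
  let ?A = "{K. finite K \<and> K \<noteq> {} \<and> K \<subseteq> V}"
  let ?c = "INF K\<in>?A. ?r K"
  have eb: "edge_boundary (V, E) K = bdry K" for K by (simp add: edge_boundary_def bdry_def)
  have c0: "?c \<noteq> 0" using na by (simp add: amenable_def eb)
  have bb: "bdd_below (?r ` ?A)" by (rule bdd_belowI2[of _ 0]) simp
  obtain v0 where v0: "v0 \<in> V" using Rep_nonempty Rep_V by blast
  have "{v0} \<in> ?A" using v0 by simp
  then have ne: "?A \<noteq> {}" by (metis empty_iff)
  have "0 \<le> ?c" by (rule cINF_greatest[OF ne]) simp
  then have cpos: "0 < ?c" using c0 by simp
  have iso: "?c * real (card C) \<le> real (card (bdry C))" if C: "finite C" "C \<subseteq> V" "C \<noteq> {}" for C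
  proof -
    have "?c \<le> ?r C" by (rule cINF_lower[OF bb]) (use C in blast)
    moreover have "0 < card C" using C card_gt_0_iff by blast
    ultimately show ?thesis by (simp add: pos_le_divide_eq)
  qed
  obtain R where R: "finite R" "R \<subseteq> V" "R \<noteq> {}" "\<And>x. x \<in> V ==> \<exists>!a. a \<in> R \<and> same_orbit a x" using transversal by blast
  note hd = haarD[OF H]
  have wpos: "0 < w a" if "a \<in> R" for a using hd(3) R(2) that by blast
  have split: "(\<integral>\<^sup>+x. h x \<partial>count_space V) = (\<Sum>a\<in>R. \<integral>\<^sup>+x. (if same_orbit a x then h x else 0) \<partial>count_space V)"
    for h :: "'v => ennreal"
  proof -
    have "(\<integral>\<^sup>+x. h x \<partial>count_space V) = (\<integral>\<^sup>+x. (\<Sum>a\<in>R. if same_orbit a x then h x else 0) \<partial>count_space V)"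
    proof (rule nn_integral_cong)
      fix x assume "x \<in> space (count_space V)"
      then have "\<exists>!a. a \<in> R \<and> same_orbit a x" using R(4) by simp
      then obtain a where a: "a \<in> R" "same_orbit a x" "\<And>b. b \<in> R ==> same_orbit b x ==> b = a" by (auto elim!: ex1E)
      have "(\<Sum>b\<in>R. if same_orbit b x then h x else 0) = (\<Sum>b\<in>R. if b = a then h x else 0)"
      proof (rule sum.cong[OF refl])
        fix b assume b: "b \<in> R"
        have "same_orbit b x = (b = a)"
        proof
          show "b = a" if "same_orbit b x" by (rule a(3)[OF b that])
          show "same_orbit b x" if "b = a" unfolding that by (rule a(2))
        qed
        then show "(if same_orbit b x then h x else 0) = (if b = a then h x else 0)" by simp
      qed
      also have "... = h x" using R(1) a(1) by simp
      finally show "h x = (\<Sum>a\<in>R. if same_orbit a x then h x else 0)" by simp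
    qed
    also have "... = (\<Sum>a\<in>R. \<integral>\<^sup>+x. (if same_orbit a x then h x else 0) \<partial>count_space V)"
      by (rule nn_integral_sum) simp
    finally show ?thesis .
  qed
  let ?q = "\<lambda>n. \<Sum>a\<in>R. 1 / w a * (\<Sum>y\<in>nbr a. prob {H \<in> space P. \<not> conn (light n (edges H)) a y})"
  have main: "?c * (\<Sum>b\<in>R. 1 / w b) \<le> ?q n" for n
  proof -
    let ?In = "\<lambda>a b. \<integral>\<^sup>+x. (if same_orbit a x then mass n x b else 0) \<partial>count_space V"
    let ?Out = "\<lambda>a b. \<integral>\<^sup>+y. (if same_orbit b y then mass n a y else 0) \<partial>count_space V"
    have mt: "ennreal (1 / w b) * ?In a b = ennreal (1 / w a) * ?Out a b" if ab: "a \<in> R" "b \<in> R" for a b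
    proof -
      have V: "a \<in> V" "b \<in> V" using ab R(2) by auto
      have m: "ennreal (w a) * ?In a b = ennreal (w b) * ?Out a b"
        by (rule mass_transport[OF H V mass_invariant])
      have i: "ennreal (1 / w b) = ennreal (1 / w a * (1 / w b)) * ennreal (w a)"
        "ennreal (1 / w a) = ennreal (1 / w a * (1 / w b)) * ennreal (w b)"
        using wpos[OF ab(1)] wpos[OF ab(2)] by (simp_all add: ennreal_mult'[symmetric])
      show ?thesis unfolding i mult.assoc m ..
    qed
    have "ennreal (?c * (\<Sum>b\<in>R. 1 / w b)) = (\<Sum>b\<in>R. ennreal (1 / w b) * ennreal ?c)"
    proof -
      have "(\<Sum>b\<in>R. ennreal (1 / w b) * ennreal ?c) = (\<Sum>b\<in>R. ennreal (1 / w b * ?c))"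
        using cpos wpos by (intro sum.cong refl ennreal_mult[symmetric]) (auto simp: less_imp_le)
      also have "... = ennreal (\<Sum>b\<in>R. 1 / w b * ?c)"
        using cpos wpos by (intro sum_ennreal) (auto simp: less_imp_le)
      also have "(\<Sum>b\<in>R. 1 / w b * ?c) = ?c * (\<Sum>b\<in>R. 1 / w b)"
        by (subst mult.commute[of ?c]) (rule sum_distrib_right[symmetric])
      finally show ?thesis by (rule sym)
    qed
    also have "... \<le> (\<Sum>b\<in>R. ennreal (1 / w b) * (\<Sum>a\<in>R. ?In a b))"
      unfolding split[symmetric] by (intro sum_mono mult_left_mono mass_in iso) (use R(2) in auto)
    also have "... = (\<Sum>a\<in>R. ennreal (1 / w a) * (\<Sum>b\<in>R. ?Out a b))"
      unfolding sum_distrib_left using mt by (subst sum.swap) (intro sum.cong refl, simp)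
    also have "... \<le> (\<Sum>a\<in>R. ennreal (1 / w a) * ennreal (\<Sum>y\<in>nbr a. prob {H \<in> space P. \<not> conn (light n (edges H)) a y}))"
      unfolding split[symmetric] by (intro sum_mono mult_left_mono mass_out) (use R(2) in auto)
    also have "... = (\<Sum>a\<in>R. ennreal (1 / w a * (\<Sum>y\<in>nbr a. prob {H \<in> space P. \<not> conn (light n (edges H)) a y})))"
      using wpos by (intro sum.cong refl ennreal_mult[symmetric]) (auto simp: less_imp_le intro: sum_nonneg)
    also have "... = ennreal (?q n)"
      using wpos by (intro sum_ennreal mult_nonneg_nonneg sum_nonneg) (auto simp: less_imp_le)
    finally have "ennreal (?c * (\<Sum>b\<in>R. 1 / w b)) \<le> ennreal (?q n)" .
    moreover have "0 \<le> ?q n" using wpos by (intro sum_nonneg mult_nonneg_nonneg) (auto simp: less_imp_le)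
    ultimately show ?thesis by simp
  qed
  have "?q \<longlonglongrightarrow> (\<Sum>a\<in>R. 1 / w a * (\<Sum>y\<in>nbr a. 0))"
  proof (intro tendsto_sum tendsto_mult tendsto_const)
    fix a y assume "a \<in> R" "y \<in> nbr a"
    then have "a \<in> V" "y \<in> V" using R(2) nbr_V by auto
    then show "(\<lambda>n. prob {H \<in> space P. \<not> conn (light n (edges H)) a y}) \<longlonglongrightarrow> 0" by (rule split_probability_tendsto)
  qed
  then have "?q \<longlonglongrightarrow> 0" by simp
  then have "?c * (\<Sum>b\<in>R. 1 / w b) \<le> 0" using main by (intro LIMSEQ_le_const) auto
  moreover have "0 < (\<Sum>b\<in>R. 1 / w b)" using R(1,3) wpos by (intro sum_pos) auto
  ultimately show False using cpos by (simp add: mult_le_0_iff)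
qed

end

section \<open>The two directions combined\<close>

lemma ex_qt_graph:
  assumes "simple_graph (V, E)" "connected_graph (V, E)" "locally_finite (V, E)" "infinite V" "quasi_transitive (V, E)"
  shows "\<exists>Rep. qt_graph V E Rep"
proof -
  interpret lf_graph V E
  proof
    show "\<exists>u v. u \<in> V \<and> v \<in> V \<and> u \<noteq> v \<and> e = {u, v}" if e: "e \<in> E" for e
    proof -
      have "card e = 2" "e \<subseteq> V" using assms(1) e by (auto simp: simple_graph_def)
      then show ?thesis unfolding card_2_iff by blast
    qed
    show "conn E x y" if "x \<in> V" "y \<in> V" for x y
      using assms(2) that by (simp add: connected_graph_def reachable_conn)
    show "finite {e \<in> E. v \<in> e}" if "v \<in> V" for v using assms(3) that by (simp add: locally_finite_def)
    show "infinite V" by (rule assms(4))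
  qed
  let ?orb = "orbit (aut_group (V, E)) (\<lambda>f. f)"
  have "finite (?orb ` V)"
    using assms(5) by (simp add: quasi_transitive_def orbits_def setcompr_eq_image)
  then obtain Rep where Rep: "Rep \<subseteq> V" "finite Rep" "?orb ` V = ?orb ` Rep"
    using finite_subset_image[of "?orb ` V" ?orb V] by auto
  have "\<exists>ro\<in>Rep. \<exists>f\<in>Aut. x = f ro" if x: "x \<in> V" for x
  proof -
    obtain ro where ro: "ro \<in> Rep" "?orb x = ?orb ro" using Rep(3) x by blast
    have "x \<in> ?orb x" unfolding orbit_def using aut_id x by (auto intro!: exI[of _ "\<lambda>x\<in>V. x"])
    then have "x \<in> ?orb ro" using ro(2) by simp
    then show ?thesis using ro(1) by (auto simp: orbit_def)
  qed
  then have "qt_graph V E Rep" using Rep(1,2) by unfold_locales auto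
  then show ?thesis by blast
qed

theorem corollary2:
  fixes G :: "'v graph"
  assumes "simple_graph G" and "connected_graph G" and "locally_finite G"
    and "infinite (verts G)" and "quasi_transitive G" and "unimodular G"
  shows "amenable G \<and> one_ended G \<longleftrightarrow>
    (\<exists>P. invariant_random_subgraph G P \<and> (AE T in P. spanning_tree G T \<and> one_ended T))"
proof -
  obtain V E where G: "G = (V, E)" by (cases G)
  obtain Rep where "qt_graph V E Rep" using ex_qt_graph[of V E] assms(1-5) unfolding G by auto
  then interpret qt_graph V E Rep .
  obtain \<mu> w where H: "haar \<mu> w" using ex_haar assms(6) unfolding G by blast
  show ?thesis
  proof
    assume "amenable G \<and> one_ended G"
    then obtain N K T S a0 C P r where wt: "weak_trees V E Rep N K T S a0 C P r"
      using ex_weak_trees assms(6) unfolding G by blast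
    have "AE T in P. spanning_tree G T \<and> one_ended T"
      using weak_trees.AE_all[OF wt] AE_space
    proof eventually_elim
      case (elim T)
      then have v: "verts T = V" and s: "T \<in> subgraphs (V, E)" and f: "forest (edges T)"
        and c: "\<And>x y. {x, y} \<in> E ==> conn (edges T) x y"
        and fin: "\<And>e. e \<in> edges T ==> \<exists>D. finite D \<and> D \<subseteq> V \<and> {h \<in> edges T. card (h \<inter> D) = 1} = {e}"
        by (auto simp: weak_trees.space_P[OF wt])
      have FE: "edges T \<subseteq> E" and sg: "simple_graph T" using s by (auto simp: subgraphs_def)
      have cn: "conn (edges T) x y" if "x \<in> V" "y \<in> V" for x y
        by (rule conn_least[OF connected[OF that] conn_refl conn_trans c])
      have tr: "tree V (edges T)"
      proof
        show "\<exists>u v. u \<in> V \<and> v \<in> V \<and> u \<noteq> v \<and> e = {u, v}" if "e \<in> edges T" for e using edgeE FE that by blast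
        show "conn (edges T) x y" if "x \<in> V" "y \<in> V" for x y by (rule cn[OF that])
        show "\<not> conn (edges T - {{u, v}}) u v" if "{u, v} \<in> edges T" for u v using f that by (simp add: forest_def)
      qed
      have "V \<noteq> {}" using infinite_V by auto
      then have "is_tree T"
        using sg cn forest_no_cycle[OF f] v by (simp add: is_tree_def connected_graph_def reachable_conn)
      moreover have "one_ended (V, edges T)"
        by (rule tree_one_ended[OF tr FE]) (use fin bdry_Int[OF FE] in metis)
      moreover have "T = (V, edges T)" using v by (metis prod.collapse)
      ultimately show ?case using s v unfolding G spanning_tree_def by simp
    qed
    then show "\<exists>P. invariant_random_subgraph G P \<and> (AE T in P. spanning_tree G T \<and> one_ended T)"
      using weak_trees.invariant[OF wt] unfolding G by blast
  next
    assume "\<exists>P. invariant_random_subgraph G P \<and> (AE T in P. spanning_tree G T \<and> one_ended T)"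
    then obtain P where P: "invariant_random_subgraph (V, E) P" "AE T in P. spanning_tree (V, E) T \<and> one_ended T"
      unfolding G by blast
    have "random_tree V E Rep P"
      by (rule random_tree.intro[OF qt_graph_axioms], rule random_tree_axioms.intro)
        (use P in \<open>simp_all add: invariant_random_subgraph_def\<close>)
    then interpret random_tree V E Rep P .
    show "amenable G \<and> one_ended G" unfolding G using graph_amenable[OF H] graph_one_ended by blast
  qed
qed

end
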